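(* Let $K$ be a compact Hausdorff space and let $(\Omega,\Sigma,\mu)$ be a measure space. Then the (complex) Banach spaces $C(K)$ and $L_p(\mu)$, $1\le p\le\infty$, have property $(\mathbb{A})$.
   Context: For a Banach space $X$, $\mathcal{F}(X)$ is the operator-norm closure of the finite rank operators on $X$. An irreducible $(n\times n)$-matrix group is a finite subgroup of $GL_n(\mathbb{C})$ whose linear span is all of $M_n(\mathbb{C})$. For a finite biorthogonal system $\{(x_i,x_j^* ) : x_i\in X,\ x_j^*\in X^*,\ i,j=1,\dots,n\}$ (i.e. $x_j^*(x_i)=\delta_{ij}$), the associated algebra homomorphism $E:M_n(\mathbb{C})\to\mathcal{F}(X)$ is $E((a_{ij}))=\sum_{i,j}a_{ij}\,x_i\otimes x_j^*$, where $x\otimes x^*$ is the operator $z\mapsto x^*(z)x$. Property $(\mathbb{A})$ for $X$: there is a net of finite biorthogonal systems $\{(x_{i,\lambda},x_{j,\lambda}^* ) : i,j=1,\dots,n_\lambda\}$ $(\lambda\in\Lambda)$ in $X\times X^*$, with corresponding maps $E_\lambda:M_{n_\lambda}(\mathbb{C})\to\mathcal{F}(X)$, such that with $P_\lambda=E_\lambda(I_{n_\lambda})$: (i) $P_\lambda\to 1_X$ strongly; (ii) the adjoints $P_\lambda^a\to 1_{X^*}$ strongly; (iii) for each $\lambda$ there is an irreducible $(n_\lambda\times n_\lambda)$-matrix group $\mathcal{G}_\lambda$ such that $\sup\{\|E_\lambda(g)\| : g\in\mathcal{G}_\lambda,\ \lambda\in\Lambda\}<\infty$ (operator norm). Banach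 spaces are assumed infinite dimensional throughout. *)

theory Defs
  imports
    "HOL-Analysis.Analysis"
    "HOL-Probability.Essential_Supremum"
    "Jordan_Normal_Form.VS_Connect"
begin

text \<open>
  The spaces \<open>L\<^sub>p(\<mu>)\<close> depend on a term, so Banach spaces are represented by structures with an
  explicit carrier: a complex vector space in the sense of \<^theory>\<open>HOL-Algebra.Module\<close> (over the
  ring \<open>class_ring\<close> of complex numbers) together with a norm.  The fields \<open>mult\<close> and \<open>one\<close>,
  inherited from the record of modules, carry no meaning.
\<close>

record 'v normed_module = "(complex, 'v) module" +
  nrm :: "'v \<Rightarrow> real"

definition infinite_dimensional :: "'v normed_module \<Rightarrow> bool" where
  "infinite_dimensional X \<longleftrightarrow> \<not> vectorspace.fin_dim class_ring X"

definition operator_norm :: "'v normed_module \<Rightarrow> ('v \<Rightarrow> 'v) \<Rightarrow> real" where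
  "operator_norm X T = Sup {nrm X (T z) |z. z \<in> carrier X \<and> nrm X z \<le> 1}"

definition bounded_functional :: "'v normed_module \<Rightarrow> ('v \<Rightarrow> complex) \<Rightarrow> bool" where
  "bounded_functional X f \<longleftrightarrow>
     (\<forall>y\<in>carrier X. \<forall>z\<in>carrier X. f (y \<oplus>\<^bsub>X\<^esub> z) = f y + f z) \<and>
     (\<forall>c. \<forall>z\<in>carrier X. f (c \<odot>\<^bsub>X\<^esub> z) = c * f z) \<and>
     (\<exists>B. \<forall>z\<in>carrier X. cmod (f z) \<le> B * nrm X z)"

definition dual :: "'v normed_module \<Rightarrow> ('v \<Rightarrow> complex) normed_module" where
  "dual X =
     \<lparr>carrier = {f \<in> extensional (carrier X). bounded_functional X f},
      mult = undefined, one = undefined,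
      zero = (\<lambda>z\<in>carrier X. 0),
      add = (\<lambda>f g. \<lambda>z\<in>carrier X. f z + g z),
      smult = (\<lambda>c f. \<lambda>z\<in>carrier X. c * f z),
      nrm = (\<lambda>f. Sup {cmod (f z) |z. z \<in> carrier X \<and> nrm X z \<le> 1})\<rparr>"

definition adjoint_operator ::
  "'v normed_module \<Rightarrow> ('v \<Rightarrow> 'v) \<Rightarrow> ('v \<Rightarrow> complex) \<Rightarrow> 'v \<Rightarrow> complex" where
  "adjoint_operator X T f = (\<lambda>z\<in>carrier X. f (T z))"


text \<open>Indices of systems and matrices run over \<open>0, \<dots>, n - 1\<close>.\<close>

definition biorthogonal_system ::
  "'v normed_module \<Rightarrow> nat \<Rightarrow> (nat \<Rightarrow> 'v) \<Rightarrow> (nat \<Rightarrow> 'v \<Rightarrow> complex) \<Rightarrow> bool" where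
  "biorthogonal_system X n x f \<longleftrightarrow>
     0 < n \<and> (\<forall>i<n. x i \<in> carrier X) \<and> (\<forall>j<n. f j \<in> carrier (dual X)) \<and>
     (\<forall>i<n. \<forall>j<n. f j (x i) = (if i = j then 1 else 0))"

definition rank_one :: "'v normed_module \<Rightarrow> 'v \<Rightarrow> ('v \<Rightarrow> complex) \<Rightarrow> 'v \<Rightarrow> 'v" where
  "rank_one X y f z = f z \<odot>\<^bsub>X\<^esub> y"

definition matrix_operator ::
  "'v normed_module \<Rightarrow> nat \<Rightarrow> (nat \<Rightarrow> 'v) \<Rightarrow> (nat \<Rightarrow> 'v \<Rightarrow> complex) \<Rightarrow> complex mat \<Rightarrow> 'v \<Rightarrow> 'v" where
  "matrix_operator X n x f A z =
     (\<Oplus>\<^bsub>X\<^esub>i\<in>{..<n}. \<Oplus>\<^bsub>X\<^esub>j\<in>{..<n}. A $$ (i, j) \<odot>\<^bsub>X\<^esub> rank_one X (x i) (f j) z)"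

text \<open>The unit group of the ring of \<open>n \<times> n\<close> matrices is \<open>GL\<^sub>n(\<complex>)\<close>.\<close>

definition irreducible_matrix_group :: "nat \<Rightarrow> complex mat set \<Rightarrow> bool" where
  "irreducible_matrix_group n G \<longleftrightarrow>
     finite G \<and> subgroup G (units_of (ring_mat TYPE(complex) n ())) \<and>
     LinearCombinations.module.span class_ring (module_mat TYPE(complex) n n) G = carrier_mat n n"


definition directed_by :: "'l set \<Rightarrow> 'l rel \<Rightarrow> bool" where
  "directed_by L r \<longleftrightarrow>
     L \<noteq> {} \<and> preorder_on L r \<and> (\<forall>a\<in>L. \<forall>b\<in>L. \<exists>c\<in>L. (a, c) \<in> r \<and> (b, c) \<in> r)"

definition strongly_to_identity ::
  "'v normed_module \<Rightarrow> 'l set \<Rightarrow> 'l rel \<Rightarrow> ('l \<Rightarrow> 'v \<Rightarrow> 'v) \<Rightarrow> bool" where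
  "strongly_to_identity X L r T \<longleftrightarrow>
     (\<forall>z\<in>carrier X. \<forall>e>0. \<exists>a\<in>L. \<forall>l\<in>L. (a, l) \<in> r \<longrightarrow> nrm X (T l z \<ominus>\<^bsub>X\<^esub> z) < e)"

definition property_A_net ::
  "'v normed_module \<Rightarrow> 'l set \<Rightarrow> 'l rel \<Rightarrow> ('l \<Rightarrow> nat) \<Rightarrow> ('l \<Rightarrow> nat \<Rightarrow> 'v) \<Rightarrow>
     ('l \<Rightarrow> nat \<Rightarrow> 'v \<Rightarrow> complex) \<Rightarrow> ('l \<Rightarrow> complex mat set) \<Rightarrow> bool" where
  "property_A_net X L r n x f G \<longleftrightarrow>
     (let E = (\<lambda>l. matrix_operator X (n l) (x l) (f l));
          P = (\<lambda>l. E l (1\<^sub>m (n l)))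
      in directed_by L r \<and>
         (\<forall>l\<in>L. biorthogonal_system X (n l) (x l) (f l)) \<and>
         strongly_to_identity X L r P \<and>
         strongly_to_identity (dual X) L r (\<lambda>l. adjoint_operator X (P l)) \<and>
         (\<forall>l\<in>L. irreducible_matrix_group (n l) (G l)) \<and>
         bdd_above {operator_norm X (E l g) |l g. l \<in> L \<and> g \<in> G l})"

text \<open>
  One cannot quantify over the type of the indices of a net.  The type chosen here is large enough
  to lose nothing: by \<open>property_A_netI\<close> below, a net over any index type whatsoever yields
  one over this type.
\<close>

definition property_A :: "'v normed_module \<Rightarrow> bool" where
  "property_A X \<longleftrightarrow>
     (\<exists>(L :: ('v set \<times> ('v \<Rightarrow> complex) set \<times> nat) set) r n x f G. property_A_net X L r n x f G)"

lemma directed_by_finite_bound: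
  assumes "directed_by L r" "finite S" "\<forall>s\<in>S. g s \<in> L"
  shows "\<exists>c\<in>L. \<forall>s\<in>S. (g s, c) \<in> r"
  using assms(2,3)
proof (induction S rule: finite_induct)
  case empty
  then show ?case using assms(1) by (auto simp: directed_by_def)
next
  case (insert s S)
  then obtain c where c: "c \<in> L" "\<forall>s\<in>S. (g s, c) \<in> r" by auto
  obtain d where d: "d \<in> L" "(c, d) \<in> r" "(g s, d) \<in> r"
    using assms(1) c(1) insert.prems unfolding directed_by_def by (meson insertI1)
  have "trans r" using assms(1) by (auto simp: directed_by_def preorder_on_def)
  then have "\<forall>s\<in>S. (g s, d) \<in> r" using c(2) d(2) by (meson transD)
  then show ?case using d by auto
qed

lemma strongly_to_identity_finite:
  assumes "strongly_to_identity X L r T" "directed_by L r" "finite A" "A \<subseteq> carrier X" "e > 0"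
  shows "\<exists>a\<in>L. \<forall>l\<in>L. (a, l) \<in> r \<longrightarrow> (\<forall>z\<in>A. nrm X (T l z \<ominus>\<^bsub>X\<^esub> z) < e)"
proof -
  have "\<forall>z\<in>A. \<exists>a\<in>L. \<forall>l\<in>L. (a, l) \<in> r \<longrightarrow> nrm X (T l z \<ominus>\<^bsub>X\<^esub> z) < e"
    using assms(1,4,5) unfolding strongly_to_identity_def by auto
  then obtain g where g: "\<forall>z\<in>A. g z \<in> L"
    "\<forall>z\<in>A. \<forall>l\<in>L. (g z, l) \<in> r \<longrightarrow> nrm X (T l z \<ominus>\<^bsub>X\<^esub> z) < e"
    by metis
  obtain c where c: "c \<in> L" "\<forall>z\<in>A. (g z, c) \<in> r"
    using directed_by_finite_bound[OF assms(2,3) g(1)] by auto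
  have "trans r" using assms(2) by (auto simp: directed_by_def preorder_on_def)
  then show ?thesis using c g by (meson transD)
qed

lemma property_A_netI:
  fixes L :: "'l set" and X :: "'v normed_module"
  assumes net: "property_A_net X L r n x f G"
  shows "property_A X"
proof -
  define P where "P = (\<lambda>l. matrix_operator X (n l) (x l) (f l) (1\<^sub>m (n l)))"
  define Q where "Q = (\<lambda>l. adjoint_operator X (P l))"
  have dir: "directed_by L r"
    and bio: "\<forall>l\<in>L. biorthogonal_system X (n l) (x l) (f l)"
    and sP: "strongly_to_identity X L r P"
    and sQ: "strongly_to_identity (dual X) L r Q"
    and irr: "\<forall>l\<in>L. irreducible_matrix_group (n l) (G l)"
    and bdd: "bdd_above {operator_norm X (matrix_operator X (n l) (x l) (f l) g) |l g. l \<in> L \<and> g \<in> G l}"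
    using net unfolding property_A_net_def P_def Q_def Let_def by auto
  define I :: "('v set \<times> ('v \<Rightarrow> complex) set \<times> nat) set" where
    "I = {(A, B, k). finite A \<and> A \<subseteq> carrier X \<and> finite B \<and> B \<subseteq> carrier (dual X)}"
  define s :: "('v set \<times> ('v \<Rightarrow> complex) set \<times> nat) rel" where
    "s = {((A, B, k), (A', B', k')). (A, B, k) \<in> I \<and> (A', B', k') \<in> I \<and> A \<subseteq> A' \<and> B \<subseteq> B' \<and> k \<le> k'}"
  have dirI: "directed_by I s"
    unfolding directed_by_def
  proof (intro conjI ballI)
    show "I \<noteq> {}" by (auto simp: I_def)
    show "preorder_on I s"
      unfolding preorder_on_def refl_on_def trans_def s_def by auto
    fix a b assume "a \<in> I" "b \<in> I"
    then show "\<exists>c\<in>I. (a, c) \<in> s \<and> (b, c) \<in> s"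
      by (intro bexI[of _ "(fst a \<union> fst b, fst (snd a) \<union> fst (snd b), max (snd (snd a)) (snd (snd b)))"])
         (auto simp: I_def s_def)
  qed
  have "\<exists>l\<in>L. (\<forall>z\<in>A. nrm X (P l z \<ominus>\<^bsub>X\<^esub> z) < 1 / Suc k) \<and>
      (\<forall>z\<in>B. nrm (dual X) (Q l z \<ominus>\<^bsub>dual X\<^esub> z) < 1 / Suc k)" if "(A, B, k) \<in> I" for A B k
  proof -
    from that have fin: "finite A" "A \<subseteq> carrier X" "finite B" "B \<subseteq> carrier (dual X)"
      by (auto simp: I_def)
    obtain a where a: "a \<in> L" "\<forall>l\<in>L. (a, l) \<in> r \<longrightarrow> (\<forall>z\<in>A. nrm X (P l z \<ominus>\<^bsub>X\<^esub> z) < 1 / Suc k)"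
      using strongly_to_identity_finite[OF sP dir fin(1,2), of "1 / Suc k"] by auto
    obtain b where b: "b \<in> L"
      "\<forall>l\<in>L. (b, l) \<in> r \<longrightarrow> (\<forall>z\<in>B. nrm (dual X) (Q l z \<ominus>\<^bsub>dual X\<^esub> z) < 1 / Suc k)"
      using strongly_to_identity_finite[OF sQ dir fin(3,4), of "1 / Suc k"] by auto
    obtain c where "c \<in> L" "(a, c) \<in> r" "(b, c) \<in> r"
      using dir a(1) b(1) by (auto simp: directed_by_def)
    then show ?thesis using a b by blast
  qed
  then have "\<forall>i. \<exists>l. i \<in> I \<longrightarrow> l \<in> L \<and>
      (\<forall>z\<in>fst i. nrm X (P l z \<ominus>\<^bsub>X\<^esub> z) < 1 / Suc (snd (snd i))) \<and>
      (\<forall>z\<in>fst (snd i). nrm (dual X) (Q l z \<ominus>\<^bsub>dual X\<^esub> z) < 1 / Suc (snd (snd i)))"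
    by (metis prod.collapse)
  then obtain h where h: "\<And>i. i \<in> I \<Longrightarrow> h i \<in> L"
    "\<And>i z. i \<in> I \<Longrightarrow> z \<in> fst i \<Longrightarrow> nrm X (P (h i) z \<ominus>\<^bsub>X\<^esub> z) < 1 / Suc (snd (snd i))"
    "\<And>i z. i \<in> I \<Longrightarrow> z \<in> fst (snd i) \<Longrightarrow>
        nrm (dual X) (Q (h i) z \<ominus>\<^bsub>dual X\<^esub> z) < 1 / Suc (snd (snd i))"
    by metis
  have sPI: "strongly_to_identity X I s (\<lambda>i. P (h i))"
    unfolding strongly_to_identity_def
  proof (intro ballI allI impI)
    fix z and e :: real assume z: "z \<in> carrier X" and e: "e > 0"
    obtain k where k: "1 / Suc k < e" using e nat_approx_posE by metis
    show "\<exists>a\<in>I. \<forall>l\<in>I. (a, l) \<in> s \<longrightarrow> nrm X (P (h l) z \<ominus>\<^bsub>X\<^esub> z) < e"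
    proof (intro bexI[of _ "({z}, {}, k)"] ballI impI)
      fix l assume l: "l \<in> I" "(({z}, {}, k), l) \<in> s"
      then have "z \<in> fst l" "k \<le> snd (snd l)" by (auto simp: s_def)
      then have "1 / Suc (snd (snd l)) \<le> 1 / Suc k" by (simp add: field_simps)
      with h(2)[OF l(1) \<open>z \<in> fst l\<close>] k show "nrm X (P (h l) z \<ominus>\<^bsub>X\<^esub> z) < e" by linarith
    qed (use z in \<open>auto simp: I_def\<close>)
  qed
  have sQI: "strongly_to_identity (dual X) I s (\<lambda>i. Q (h i))"
    unfolding strongly_to_identity_def
  proof (intro ballI allI impI)
    fix z and e :: real assume z: "z \<in> carrier (dual X)" and e: "e > 0"
    obtain k where k: "1 / Suc k < e" using e nat_approx_posE by metis
    show "\<exists>a\<in>I. \<forall>l\<in>I. (a, l) \<in> s \<longrightarrow> nrm (dual X) (Q (h l) z \<ominus>\<^bsub>dual X\<^esub> z) < e"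
    proof (intro bexI[of _ "({}, {z}, k)"] ballI impI)
      fix l assume l: "l \<in> I" "(({}, {z}, k), l) \<in> s"
      then have "z \<in> fst (snd l)" "k \<le> snd (snd l)" by (auto simp: s_def)
      then have "1 / Suc (snd (snd l)) \<le> 1 / Suc k" by (simp add: field_simps)
      with h(3)[OF l(1) \<open>z \<in> fst (snd l)\<close>] k
      show "nrm (dual X) (Q (h l) z \<ominus>\<^bsub>dual X\<^esub> z) < e" by linarith
    qed (use z in \<open>auto simp: I_def\<close>)
  qed
  have "bdd_above {operator_norm X (matrix_operator X (n (h i)) (x (h i)) (f (h i)) g) |i g.
      i \<in> I \<and> g \<in> G (h i)}"
    by (rule bdd_above_mono[OF bdd]) (use h(1) in blast)
  then have "property_A_net X I s (n \<circ> h) (x \<circ> h) (f \<circ> h) (G \<circ> h)"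
    using dirI bio irr sPI sQI h(1) unfolding property_A_net_def Let_def P_def Q_def by simp
  then show ?thesis unfolding property_A_def by blast
qed


definition C_space :: "'k topology \<Rightarrow> ('k \<Rightarrow> complex) normed_module" where
  "C_space K =
     \<lparr>carrier = {f \<in> extensional (topspace K). continuous_map K euclidean f},
      mult = undefined, one = undefined,
      zero = (\<lambda>t\<in>topspace K. 0),
      add = (\<lambda>f g. \<lambda>t\<in>topspace K. f t + g t),
      smult = (\<lambda>c f. \<lambda>t\<in>topspace K. c * f t),
      nrm = (\<lambda>f. SUP t\<in>topspace K. cmod (f t))\<rparr>"

definition Lp_functions :: "'a measure \<Rightarrow> ennreal \<Rightarrow> ('a \<Rightarrow> complex) set" where
  "Lp_functions M p = {f \<in> borel_measurable M.
     if p = \<infinity> then esssup M (\<lambda>t. ennreal (cmod (f t))) < \<infinity>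
     else integrable M (\<lambda>t. cmod (f t) powr enn2real p)}"

definition Lp_seminorm :: "'a measure \<Rightarrow> ennreal \<Rightarrow> ('a \<Rightarrow> complex) \<Rightarrow> real" where
  "Lp_seminorm M p f =
     (if p = \<infinity> then enn2real (esssup M (\<lambda>t. ennreal (cmod (f t))))
      else (LINT t|M. cmod (f t) powr enn2real p) powr (1 / enn2real p))"

definition Lp_eq :: "'a measure \<Rightarrow> ennreal \<Rightarrow> ('a \<Rightarrow> complex) rel" where
  "Lp_eq M p = {(f, g). f \<in> Lp_functions M p \<and> g \<in> Lp_functions M p \<and> (AE t in M. f t = g t)}"

text \<open>
  Elements are equivalence classes modulo equality almost everywhere; the norm of a class is the
  common value of the seminorm on its members.
\<close>

definition Lp_space :: "'a measure \<Rightarrow> ennreal \<Rightarrow> ('a \<Rightarrow> complex) set normed_module" where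
  "Lp_space M p =
     \<lparr>carrier = Lp_functions M p // Lp_eq M p,
      mult = undefined, one = undefined,
      zero = Lp_eq M p `` {\<lambda>t. 0},
      add = (\<lambda>F G. \<Union>f\<in>F. \<Union>g\<in>G. Lp_eq M p `` {\<lambda>t. f t + g t}),
      smult = (\<lambda>c F. \<Union>f\<in>F. Lp_eq M p `` {\<lambda>t. c * f t}),
      nrm = (\<lambda>F. the_elem (Lp_seminorm M p ` F))\<rparr>"


text \<open>
  The structures above are complex vector spaces, and the operations on classes are given by
  representatives.
\<close>

lemma vectorspaceI:
  fixes X :: "'v normed_module"
  assumes closed: "\<And>x y. x \<in> carrier X \<Longrightarrow> y \<in> carrier X \<Longrightarrow> x \<oplus>\<^bsub>X\<^esub> y \<in> carrier X"
    "\<zero>\<^bsub>X\<^esub> \<in> carrier X"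
    "\<And>c x. x \<in> carrier X \<Longrightarrow> c \<odot>\<^bsub>X\<^esub> x \<in> carrier X"
    and add: "\<And>x y z. x \<in> carrier X \<Longrightarrow> y \<in> carrier X \<Longrightarrow> z \<in> carrier X \<Longrightarrow>
        (x \<oplus>\<^bsub>X\<^esub> y) \<oplus>\<^bsub>X\<^esub> z = x \<oplus>\<^bsub>X\<^esub> (y \<oplus>\<^bsub>X\<^esub> z)"
    "\<And>x y. x \<in> carrier X \<Longrightarrow> y \<in> carrier X \<Longrightarrow> x \<oplus>\<^bsub>X\<^esub> y = y \<oplus>\<^bsub>X\<^esub> x"
    "\<And>x. x \<in> carrier X \<Longrightarrow> \<zero>\<^bsub>X\<^esub> \<oplus>\<^bsub>X\<^esub> x = x"
    "\<And>x. x \<in> carrier X \<Longrightarrow> (- 1) \<odot>\<^bsub>X\<^esub> x \<oplus>\<^bsub>X\<^esub> x = \<zero>\<^bsub>X\<^esub>"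
    and smult: "\<And>a b x. x \<in> carrier X \<Longrightarrow> (a + b) \<odot>\<^bsub>X\<^esub> x = a \<odot>\<^bsub>X\<^esub> x \<oplus>\<^bsub>X\<^esub> b \<odot>\<^bsub>X\<^esub> x"
    "\<And>a x y. x \<in> carrier X \<Longrightarrow> y \<in> carrier X \<Longrightarrow>
        a \<odot>\<^bsub>X\<^esub> (x \<oplus>\<^bsub>X\<^esub> y) = a \<odot>\<^bsub>X\<^esub> x \<oplus>\<^bsub>X\<^esub> a \<odot>\<^bsub>X\<^esub> y"
    "\<And>a b x. x \<in> carrier X \<Longrightarrow> (a * b) \<odot>\<^bsub>X\<^esub> x = a \<odot>\<^bsub>X\<^esub> (b \<odot>\<^bsub>X\<^esub> x)"
    "\<And>x. x \<in> carrier X \<Longrightarrow> 1 \<odot>\<^bsub>X\<^esub> x = x"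
  shows "vectorspace class_ring X"
proof -
  have "abelian_group X"
    by (rule abelian_groupI) (use closed add in \<open>blast+\<close>)
  then have "module class_ring X"
    by (intro moduleI) (use closed smult class_cring.is_cring in auto)
  then show ?thesis
    by (intro vectorspace.intro) (auto intro: class_field.field_axioms)
qed

lemma vectorspace_C_space: "vectorspace class_ring (C_space K)"
proof -
  have add: "continuous_map K euclidean (\<lambda>t\<in>topspace K. f t + g t)"
    if "continuous_map K euclidean f" "continuous_map K euclidean g" for f g :: "'a \<Rightarrow> complex"
    by (rule continuous_map_eq[OF continuous_map_add[OF that]]) auto
  have smult: "continuous_map K euclidean (\<lambda>t\<in>topspace K. c * f t)"
    if "continuous_map K euclidean f" for c and f :: "'a \<Rightarrow> complex"
  proof -
    have "continuous_map euclidean euclidean ((*) c)"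
      by (auto intro: continuous_intros)
    from continuous_map_compose[OF that this] show ?thesis
      by (rule continuous_map_eq) auto
  qed
  have zero: "continuous_map K euclidean (\<lambda>t\<in>topspace K. 0 :: complex)"
    by (rule continuous_map_eq[of K euclidean "\<lambda>t. 0"]) auto
  show ?thesis
    by (rule vectorspaceI)
      (use add smult zero in \<open>auto simp: C_space_def algebra_simps extensional_def fun_eq_iff restrict_def\<close>)
qed

lemma vectorspace_dual:
  assumes "vectorspace class_ring X"
  shows "vectorspace class_ring (dual X)"
proof -
  interpret vectorspace class_ring X by fact
  have bf_add: "bounded_functional X (\<lambda>z\<in>carrier X. f z + g z)"
    if bf: "bounded_functional X f" "bounded_functional X g" for f g
  proof -
    obtain B C where "\<forall>z\<in>carrier X. cmod (f z) \<le> B * nrm X z" "\<forall>z\<in>carrier X. cmod (g z) \<le> C * nrm X z"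
      using bf unfolding bounded_functional_def by blast
    then have "\<forall>z\<in>carrier X. cmod (f z + g z) \<le> (B + C) * nrm X z"
      by (metis add_mono distrib_right norm_triangle_le)
    then have "\<exists>B. \<forall>z\<in>carrier X. cmod (f z + g z) \<le> B * nrm X z" by blast
    then show ?thesis using bf smult_closed unfolding bounded_functional_def
      by (simp add: algebra_simps)
  qed
  have bf_smult: "bounded_functional X (\<lambda>z\<in>carrier X. c * f z)"
    if bf: "bounded_functional X f" for f c
  proof -
    obtain B where "\<forall>z\<in>carrier X. cmod (f z) \<le> B * nrm X z"
      using bf unfolding bounded_functional_def by blast
    then have "\<forall>z\<in>carrier X. cmod (c * f z) \<le> (cmod c * B) * nrm X z"
      by (simp add: norm_mult mult.assoc mult_left_mono)
    then have "\<exists>B. \<forall>z\<in>carrier X. cmod (c * f z) \<le> B * nrm X z" by blast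
    then show ?thesis using bf smult_closed unfolding bounded_functional_def
      by (simp add: algebra_simps)
  qed
  have bf_0: "bounded_functional X (\<lambda>z\<in>carrier X. 0)"
    using smult_closed by (auto simp: bounded_functional_def intro!: exI[of _ 0])
  show ?thesis
    by (rule vectorspaceI)
      (use bf_add bf_smult bf_0 in \<open>auto simp: dual_def algebra_simps extensional_def fun_eq_iff restrict_def\<close>)
qed

lemma equiv_Lp_eq: "equiv (Lp_functions M p) (Lp_eq M p)"
  by (rule equivI) (auto simp: Lp_eq_def refl_on_def sym_def trans_def)

lemma powr_add_le:
  fixes a b q :: real assumes "a \<ge> 0" "b \<ge> 0" "q \<ge> 0"
  shows "(a + b) powr q \<le> 2 powr q * (a powr q + b powr q)"
proof -
  have "(a + b) powr q \<le> (2 * max a b) powr q" using assms by (intro powr_mono2) auto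
  also have "\<dots> = 2 powr q * (max a b) powr q" using assms by (simp add: powr_mult)
  also have "(max a b) powr q \<le> a powr q + b powr q" by (auto simp: max_def)
  finally show ?thesis by simp
qed

lemma Lp_functions_add:
  assumes "f \<in> Lp_functions M p" "g \<in> Lp_functions M p"
  shows "(\<lambda>t. f t + g t) \<in> Lp_functions M p"
proof (cases "p = \<infinity>")
  case True
  have [measurable]: "f \<in> borel_measurable M" "g \<in> borel_measurable M"
    using assms by (auto simp: Lp_functions_def)
  have "esssup M (\<lambda>t. ennreal (cmod (f t + g t))) \<le>
      esssup M (\<lambda>t. ennreal (cmod (f t))) + esssup M (\<lambda>t. ennreal (cmod (g t)))"
  proof (rule esssup_I)
    show "AE t in M. ennreal (cmod (f t + g t)) \<le>
      esssup M (\<lambda>t. ennreal (cmod (f t))) + esssup M (\<lambda>t. ennreal (cmod (g t)))"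
      using esssup_AE[of "\<lambda>t. ennreal (cmod (f t))" M] esssup_AE[of "\<lambda>t. ennreal (cmod (g t))" M]
    proof eventually_elim
      case (elim t)
      have "ennreal (cmod (f t + g t)) \<le> ennreal (cmod (f t)) + ennreal (cmod (g t))"
        by (simp add: norm_triangle_ineq flip: ennreal_plus)
      with elim show ?case by (meson add_mono order_trans)
    qed
  qed auto
  also have "\<dots> < \<infinity>" using assms True by (auto simp: Lp_functions_def)
  finally show ?thesis using True by (auto simp: Lp_functions_def)
next
  case False
  have [measurable]: "f \<in> borel_measurable M" "g \<in> borel_measurable M"
    using assms by (auto simp: Lp_functions_def)
  have "integrable M (\<lambda>t. 2 powr enn2real p * (cmod (f t) powr enn2real p + cmod (g t) powr enn2real p))"
    using assms False by (auto simp: Lp_functions_def)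
  then have "integrable M (\<lambda>t. cmod (f t + g t) powr enn2real p)"
  proof (rule Bochner_Integration.integrable_bound)
    show "AE t in M. norm (cmod (f t + g t) powr enn2real p) \<le>
      norm (2 powr enn2real p * (cmod (f t) powr enn2real p + cmod (g t) powr enn2real p))"
    proof (rule AE_I2)
      fix t
      have "cmod (f t + g t) powr enn2real p \<le> (cmod (f t) + cmod (g t)) powr enn2real p"
        by (intro powr_mono2) (auto simp: norm_triangle_ineq)
      also have "\<dots> \<le> 2 powr enn2real p * (cmod (f t) powr enn2real p + cmod (g t) powr enn2real p)"
        by (rule powr_add_le) auto
      finally show "norm (cmod (f t + g t) powr enn2real p) \<le>
        norm (2 powr enn2real p * (cmod (f t) powr enn2real p + cmod (g t) powr enn2real p))" by simp
    qed
  qed auto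
  then show ?thesis using False by (auto simp: Lp_functions_def)
qed

lemma Lp_functions_smult:
  assumes "f \<in> Lp_functions M p"
  shows "(\<lambda>t. c * f t) \<in> Lp_functions M p"
proof (cases "p = \<infinity>")
  case True
  have [measurable]: "f \<in> borel_measurable M"
    using assms by (auto simp: Lp_functions_def)
  have "esssup M (\<lambda>t. ennreal (cmod (c * f t))) \<le> ennreal (cmod c) * esssup M (\<lambda>t. ennreal (cmod (f t)))"
  proof (rule esssup_I)
    show "AE t in M. ennreal (cmod (c * f t)) \<le> ennreal (cmod c) * esssup M (\<lambda>t. ennreal (cmod (f t)))"
      using esssup_AE[of "\<lambda>t. ennreal (cmod (f t))" M]
      by eventually_elim (auto simp: norm_mult ennreal_mult intro!: mult_left_mono)
  qed auto
  also have "\<dots> < \<infinity>" using assms True by (auto simp: Lp_functions_def ennreal_mult_less_top)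
  finally show ?thesis using True by (auto simp: Lp_functions_def)
next
  case False
  then show ?thesis using assms by (auto simp: Lp_functions_def norm_mult powr_mult)
qed

lemma Lp_functions_0: "(\<lambda>t. 0) \<in> Lp_functions M p"
proof -
  have "esssup M (\<lambda>t. 0 :: ennreal) \<le> 0" by (rule esssup_I) auto
  then show ?thesis by (auto simp: Lp_functions_def)
qed

lemma Lp_class_eq:
  assumes "f \<in> Lp_functions M p" "g \<in> Lp_functions M p" "AE t in M. f t = g t"
  shows "Lp_eq M p `` {f} = Lp_eq M p `` {g}"
  using assms equiv_class_eq[OF equiv_Lp_eq, of f g M p] by (auto simp: Lp_eq_def)

lemma Lp_space_add:
  assumes "f \<in> Lp_functions M p" "g \<in> Lp_functions M p"
  shows "Lp_eq M p `` {f} \<oplus>\<^bsub>Lp_space M p\<^esub> Lp_eq M p `` {g} = Lp_eq M p `` {\<lambda>t. f t + g t}"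
proof -
  have *: "Lp_eq M p `` {\<lambda>t. f' t + g' t} = Lp_eq M p `` {\<lambda>t. f t + g t}"
    if "f' \<in> Lp_eq M p `` {f}" "g' \<in> Lp_eq M p `` {g}" for f' g'
    using that by (intro Lp_class_eq Lp_functions_add) (auto simp: Lp_eq_def)
  have mem: "f \<in> Lp_eq M p `` {f}" "g \<in> Lp_eq M p `` {g}" using assms by (auto simp: Lp_eq_def)
  have "(\<Union>f'\<in>Lp_eq M p `` {f}. \<Union>g'\<in>Lp_eq M p `` {g}. Lp_eq M p `` {\<lambda>t. f' t + g' t}) =
      Lp_eq M p `` {\<lambda>t. f t + g t}"
    by (intro UN_constant_eq[OF mem(1)] UN_constant_eq[OF mem(2)] ballI *)
  then show ?thesis by (simp only: Lp_space_def ring.simps)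
qed

lemma Lp_space_smult:
  assumes "f \<in> Lp_functions M p"
  shows "c \<odot>\<^bsub>Lp_space M p\<^esub> Lp_eq M p `` {f} = Lp_eq M p `` {\<lambda>t. c * f t}"
proof -
  have *: "Lp_eq M p `` {\<lambda>t. c * f' t} = Lp_eq M p `` {\<lambda>t. c * f t}"
    if "f' \<in> Lp_eq M p `` {f}" for f'
  proof (intro Lp_class_eq Lp_functions_smult)
    show "AE t in M. c * f' t = c * f t"
      using that unfolding Lp_eq_def by (force elim: eventually_mono)
  qed (use that assms in \<open>auto simp: Lp_eq_def\<close>)
  have mem: "f \<in> Lp_eq M p `` {f}" using assms by (auto simp: Lp_eq_def)
  have "(\<Union>f'\<in>Lp_eq M p `` {f}. Lp_eq M p `` {\<lambda>t. c * f' t}) = Lp_eq M p `` {\<lambda>t. c * f t}"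
    by (intro UN_constant_eq[OF mem] ballI *)
  then show ?thesis by (simp only: Lp_space_def module.simps)
qed

lemma Lp_space_nrm:
  assumes "f \<in> Lp_functions M p"
  shows "nrm (Lp_space M p) (Lp_eq M p `` {f}) = Lp_seminorm M p f"
proof -
  have *: "Lp_seminorm M p g = Lp_seminorm M p f" if "g \<in> Lp_eq M p `` {f}" for g
  proof -
    have ae: "AE t in M. g t = f t" and [measurable]: "f \<in> borel_measurable M" "g \<in> borel_measurable M"
      using that by (auto simp: Lp_eq_def Lp_functions_def)
    have "esssup M (\<lambda>t. ennreal (cmod (g t))) = esssup M (\<lambda>t. ennreal (cmod (f t)))"
      by (rule esssup_AE_cong) (use ae in \<open>auto elim!: eventually_mono\<close>)
    moreover have "(LINT t|M. cmod (g t) powr enn2real p) = (LINT t|M. cmod (f t) powr enn2real p)"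
      by (rule integral_cong_AE) (use ae in \<open>auto elim!: eventually_mono\<close>)
    ultimately show ?thesis by (simp add: Lp_seminorm_def)
  qed
  have "f \<in> Lp_eq M p `` {f}" using assms by (auto simp: Lp_eq_def)
  then have "Lp_seminorm M p ` (Lp_eq M p `` {f}) = {Lp_seminorm M p f}"
    using * by (metis (no_types, lifting) image_cong image_constant)
  then show ?thesis by (simp add: Lp_space_def)
qed

lemma Lp_space_zero: "\<zero>\<^bsub>Lp_space M p\<^esub> = Lp_eq M p `` {\<lambda>t. 0}"
  by (simp add: Lp_space_def)

lemma Lp_space_carrier: "carrier (Lp_space M p) = (\<lambda>f. Lp_eq M p `` {f}) ` Lp_functions M p"
  by (auto simp: Lp_space_def quotient_def)

lemma vectorspace_Lp_space: "vectorspace class_ring (Lp_space M p)"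
proof -
  have neg: "(\<lambda>t. - f t) \<in> Lp_functions M p" if "f \<in> Lp_functions M p" for f
    using Lp_functions_smult[OF that, of "- 1"] by simp
  show ?thesis by (rule vectorspaceI)
    (auto simp: neg Lp_space_carrier Lp_space_add Lp_space_smult Lp_space_zero Lp_functions_0
      Lp_functions_add Lp_functions_smult algebra_simps intro!: imageI)
qed

end

theory Submission
  imports Defs
begin

text \<open>
  All spaces of the theorem consist of functions, and in each of them one can cut the underlying
  set into finitely many pieces and replace a function by its mean value on every piece. Let
  \<open>x\<^sub>i\<close> be the indicator function of the \<open>i\<close>-th piece, suitably normalised, and let
  \<open>x\<^sub>i\<^sup>*\<close> be the mean value over that piece. For a permutation \<open>\<sigma>\<close> and signs \<open>s\<^sub>i\<close> the
  operator \<open>f \<mapsto> \<Sum>\<^sub>i s\<^sub>i x\<^sub>\<sigma>\<^sub>(\<^sub>i\<^sub>)\<^sup>*(f) x\<^sub>i\<close> is the averaging operator followed by an isometry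
  of the span of the \<open>x\<^sub>i\<close>, which is a finite-dimensional \<open>\<ell>\<^sub>p\<close>; so its norm is at most one. These
  operators are the images \<open>E(g)\<close> of the signed permutation matrices, and the signed permutation
  matrices form an irreducible matrix group. Hence the bound in (iii) is automatic, and the
  theorem reduces to a statement about finitely many vectors and functionals
  (\<open>property_A_of_approximating_systems\<close>): given finite sets \<open>A\<close> of functions and \<open>B\<close> of
  functionals and \<open>e > 0\<close>, find pieces such that the averaging operator \<open>P\<close> satisfies
  \<open>\<parallel>P f - f\<parallel> \<le> e\<close> for \<open>f \<in> A\<close> and \<open>\<parallel>\<phi> \<circ> P - \<phi>\<parallel> \<le> e\<close> for \<open>\<phi> \<in> B\<close>. The net is then indexed by the
  triples \<open>(A, B, k)\<close> with \<open>e = 1 / (k + 1)\<close>.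

  The condition on \<open>A\<close> says that the functions in \<open>A\<close> are nearly constant on the pieces. The
  condition on \<open>B\<close> is of the same kind once the functionals are represented by functions. How this
  is done depends on the space.

  \<^item> If \<open>1 < p < \<infinity>\<close>, every functional is close in norm to the integral against a simple function
    (\<open>form_approximation\<close>): an almost minimiser \<open>u\<close> of \<open>\<parallel>u\<parallel>\<^sup>p / p - Re (\<phi> u)\<close> can be taken simple,
    and since \<open>\<parallel>\<cdot>\<parallel>\<^sup>p\<close> is uniformly smooth, \<open>\<phi>\<close> almost equals the derivative of \<open>\<parallel>\<cdot>\<parallel>\<^sup>p / p\<close> at
    \<open>u\<close>, which is integration against \<open>\<bar>u\<bar>\<^sup>p\<^sup>-\<^sup>2 cnj u\<close>. The averages are conditional expectations.

  \<^item> On \<open>C(K)\<close> and \<open>L\<^sub>\<infinity>\<close> a functional need not be given by a function, but finitely many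
    functionals are dominated by one positive functional \<open>\<psi>\<close> (\<open>dominating_positive_form\<close>) and are
    close in norm to functionals \<open>f \<mapsto> \<psi> (u f)\<close> with \<open>u\<close> in the algebra (\<open>approximate_density\<close>).
    The pieces become a partition of unity into functions \<open>h\<close>, because \<open>C(K)\<close> need not
    contain indicator functions. It is chosen such that the part where two of them overlap is small for \<open>\<psi>\<close>
    (\<open>partition_of_unity\<close>), and the averages are taken with respect to \<open>\<psi>\<close> over the part where
    \<open>h = 1\<close>.

  \<^item> On \<open>L\<^sub>1(\<mu>)\<close> a functional has a bounded density on every part of the measure space that carries
    an integrable function, by the theorem of Radon and Nikodym. If \<open>\<mu>\<close> is not \<open>\<sigma>\<close>-finite, these
    densities need not come from one measurable function, but they are consistent with each other
    (\<open>local_density\<close>). Rounding their values to a grid cuts every such part into finitely many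
    pieces, again consistently, so that one functional \<open>f \<mapsto> \<integral> f\<close> per piece is defined on
    the whole space (\<open>colour_approximating_system\<close>).
\<close>

section \<open>Signed permutation matrices\<close>

definition signed_permutation_matrix :: "nat \<Rightarrow> (nat \<Rightarrow> nat) \<Rightarrow> (nat \<Rightarrow> complex) \<Rightarrow> complex mat" where
  "signed_permutation_matrix n \<sigma> s = mat n n (\<lambda>(i, j). if j = \<sigma> i then s i else 0)"

definition signed_permutations :: "nat \<Rightarrow> complex mat set" where
  "signed_permutations n = {signed_permutation_matrix n \<sigma> s |\<sigma> s.
     \<sigma> permutes {..<n} \<and> (\<forall>i<n. s i \<in> {1, - 1})}"

lemma signed_permutation_matrix_carrier [simp]:
  "signed_permutation_matrix n \<sigma> s \<in> carrier_mat n n"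
  by (simp add: signed_permutation_matrix_def)

lemma signed_permutation_matrix_mult:
  assumes "\<sigma> permutes {..<n}"
  shows "signed_permutation_matrix n \<sigma> s * signed_permutation_matrix n \<tau> t =
    signed_permutation_matrix n (\<tau> \<circ> \<sigma>) (\<lambda>i. s i * t (\<sigma> i))"
proof (rule eq_matI)
  fix i j assume ij: "i < dim_row (signed_permutation_matrix n (\<tau> \<circ> \<sigma>) (\<lambda>i. s i * t (\<sigma> i)))"
    "j < dim_col (signed_permutation_matrix n (\<tau> \<circ> \<sigma>) (\<lambda>i. s i * t (\<sigma> i)))"
  then have ij': "i < n" "j < n" by (auto simp: signed_permutation_matrix_def)
  have si: "\<sigma> i < n" using permutes_in_image[OF assms, of i] ij' by auto
  have "(signed_permutation_matrix n \<sigma> s * signed_permutation_matrix n \<tau> t) $$ (i, j) =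
      (\<Sum>k<n. (if k = \<sigma> i then s i else 0) * (if j = \<tau> k then t k else 0))"
    using ij' by (simp add: signed_permutation_matrix_def scalar_prod_def atLeast0LessThan)
  also have "\<dots> = (\<Sum>k<n. if k = \<sigma> i then s i * (if j = \<tau> k then t k else 0) else 0)"
    by (intro sum.cong) auto
  also have "\<dots> = signed_permutation_matrix n (\<tau> \<circ> \<sigma>) (\<lambda>i. s i * t (\<sigma> i)) $$ (i, j)"
    using ij' si by (simp add: signed_permutation_matrix_def)
  finally show "(signed_permutation_matrix n \<sigma> s * signed_permutation_matrix n \<tau> t) $$ (i, j) =
    signed_permutation_matrix n (\<tau> \<circ> \<sigma>) (\<lambda>i. s i * t (\<sigma> i)) $$ (i, j)" .
qed (auto simp: signed_permutation_matrix_def)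

lemma signed_permutation_matrix_one:
  assumes "\<And>i. i < n \<Longrightarrow> \<sigma> i = i" "\<And>i. i < n \<Longrightarrow> s i = 1"
  shows "signed_permutation_matrix n \<sigma> s = 1\<^sub>m n"
  by (rule eq_matI) (use assms in \<open>auto simp: signed_permutation_matrix_def\<close>)

lemma finite_signed_permutations: "finite (signed_permutations n)"
proof (rule finite_subset)
  show "signed_permutations n \<subseteq> (\<lambda>(\<sigma>, s). signed_permutation_matrix n \<sigma> s) `
      ({\<sigma>. \<sigma> permutes {..<n}} \<times> ({..<n} \<rightarrow>\<^sub>E {1, - 1}))"
  proof
    fix A assume "A \<in> signed_permutations n"
    then obtain \<sigma> s where *: "A = signed_permutation_matrix n \<sigma> s" "\<sigma> permutes {..<n}"
      "\<forall>i<n. s i \<in> {1, - 1}" by (auto simp: signed_permutations_def)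
    then have "A = signed_permutation_matrix n \<sigma> (restrict s {..<n})"
      by (auto simp: signed_permutation_matrix_def intro!: eq_matI)
    then show "A \<in> (\<lambda>(\<sigma>, s). signed_permutation_matrix n \<sigma> s) `
      ({\<sigma>. \<sigma> permutes {..<n}} \<times> ({..<n} \<rightarrow>\<^sub>E {1, - 1}))"
      using * by (intro image_eqI[of _ _ "(\<sigma>, restrict s {..<n})"]) auto
  qed
  show "finite ((\<lambda>(\<sigma>, s). signed_permutation_matrix n \<sigma> s) `
      ({\<sigma>. \<sigma> permutes {..<n}} \<times> ({..<n} \<rightarrow>\<^sub>E {1, - 1})))"
    by (intro finite_imageI finite_cartesian_product finite_permutations finite_PiE) auto
qed

lemma signed_permutations_mult_closed:
  assumes "A \<in> signed_permutations n" "B \<in> signed_permutations n"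
  shows "A * B \<in> signed_permutations n"
proof -
  obtain \<sigma> s \<tau> t where *: "A = signed_permutation_matrix n \<sigma> s" "\<sigma> permutes {..<n}"
      "\<forall>i<n. s i \<in> {1, - 1}" "B = signed_permutation_matrix n \<tau> t" "\<tau> permutes {..<n}"
      "\<forall>i<n. t i \<in> {1, - 1}" using assms by (auto simp: signed_permutations_def)
  have "\<sigma> i < n" if "i < n" for i using permutes_in_image[OF *(2), of i] that by auto
  then have "\<forall>i<n. s i * t (\<sigma> i) \<in> {1, - 1}" using *(3,6) by fastforce
  then show ?thesis using * permutes_compose[OF *(2,5)]
    unfolding signed_permutations_def by (auto simp: signed_permutation_matrix_mult)
qed

lemma signed_permutations_inverse:
  assumes "A \<in> signed_permutations n"
  shows "\<exists>B \<in> signed_permutations n. A * B = 1\<^sub>m n \<and> B * A = 1\<^sub>m n"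
proof -
  obtain \<sigma> s where *: "A = signed_permutation_matrix n \<sigma> s" "\<sigma> permutes {..<n}"
      "\<forall>i<n. s i \<in> {1, - 1}" using assms by (auto simp: signed_permutations_def)
  have inv: "inv_into UNIV \<sigma> permutes {..<n}" by (rule permutes_inv[OF *(2)])
  have lt: "inv_into UNIV \<sigma> i < n" if "i < n" for i using permutes_in_image[OF inv, of i] that by auto
  have sq: "s i * s i = 1" if "i < n" for i using *(3) that by fastforce
  define B where "B = signed_permutation_matrix n (inv_into UNIV \<sigma>) (\<lambda>i. s (inv_into UNIV \<sigma> i))"
  have "B \<in> signed_permutations n"
    unfolding signed_permutations_def B_def using inv lt *(3) by blast
  moreover have "A * B = 1\<^sub>m n"
    unfolding B_def *(1) using sq permutes_inverses[OF *(2)]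
    by (subst signed_permutation_matrix_mult[OF *(2)]) (intro signed_permutation_matrix_one, auto)
  moreover have "B * A = 1\<^sub>m n"
    unfolding B_def *(1) using sq lt permutes_inverses[OF *(2)]
    by (subst signed_permutation_matrix_mult[OF inv]) (intro signed_permutation_matrix_one, auto)
  ultimately show ?thesis by blast
qed

lemma subgroup_signed_permutations:
  "subgroup (signed_permutations n) (units_of (ring_mat TYPE(complex) n ()))"
proof -
  interpret R: Ring.ring "ring_mat TYPE(complex) n ()" by (rule ring_mat)
  interpret U: group "units_of (ring_mat TYPE(complex) n ())" by (rule R.units_group)
  have sub: "signed_permutations n \<subseteq> Units (ring_mat TYPE(complex) n ())"
  proof
    fix A assume A: "A \<in> signed_permutations n"
    then obtain B where "B \<in> signed_permutations n" "A * B = 1\<^sub>m n" "B * A = 1\<^sub>m n"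
      using signed_permutations_inverse by blast
    with A show "A \<in> Units (ring_mat TYPE(complex) n ())"
      by (auto simp: Units_def ring_mat_simps signed_permutations_def)
  qed
  show ?thesis
  proof (rule U.subgroupI)
    show "signed_permutations n \<subseteq> carrier (units_of (ring_mat TYPE(complex) n ()))"
      using sub by (simp add: units_of_def)
    have "signed_permutation_matrix n id (\<lambda>_. 1) \<in> signed_permutations n"
      unfolding signed_permutations_def using permutes_id by fastforce
    then show "signed_permutations n \<noteq> {}" by blast
    fix A assume A: "A \<in> signed_permutations n"
    then obtain B where B: "B \<in> signed_permutations n" "A * B = 1\<^sub>m n" "B * A = 1\<^sub>m n"
      using signed_permutations_inverse by blast
    have "inv\<^bsub>units_of (ring_mat TYPE(complex) n ())\<^esub> A = B"
      using A B sub by (intro U.inv_equality) (auto simp: units_of_def ring_mat_simps)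
    then show "inv\<^bsub>units_of (ring_mat TYPE(complex) n ())\<^esub> A \<in> signed_permutations n"
      using B by simp
    fix C assume "C \<in> signed_permutations n"
    then show "A \<otimes>\<^bsub>units_of (ring_mat TYPE(complex) n ())\<^esub> C \<in> signed_permutations n"
      using signed_permutations_mult_closed[OF A] by (simp add: units_of_def ring_mat_simps)
  qed
qed

text \<open>
  Averaging over signs and permutations isolates single entries: the matrix units lie in the span,
  which gives irreducibility.
\<close>

lemma span_signed_permutations:
  "LinearCombinations.module.span class_ring (module_mat TYPE(complex) n n) (signed_permutations n)
     = carrier_mat n n"
proof -
  let ?M = "module_mat TYPE(complex) n n"
  interpret M: vectorspace class_ring ?M by (rule matrix_vs)
  let ?S = "M.span (signed_permutations n)"
  have car: "carrier ?M = carrier_mat n n" by (simp add: module_mat_simps)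
  have G: "signed_permutations n \<subseteq> carrier ?M"
    by (auto simp: signed_permutations_def module_mat_simps)
  have sub: "submodule class_ring ?S ?M" by (rule M.span_is_submodule[OF G])
  have inS: "A \<in> ?S" if "A \<in> signed_permutations n" for A
    using M.in_own_span[OF G] that by blast
  have addS: "A + B \<in> ?S" if "A \<in> ?S" "B \<in> ?S" for A B
    using submodule.m_closed[OF sub that] by (simp add: module_mat_simps)
  have smultS: "c \<cdot>\<^sub>m A \<in> ?S" if "A \<in> ?S" for c A
    using submodule.smult_closed[OF sub _ that, of c] by (simp add: module_mat_simps)
  have part: "mat n n (\<lambda>ij. if ij \<in> I then A $$ ij else 0) \<in> ?S"
    if "finite I" "I \<subseteq> {..<n} \<times> {..<n}" for I and A :: "complex mat"
    using that
  proof (induction I rule: finite_induct)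
    case empty
    have "signed_permutation_matrix n id (\<lambda>_. 1) \<in> signed_permutations n"
      unfolding signed_permutations_def using permutes_id by fastforce
    from smultS[OF inS[OF this], of 0] have "0 \<cdot>\<^sub>m signed_permutation_matrix n id (\<lambda>_. 1) \<in> ?S" .
    moreover have "0 \<cdot>\<^sub>m signed_permutation_matrix n id (\<lambda>_. 1) =
        mat n n (\<lambda>ij. if ij \<in> {} then A $$ ij else 0)"
      by (intro eq_matI) (auto simp: signed_permutation_matrix_def)
    ultimately show ?case by simp
  next
    case (insert ij I)
    obtain a b where ij: "ij = (a, b)" by fastforce
    with insert.prems have ab: "a < n" "b < n" by auto
    define T where "T = Transposition.transpose a b"
    have T: "T permutes {..<n}" unfolding T_def using ab by (intro permutes_swap_id) auto
    have Ta: "T a = b" by (simp add: T_def)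
    define Q where "Q = signed_permutation_matrix n T (\<lambda>_. 1)"
    define Q' where "Q' = signed_permutation_matrix n T (\<lambda>i. if i = a then - 1 else 1)"
    have QS: "Q \<in> ?S" "Q' \<in> ?S" unfolding Q_def Q'_def
      by (rule inS; use T in \<open>force simp: signed_permutations_def\<close>)+
    \<comment> \<open>Flipping the sign of row \<open>a\<close> isolates the only entry of that row, which is at \<open>(a, b)\<close>.\<close>
    have "mat n n (\<lambda>ij'. if ij' \<in> insert ij I then A $$ ij' else 0) =
        (mat n n (\<lambda>ij. if ij \<in> I then A $$ ij else 0) + (A $$ ij / 2) \<cdot>\<^sub>m Q) + (- A $$ ij / 2) \<cdot>\<^sub>m Q'"
      using insert.hyps(2) ab Ta
      by (intro eq_matI) (auto simp: Q_def Q'_def signed_permutation_matrix_def ij)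
    moreover have "(mat n n (\<lambda>ij. if ij \<in> I then A $$ ij else 0) + (A $$ ij / 2) \<cdot>\<^sub>m Q) +
        (- A $$ ij / 2) \<cdot>\<^sub>m Q' \<in> ?S"
      using insert.IH insert.prems by (intro addS smultS QS) auto
    ultimately show ?case by simp
  qed
  have "A \<in> ?S" if A: "A \<in> carrier_mat n n" for A
  proof -
    have "A = mat n n (\<lambda>ij. if ij \<in> {..<n} \<times> {..<n} then A $$ ij else 0)"
      using A by (intro eq_matI) auto
    then show ?thesis using part[of "{..<n} \<times> {..<n}" A] by simp
  qed
  moreover have "?S \<subseteq> carrier_mat n n" using submodule.subset[OF sub] by (simp add: car)
  ultimately show ?thesis by blast
qed

lemma irreducible_signed_permutations: "irreducible_matrix_group n (signed_permutations n)"
  unfolding irreducible_matrix_group_def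
  using finite_signed_permutations subgroup_signed_permutations span_signed_permutations by blast

lemma matrix_operator_signed_permutation:
  fixes X :: "'v normed_module"
  assumes X: "vectorspace class_ring X" and x: "\<And>i. i < n \<Longrightarrow> x i \<in> carrier X"
    and \<sigma>: "\<sigma> permutes {..<n}"
  shows "matrix_operator X n x f (signed_permutation_matrix n \<sigma> s) z =
    (\<Oplus>\<^bsub>X\<^esub>i\<in>{..<n}. (s i * f (\<sigma> i) z) \<odot>\<^bsub>X\<^esub> x i)"
proof -
  interpret X: vectorspace class_ring X by fact
  have "(\<Oplus>\<^bsub>X\<^esub>j\<in>{..<n}. signed_permutation_matrix n \<sigma> s $$ (i, j) \<odot>\<^bsub>X\<^esub> rank_one X (x i) (f j) z) =
      (s i * f (\<sigma> i) z) \<odot>\<^bsub>X\<^esub> x i" if i: "i < n" for i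
  proof -
    have si: "\<sigma> i \<in> {..<n}" using permutes_in_image[OF \<sigma>, of i] i by simp
    have "(\<Oplus>\<^bsub>X\<^esub>j\<in>{..<n}. signed_permutation_matrix n \<sigma> s $$ (i, j) \<odot>\<^bsub>X\<^esub> rank_one X (x i) (f j) z) =
      (\<Oplus>\<^bsub>X\<^esub>j\<in>{..<n}. if \<sigma> i = j then (s i * f j z) \<odot>\<^bsub>X\<^esub> x i else \<zero>\<^bsub>X\<^esub>)"
      using i x[OF i] X.smult_closed X.smult_assoc1[of _ _ "x i"] X.smult_l_null
      by (intro X.finsum_cong') (auto simp: signed_permutation_matrix_def rank_one_def)
    also have "\<dots> = (s i * f (\<sigma> i) z) \<odot>\<^bsub>X\<^esub> x i"
      using si x[OF i] X.smult_closed by (intro X.finsum_singleton) auto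
    finally show ?thesis .
  qed
  then show ?thesis unfolding matrix_operator_def
    using x X.smult_closed by (intro X.finsum_cong') auto
qed

section \<open>Function models of a normed space\<close>

lemma directed_by_finite_triples:
  fixes C :: "'b set" and D :: "'c set"
  assumes L: "L = {(A, B, k :: nat). finite A \<and> A \<subseteq> C \<and> finite B \<and> B \<subseteq> D}"
    and r: "r = {(l, m). l \<in> L \<and> m \<in> L \<and> fst l \<subseteq> fst m \<and> fst (snd l) \<subseteq> fst (snd m) \<and>
      snd (snd l) \<le> snd (snd m)}"
  shows "directed_by L r"
  unfolding directed_by_def
proof (intro conjI ballI)
  have "({}, {}, 0) \<in> L" by (simp add: L)
  then show "L \<noteq> {}" by blast
  have "refl_on L r" unfolding r refl_on_def by simp
  moreover have "trans r"
  proof (rule transI)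
    fix l m k assume "(l, m) \<in> r" "(m, k) \<in> r"
    then have lmk: "l \<in> L" "k \<in> L" "fst l \<subseteq> fst m" "fst m \<subseteq> fst k" "fst (snd l) \<subseteq> fst (snd m)"
      "fst (snd m) \<subseteq> fst (snd k)" "snd (snd l) \<le> snd (snd m)" "snd (snd m) \<le> snd (snd k)"
      by (simp_all add: r)
    show "(l, k) \<in> r"
      using subset_trans[OF lmk(3,4)] subset_trans[OF lmk(5,6)] le_trans[OF lmk(7,8)] lmk(1,2)
      by (simp add: r)
  qed
  moreover have "r \<subseteq> L \<times> L" by (simp add: r subset_iff)
  ultimately show "preorder_on L r" unfolding preorder_on_def by simp
  fix a b assume ab: "a \<in> L" "b \<in> L"
  define c where "c = (fst a \<union> fst b, fst (snd a) \<union> fst (snd b), max (snd (snd a)) (snd (snd b)))"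
  have c: "c \<in> L" using ab by (simp add: L c_def case_prod_beta)
  have "(a, c) \<in> r" "(b, c) \<in> r" using ab c by (simp_all add: r c_def)
  with c show "\<exists>c\<in>L. (a, c) \<in> r \<and> (b, c) \<in> r" by blast
qed

text \<open>
  Functionals are considered on a space of functions with a seminorm, before functions that agree
  almost everywhere are identified.
\<close>

definition bounded_form ::
  "('a \<Rightarrow> complex) set \<Rightarrow> (('a \<Rightarrow> complex) \<Rightarrow> real) \<Rightarrow> (('a \<Rightarrow> complex) \<Rightarrow> complex) \<Rightarrow> bool" where
  "bounded_form W N \<phi> \<longleftrightarrow>
     (\<forall>f\<in>W. \<forall>g\<in>W. \<phi> (\<lambda>t. f t + g t) = \<phi> f + \<phi> g) \<and>
     (\<forall>c. \<forall>f\<in>W. \<phi> (\<lambda>t. c * f t) = c * \<phi> f) \<and>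
     (\<exists>C. \<forall>f\<in>W. cmod (\<phi> f) \<le> C * N f)"

text \<open>
  What has to be constructed in each space. The index set is an arbitrary finite set, which avoids
  numberings. The condition with \<open>\<sigma>\<close> and \<open>s\<close> says that every signed permutation matrix acts as a
  contraction.
\<close>

definition approximating_system ::
  "('a \<Rightarrow> complex) set \<Rightarrow> (('a \<Rightarrow> complex) \<Rightarrow> real) \<Rightarrow> ('a \<Rightarrow> complex) set \<Rightarrow>
     (('a \<Rightarrow> complex) \<Rightarrow> complex) set \<Rightarrow> real \<Rightarrow>
     'i set \<Rightarrow> ('i \<Rightarrow> 'a \<Rightarrow> complex) \<Rightarrow> ('i \<Rightarrow> ('a \<Rightarrow> complex) \<Rightarrow> complex) \<Rightarrow> bool" where
  "approximating_system W N A B e I x F \<longleftrightarrow>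
     finite I \<and> I \<noteq> {} \<and> (\<forall>i\<in>I. x i \<in> W) \<and> (\<forall>i\<in>I. bounded_form W N (F i)) \<and>
     (\<forall>i\<in>I. \<forall>j\<in>I. F j (x i) = (if i = j then 1 else 0)) \<and>
     (\<forall>\<sigma> s f. bij_betw \<sigma> I I \<longrightarrow> (\<forall>i\<in>I. s i \<in> {1, - 1}) \<longrightarrow> f \<in> W \<longrightarrow>
        N (\<lambda>t. \<Sum>i\<in>I. s i * F (\<sigma> i) f * x i t) \<le> N f) \<and>
     (\<forall>f\<in>A. N (\<lambda>t. (\<Sum>i\<in>I. F i f * x i t) - f t) \<le> e) \<and>
     (\<forall>\<phi>\<in>B. \<forall>f\<in>W. cmod (\<phi> (\<lambda>t. \<Sum>i\<in>I. F i f * x i t) - \<phi> f) \<le> e * N f)"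

lemma bounded_form_add:
  "bounded_form W N \<phi> \<Longrightarrow> f \<in> W \<Longrightarrow> g \<in> W \<Longrightarrow> \<phi> (\<lambda>t. f t + g t) = \<phi> f + \<phi> g"
  by (simp add: bounded_form_def)

lemma bounded_form_smult:
  "bounded_form W N \<phi> \<Longrightarrow> f \<in> W \<Longrightarrow> \<phi> (\<lambda>t. c * f t) = c * \<phi> f"
  by (simp add: bounded_form_def)

lemma bounded_functionalD:
  assumes "bounded_functional X \<phi>"
  shows "y \<in> carrier X \<Longrightarrow> z \<in> carrier X \<Longrightarrow> \<phi> (y \<oplus>\<^bsub>X\<^esub> z) = \<phi> y + \<phi> z"
    "z \<in> carrier X \<Longrightarrow> \<phi> (c \<odot>\<^bsub>X\<^esub> z) = c * \<phi> z"
    "\<exists>C. \<forall>z\<in>carrier X. cmod (\<phi> z) \<le> C * nrm X z"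
  using assms unfolding bounded_functional_def by simp_all

text \<open>
  A description of a space \<open>X\<close> by functions: \<open>q\<close> maps a function to the element of \<open>X\<close> that it
  represents, its restriction for \<open>C(K)\<close> and its class modulo null functions for \<open>L\<^sub>p\<close>.
\<close>

locale function_model =
  fixes X :: "'v normed_module" and W :: "('a \<Rightarrow> complex) set" and N :: "('a \<Rightarrow> complex) \<Rightarrow> real"
    and q :: "('a \<Rightarrow> complex) \<Rightarrow> 'v"
  assumes X: "vectorspace class_ring X"
    and W_add: "\<And>f g. f \<in> W \<Longrightarrow> g \<in> W \<Longrightarrow> (\<lambda>t. f t + g t) \<in> W"
    and W_smult: "\<And>c f. f \<in> W \<Longrightarrow> (\<lambda>t. c * f t) \<in> W"
    and q_onto: "q ` W = carrier X"
    and q_add: "\<And>f g. f \<in> W \<Longrightarrow> g \<in> W \<Longrightarrow> q f \<oplus>\<^bsub>X\<^esub> q g = q (\<lambda>t. f t + g t)"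
    and q_smult: "\<And>c f. f \<in> W \<Longrightarrow> c \<odot>\<^bsub>X\<^esub> q f = q (\<lambda>t. c * f t)"
    and q_nrm: "\<And>f. f \<in> W \<Longrightarrow> nrm X (q f) = N f"
    and N_zero: "N (\<lambda>t. 0) = 0"
    and N_nonneg: "\<And>f. f \<in> W \<Longrightarrow> 0 \<le> N f"
begin

sublocale X: vectorspace class_ring X by (rule X)

lemma q_carrier [simp]: "f \<in> W \<Longrightarrow> q f \<in> carrier X"
  using q_onto by blast

lemma W_zero: "(\<lambda>t. 0) \<in> W"
proof -
  obtain f where "f \<in> W" using q_onto X.zero_closed by blast
  from W_smult[OF this, of 0] show ?thesis by simp
qed

lemma q_zero: "q (\<lambda>t. 0) = \<zero>\<^bsub>X\<^esub>"
  using q_smult[OF W_zero, of 0] X.smult_l_null[of "q (\<lambda>t. 0)"] W_zero by simp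

lemma W_sum: "(\<And>i. i \<in> I \<Longrightarrow> g i \<in> W) \<Longrightarrow> (\<lambda>t. \<Sum>i\<in>I. g i t) \<in> W"
  by (induction I rule: infinite_finite_induct) (auto simp: W_zero W_add)

lemma q_sum:
  "finite I \<Longrightarrow> (\<And>i. i \<in> I \<Longrightarrow> g i \<in> W) \<Longrightarrow> (\<Oplus>\<^bsub>X\<^esub>i\<in>I. q (g i)) = q (\<lambda>t. \<Sum>i\<in>I. g i t)"
proof (induction I rule: finite_induct)
  case empty
  then show ?case by (simp add: q_zero)
next
  case (insert i I)
  have "(\<Oplus>\<^bsub>X\<^esub>i\<in>insert i I. q (g i)) = q (g i) \<oplus>\<^bsub>X\<^esub> (\<Oplus>\<^bsub>X\<^esub>i\<in>I. q (g i))"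
    using insert by (intro X.finsum_insert) auto
  also have "\<dots> = q (g i) \<oplus>\<^bsub>X\<^esub> q (\<lambda>t. \<Sum>i\<in>I. g i t)" using insert by simp
  also have "\<dots> = q (\<lambda>t. g i t + (\<Sum>i\<in>I. g i t))" using insert by (intro q_add W_sum) auto
  finally show ?case using insert by simp
qed

lemma q_diff: "f \<in> W \<Longrightarrow> g \<in> W \<Longrightarrow> q f \<ominus>\<^bsub>X\<^esub> q g = q (\<lambda>t. f t - g t)"
proof -
  assume fg: "f \<in> W" "g \<in> W"
  have "\<ominus>\<^bsub>X\<^esub> q g = (- 1) \<odot>\<^bsub>X\<^esub> q g"
    using X.smult_l_minus[of 1 "q g"] X.smult_one[of "q g"] fg by (simp add: class_ring_simps)
  then have "q f \<ominus>\<^bsub>X\<^esub> q g = q f \<oplus>\<^bsub>X\<^esub> q (\<lambda>t. - 1 * g t)"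
    unfolding a_minus_def using q_smult[OF fg(2), of "- 1"] by simp
  also have "\<dots> = q (\<lambda>t. f t + - 1 * g t)" by (intro q_add fg W_smult)
  finally show ?thesis by simp
qed

text \<open>
  A bounded functional does not see the choice of representatives, because their difference has
  seminorm zero.
\<close>

lemma bounded_form_q_cong:
  assumes \<phi>: "bounded_form W N \<phi>" and fg: "f \<in> W" "g \<in> W" "q f = q g"
  shows "\<phi> f = \<phi> g"
proof -
  have "q (\<lambda>t. f t + - 1 * g t) = \<zero>\<^bsub>X\<^esub>"
    using q_diff[OF fg(1,2)] fg X.r_neg[of "q g"] by (simp add: a_minus_def)
  moreover have d: "(\<lambda>t. f t + - 1 * g t) \<in> W" by (intro W_add W_smult fg)
  ultimately have "N (\<lambda>t. f t + - 1 * g t) = 0"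
    using q_nrm[OF d] q_nrm[OF W_zero] q_zero N_zero by simp
  moreover obtain C where "cmod (\<phi> (\<lambda>t. f t + - 1 * g t)) \<le> C * N (\<lambda>t. f t + - 1 * g t)"
    using \<phi> d unfolding bounded_form_def by blast
  ultimately have "\<phi> (\<lambda>t. f t + - 1 * g t) = 0" by simp
  moreover have "\<phi> (\<lambda>t. f t + - 1 * g t) = \<phi> f + \<phi> (\<lambda>t. - 1 * g t)"
    by (rule bounded_form_add[OF \<phi> fg(1) W_smult[OF fg(2)]])
  moreover have "\<phi> (\<lambda>t. - 1 * g t) = - 1 * \<phi> g"
    by (rule bounded_form_smult[OF \<phi> fg(2)])
  ultimately show ?thesis by simp
qed

definition lift_form :: "(('a \<Rightarrow> complex) \<Rightarrow> complex) \<Rightarrow> 'v \<Rightarrow> complex" where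
  "lift_form \<phi> = (\<lambda>v\<in>carrier X. \<phi> (inv_into W q v))"

lemma lift_form_q:
  assumes "bounded_form W N \<phi>" "f \<in> W"
  shows "lift_form \<phi> (q f) = \<phi> f"
proof -
  have *: "q f \<in> q ` W" using assms(2) by (rule imageI)
  have "\<phi> (inv_into W q (q f)) = \<phi> f"
    by (rule bounded_form_q_cong[OF assms(1) inv_into_into[OF *] assms(2) f_inv_into_f[OF *]])
  then show ?thesis using assms(2) by (simp add: lift_form_def)
qed

lemma lift_form_dual:
  assumes \<phi>: "bounded_form W N \<phi>"
  shows "lift_form \<phi> \<in> carrier (dual X)"
proof -
  have "bounded_functional X (lift_form \<phi>)"
    unfolding bounded_functional_def q_onto[symmetric] ball_simps
    using \<phi> W_add W_smult unfolding bounded_form_def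
    by (simp add: q_add q_smult q_nrm lift_form_q[OF \<phi>])
  then show ?thesis by (simp add: dual_def lift_form_def)
qed

lemma bounded_form_of_dual:
  assumes "\<phi> \<in> carrier (dual X)"
  shows "bounded_form W N (\<lambda>f. \<phi> (q f))"
proof -
  have \<phi>: "bounded_functional X \<phi>" using assms unfolding dual_def by simp
  obtain C where C: "\<forall>z\<in>carrier X. cmod (\<phi> z) \<le> C * nrm X z"
    using bounded_functionalD(3)[OF \<phi>] ..
  show ?thesis
    unfolding bounded_form_def
  proof (intro conjI ballI allI exI[of _ C])
    fix f g assume fg: "f \<in> W" "g \<in> W"
    show "\<phi> (q (\<lambda>t. f t + g t)) = \<phi> (q f) + \<phi> (q g)"
      using bounded_functionalD(1)[OF \<phi> q_carrier[OF fg(1)] q_carrier[OF fg(2)]] by (simp only: q_add[OF fg])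
  next
    fix c f assume f: "f \<in> W"
    show "\<phi> (q (\<lambda>t. c * f t)) = c * \<phi> (q f)"
      using bounded_functionalD(2)[OF \<phi> q_carrier[OF f], of c] by (simp only: q_smult[OF f])
  next
    fix f assume f: "f \<in> W"
    show "cmod (\<phi> (q f)) \<le> C * N f" using bspec[OF C q_carrier[OF f]] by (simp only: q_nrm[OF f])
  qed
qed

lemma dual_nrm_le:
  assumes "\<And>f. f \<in> W \<Longrightarrow> cmod (\<phi> (q f)) \<le> e * N f" "0 \<le> e"
  shows "nrm (dual X) \<phi> \<le> e"
proof -
  have "Sup {cmod (\<phi> z) |z. z \<in> carrier X \<and> nrm X z \<le> 1} \<le> e"
  proof (rule cSup_least)
    have "nrm X \<zero>\<^bsub>X\<^esub> = 0" using q_nrm[OF W_zero] q_zero N_zero by simp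
    then show "{cmod (\<phi> z) |z. z \<in> carrier X \<and> nrm X z \<le> 1} \<noteq> {}"
      using X.zero_closed by (auto intro!: exI[of _ "\<zero>\<^bsub>X\<^esub>"])
    fix y assume "y \<in> {cmod (\<phi> z) |z. z \<in> carrier X \<and> nrm X z \<le> 1}"
    then obtain f where f: "f \<in> W" "N f \<le> 1" "y = cmod (\<phi> (q f))"
      unfolding q_onto[symmetric] using q_nrm by auto
    have "e * N f \<le> e * 1" using f assms(2) by (intro mult_left_mono) auto
    with assms(1)[OF f(1)] f show "y \<le> e" by linarith
  qed
  then show ?thesis by (simp add: dual_def)
qed

lemma operator_norm_le_one:
  assumes "\<And>f. f \<in> W \<Longrightarrow> nrm X (T (q f)) \<le> N f"
  shows "operator_norm X T \<le> 1"
  unfolding operator_norm_def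
proof (rule cSup_least)
  have "nrm X \<zero>\<^bsub>X\<^esub> = 0" using q_nrm[OF W_zero] q_zero N_zero by simp
  then show "{nrm X (T z) |z. z \<in> carrier X \<and> nrm X z \<le> 1} \<noteq> {}"
    using X.zero_closed by (auto intro!: exI[of _ "\<zero>\<^bsub>X\<^esub>"])
  fix y assume "y \<in> {nrm X (T z) |z. z \<in> carrier X \<and> nrm X z \<le> 1}"
  then obtain f where f: "f \<in> W" "N f \<le> 1" "y = nrm X (T (q f))"
    unfolding q_onto[symmetric] using q_nrm by auto
  with assms[OF f(1)] show "y \<le> 1" by linarith
qed

text \<open>
  One member of the net. Numbering the index set turns signed permutations of \<open>{..<n}\<close> into the
  maps \<open>\<sigma>\<close> and \<open>s\<close> of the approximating system; the identity matrix is one of them.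
\<close>

lemma finite_level_system:
  assumes sys: "approximating_system W N A (B :: (('a \<Rightarrow> complex) \<Rightarrow> complex) set) e I x F"
    and A: "A \<subseteq> W" and e: "0 \<le> e"
  shows "\<exists>n y f. biorthogonal_system X n y f \<and>
      (\<forall>g\<in>signed_permutations n. operator_norm X (matrix_operator X n y f g) \<le> 1) \<and>
      (\<forall>a\<in>A. nrm X (matrix_operator X n y f (1\<^sub>m n) (q a) \<ominus>\<^bsub>X\<^esub> q a) \<le> e) \<and>
      (\<forall>\<phi>\<in>carrier (dual X). (\<lambda>a. \<phi> (q a)) \<in> B \<longrightarrow>
         nrm (dual X) (adjoint_operator X (matrix_operator X n y f (1\<^sub>m n)) \<phi> \<ominus>\<^bsub>dual X\<^esub> \<phi>) \<le> e)"
proof -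
  note S = sys[unfolded approximating_system_def]
  from S have fin: "finite I" and ne: "I \<noteq> {}" and xW: "\<And>i. i \<in> I \<Longrightarrow> x i \<in> W"
    and Fb: "\<And>i. i \<in> I \<Longrightarrow> bounded_form W N (F i)"
    and bi: "\<And>i j. i \<in> I \<Longrightarrow> j \<in> I \<Longrightarrow> F j (x i) = (if i = j then 1 else 0)"
    and contr: "\<And>\<sigma> s f. bij_betw \<sigma> I I \<Longrightarrow> (\<forall>i\<in>I. s i \<in> {1, - 1}) \<Longrightarrow> f \<in> W \<Longrightarrow>
        N (\<lambda>t. \<Sum>i\<in>I. s i * F (\<sigma> i) f * x i t) \<le> N f"
    and appA: "\<And>f. f \<in> A \<Longrightarrow> N (\<lambda>t. (\<Sum>i\<in>I. F i f * x i t) - f t) \<le> e"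
    and appB: "\<And>\<phi> f. \<phi> \<in> B \<Longrightarrow> f \<in> W \<Longrightarrow>
        cmod (\<phi> (\<lambda>t. \<Sum>i\<in>I. F i f * x i t) - \<phi> f) \<le> e * N f"
    by auto
  obtain h where h: "bij_betw h {..<card I} I"
    using ex_bij_betw_nat_finite[OF fin] atLeast0LessThan by metis
  define n where "n = card I"
  have n: "0 < n" using fin ne by (auto simp: n_def card_gt_0_iff)
  have hb: "bij_betw h {..<n} I" using h by (simp add: n_def)
  have hI: "h i \<in> I" if "i < n" for i using hb that by (auto simp: bij_betw_def)
  have hinj: "h i = h j \<longleftrightarrow> i = j" if "i < n" "j < n" for i j
    using hb that by (auto simp: bij_betw_def inj_on_def)
  define y where "y = (\<lambda>i. q (x (h i)))"
  define f where "f = (\<lambda>i. lift_form (F (h i)))"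
  have yX: "y i \<in> carrier X" if "i < n" for i using hI[OF that] xW by (auto simp: y_def)
  have op: "matrix_operator X n y f (signed_permutation_matrix n \<sigma> s) (q a) =
      q (\<lambda>t. \<Sum>i<n. s i * F (h (\<sigma> i)) a * x (h i) t)"
    if \<sigma>: "\<sigma> permutes {..<n}" and a: "a \<in> W" for \<sigma> s a
  proof -
    have "matrix_operator X n y f (signed_permutation_matrix n \<sigma> s) (q a) =
        (\<Oplus>\<^bsub>X\<^esub>i\<in>{..<n}. (s i * f (\<sigma> i) (q a)) \<odot>\<^bsub>X\<^esub> y i)"
      by (rule matrix_operator_signed_permutation[OF X yX \<sigma>])
    also have "\<dots> = (\<Oplus>\<^bsub>X\<^esub>i\<in>{..<n}. q (\<lambda>t. s i * F (h (\<sigma> i)) a * x (h i) t))"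
    proof (intro X.finsum_cong')
      fix i assume "i \<in> {..<n}"
      then have i: "i < n" by simp
      have "\<sigma> i < n" using permutes_in_image[OF \<sigma>, of i] i by auto
      then have "f (\<sigma> i) (q a) = F (h (\<sigma> i)) a" using hI Fb a by (simp add: f_def lift_form_q)
      then show "(s i * f (\<sigma> i) (q a)) \<odot>\<^bsub>X\<^esub> y i = q (\<lambda>t. s i * F (h (\<sigma> i)) a * x (h i) t)"
        using q_smult xW hI[OF i] by (simp add: y_def)
    qed (use xW hI W_smult in auto)
    also have "\<dots> = q (\<lambda>t. \<Sum>i<n. s i * F (h (\<sigma> i)) a * x (h i) t)"
      using xW hI W_smult by (intro q_sum) auto
    finally show ?thesis .
  qed
  have one: "1\<^sub>m n = signed_permutation_matrix n id (\<lambda>_. 1)"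
    by (rule signed_permutation_matrix_one[symmetric]) auto
  define P where "P = matrix_operator X n y f (1\<^sub>m n)"
  have PW: "(\<lambda>t. \<Sum>i\<in>I. F i a * x i t) \<in> W" for a
    using xW W_smult by (intro W_sum) auto
  have P: "P (q a) = q (\<lambda>t. \<Sum>i\<in>I. F i a * x i t)" if "a \<in> W" for a
  proof -
    have "P (q a) = q (\<lambda>t. \<Sum>i<n. F (h i) a * x (h i) t)"
      using op[OF permutes_id that, of "\<lambda>_. 1"] unfolding P_def one by (simp only: id_apply mult_1)
    also have "(\<lambda>t. \<Sum>i<n. F (h i) a * x (h i) t) = (\<lambda>t. \<Sum>i\<in>I. F i a * x i t)"
      by (intro ext sum.reindex_bij_betw[OF hb])
    finally show ?thesis .
  qed
  have "biorthogonal_system X n y f"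
    unfolding biorthogonal_system_def
  proof (intro conjI allI impI n yX)
    fix i j assume ij: "i < n" "j < n"
    show "f j \<in> carrier (dual X)" unfolding f_def by (rule lift_form_dual[OF Fb[OF hI[OF ij(2)]]])
    have "f j (y i) = F (h j) (x (h i))"
      unfolding f_def y_def by (rule lift_form_q[OF Fb[OF hI[OF ij(2)]] xW[OF hI[OF ij(1)]]])
    then show "f j (y i) = (if i = j then 1 else 0)"
      using bi[OF hI[OF ij(1)] hI[OF ij(2)]] hinj[OF ij] by simp
  qed
  moreover have "operator_norm X (matrix_operator X n y f g) \<le> 1" if g: "g \<in> signed_permutations n" for g
  proof (rule operator_norm_le_one)
    fix a assume a: "a \<in> W"
    obtain \<sigma> s where gs: "g = signed_permutation_matrix n \<sigma> s" "\<sigma> permutes {..<n}"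
      "\<forall>i<n. s i \<in> {1, - 1}" using g by (auto simp: signed_permutations_def)
    define k where "k = inv_into {..<n} h"
    have k: "bij_betw k I {..<n}" unfolding k_def by (rule bij_betw_inv_into[OF hb])
    have kh: "k (h i) = i" if "i < n" for i
      unfolding k_def using hb that by (simp add: bij_betw_def)
    have "bij_betw (h \<circ> (\<sigma> \<circ> k)) I I"
      by (rule bij_betw_trans[OF bij_betw_trans[OF k permutes_imp_bij[OF gs(2)]] hb])
    moreover have "\<forall>i\<in>I. s (k i) \<in> {1, - 1}"
      using gs(3) k by (auto simp: bij_betw_def)
    ultimately have "N (\<lambda>t. \<Sum>i\<in>I. s (k i) * F ((h \<circ> (\<sigma> \<circ> k)) i) a * x i t) \<le> N a"
      using a by (intro contr)
    moreover have "(\<lambda>t. \<Sum>i\<in>I. s (k i) * F ((h \<circ> (\<sigma> \<circ> k)) i) a * x i t) =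
        (\<lambda>t. \<Sum>i<n. s i * F (h (\<sigma> i)) a * x (h i) t)"
      by (subst sum.reindex_bij_betw[OF hb, symmetric]) (simp add: kh)
    moreover have "(\<lambda>t. \<Sum>i<n. s i * F (h (\<sigma> i)) a * x (h i) t) \<in> W"
      using xW hI W_smult by (intro W_sum) auto
    ultimately show "nrm X (matrix_operator X n y f g (q a)) \<le> N a"
      by (simp add: gs(1) op[OF gs(2) a] q_nrm)
  qed
  moreover have "nrm X (P (q a) \<ominus>\<^bsub>X\<^esub> q a) \<le> e" if a: "a \<in> A" for a
  proof -
    have aW: "a \<in> W" using a A by auto
    have "(\<lambda>t. (\<Sum>i\<in>I. F i a * x i t) + - 1 * a t) \<in> W" by (intro W_add PW W_smult aW)
    then have dW: "(\<lambda>t. (\<Sum>i\<in>I. F i a * x i t) - a t) \<in> W" by simp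
    show ?thesis using appA[OF a] by (simp add: P[OF aW] q_diff[OF PW aW] q_nrm[OF dW])
  qed
  moreover have "nrm (dual X) (adjoint_operator X P \<phi> \<ominus>\<^bsub>dual X\<^esub> \<phi>) \<le> e"
    if \<phi>: "\<phi> \<in> carrier (dual X)" and \<phi>B: "(\<lambda>a. \<phi> (q a)) \<in> B" for \<phi>
  proof -
    interpret D: vectorspace class_ring "dual X" by (rule vectorspace_dual[OF X])
    have neg: "\<ominus>\<^bsub>dual X\<^esub> \<phi> = (- 1) \<odot>\<^bsub>dual X\<^esub> \<phi>"
      using D.smult_l_minus[of 1 \<phi>] D.smult_one[of \<phi>] \<phi> by (simp add: class_ring_simps)
    have *: "(adjoint_operator X P \<phi> \<ominus>\<^bsub>dual X\<^esub> \<phi>) (q a) = \<phi> (P (q a)) - \<phi> (q a)" if "a \<in> W" for a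
      unfolding a_minus_def neg using that by (simp add: dual_def adjoint_operator_def)
    show ?thesis
    proof (rule dual_nrm_le[OF _ e])
      fix a assume a: "a \<in> W"
      show "cmod ((adjoint_operator X P \<phi> \<ominus>\<^bsub>dual X\<^esub> \<phi>) (q a)) \<le> e * N a"
        using appB[OF \<phi>B a] by (simp add: * a P)
    qed
  qed
  ultimately show ?thesis unfolding P_def by blast
qed

text \<open>
  The tolerance belongs to the index, so that an index above \<open>({z}, {}, k)\<close> or \<open>({}, {z}, k)\<close>
  makes the error at \<open>z\<close> at most \<open>1 / (k + 1)\<close>; this gives both strong convergences at once. All
  operator norms in question are at most one.
\<close>

theorem property_A_of_approximating_systems:
  assumes loc: "\<And>A B e. finite A \<Longrightarrow> A \<subseteq> W \<Longrightarrow> finite B \<Longrightarrow> \<forall>\<phi>\<in>B. bounded_form W N \<phi> \<Longrightarrow> 0 < e \<Longrightarrow>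
      \<exists>(I :: 'i set) x F. approximating_system W N A B e I x F"
  shows "property_A X"
proof -
  define L where "L = {(A, B, k :: nat). finite A \<and> A \<subseteq> carrier X \<and> finite B \<and> B \<subseteq> carrier (dual X)}"
  define r where "r = {(l, m). l \<in> L \<and> m \<in> L \<and> fst l \<subseteq> fst m \<and> fst (snd l) \<subseteq> fst (snd m) \<and>
      snd (snd l) \<le> snd (snd m)}"
  have dir: "directed_by L r"
    by (rule directed_by_finite_triples[OF L_def r_def])
  define good where "good = (\<lambda>(l :: 'v set \<times> ('v \<Rightarrow> complex) set \<times> nat) n y f. biorthogonal_system X n y f \<and>
      (\<forall>g\<in>signed_permutations n. operator_norm X (matrix_operator X n y f g) \<le> 1) \<and>
      (\<forall>z\<in>fst l. nrm X (matrix_operator X n y f (1\<^sub>m n) z \<ominus>\<^bsub>X\<^esub> z) \<le> 1 / real (Suc (snd (snd l)))) \<and>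
      (\<forall>\<phi>\<in>fst (snd l). nrm (dual X) (adjoint_operator X (matrix_operator X n y f (1\<^sub>m n)) \<phi>
          \<ominus>\<^bsub>dual X\<^esub> \<phi>) \<le> 1 / real (Suc (snd (snd l)))))"
  have "\<exists>n y f. good l n y f" if "l \<in> L" for l
  proof -
    obtain A B k where l: "l = (A, B, k)" by (cases l)
    have AB: "finite A" "A \<subseteq> carrier X" "finite B" "B \<subseteq> carrier (dual X)"
      using that by (auto simp: l L_def)
    define A' where "A' = inv_into W q ` A"
    define B' where "B' = (\<lambda>\<phi> a. \<phi> (q a)) ` B"
    have "A' \<subseteq> W" unfolding A'_def using AB(2) unfolding q_onto[symmetric] by (auto intro: inv_into_into)
    moreover have "\<forall>\<phi>\<in>B'. bounded_form W N \<phi>"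
      unfolding B'_def using AB(4) bounded_form_of_dual by auto
    ultimately obtain I :: "'i set" and x F where "approximating_system W N A' B' (1 / real (Suc k)) I x F"
      using loc[of A' B' "1 / real (Suc k)"] AB by (auto simp: A'_def B'_def)
    from finite_level_system[OF this \<open>A' \<subseteq> W\<close>]
    obtain n y f where *: "biorthogonal_system X n y f"
      "\<forall>g\<in>signed_permutations n. operator_norm X (matrix_operator X n y f g) \<le> 1"
      "\<forall>a\<in>A'. nrm X (matrix_operator X n y f (1\<^sub>m n) (q a) \<ominus>\<^bsub>X\<^esub> q a) \<le> 1 / real (Suc k)"
      "\<forall>\<phi>\<in>carrier (dual X). (\<lambda>a. \<phi> (q a)) \<in> B' \<longrightarrow>
         nrm (dual X) (adjoint_operator X (matrix_operator X n y f (1\<^sub>m n)) \<phi> \<ominus>\<^bsub>dual X\<^esub> \<phi>) \<le> 1 / real (Suc k)"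
      by auto
    have "q (inv_into W q z) = z" if "z \<in> A" for z
      using that AB(2) by (metis f_inv_into_f q_onto subsetD)
    then have "\<forall>z\<in>A. nrm X (matrix_operator X n y f (1\<^sub>m n) z \<ominus>\<^bsub>X\<^esub> z) \<le> 1 / real (Suc k)"
      using *(3) by (auto simp: A'_def)
    moreover have "\<forall>\<phi>\<in>B. nrm (dual X) (adjoint_operator X (matrix_operator X n y f (1\<^sub>m n)) \<phi>
        \<ominus>\<^bsub>dual X\<^esub> \<phi>) \<le> 1 / real (Suc k)"
      using *(4) AB(4) by (auto simp: B'_def)
    ultimately show ?thesis using *(1,2) unfolding good_def l by auto
  qed
  then obtain n y f where good: "\<And>l. l \<in> L \<Longrightarrow> good l (n l) (y l) (f l)" by metis
  have "property_A_net X L r n y f (\<lambda>l. signed_permutations (n l))"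
    unfolding property_A_net_def Let_def
  proof (intro conjI ballI dir irreducible_signed_permutations)
    fix l assume "l \<in> L"
    then show "biorthogonal_system X (n l) (y l) (f l)" using good by (auto simp: good_def)
  next
    show "strongly_to_identity X L r (\<lambda>l. matrix_operator X (n l) (y l) (f l) (1\<^sub>m (n l)))"
      unfolding strongly_to_identity_def
    proof (intro ballI allI impI)
      fix z and e :: real assume z: "z \<in> carrier X" and e: "e > 0"
      obtain k where k: "1 / real (Suc k) < e" using e nat_approx_posE by metis
      show "\<exists>a\<in>L. \<forall>l\<in>L. (a, l) \<in> r \<longrightarrow>
          nrm X (matrix_operator X (n l) (y l) (f l) (1\<^sub>m (n l)) z \<ominus>\<^bsub>X\<^esub> z) < e"
      proof (intro bexI[of _ "({z}, {}, k)"] ballI impI)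
        fix l assume l: "l \<in> L" "(({z}, {}, k), l) \<in> r"
        then have "z \<in> fst l" "k \<le> snd (snd l)" by (auto simp: r_def)
        then have "1 / real (Suc (snd (snd l))) \<le> 1 / real (Suc k)" by (simp add: field_simps)
        with good[OF l(1)] \<open>z \<in> fst l\<close> k
        show "nrm X (matrix_operator X (n l) (y l) (f l) (1\<^sub>m (n l)) z \<ominus>\<^bsub>X\<^esub> z) < e"
          unfolding good_def by fastforce
      qed (use z in \<open>auto simp: L_def\<close>)
    qed
    show "strongly_to_identity (dual X) L r
        (\<lambda>l. adjoint_operator X (matrix_operator X (n l) (y l) (f l) (1\<^sub>m (n l))))"
      unfolding strongly_to_identity_def
    proof (intro ballI allI impI)
      fix z and e :: real assume z: "z \<in> carrier (dual X)" and e: "e > 0"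
      obtain k where k: "1 / real (Suc k) < e" using e nat_approx_posE by metis
      show "\<exists>a\<in>L. \<forall>l\<in>L. (a, l) \<in> r \<longrightarrow>
          nrm (dual X) (adjoint_operator X (matrix_operator X (n l) (y l) (f l) (1\<^sub>m (n l))) z
            \<ominus>\<^bsub>dual X\<^esub> z) < e"
      proof (intro bexI[of _ "({}, {z}, k)"] ballI impI)
        fix l assume l: "l \<in> L" "(({}, {z}, k), l) \<in> r"
        then have "z \<in> fst (snd l)" "k \<le> snd (snd l)" by (auto simp: r_def)
        then have "1 / real (Suc (snd (snd l))) \<le> 1 / real (Suc k)" by (simp add: field_simps)
        with good[OF l(1)] \<open>z \<in> fst (snd l)\<close> k
        show "nrm (dual X) (adjoint_operator X (matrix_operator X (n l) (y l) (f l) (1\<^sub>m (n l))) z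
            \<ominus>\<^bsub>dual X\<^esub> z) < e"
          unfolding good_def by fastforce
      qed (use z in \<open>auto simp: L_def\<close>)
    qed
    show "bdd_above {operator_norm X (matrix_operator X (n l) (y l) (f l) g) |l g.
        l \<in> L \<and> g \<in> signed_permutations (n l)}"
      using good unfolding good_def by (intro bdd_aboveI[of _ 1]) auto
  qed
  then show ?thesis by (rule property_A_netI)
qed

end

section \<open>Cluster points and norms of functionals\<close>

text \<open>
  Functionals with a common pointwise bound live in a product of closed discs, which is compact by
  Tychonoff's theorem. So they have a cluster point, and it inherits every closed condition.
\<close>

lemma cluster_functional:
  fixes \<Lambda> :: "'i \<Rightarrow> 'v \<Rightarrow> complex"
  assumes F: "F \<noteq> bot" and bound: "\<And>i f. cmod (\<Lambda> i f) \<le> C f"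
  shows "\<exists>L. \<forall>S. closed S \<longrightarrow> eventually (\<lambda>i. \<Lambda> i \<in> S) F \<longrightarrow> L \<in> S"
proof -
  define U where "U = PiE UNIV (\<lambda>f. cball (0 :: complex) (C f))"
  have "compactin (product_topology (\<lambda>f. euclidean) UNIV) U"
    unfolding U_def compactin_PiE by auto
  then have "compact U" by (simp add: euclidean_product_topology)
  moreover have "\<forall>\<^sub>F x in filtermap \<Lambda> F. x \<in> U"
    using bound by (auto simp: eventually_filtermap U_def PiE_def intro!: always_eventually)
  moreover have "filtermap \<Lambda> F \<noteq> bot" using F by (simp add: filtermap_bot_iff)
  ultimately obtain L where L: "inf (nhds L) (filtermap \<Lambda> F) \<noteq> bot"
    unfolding compact_filter by blast
  show ?thesis
  proof (intro exI[of _ L] allI impI, rule ccontr)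
    fix S assume S: "closed S" "eventually (\<lambda>i. \<Lambda> i \<in> S) F" "L \<notin> S"
    have "eventually (\<lambda>x. x \<in> - S) (nhds L)"
      using S(1,3) by (intro eventually_nhds_in_open) auto
    moreover have "eventually (\<lambda>x. x \<in> S) (filtermap \<Lambda> F)"
      using S(2) by (simp add: eventually_filtermap)
    ultimately have "eventually (\<lambda>x. False) (inf (nhds L) (filtermap \<Lambda> F))"
      unfolding eventually_inf by (metis ComplD)
    with L show False by (simp add: trivial_limit_def)
  qed
qed

text \<open>
  Multiplying \<open>f\<close> by a number of modulus one makes \<open>\<Phi> f\<close> real, so a bound on real parts over the
  unit ball is a bound on the norm. As \<open>N f\<close> may be zero, \<open>f\<close> is scaled by numbers slightly
  larger than \<open>N f\<close>.
\<close>

lemma cmod_form_le: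
  assumes smult: "\<And>c f. f \<in> W \<Longrightarrow> (\<lambda>t. c * f t) \<in> W"
    and N: "\<And>c f. f \<in> W \<Longrightarrow> N (\<lambda>t. c * f t) \<le> cmod c * N f" "\<And>f. f \<in> W \<Longrightarrow> 0 \<le> N f"
    and hom: "\<And>c f. f \<in> W \<Longrightarrow> \<Phi> (\<lambda>t. c * f t) = c * \<Phi> f"
    and Re: "\<And>f. f \<in> W \<Longrightarrow> N f \<le> 1 \<Longrightarrow> Re (\<Phi> f) \<le> e"
    and f: "f \<in> W"
  shows "cmod (\<Phi> f) \<le> e * N f"
proof -
  have *: "cmod (\<Phi> f) \<le> e * r" if r: "r > N f" for r
  proof -
    have r0: "r > 0" using r N(2)[OF f] by linarith
    define u where "u = (if \<Phi> f = 0 then 1 else cnj (\<Phi> f) / cmod (\<Phi> f))"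
    have u: "cmod u = 1" "u * \<Phi> f = cmod (\<Phi> f)"
      by (auto simp: u_def norm_divide complex_norm_square[symmetric] power2_eq_square mult.commute)
    have "N (\<lambda>t. u / r * f t) \<le> cmod (u / r) * N f" by (rule N(1)[OF f])
    also have "\<dots> = N f / r" using u r0 by (simp add: norm_divide)
    also have "\<dots> \<le> 1" using r r0 by (simp add: divide_simps)
    finally have "Re (\<Phi> (\<lambda>t. u / r * f t)) \<le> e" by (rule Re[OF smult[OF f]])
    also have "\<Phi> (\<lambda>t. u / r * f t) = of_real (cmod (\<Phi> f) / r)"
      unfolding hom[OF f] using u by (simp add: divide_simps)
    finally show ?thesis using r0 by (simp add: divide_simps mult.commute)
  qed
  show ?thesis
  proof (rule field_le_epsilon)
    fix d :: real assume d: "d > 0"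
    define r where "r = N f + d / (\<bar>e\<bar> + 1)"
    have "r > N f" using d by (simp add: r_def add_pos_nonneg)
    from *[OF this] have "cmod (\<Phi> f) \<le> e * N f + e * (d / (\<bar>e\<bar> + 1))" by (simp add: r_def algebra_simps)
    also have "e * (d / (\<bar>e\<bar> + 1)) \<le> (\<bar>e\<bar> + 1) * (d / (\<bar>e\<bar> + 1))"
      using d by (intro mult_right_mono) auto
    also have "\<dots> = d" by simp
    finally show "cmod (\<Phi> f) \<le> e * N f + d" by simp
  qed
qed

section \<open>Algebras with an essential supremum norm\<close>

abbreviation cplx :: "('a \<Rightarrow> real) \<Rightarrow> 'a \<Rightarrow> complex" where
  "cplx g \<equiv> (\<lambda>t. complex_of_real (g t))"

text \<open>
  The common features of \<open>C(K)\<close> and \<open>L\<^sub>\<infinity>\<close>. The filter \<open>F\<close> tells where a property has to hold: it is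
  the principal filter of the space \<open>K\<close>, respectively the filter of sets with a null complement.
\<close>

locale ess_sup_algebra =
  fixes V :: "('a \<Rightarrow> complex) set" and F :: "'a filter" and N :: "('a \<Rightarrow> complex) \<Rightarrow> real"
  assumes F: "F \<noteq> bot"
    and V_const: "\<And>c. (\<lambda>t. c) \<in> V"
    and V_add: "\<And>f g. f \<in> V \<Longrightarrow> g \<in> V \<Longrightarrow> (\<lambda>t. f t + g t) \<in> V"
    and V_mult: "\<And>f g. f \<in> V \<Longrightarrow> g \<in> V \<Longrightarrow> (\<lambda>t. f t * g t) \<in> V"
    and V_comp: "\<And>G f. continuous_on UNIV G \<Longrightarrow> f \<in> V \<Longrightarrow> (\<lambda>t. G (f t)) \<in> V"
    and V_divide: "\<And>f g. f \<in> V \<Longrightarrow> g \<in> V \<Longrightarrow> \<forall>\<^sub>F t in F. g t \<noteq> 0 \<Longrightarrow>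
      \<forall>\<^sub>F t in F. cmod (f t) \<le> cmod (g t) \<Longrightarrow> (\<lambda>t. f t / g t) \<in> V"
    and N_le_iff: "\<And>f c. f \<in> V \<Longrightarrow> 0 \<le> c \<Longrightarrow> N f \<le> c \<longleftrightarrow> (\<forall>\<^sub>F t in F. cmod (f t) \<le> c)"
    and N_nonneg: "\<And>f. f \<in> V \<Longrightarrow> 0 \<le> N f"
begin

lemma eventually_le_N: "f \<in> V \<Longrightarrow> \<forall>\<^sub>F t in F. cmod (f t) \<le> N f"
  using N_le_iff[of f "N f"] N_nonneg by auto

lemma V_smult: "f \<in> V \<Longrightarrow> (\<lambda>t. c * f t) \<in> V"
  using V_mult[OF V_const[of c]] .

lemma V_diff: "f \<in> V \<Longrightarrow> g \<in> V \<Longrightarrow> (\<lambda>t. f t - g t) \<in> V"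
  using V_add[of f "\<lambda>t. - 1 * g t"] V_smult[of g "- 1"] by simp

lemma V_sum: "(\<And>i. i \<in> I \<Longrightarrow> g i \<in> V) \<Longrightarrow> (\<lambda>t. \<Sum>i\<in>I. g i t) \<in> V"
  by (induction I rule: infinite_finite_induct) (auto simp: V_const V_add)

lemma V_prod: "(\<And>i. i \<in> I \<Longrightarrow> g i \<in> V) \<Longrightarrow> (\<lambda>t. \<Prod>i\<in>I. g i t) \<in> V"
  by (induction I rule: infinite_finite_induct) (auto simp: V_const V_mult)

lemma V_cnj: "f \<in> V \<Longrightarrow> (\<lambda>t. cnj (f t)) \<in> V"
  by (rule V_comp) (intro continuous_intros)

lemma V_cmod: "f \<in> V \<Longrightarrow> cplx (\<lambda>t. cmod (f t)) \<in> V"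
  by (rule V_comp[where G = "\<lambda>z. complex_of_real (cmod z)"]) (intro continuous_intros)

lemma V_Re: "f \<in> V \<Longrightarrow> cplx (\<lambda>t. Re (f t)) \<in> V"
  by (rule V_comp[where G = "\<lambda>z. complex_of_real (Re z)"]) (intro continuous_intros)

lemma V_Im: "f \<in> V \<Longrightarrow> cplx (\<lambda>t. Im (f t)) \<in> V"
  by (rule V_comp[where G = "\<lambda>z. complex_of_real (Im z)"]) (intro continuous_intros)

lemma V_real_comp:
  assumes "continuous_on UNIV G" "cplx g \<in> V"
  shows "cplx (\<lambda>t. G (g t)) \<in> V"
proof -
  have "continuous_on UNIV (\<lambda>z. complex_of_real (G (Re z)))"
    by (intro continuous_intros continuous_on_compose2[OF assms(1)]) auto
  from V_comp[OF this assms(2)] show ?thesis by simp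
qed

lemma N_smult_le: "f \<in> V \<Longrightarrow> N (\<lambda>t. c * f t) \<le> cmod c * N f"
  using eventually_le_N[of f] N_nonneg[of f]
  by (subst N_le_iff) (auto intro: V_smult elim!: eventually_mono simp: norm_mult mult_left_mono)

lemma N_mono:
  assumes "f \<in> V" "g \<in> V" "\<forall>\<^sub>F t in F. cmod (f t) \<le> cmod (g t)"
  shows "N f \<le> N g"
  using assms(3) eventually_le_N[OF assms(2)]
  by (subst N_le_iff[OF assms(1) N_nonneg[OF assms(2)]]) (auto elim: eventually_elim2)

text \<open>
  Positivity is stated on functions whose imaginary part vanishes everywhere; by
  \<open>bounded_form_AE_cong\<close> this covers the functions that are real up to the filter.
\<close>

definition positive_form :: "(('a \<Rightarrow> complex) \<Rightarrow> complex) \<Rightarrow> bool" where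
  "positive_form \<psi> \<longleftrightarrow> bounded_form V N \<psi> \<and>
     (\<forall>f\<in>V. (\<forall>t. Im (f t) = 0) \<longrightarrow>
        Im (\<psi> f) = 0 \<and> ((\<forall>\<^sub>F t in F. 0 \<le> Re (f t)) \<longrightarrow> 0 \<le> Re (\<psi> f)))"

lemma positive_formI:
  assumes b: "bounded_form V N \<psi>" and g: "\<And>g. cplx g \<in> V \<Longrightarrow> Im (\<psi> (cplx g)) = 0"
    "\<And>g. cplx g \<in> V \<Longrightarrow> \<forall>\<^sub>F t in F. 0 \<le> g t \<Longrightarrow> 0 \<le> Re (\<psi> (cplx g))"
  shows "positive_form \<psi>"
  unfolding positive_form_def
proof (intro conjI ballI impI b)
  fix f assume f: "f \<in> V" "\<forall>t. Im (f t) = 0"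
  then have eq: "f = cplx (\<lambda>t. Re (f t))" by (auto simp: complex_eq_iff)
  have V: "cplx (\<lambda>t. Re (f t)) \<in> V" using f(1) by (subst (asm) eq)
  have "Im (\<psi> (cplx (\<lambda>t. Re (f t)))) = 0" by (rule g(1)[OF V])
  then show "Im (\<psi> f) = 0" by (subst eq)
  assume "\<forall>\<^sub>F t in F. 0 \<le> Re (f t)"
  then have "0 \<le> Re (\<psi> (cplx (\<lambda>t. Re (f t))))" by (rule g(2)[OF V])
  then show "0 \<le> Re (\<psi> f)" by (subst eq)
qed

lemma positive_formD:
  assumes "positive_form \<psi>"
  shows "bounded_form V N \<psi>" "cplx g \<in> V \<Longrightarrow> \<psi> (cplx g) = of_real (Re (\<psi> (cplx g)))"
    "cplx g \<in> V \<Longrightarrow> \<forall>\<^sub>F t in F. 0 \<le> g t \<Longrightarrow> 0 \<le> Re (\<psi> (cplx g))"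
    "cplx g \<in> V \<Longrightarrow> Im (\<psi> (cplx g)) = 0"
proof -
  note p = assms[unfolded positive_form_def]
  show "bounded_form V N \<psi>" by (rule conjunct1[OF p])
  note q = bspec[OF conjunct2[OF p], of "cplx g"]
  show "Im (\<psi> (cplx g)) = 0" if "cplx g \<in> V" using q[OF that] by simp
  then show "\<psi> (cplx g) = of_real (Re (\<psi> (cplx g)))" if "cplx g \<in> V"
    using that by (simp only: complex_eq_iff Re_complex_of_real Im_complex_of_real)
  show "0 \<le> Re (\<psi> (cplx g))" if "cplx g \<in> V" "\<forall>\<^sub>F t in F. 0 \<le> g t"
    using q[OF that(1)] that(2) by simp
qed

lemma bounded_form_bound: "bounded_form V N \<phi> \<Longrightarrow> \<exists>C. \<forall>f\<in>V. cmod (\<phi> f) \<le> C * N f"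
  by (simp add: bounded_form_def)

lemma bounded_form_0: "bounded_form V N \<phi> \<Longrightarrow> \<phi> (\<lambda>t. 0) = 0"
  using bounded_form_smult[of V N \<phi> "\<lambda>t. 0" 0] V_const by simp

lemma bounded_form_diff:
  assumes "bounded_form V N \<phi>" "f \<in> V" "g \<in> V"
  shows "\<phi> (\<lambda>t. f t - g t) = \<phi> f - \<phi> g"
  using bounded_form_add[OF assms(1,2) V_smult[OF assms(3)], of "- 1"]
    bounded_form_smult[OF assms(1,3), of "- 1"] by simp

lemma bounded_form_sum:
  assumes \<phi>: "bounded_form V N \<phi>" and g: "\<And>i. i \<in> I \<Longrightarrow> g i \<in> V"
  shows "\<phi> (\<lambda>t. \<Sum>i\<in>I. g i t) = (\<Sum>i\<in>I. \<phi> (g i))"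
  using g
proof (induction I rule: infinite_finite_induct)
  case (insert i I)
  have "\<phi> (\<lambda>t. g i t + (\<Sum>i\<in>I. g i t)) = \<phi> (g i) + \<phi> (\<lambda>t. \<Sum>i\<in>I. g i t)"
    using insert.prems by (intro bounded_form_add[OF \<phi>] V_sum) auto
  then show ?case using insert by simp
qed (auto simp: bounded_form_0[OF \<phi>])

lemma bounded_form_AE_cong:
  assumes \<phi>: "bounded_form V N \<phi>" and fg: "f \<in> V" "g \<in> V" "\<forall>\<^sub>F t in F. f t = g t"
  shows "\<phi> f = \<phi> g"
proof -
  have d: "(\<lambda>t. f t - g t) \<in> V" by (rule V_diff[OF fg(1,2)])
  have "N (\<lambda>t. f t - g t) \<le> 0"
    using fg(3) by (subst N_le_iff[OF d order_refl]) (auto elim: eventually_mono)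
  then have "N (\<lambda>t. f t - g t) = 0" using N_nonneg[OF d] by simp
  moreover obtain C where "cmod (\<phi> (\<lambda>t. f t - g t)) \<le> C * N (\<lambda>t. f t - g t)"
    using \<phi> d unfolding bounded_form_def by blast
  ultimately show ?thesis using bounded_form_diff[OF \<phi> fg(1,2)] by simp
qed

lemma bounded_formI:
  assumes "\<And>f g. f \<in> V \<Longrightarrow> g \<in> V \<Longrightarrow> \<phi> (\<lambda>t. f t + g t) = \<phi> f + \<phi> g"
    "\<And>c f. f \<in> V \<Longrightarrow> \<phi> (\<lambda>t. c * f t) = c * \<phi> f"
    "\<And>f. f \<in> V \<Longrightarrow> cmod (\<phi> f) \<le> C * N f"
  shows "bounded_form V N \<phi>"
  unfolding bounded_form_def using assms by blast

text \<open>
  The functionals need only be linear in the limit; the application to point evaluations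
  \<open>t \<mapsto> f t\<close>, which are bounded by \<open>N f\<close> only for almost all \<open>t\<close>, depends on this.
\<close>

lemma cluster_form:
  assumes Q: "Q \<noteq> bot"
    and bound: "\<And>i f. f \<in> V \<Longrightarrow> cmod (\<Lambda> i f) \<le> C * N f"
    and add: "\<And>f g. f \<in> V \<Longrightarrow> g \<in> V \<Longrightarrow> \<forall>\<^sub>F i in Q. \<Lambda> i (\<lambda>t. f t + g t) = \<Lambda> i f + \<Lambda> i g"
    and smult: "\<And>c f. f \<in> V \<Longrightarrow> \<forall>\<^sub>F i in Q. \<Lambda> i (\<lambda>t. c * f t) = c * \<Lambda> i f"
  shows "\<exists>L. bounded_form V N L \<and> (\<forall>f\<in>V. cmod (L f) \<le> C * N f) \<and>
    (\<forall>f T. f \<in> V \<longrightarrow> closed T \<longrightarrow> (\<forall>\<^sub>F i in Q. \<Lambda> i f \<in> T) \<longrightarrow> L f \<in> T)"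
proof -
  define \<Lambda>' where "\<Lambda>' = (\<lambda>i f. if f \<in> V then \<Lambda> i f else 0)"
  have "cmod (\<Lambda>' i f) \<le> (if f \<in> V then C * N f else 0)" for i f
    using bound by (simp add: \<Lambda>'_def)
  from cluster_functional[of Q \<Lambda>', OF Q this] obtain L
    where "\<forall>S. closed S \<longrightarrow> eventually (\<lambda>i. \<Lambda>' i \<in> S) Q \<longrightarrow> L \<in> S" ..
  then have L: "L \<in> S" if "closed S" "eventually (\<lambda>i. \<Lambda>' i \<in> S) Q" for S using that by blast
  have coord: "continuous_on UNIV (\<lambda>y. y f)" for f :: "'a \<Rightarrow> complex"
    by (rule continuous_on_product_coordinates)
  have L1: "L f \<in> T" if "f \<in> V" "closed T" "\<forall>\<^sub>F i in Q. \<Lambda> i f \<in> T" for f T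
  proof -
    have "closed ((\<lambda>y. y f) -` T)" by (intro closed_vimage that(2) coord)
    from L[OF this] show ?thesis using that(1,3) by (simp add: \<Lambda>'_def)
  qed
  have bd: "cmod (L f) \<le> C * N f" if "f \<in> V" for f
    using L1[OF that, of "cball 0 (C * N f)"] bound[OF that] by simp
  have "bounded_form V N L"
  proof (rule bounded_formI[OF _ _ bd])
    fix f g assume fg: "f \<in> V" "g \<in> V"
    have "closed {y. y (\<lambda>t. f t + g t) = y f + (y g :: complex)}"
      by (intro closed_Collect_eq continuous_intros coord)
    from L[OF this] show "L (\<lambda>t. f t + g t) = L f + L g"
      using add[OF fg] fg V_add[OF fg] by (simp add: \<Lambda>'_def)
  next
    fix c f assume f: "f \<in> V"
    have "closed {y. y (\<lambda>t. c * f t) = c * (y f :: complex)}"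
      by (intro closed_Collect_eq continuous_intros coord)
    from L[OF this] show "L (\<lambda>t. c * f t) = c * L f"
      using smult[OF f] f V_smult[OF f] by (simp add: \<Lambda>'_def)
  qed
  then show ?thesis by (intro exI[of _ L] conjI ballI allI impI bd L1)
qed

text \<open>
  This \<open>\<psi>\<close> plays the role of the total variation of \<open>\<phi>\<close>. Choose \<open>\<theta>\<^sub>n\<close> in the unit ball that
  nearly attain the norm of \<open>\<phi>\<close> and let \<open>L\<close> be a cluster point of the functionals
  \<open>f \<mapsto> \<phi> (\<theta>\<^sub>n f)\<close>. If \<open>\<bar>f\<bar> \<le> 1\<close> and \<open>\<bar>u\<bar> = 1\<close>, then \<open>\<theta>\<^sub>n (1 - \<bar>f\<bar>) + u f\<close> is again in the unit ball,
  so passing from \<open>\<theta>\<^sub>n\<close> to it can increase \<open>Re \<phi>\<close> only by a small amount. In the limit this is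
  \<open>\<bar>\<phi> f\<bar> \<le> Re (L \<bar>f\<bar>)\<close>, and \<open>\<psi>\<close> is the real part of \<open>L\<close>.
\<close>

lemma dominating_positive_form:
  assumes \<phi>: "bounded_form V N \<phi>"
  shows "\<exists>\<psi>. positive_form \<psi> \<and> (\<forall>f\<in>V. cmod (\<phi> f) \<le> Re (\<psi> (cplx (\<lambda>t. cmod (f t)))))"
proof -
  obtain C' where C': "\<And>f. f \<in> V \<Longrightarrow> cmod (\<phi> f) \<le> C' * N f"
    using \<phi> unfolding bounded_form_def by blast
  define C where "C = \<bar>C'\<bar>"
  have C: "cmod (\<phi> f) \<le> C * N f" if "f \<in> V" for f
    using C'[OF that] mult_right_mono[OF abs_ge_self[of C'] N_nonneg[OF that]] by (simp add: C_def)
  have C0: "0 \<le> C" by (simp add: C_def)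
  define S where "S = {Re (\<phi> \<theta>) |\<theta>. \<theta> \<in> V \<and> N \<theta> \<le> 1}"
  have bdd: "bdd_above S"
  proof (rule bdd_aboveI[of _ C])
    fix x assume "x \<in> S"
    then obtain \<theta> where \<theta>: "\<theta> \<in> V" "N \<theta> \<le> 1" "x = Re (\<phi> \<theta>)" by (auto simp: S_def)
    have "x \<le> C * N \<theta>" using C[OF \<theta>(1)] complex_Re_le_cmod[of "\<phi> \<theta>"] \<theta>(3) by linarith
    also have "\<dots> \<le> C" using mult_left_mono[OF \<theta>(2) C0] by simp
    finally show "x \<le> C" .
  qed
  have "N (\<lambda>t. 0) \<le> 1" by (subst N_le_iff[OF V_const]) auto
  then have ne: "S \<noteq> {}" unfolding S_def using V_const[of 0] by blast
  have "\<exists>\<theta>. \<theta> \<in> V \<and> N \<theta> \<le> 1 \<and> Sup S - 1 / real (Suc n) < Re (\<phi> \<theta>)" for n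
  proof -
    have "Sup S - 1 / real (Suc n) < Sup S" by simp
    then obtain x where "x \<in> S" "Sup S - 1 / real (Suc n) < x" using less_cSup_iff[OF ne bdd] by blast
    then show ?thesis by (auto simp: S_def)
  qed
  then obtain \<theta> where \<theta>: "\<And>n. \<theta> n \<in> V" "\<And>n. N (\<theta> n) \<le> 1"
    "\<And>n. Sup S - 1 / real (Suc n) < Re (\<phi> (\<theta> n))" by metis
  define \<Lambda> where "\<Lambda> = (\<lambda>n f. \<phi> (\<lambda>t. \<theta> n t * f t))"
  have \<theta>le: "\<forall>\<^sub>F t in F. cmod (\<theta> n t) \<le> 1" for n using \<theta> N_le_iff[of "\<theta> n" 1] by simp
  have \<theta>f: "(\<lambda>t. \<theta> n t * f t) \<in> V" if "f \<in> V" for n f by (rule V_mult[OF \<theta>(1) that])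
  have bound: "cmod (\<Lambda> n f) \<le> C * N f" if f: "f \<in> V" for n f
  proof -
    have "\<forall>\<^sub>F t in F. cmod (\<theta> n t * f t) \<le> cmod (f t)"
      using \<theta>le[of n] by eventually_elim (simp add: norm_mult mult_left_le_one_le)
    from N_mono[OF \<theta>f[OF f] f this] have "N (\<lambda>t. \<theta> n t * f t) \<le> N f" .
    then have "C * N (\<lambda>t. \<theta> n t * f t) \<le> C * N f" using C0 by (rule mult_left_mono)
    with C[OF \<theta>f[OF f, of n]] show ?thesis by (simp add: \<Lambda>_def)
  qed
  have add: "\<Lambda> n (\<lambda>t. f t + g t) = \<Lambda> n f + \<Lambda> n g" if "f \<in> V" "g \<in> V" for n f g
    unfolding \<Lambda>_def using bounded_form_add[OF \<phi> \<theta>f[OF that(1)] \<theta>f[OF that(2)], of n n]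
    by (simp add: algebra_simps)
  have smult: "\<Lambda> n (\<lambda>t. c * f t) = c * \<Lambda> n f" if "f \<in> V" for n c f
    unfolding \<Lambda>_def using bounded_form_smult[OF \<phi> \<theta>f[OF that], of c n]
    by (simp add: algebra_simps)
  obtain L where L: "bounded_form V N L" "\<And>f. f \<in> V \<Longrightarrow> cmod (L f) \<le> C * N f"
    "\<And>f T. f \<in> V \<Longrightarrow> closed T \<Longrightarrow> \<forall>\<^sub>F i in sequentially. \<Lambda> i f \<in> T \<Longrightarrow> L f \<in> T"
  proof -
    have "\<exists>L. bounded_form V N L \<and> (\<forall>f\<in>V. cmod (L f) \<le> C * N f) \<and>
        (\<forall>f T. f \<in> V \<longrightarrow> closed T \<longrightarrow> (\<forall>\<^sub>F i in sequentially. \<Lambda> i f \<in> T) \<longrightarrow> L f \<in> T)"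
      by (rule cluster_form) (simp_all add: bound add smult)
    then show ?thesis using that by blast
  qed
  have dom1: "cmod (\<phi> f) \<le> Re (L (cplx (\<lambda>t. cmod (f t))))" if f: "f \<in> V" "N f \<le> 1" for f
  proof -
    let ?g = "cplx (\<lambda>t. cmod (f t))"
    have g: "?g \<in> V" by (rule V_cmod[OF f(1)])
    define u where "u = (if \<phi> f = 0 then 1 else cnj (\<phi> f) / cmod (\<phi> f))"
    have u: "cmod u = 1" "u * \<phi> f = cmod (\<phi> f)"
      by (auto simp: u_def norm_divide complex_norm_square[symmetric] power2_eq_square mult.commute)
    have "cmod (\<phi> f) - 1 / real (Suc n) \<le> Re (\<Lambda> n ?g)" for n
    proof -
      \<comment> \<open>The competitor \<open>\<theta>\<^sub>n (1 - \<bar>f\<bar>) + u f\<close> for the supremum.\<close>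
      let ?h = "\<lambda>t. (\<theta> n t - \<theta> n t * ?g t) + u * f t"
      have h: "?h \<in> V" by (intro V_add V_diff V_smult \<theta>f g \<theta>(1) f(1))
      have "\<forall>\<^sub>F t in F. cmod (f t) \<le> 1" using f N_le_iff[of f 1] by simp
      then have "\<forall>\<^sub>F t in F. cmod (?h t) \<le> 1" using \<theta>le[of n]
      proof eventually_elim
        case (elim t)
        have "?h t = \<theta> n t * of_real (1 - cmod (f t)) + u * f t" by (simp add: algebra_simps)
        then have "cmod (?h t) \<le> cmod (\<theta> n t) * (1 - cmod (f t)) + cmod (f t)"
          using norm_triangle_ineq[of "\<theta> n t * of_real (1 - cmod (f t))" "u * f t"] elim u
          by (simp add: norm_mult del: of_real_diff)
        also have "\<dots> \<le> 1 * (1 - cmod (f t)) + cmod (f t)"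
          using elim by (intro add_right_mono mult_right_mono) auto
        finally show ?case by simp
      qed
      then have "N ?h \<le> 1" using N_le_iff[OF h] by simp
      then have "Re (\<phi> ?h) \<le> Sup S"
        using h by (intro cSup_upper[OF _ bdd]) (auto simp: S_def)
      also have "\<phi> ?h = \<phi> (\<theta> n) - \<Lambda> n ?g + u * \<phi> f"
        unfolding \<Lambda>_def
        by (simp only: bounded_form_add[OF \<phi> V_diff[OF \<theta>(1) \<theta>f[OF g]] V_smult[OF f(1)]]
            bounded_form_diff[OF \<phi> \<theta>(1) \<theta>f[OF g]] bounded_form_smult[OF \<phi> f(1)])
      finally show ?thesis using \<theta>(3)[of n] u(2) by simp
    qed
    then have fin: "cmod (\<phi> f) - e \<le> Re (L ?g)" if e: "e > 0" for e
    proof -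
      obtain k where k: "1 / real (Suc k) < e" using e nat_approx_posE by metis
      have "closed {z. cmod (\<phi> f) - e \<le> Re z}" by (rule closed_halfspace_Re_ge)
      moreover have "\<forall>\<^sub>F n in sequentially. \<Lambda> n ?g \<in> {z. cmod (\<phi> f) - e \<le> Re z}"
        unfolding eventually_sequentially mem_Collect_eq
      proof (intro exI allI impI)
        fix n assume "k \<le> n"
        then have "1 / real (Suc n) \<le> 1 / real (Suc k)" by (simp add: frac_le)
        then show "cmod (\<phi> f) - e \<le> Re (\<Lambda> n ?g)"
          using \<open>\<And>n. cmod (\<phi> f) - 1 / real (Suc n) \<le> Re (\<Lambda> n ?g)\<close>[of n] k by linarith
      qed
      ultimately show ?thesis using L(3)[OF g] by blast
    qed
    show ?thesis by (rule field_le_epsilon) (use fin in force)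
  qed
  have dom: "cmod (\<phi> f) \<le> Re (L (cplx (\<lambda>t. cmod (f t))))" if f: "f \<in> V" for f
  proof -
    define r where "r = N f + 1"
    have r: "r > 0" using N_nonneg[OF f] by (simp add: r_def)
    define c where "c = complex_of_real (1 / r)"
    have c: "cmod c = 1 / r" unfolding c_def norm_of_real using r by simp
    have Re_c: "Re (c * z) = Re z / r" for z unfolding c_def by (simp add: Re_divide_of_real)
    have "N (\<lambda>t. c * f t) \<le> cmod c * N f" by (rule N_smult_le[OF f])
    also have "cmod c * N f = N f / r" by (simp add: c)
    also have "\<dots> \<le> 1" unfolding divide_le_eq_1_pos[OF r] by (simp add: r_def)
    finally have N1: "N (\<lambda>t. c * f t) \<le> 1" .
    have eq: "cplx (\<lambda>t. cmod (c * f t)) = (\<lambda>t. c * cplx (\<lambda>t. cmod (f t)) t)"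
    proof
      fix t show "cplx (\<lambda>t. cmod (c * f t)) t = c * cplx (\<lambda>t. cmod (f t)) t"
        unfolding norm_mult c(1) by (simp add: c_def)
    qed
    have "cmod (\<phi> (\<lambda>t. c * f t)) \<le> Re (L (\<lambda>t. c * cplx (\<lambda>t. cmod (f t)) t))"
      using dom1[OF V_smult[OF f] N1] by (simp only: eq)
    moreover have "\<phi> (\<lambda>t. c * f t) = c * \<phi> f" by (rule bounded_form_smult[OF \<phi> f])
    moreover have "L (\<lambda>t. c * cplx (\<lambda>t. cmod (f t)) t) = c * L (cplx (\<lambda>t. cmod (f t)))"
      by (rule bounded_form_smult[OF L(1) V_cmod[OF f]])
    ultimately have "cmod (c * \<phi> f) \<le> Re (c * L (cplx (\<lambda>t. cmod (f t))))" by (simp only:)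
    then have "cmod (\<phi> f) / r \<le> Re (L (cplx (\<lambda>t. cmod (f t)))) / r"
      by (simp only: norm_mult c Re_c) simp
    then show ?thesis using r by (simp add: divide_le_cancel)
  qed
  define \<psi> where "\<psi> = (\<lambda>f. (L f + cnj (L (\<lambda>t. cnj (f t)))) / 2)"
  have \<psi>real: "\<psi> (cplx g) = of_real (Re (L (cplx g)))" for g
    by (simp add: \<psi>_def complex_eq_iff)
  have "bounded_form V N \<psi>"
  proof (rule bounded_formI)
    fix f g assume fg: "f \<in> V" "g \<in> V"
    show "\<psi> (\<lambda>t. f t + g t) = \<psi> f + \<psi> g"
      using bounded_form_add[OF L(1) fg] bounded_form_add[OF L(1) V_cnj[OF fg(1)] V_cnj[OF fg(2)]]
      by (simp add: \<psi>_def add_divide_distrib)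
  next
    fix c f assume f: "f \<in> V"
    show "\<psi> (\<lambda>t. c * f t) = c * \<psi> f"
      using bounded_form_smult[OF L(1) f, of c] bounded_form_smult[OF L(1) V_cnj[OF f], of "cnj c"]
      by (simp add: \<psi>_def algebra_simps)
  next
    fix f assume f: "f \<in> V"
    have "N (\<lambda>t. cnj (f t)) \<le> N f" by (rule N_mono[OF V_cnj[OF f] f]) simp
    then have "C * N (\<lambda>t. cnj (f t)) \<le> C * N f" using C0 by (rule mult_left_mono)
    then have "cmod (cnj (L (\<lambda>t. cnj (f t)))) \<le> C * N f"
      using L(2)[OF V_cnj[OF f]] by simp
    then have "cmod (L f + cnj (L (\<lambda>t. cnj (f t)))) \<le> 2 * (C * N f)"
      using L(2)[OF f] norm_triangle_ineq[of "L f" "cnj (L (\<lambda>t. cnj (f t)))"] by linarith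
    then show "cmod (\<psi> f) \<le> C * N f" by (simp add: \<psi>_def norm_divide)
  qed
  moreover have "0 \<le> Re (\<psi> (cplx g))" if g: "cplx g \<in> V" "\<forall>\<^sub>F t in F. 0 \<le> g t" for g
  proof -
    have "L (cplx g) = L (cplx (\<lambda>t. cmod (cplx g t)))"
      using g(2) by (intro bounded_form_AE_cong[OF L(1) g(1) V_cmod[OF g(1)]]) (auto elim: eventually_mono)
    then have "cmod (\<phi> (cplx g)) \<le> Re (L (cplx g))" using dom[OF g(1)] by simp
    then have "0 \<le> Re (L (cplx g))" by (rule order_trans[OF norm_ge_zero])
    then show ?thesis by (simp only: \<psi>real Re_complex_of_real)
  qed
  moreover have "Im (\<psi> (cplx g)) = 0" for g by (simp only: \<psi>real Im_complex_of_real)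
  ultimately have "positive_form \<psi>" by (intro positive_formI)
  moreover have "\<forall>f\<in>V. cmod (\<phi> f) \<le> Re (\<psi> (cplx (\<lambda>t. cmod (f t))))"
    using dom by (simp add: \<psi>real)
  ultimately show ?thesis by (intro exI[of _ \<psi>] conjI)
qed

lemma positive_form_mono:
  assumes \<psi>: "positive_form \<psi>" and "cplx f \<in> V" "cplx g \<in> V" "\<forall>\<^sub>F t in F. f t \<le> g t"
  shows "Re (\<psi> (cplx f)) \<le> Re (\<psi> (cplx g))"
proof -
  have d: "cplx (\<lambda>t. g t - f t) \<in> V" using V_diff[OF assms(3,2)] by simp
  have "0 \<le> Re (\<psi> (cplx (\<lambda>t. g t - f t)))"
    using assms(4) by (intro positive_formD(3)[OF \<psi> d]) (auto elim: eventually_mono)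
  moreover have "\<psi> (cplx (\<lambda>t. g t - f t)) = \<psi> (cplx g) - \<psi> (cplx f)"
    using bounded_form_diff[OF positive_formD(1)[OF \<psi>] assms(3,2)] by simp
  ultimately show ?thesis by simp
qed

lemma positive_form_cmod_le:
  assumes \<psi>: "positive_form \<psi>" and f: "f \<in> V" and r: "cplx r \<in> V" "\<forall>\<^sub>F t in F. cmod (f t) \<le> r t"
  shows "cmod (\<psi> f) \<le> Re (\<psi> (cplx r))"
proof -
  note b = positive_formD(1)[OF \<psi>]
  define u where "u = (if \<psi> f = 0 then 1 else cnj (\<psi> f) / cmod (\<psi> f))"
  have u: "cmod u = 1" "u * \<psi> f = cmod (\<psi> f)"
    by (auto simp: u_def norm_divide complex_norm_square[symmetric] power2_eq_square mult.commute)
  let ?h = "\<lambda>t. u * f t"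
  have h: "?h \<in> V" by (rule V_smult[OF f])
  have "?h = (\<lambda>t. cplx (\<lambda>t. Re (?h t)) t + \<i> * cplx (\<lambda>t. Im (?h t)) t)"
    by (auto simp: complex_eq_iff)
  then have "\<psi> ?h = \<psi> (\<lambda>t. cplx (\<lambda>t. Re (?h t)) t + \<i> * cplx (\<lambda>t. Im (?h t)) t)" by simp
  also have "\<dots> = \<psi> (cplx (\<lambda>t. Re (?h t))) + \<psi> (\<lambda>t. \<i> * cplx (\<lambda>t. Im (?h t)) t)"
    by (rule bounded_form_add[OF b V_Re[OF h] V_smult[OF V_Im[OF h]]])
  also have "\<psi> (\<lambda>t. \<i> * cplx (\<lambda>t. Im (?h t)) t) = \<i> * \<psi> (cplx (\<lambda>t. Im (?h t)))"
    by (rule bounded_form_smult[OF b V_Im[OF h]])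
  finally have "Re (\<psi> ?h) = Re (\<psi> (cplx (\<lambda>t. Re (?h t))))"
    using positive_formD(4)[OF \<psi> V_Im[OF h]] by simp
  also have "\<dots> \<le> Re (\<psi> (cplx r))"
  proof (rule positive_form_mono[OF \<psi> V_Re[OF h] r(1)])
    show "\<forall>\<^sub>F t in F. Re (?h t) \<le> r t" using r(2)
    proof eventually_elim
      case (elim t)
      have "Re (?h t) \<le> cmod (?h t)" by (rule complex_Re_le_cmod)
      also have "\<dots> = cmod (f t)" using u(1) by (simp add: norm_mult)
      finally show ?case using elim by linarith
    qed
  qed
  also have "\<psi> ?h = cmod (\<psi> f)" using bounded_form_smult[OF b f, of u] u(2) by simp
  finally show ?thesis by simp
qed

lemma positive_form_zero: "positive_form (\<lambda>f. 0)"
proof -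
  have "bounded_form V N (\<lambda>f. 0)" by (rule bounded_formI[of _ 0]) auto
  then show ?thesis by (rule positive_formI) simp_all
qed

lemma positive_form_plus:
  assumes "positive_form \<psi>" "positive_form \<psi>'"
  shows "positive_form (\<lambda>f. \<psi> f + \<psi>' f)"
proof -
  note b = positive_formD(1)[OF assms(1)] positive_formD(1)[OF assms(2)]
  obtain C where C: "\<forall>f\<in>V. cmod (\<psi> f) \<le> C * N f" using bounded_form_bound[OF b(1)] ..
  obtain C' where C': "\<forall>f\<in>V. cmod (\<psi>' f) \<le> C' * N f" using bounded_form_bound[OF b(2)] ..
  have "bounded_form V N (\<lambda>f. \<psi> f + \<psi>' f)"
  proof (rule bounded_formI)
    fix f g assume fg: "f \<in> V" "g \<in> V"
    show "\<psi> (\<lambda>t. f t + g t) + \<psi>' (\<lambda>t. f t + g t) = \<psi> f + \<psi>' f + (\<psi> g + \<psi>' g)"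
      by (simp only: bounded_form_add[OF b(1) fg] bounded_form_add[OF b(2) fg] add_ac)
  next
    fix c f assume f: "f \<in> V"
    show "\<psi> (\<lambda>t. c * f t) + \<psi>' (\<lambda>t. c * f t) = c * (\<psi> f + \<psi>' f)"
      by (simp only: bounded_form_smult[OF b(1) f] bounded_form_smult[OF b(2) f] distrib_left)
  next
    fix f assume "f \<in> V"
    then show "cmod (\<psi> f + \<psi>' f) \<le> (C + C') * N f"
      using bspec[OF C] bspec[OF C'] norm_triangle_ineq[of "\<psi> f" "\<psi>' f"]
      by (fastforce simp: distrib_right)
  qed
  moreover have "Im (\<psi> (cplx g) + \<psi>' (cplx g)) = 0" if "cplx g \<in> V" for g
    using positive_formD(4)[OF assms(1) that] positive_formD(4)[OF assms(2) that] by simp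
  moreover have "0 \<le> Re (\<psi> (cplx g) + \<psi>' (cplx g))" if "cplx g \<in> V" "\<forall>\<^sub>F t in F. 0 \<le> g t" for g
    using positive_formD(3)[OF assms(1) that] positive_formD(3)[OF assms(2) that] by simp
  ultimately show ?thesis by (intro positive_formI)
qed

lemma common_dominating_positive_form:
  assumes "finite B" "\<forall>\<phi>\<in>B. bounded_form V N \<phi>"
  shows "\<exists>\<psi>. positive_form \<psi> \<and> (\<forall>\<phi>\<in>B. \<forall>f\<in>V. cmod (\<phi> f) \<le> Re (\<psi> (cplx (\<lambda>t. cmod (f t)))))"
  using assms
proof (induction B rule: finite_induct)
  case empty
  then show ?case using positive_form_zero by blast
next
  case (insert \<phi> B)
  then obtain \<psi> where \<psi>: "positive_form \<psi>"
    "\<forall>\<phi>\<in>B. \<forall>f\<in>V. cmod (\<phi> f) \<le> Re (\<psi> (cplx (\<lambda>t. cmod (f t))))" by auto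
  obtain \<psi>' where \<psi>': "positive_form \<psi>'" "\<forall>f\<in>V. cmod (\<phi> f) \<le> Re (\<psi>' (cplx (\<lambda>t. cmod (f t))))"
    using dominating_positive_form[of \<phi>] insert.prems by auto
  have nn: "0 \<le> Re (\<psi> (cplx (\<lambda>t. cmod (f t))))" "0 \<le> Re (\<psi>' (cplx (\<lambda>t. cmod (f t))))" if "f \<in> V" for f
    by (rule positive_formD(3)[OF \<psi>(1) V_cmod[OF that]], simp,
        rule positive_formD(3)[OF \<psi>'(1) V_cmod[OF that]], simp)
  have "cmod (\<xi> f) \<le> Re (\<psi> (cplx (\<lambda>t. cmod (f t))) + \<psi>' (cplx (\<lambda>t. cmod (f t))))"
    if \<xi>: "\<xi> \<in> insert \<phi> B" and f: "f \<in> V" for \<xi> f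
  proof (cases "\<xi> = \<phi>")
    case True
    show ?thesis using bspec[OF \<psi>'(2) f] nn(1)[OF f] unfolding True plus_complex.sel by linarith
  next
    case False
    then have "\<xi> \<in> B" using \<xi> by simp
    from bspec[OF bspec[OF \<psi>(2) this] f] show ?thesis using nn(2)[OF f] unfolding plus_complex.sel by linarith
  qed
  then show ?case
    by (intro exI[of _ "\<lambda>f. \<psi> f + \<psi>' f"] conjI positive_form_plus[OF \<psi>(1) \<psi>'(1)] ballI)
qed

text \<open>
  An approximate Radon-Nikodym theorem by least squares. If \<open>\<phi>\<close> were \<open>f \<mapsto> \<psi> (cnj u f)\<close>, then
  \<open>u\<close> would minimise \<open>\<psi> \<bar>u\<bar>\<^sup>2 - 2 Re (\<phi> u)\<close>. This expression is bounded below because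
  \<open>Re (\<phi> u) \<le> \<psi> \<bar>u\<bar>\<close> and \<open>2 \<bar>u\<bar> - 1 \<le> \<bar>u\<bar>\<^sup>2\<close>. A minimiser need not exist in \<open>V\<close>, but for a nearly
  minimal \<open>u\<close> a variation of size \<open>\<delta>\<close> shows that the derivative is small, uniformly over the unit
  ball.
\<close>

lemma approximate_density:
  assumes \<psi>: "positive_form \<psi>" and \<phi>: "bounded_form V N \<phi>"
    and dom: "\<forall>f\<in>V. cmod (\<phi> f) \<le> Re (\<psi> (cplx (\<lambda>t. cmod (f t))))"
    and e: "0 < e"
  shows "\<exists>u\<in>V. \<forall>f\<in>V. cmod (\<psi> (\<lambda>t. u t * f t) - \<phi> f) \<le> e * N f"
proof -
  note b = positive_formD(1)[OF \<psi>]
  define M where "M = Re (\<psi> (cplx (\<lambda>t. 1)))"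
  have M0: "0 \<le> M" unfolding M_def by (rule positive_formD(3)[OF \<psi>]) (auto simp: V_const)
  define sq where "sq = (\<lambda>u. Re (\<psi> (cplx (\<lambda>t. (cmod (u t))\<^sup>2))))"
  have Vsq: "cplx (\<lambda>t. (cmod (u t))\<^sup>2) \<in> V" if "u \<in> V" for u
    using V_mult[OF V_cmod[OF that] V_cmod[OF that]] by (simp add: power2_eq_square)
  define D where "D = (\<lambda>u. sq u - 2 * Re (\<phi> u))"
  have D_ge: "- M \<le> D u" if u: "u \<in> V" for u
  proof -
    let ?a = "\<lambda>t. cmod (u t)"
    have "Re (\<psi> (cplx (\<lambda>t. 2 * ?a t - 1))) \<le> sq u"
      unfolding sq_def
    proof (rule positive_form_mono[OF \<psi> _ Vsq[OF u]])
      show "cplx (\<lambda>t. 2 * ?a t - 1) \<in> V"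
        using V_diff[OF V_smult[OF V_cmod[OF u], of 2] V_const[of 1]] by simp
      have "2 * ?a t - 1 \<le> (?a t)\<^sup>2" for t using zero_le_power2[of "?a t - 1"] by (simp add: power2_diff)
      then show "\<forall>\<^sub>F t in F. 2 * ?a t - 1 \<le> (?a t)\<^sup>2" by simp
    qed
    moreover have "\<psi> (cplx (\<lambda>t. 2 * ?a t - 1)) = 2 * \<psi> (cplx ?a) - \<psi> (cplx (\<lambda>t. 1))"
      using bounded_form_diff[OF b V_smult[OF V_cmod[OF u], of 2] V_const[of 1]]
        bounded_form_smult[OF b V_cmod[OF u], of 2] by simp
    moreover have "Re (\<phi> u) \<le> Re (\<psi> (cplx ?a))"
      using dom u complex_Re_le_cmod[of "\<phi> u"] by force
    ultimately show ?thesis by (simp add: D_def M_def)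
  qed
  define \<delta> where "\<delta> = 2 * e / (1 + M)"
  have \<delta>: "\<delta> > 0" using e M0 by (simp add: \<delta>_def)
  have bdd: "bdd_below (D ` V)" using D_ge by (intro bdd_belowI[of _ "- M"]) auto
  have "Inf (D ` V) < Inf (D ` V) + \<delta>\<^sup>2" using \<delta> by simp
  then obtain u where u: "u \<in> V" "D u < Inf (D ` V) + \<delta>\<^sup>2"
    using cInf_lessD[of "D ` V"] V_const by blast
  have umin: "D u \<le> D w + \<delta>\<^sup>2" if "w \<in> V" for w
    using cInf_lower[OF _ bdd, of "D w"] that u by force
  define \<Phi> where "\<Phi> = (\<lambda>f. \<psi> (\<lambda>t. cnj (u t) * f t) - \<phi> f)"
  have uf: "(\<lambda>t. cnj (u t) * f t) \<in> V" if "f \<in> V" for f by (rule V_mult[OF V_cnj[OF u(1)] that])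
  have main: "Re (- \<Phi> f) \<le> e" if f: "f \<in> V" "N f \<le> 1" for f
  proof -
    have f': "(\<lambda>t. of_real \<delta> * f t) \<in> V" by (rule V_smult[OF f(1)])
    have w: "(\<lambda>t. u t + of_real \<delta> * f t) \<in> V" by (rule V_add[OF u(1) f'])
    have exp: "cplx (\<lambda>t. (cmod (u t + of_real \<delta> * f t))\<^sup>2) =
        (\<lambda>t. cplx (\<lambda>t. (cmod (u t))\<^sup>2) t + (of_real (2 * \<delta>) * cplx (\<lambda>t. Re (cnj (u t) * f t)) t +
          of_real (\<delta>\<^sup>2) * cplx (\<lambda>t. (cmod (f t))\<^sup>2) t))"
    proof
      fix t
      have "(cmod (u t + of_real \<delta> * f t))\<^sup>2 =
          (cmod (u t))\<^sup>2 + (2 * \<delta> * Re (cnj (u t) * f t) + \<delta>\<^sup>2 * (cmod (f t))\<^sup>2)"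
        unfolding cmod_power2 by (simp add: power2_eq_square algebra_simps)
      then show "cplx (\<lambda>t. (cmod (u t + of_real \<delta> * f t))\<^sup>2) t =
        cplx (\<lambda>t. (cmod (u t))\<^sup>2) t + (of_real (2 * \<delta>) * cplx (\<lambda>t. Re (cnj (u t) * f t)) t +
          of_real (\<delta>\<^sup>2) * cplx (\<lambda>t. (cmod (f t))\<^sup>2) t)"
        by (metis of_real_add of_real_mult)
    qed
    have "\<psi> (cplx (\<lambda>t. (cmod (u t + of_real \<delta> * f t))\<^sup>2)) =
        \<psi> (cplx (\<lambda>t. (cmod (u t))\<^sup>2)) + (of_real (2 * \<delta>) * \<psi> (cplx (\<lambda>t. Re (cnj (u t) * f t))) +
          of_real (\<delta>\<^sup>2) * \<psi> (cplx (\<lambda>t. (cmod (f t))\<^sup>2)))"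
      unfolding exp
      by (simp only: bounded_form_add[OF b Vsq[OF u(1)] V_add[OF V_smult[OF V_Re[OF uf[OF f(1)]]] V_smult[OF Vsq[OF f(1)]]]]
          bounded_form_add[OF b V_smult[OF V_Re[OF uf[OF f(1)]]] V_smult[OF Vsq[OF f(1)]]]
          bounded_form_smult[OF b V_Re[OF uf[OF f(1)]]] bounded_form_smult[OF b Vsq[OF f(1)]])
    then have "sq (\<lambda>t. u t + of_real \<delta> * f t) =
        sq u + 2 * \<delta> * Re (\<psi> (cplx (\<lambda>t. Re (cnj (u t) * f t)))) + \<delta>\<^sup>2 * sq f"
      by (simp add: sq_def)
    moreover have "\<phi> (\<lambda>t. u t + of_real \<delta> * f t) = \<phi> u + of_real \<delta> * \<phi> f"
      by (simp only: bounded_form_add[OF \<phi> u(1) f'] bounded_form_smult[OF \<phi> f(1)])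
    moreover have "Re (\<psi> (cplx (\<lambda>t. Re (cnj (u t) * f t)))) = Re (\<psi> (\<lambda>t. cnj (u t) * f t))"
    proof -
      let ?h = "\<lambda>t. cnj (u t) * f t"
      have h: "?h \<in> V" by (rule uf[OF f(1)])
      have "\<psi> (\<lambda>t. cplx (\<lambda>t. Re (?h t)) t + \<i> * cplx (\<lambda>t. Im (?h t)) t) =
          \<psi> (cplx (\<lambda>t. Re (?h t))) + \<i> * \<psi> (cplx (\<lambda>t. Im (?h t)))"
        by (simp only: bounded_form_add[OF b V_Re[OF h] V_smult[OF V_Im[OF h]]]
            bounded_form_smult[OF b V_Im[OF h]])
      moreover have "?h = (\<lambda>t. cplx (\<lambda>t. Re (?h t)) t + \<i> * cplx (\<lambda>t. Im (?h t)) t)"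
        by (auto simp: complex_eq_iff)
      moreover have "Im (\<psi> (cplx (\<lambda>t. Im (?h t)))) = 0"
        by (rule positive_formD(4)[OF \<psi> V_Im[OF h]])
      ultimately show ?thesis by simp
    qed
    ultimately have "D (\<lambda>t. u t + of_real \<delta> * f t) = D u + 2 * \<delta> * Re (\<Phi> f) + \<delta>\<^sup>2 * sq f"
      by (simp add: D_def \<Phi>_def algebra_simps)
    then have "0 \<le> 2 * \<delta> * Re (\<Phi> f) + \<delta>\<^sup>2 * sq f + \<delta>\<^sup>2" using umin[OF w] by linarith
    moreover have "sq f \<le> M"
      unfolding sq_def M_def
    proof (rule positive_form_mono[OF \<psi> Vsq[OF f(1)] V_const])
      have "\<forall>\<^sub>F t in F. cmod (f t) \<le> 1" using f N_le_iff[of f 1] by simp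
      then show "\<forall>\<^sub>F t in F. (cmod (f t))\<^sup>2 \<le> 1"
        by eventually_elim (simp add: power_le_one)
    qed
    then have "\<delta>\<^sup>2 * sq f \<le> \<delta>\<^sup>2 * M" by (intro mult_left_mono) auto
    ultimately have "0 \<le> \<delta> * (2 * Re (\<Phi> f) + \<delta> * (1 + M))"
      by (simp add: power2_eq_square algebra_simps)
    then have "0 \<le> 2 * Re (\<Phi> f) + \<delta> * (1 + M)" using \<delta> by (simp add: zero_le_mult_iff)
    also have "\<delta> * (1 + M) = 2 * e" using M0 by (simp add: \<delta>_def)
    finally show ?thesis by simp
  qed
  have "cmod (- \<Phi> f) \<le> e * N f" if f: "f \<in> V" for f
  proof (rule cmod_form_le[where W = V])
    fix c f assume f: "f \<in> V"
    have "\<psi> (\<lambda>t. cnj (u t) * (c * f t)) = c * \<psi> (\<lambda>t. cnj (u t) * f t)"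
      using bounded_form_smult[OF b uf[OF f], of c] by (simp add: algebra_simps)
    then show "- \<Phi> (\<lambda>t. c * f t) = c * - \<Phi> f"
      unfolding \<Phi>_def by (simp add: bounded_form_smult[OF \<phi> f] algebra_simps)
  qed (use f main V_smult N_smult_le N_nonneg in auto)
  then have "\<forall>f\<in>V. cmod (\<psi> (\<lambda>t. cnj (u t) * f t) - \<phi> f) \<le> e * N f"
    unfolding \<Phi>_def norm_minus_cancel by blast
  then show ?thesis using V_cnj[OF u(1)] by (intro bexI[of _ "\<lambda>t. cnj (u t)"])
qed

end

section \<open>Partitions of unity with small overlap\<close>

definition unit_clip :: "real \<Rightarrow> real" where
  "unit_clip x = max 0 (min 1 x)"

lemma unit_clip_bounds: "0 \<le> unit_clip x" "unit_clip x \<le> 1"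
  by (simp_all add: unit_clip_def)

lemma unit_clip_eq: "unit_clip x = 0 \<longleftrightarrow> x \<le> 0" "unit_clip x = 1 \<longleftrightarrow> 1 \<le> x"
  by (auto simp: unit_clip_def max_def min_def)

text \<open>
  A cut \<open>(g, a, \<eta>)\<close> separates the points with \<open>g t < a\<close> from those with \<open>g t > a\<close>. The function
  \<open>ramp\<close> rises from zero to one on \<open>\<bar>g t - a\<bar> \<le> \<eta>\<close>. The supports of \<open>below\<close> and \<open>above\<close> are contained
  in the sets where \<open>ramp\<close> is zero and one, and \<open>below + above\<close> differs from one only on the window
  \<open>\<bar>g t - a\<bar> < 2 * \<eta>\<close>.
\<close>

type_synonym 'a cut = "('a \<Rightarrow> real) \<times> real \<times> real"

fun ramp :: "'a cut \<Rightarrow> 'a \<Rightarrow> real" where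
  "ramp (g, a, \<eta>) t = unit_clip ((g t - a) / (2 * \<eta>) + 1 / 2)"

fun above :: "'a cut \<Rightarrow> 'a \<Rightarrow> real" where
  "above (g, a, \<eta>) t = unit_clip ((g t - a) / \<eta> - 1)"

fun below :: "'a cut \<Rightarrow> 'a \<Rightarrow> real" where
  "below (g, a, \<eta>) t = unit_clip ((a - g t) / \<eta> - 1)"

lemma cut_bounds:
  "0 \<le> ramp c t" "ramp c t \<le> 1" "0 \<le> above c t" "above c t \<le> 1" "0 \<le> below c t" "below c t \<le> 1"
  by (cases c, simp add: unit_clip_bounds)+

lemma cut_properties:
  assumes "0 < \<eta>"
  shows "above (g, a, \<eta>) t \<noteq> 0 \<Longrightarrow> ramp (g, a, \<eta>) t = 1"
    "below (g, a, \<eta>) t \<noteq> 0 \<Longrightarrow> ramp (g, a, \<eta>) t = 0"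
    "ramp (g, a, \<eta>) t \<noteq> 0 \<Longrightarrow> a - \<eta> < g t"
    "ramp (g, a, \<eta>) t \<noteq> 1 \<Longrightarrow> g t < a + \<eta>"
    "above (g, a, \<eta>) t + below (g, a, \<eta>) t \<le> 1"
    "2 * \<eta> \<le> \<bar>g t - a\<bar> \<Longrightarrow> above (g, a, \<eta>) t + below (g, a, \<eta>) t = 1"
proof -
  define x where "x = (g t - a) / \<eta>"
  have x: "g t - a = x * \<eta>" using assms by (simp add: x_def)
  have r: "ramp (g, a, \<eta>) t = unit_clip (x / 2 + 1 / 2)" "above (g, a, \<eta>) t = unit_clip (x - 1)"
    "below (g, a, \<eta>) t = unit_clip (- x - 1)"
    using assms by (auto simp: x_def field_simps)
  have l: "a - \<eta> < g t \<longleftrightarrow> - 1 < x" "g t < a + \<eta> \<longleftrightarrow> x < 1"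
    using assms unfolding x_def by (auto simp: field_simps)
  have l3: "2 * \<eta> \<le> \<bar>g t - a\<bar> \<longleftrightarrow> 2 \<le> \<bar>x\<bar>"
    unfolding x using assms by (simp add: abs_mult)
  show "ramp (g, a, \<eta>) t = 1" if "above (g, a, \<eta>) t \<noteq> 0"
    using that unfolding r unit_clip_eq by simp
  show "ramp (g, a, \<eta>) t = 0" if "below (g, a, \<eta>) t \<noteq> 0"
    using that unfolding r unit_clip_eq by simp
  show "a - \<eta> < g t" if "ramp (g, a, \<eta>) t \<noteq> 0"
    using that unfolding r unit_clip_eq l by simp
  show "g t < a + \<eta>" if "ramp (g, a, \<eta>) t \<noteq> 1"
    using that unfolding r unit_clip_eq l by simp
  show "above (g, a, \<eta>) t + below (g, a, \<eta>) t \<le> 1"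
  proof (cases "x \<le> 0")
    case True
    then have "unit_clip (x - 1) = 0" unfolding unit_clip_eq by simp
    then show ?thesis unfolding r using unit_clip_bounds(2)[of "- x - 1"] by linarith
  next
    case False
    then have "unit_clip (- x - 1) = 0" unfolding unit_clip_eq by simp
    then show ?thesis unfolding r using unit_clip_bounds(2)[of "x - 1"] by linarith
  qed
  show "above (g, a, \<eta>) t + below (g, a, \<eta>) t = 1" if "2 * \<eta> \<le> \<bar>g t - a\<bar>"
  proof (cases "x \<le> 0")
    case True
    then have "unit_clip (x - 1) = 0" "unit_clip (- x - 1) = 1" using that unfolding l3 unit_clip_eq by simp_all
    then show ?thesis unfolding r by simp
  next
    case False
    then have "unit_clip (- x - 1) = 0" "unit_clip (x - 1) = 1" using that unfolding l3 unit_clip_eq by simp_all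
    then show ?thesis unfolding r by simp
  qed
qed

declare ramp.simps [simp del] above.simps [simp del] below.simps [simp del]

text \<open>
  The cells are the terms in the expansion of \<open>\<Prod>\<^sub>c (ramp c + (1 - ramp c)) = 1\<close>; the index \<open>\<alpha>\<close> is
  the set of cuts above which the cell lies. The core is the analogous term for \<open>above\<close> and
  \<open>below\<close>; it lives where the cell is equal to one.
\<close>

definition cell :: "'a cut set \<Rightarrow> 'a cut set \<Rightarrow> 'a \<Rightarrow> real" where
  "cell T \<alpha> t = (\<Prod>c\<in>\<alpha>. ramp c t) * (\<Prod>c\<in>T - \<alpha>. 1 - ramp c t)"

definition core :: "'a cut set \<Rightarrow> 'a cut set \<Rightarrow> 'a \<Rightarrow> real" where
  "core T \<alpha> t = (\<Prod>c\<in>\<alpha>. above c t) * (\<Prod>c\<in>T - \<alpha>. below c t)"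

lemma cell_nonneg: "0 \<le> cell T \<alpha> t"
  unfolding cell_def by (intro mult_nonneg_nonneg prod_nonneg) (auto simp: cut_bounds)

lemma core_nonneg: "0 \<le> core T \<alpha> t"
  unfolding core_def by (intro mult_nonneg_nonneg prod_nonneg) (auto simp: cut_bounds)

lemma sum_cell: "finite T \<Longrightarrow> (\<Sum>\<alpha>\<in>Pow T. cell T \<alpha> t) = 1"
  unfolding cell_def by (subst prod_add[symmetric]) auto

lemma cell_core:
  assumes T: "finite T" "\<And>g a \<eta>. (g, a, \<eta>) \<in> T \<Longrightarrow> 0 < \<eta>" and \<alpha>: "\<alpha> \<subseteq> T" and "core T \<alpha> t \<noteq> 0"
  shows "cell T \<alpha> t = 1"
proof -
  have fin: "finite \<alpha>" "finite (T - \<alpha>)" using T(1) \<alpha> finite_subset by auto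
  have nz: "\<And>c. c \<in> \<alpha> \<Longrightarrow> above c t \<noteq> 0" "\<And>c. c \<in> T - \<alpha> \<Longrightarrow> below c t \<noteq> 0"
    using assms(4) fin by (auto simp: core_def)
  have "ramp c t = 1" if "c \<in> \<alpha>" for c
  proof -
    obtain g a \<eta> where c: "c = (g, a, \<eta>)" by (cases c)
    have "0 < \<eta>" using T(2) that \<alpha> c by blast
    from cut_properties(1)[OF this, of g a t] show ?thesis using nz(1)[OF that] unfolding c .
  qed
  moreover have "1 - ramp c t = 1" if "c \<in> T - \<alpha>" for c
  proof -
    obtain g a \<eta> where c: "c = (g, a, \<eta>)" by (cases c)
    have "0 < \<eta>" using T(2) that c by blast
    from cut_properties(2)[OF this, of g a t] show ?thesis using nz(2)[OF that] unfolding c by simp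
  qed
  ultimately show ?thesis unfolding cell_def by simp
qed

lemma core_le_one: "core T \<alpha> t \<le> 1"
  unfolding core_def by (intro mult_le_one prod_le_1 prod_nonneg) (auto simp: cut_bounds)

lemma one_minus_prod_le:
  fixes x :: "'b \<Rightarrow> real"
  assumes "finite T" "\<And>c. c \<in> T \<Longrightarrow> 0 \<le> x c \<and> x c \<le> 1"
  shows "1 - (\<Prod>c\<in>T. x c) \<le> (\<Sum>c\<in>T. 1 - x c)"
  using assms
proof (induction T rule: finite_induct)
  case (insert c T)
  have p: "0 \<le> prod x T" "prod x T \<le> 1" using insert.prems by (auto intro: prod_nonneg prod_le_1)
  have "(1 - x c) * prod x T \<le> (1 - x c) * 1" using insert.prems p by (intro mult_left_mono) auto
  moreover have "1 - prod x T \<le> (\<Sum>c\<in>T. 1 - x c)" using insert by auto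
  ultimately show ?case using insert by (simp add: algebra_simps)
qed simp

lemma one_minus_sum_core_le:
  assumes T: "finite T" "\<And>g a \<eta>. (g, a, \<eta>) \<in> T \<Longrightarrow> 0 < \<eta>"
  shows "1 - (\<Sum>\<alpha>\<in>Pow T. core T \<alpha> t) \<le> (\<Sum>c\<in>T. 1 - above c t - below c t)"
proof -
  have "(\<Sum>\<alpha>\<in>Pow T. core T \<alpha> t) = (\<Prod>c\<in>T. above c t + below c t)"
    unfolding core_def using T(1) by (rule prod_add[symmetric])
  moreover have "0 \<le> above c t + below c t \<and> above c t + below c t \<le> 1" if "c \<in> T" for c
  proof -
    obtain g a \<eta> where c: "c = (g, a, \<eta>)" by (cases c)
    then have "0 < \<eta>" using T(2) that by blast
    from cut_properties(5)[OF this, of g a t] cut_bounds(3,5)[of c t] show ?thesis unfolding c by linarith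
  qed
  then have "1 - (\<Prod>c\<in>T. above c t + below c t) \<le> (\<Sum>c\<in>T. 1 - (above c t + below c t))"
    using one_minus_prod_le[OF T(1), of "\<lambda>c. above c t + below c t"] by simp
  ultimately show ?thesis by (simp add: algebra_simps)
qed

context ess_sup_algebra
begin

lemma continuous_clip_affine: "continuous_on UNIV (\<lambda>x. unit_clip ((b * x + d) / \<eta> + e))" if "\<eta> \<noteq> 0"
  unfolding unit_clip_def by (intro continuous_intros) (use that in auto)

lemma V_cut:
  assumes "cplx g \<in> V" "0 < \<eta>"
  shows "cplx (ramp (g, a, \<eta>)) \<in> V" "cplx (above (g, a, \<eta>)) \<in> V" "cplx (below (g, a, \<eta>)) \<in> V"
  using V_real_comp[OF continuous_clip_affine[of "2 * \<eta>" 1 "- a" "1 / 2"] assms(1)]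
    V_real_comp[OF continuous_clip_affine[of \<eta> 1 "- a" "- 1"] assms(1)]
    V_real_comp[OF continuous_clip_affine[of \<eta> "- 1" a "- 1"] assms(1)] assms(2)
  by (auto simp: ramp.simps above.simps below.simps)

lemma V_gap:
  assumes "cplx g \<in> V" "0 < \<eta>"
  shows "cplx (\<lambda>t. 1 - above (g, a, \<eta>) t - below (g, a, \<eta>) t) \<in> V"
  using V_diff[OF V_diff[OF V_const[of 1] V_cut(2)[OF assms]] V_cut(3)[OF assms]] by simp

lemma Re_form_sum:
  assumes \<psi>: "positive_form \<psi>" and g: "\<And>i. i \<in> I \<Longrightarrow> cplx (g i) \<in> V"
  shows "Re (\<psi> (cplx (\<lambda>t. \<Sum>i\<in>I. g i t))) = (\<Sum>i\<in>I. Re (\<psi> (cplx (g i))))"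
  using bounded_form_sum[OF positive_formD(1)[OF \<psi>], of I "\<lambda>i. cplx (g i)"] g by simp

lemma V_real_sum: "(\<And>i. i \<in> I \<Longrightarrow> cplx (g i) \<in> V) \<Longrightarrow> cplx (\<lambda>t. \<Sum>i\<in>I. g i t) \<in> V"
  using V_sum[of I "\<lambda>i. cplx (g i)"] by simp

text \<open>
  Pigeonhole: the windows around \<open>m\<close> well separated values are disjoint, so their total mass is at
  most \<open>\<psi> 1\<close>, and one of them has mass at most \<open>\<psi> 1 / m\<close>.
\<close>

lemma narrow_cut:
  assumes \<psi>: "positive_form \<psi>" and g: "cplx g \<in> V" and ab: "a < b" and \<delta>: "0 < \<delta>"
  shows "\<exists>a' \<eta>. a < a' \<and> a' < b \<and> 0 < \<eta> \<and> \<eta> \<le> (b - a) / 4 \<and>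
    Re (\<psi> (cplx (\<lambda>t. 1 - above (g, a', \<eta>) t - below (g, a', \<eta>) t))) \<le> \<delta>"
proof -
  define M where "M = Re (\<psi> (cplx (\<lambda>t. 1)))"
  obtain m :: nat where "M / \<delta> < real m" using reals_Archimedean2 by blast
  then have m: "M < real m * \<delta>" using \<delta> by (simp add: divide_simps)
  define \<eta> where "\<eta> = (b - a) / (4 * (real m + 1))"
  have \<eta>: "0 < \<eta>" using ab by (simp add: \<eta>_def)
  have \<eta>m: "4 * \<eta> * (real m + 1) = b - a" by (simp add: \<eta>_def field_simps)
  define p where "p = (\<lambda>s :: nat. a + 4 * \<eta> * (real s + 1))"
  define gap where "gap = (\<lambda>s t. 1 - above (g, p s, \<eta>) t - below (g, p s, \<eta>) t)"
  have gV: "cplx (gap s) \<in> V" for s unfolding gap_def by (rule V_gap[OF g \<eta>])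
  \<comment> \<open>The windows around the points \<open>p s\<close> are disjoint.\<close>
  have sum1: "(\<Sum>s<m. gap s t) \<le> 1" for t
  proof (cases "\<exists>s0<m. gap s0 t \<noteq> 0")
    case True
    then obtain s0 where s0: "s0 < m" "gap s0 t \<noteq> 0" by blast
    then have near: "\<bar>g t - p s0\<bar> < 2 * \<eta>"
      using cut_properties(6)[OF \<eta>, of g t "p s0"] by (force simp: gap_def)
    have "gap s t = 0" if "s \<noteq> s0" for s
    proof -
      have "1 \<le> \<bar>real s - real s0\<bar>" using that by linarith
      then have "4 * \<eta> * 1 \<le> 4 * \<eta> * \<bar>real s - real s0\<bar>" using \<eta> by (intro mult_left_mono) auto
      also have "\<dots> = \<bar>p s - p s0\<bar>"
      proof -
        have "p s - p s0 = 4 * \<eta> * (real s - real s0)" by (simp add: p_def algebra_simps)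
        then have "\<bar>p s - p s0\<bar> = \<bar>4 * \<eta>\<bar> * \<bar>real s - real s0\<bar>" by (simp only: abs_mult)
        moreover have "\<bar>4 * \<eta>\<bar> = 4 * \<eta>" using \<eta> by simp
        ultimately show ?thesis by (simp only:)
      qed
      finally have "2 * \<eta> \<le> \<bar>g t - p s\<bar>" using near by linarith
      from cut_properties(6)[OF \<eta>, of g t "p s", OF this] show ?thesis unfolding gap_def by linarith
    qed
    then have "(\<Sum>s<m. gap s t) = (\<Sum>s\<in>{s0}. gap s t)"
      using s0 by (intro sum.mono_neutral_right) auto
    also have "\<dots> \<le> 1" using cut_bounds[of "(g, p s0, \<eta>)" t] by (simp add: gap_def)
    finally show ?thesis .
  qed (simp add: sum.neutral)
  have "\<exists>s<m. Re (\<psi> (cplx (gap s))) \<le> \<delta>"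
  proof (rule ccontr)
    assume "\<not> ?thesis"
    then have "of_nat (card {..<m}) * \<delta> \<le> (\<Sum>s<m. Re (\<psi> (cplx (gap s))))"
      by (intro sum_bounded_below) (auto simp: not_le less_imp_le)
    also have "\<dots> = Re (\<psi> (cplx (\<lambda>t. \<Sum>s<m. gap s t)))"
      by (rule Re_form_sum[OF \<psi> gV, symmetric])
    also have "\<dots> \<le> M" unfolding M_def
      using sum1 by (intro positive_form_mono[OF \<psi> V_real_sum[OF gV] V_const]) simp
    finally show False using m by simp
  qed
  then obtain s where s: "s < m" "Re (\<psi> (cplx (gap s))) \<le> \<delta>" by blast
  have "4 * \<eta> * (real s + 1) < 4 * \<eta> * (real m + 1)"
    using \<eta> s(1) by (intro mult_strict_left_mono) auto
  then have "a < p s" "p s < b" using \<eta> \<eta>m by (auto simp: p_def)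
  moreover have "\<eta> \<le> (b - a) / 4" unfolding \<eta>_def using ab by (intro divide_left_mono) auto
  ultimately show ?thesis using s(2) \<eta> unfolding gap_def by blast
qed

text \<open>
  The hypothesis on \<open>t\<close> and \<open>t'\<close> says that no cut of \<open>T\<close> separates them. In terms of cells: it holds
  if some cell is nonzero at both points.
\<close>

definition fine_for :: "'a cut set \<Rightarrow> ('a \<Rightarrow> real) \<Rightarrow> real \<Rightarrow> bool" where
  "fine_for T g e \<longleftrightarrow> (\<exists>R. (\<forall>\<^sub>F t in F. \<bar>g t\<bar> \<le> R) \<and>
     (\<forall>t t'. \<bar>g t\<bar> \<le> R \<longrightarrow> \<bar>g t'\<bar> \<le> R \<longrightarrow>
        (\<forall>c\<in>T. ramp c t \<noteq> 0 \<and> ramp c t' \<noteq> 0 \<or> ramp c t \<noteq> 1 \<and> ramp c t' \<noteq> 1) \<longrightarrow> \<bar>g t - g t'\<bar> \<le> e))"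

text \<open>
  One narrow cut is placed between any two consecutive multiples of \<open>e / 4\<close> in the range of \<open>g\<close>.
  If the values of \<open>g\<close> at two points differ by more than \<open>e\<close>, then the whole ramp of one of these cuts
  lies between them.
\<close>

lemma fine_cuts_single:
  assumes \<psi>: "positive_form \<psi>" and g: "cplx g \<in> V" and e: "0 < e" and \<delta>: "0 < \<delta>"
  shows "\<exists>T. finite T \<and> (\<forall>(g, a, \<eta>)\<in>T. 0 < \<eta> \<and> cplx g \<in> V) \<and>
    Re (\<psi> (cplx (\<lambda>t. \<Sum>c\<in>T. 1 - above c t - below c t))) \<le> \<delta> \<and> fine_for T g e"
proof -
  define R where "R = N (cplx g) + 1"
  have R: "0 < R" using N_nonneg[OF g] by (simp add: R_def)
  have gR: "\<forall>\<^sub>F t in F. \<bar>g t\<bar> \<le> R"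
    using eventually_le_N[OF g] by eventually_elim (simp add: R_def)
  define \<epsilon> where "\<epsilon> = e / 4"
  have \<epsilon>: "0 < \<epsilon>" using e by (simp add: \<epsilon>_def)
  define m where "m = \<lceil>R / \<epsilon>\<rceil>"
  have m: "R / \<epsilon> \<le> real_of_int m" by (simp add: m_def)
  have "0 < R / \<epsilon>" using R \<epsilon> by simp
  then have "0 < real_of_int m" using m by linarith
  then have m0: "0 \<le> m" by simp
  define n where "n = real (card {-m..m})"
  have n: "0 < n" using m0 by (simp add: n_def card_gt_0_iff)
  define gap where "gap = (\<lambda>x. Re (\<psi> (cplx (\<lambda>t. 1 - above (g, x) t - below (g, x) t))))"
  have "\<forall>l. \<exists>x. real_of_int l * \<epsilon> < fst x \<and> fst x < (real_of_int l + 1) * \<epsilon> \<and>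
      0 < snd x \<and> snd x \<le> \<epsilon> / 4 \<and> gap x \<le> \<delta> / n"
  proof
    fix l :: int
    have "real_of_int l * \<epsilon> < (real_of_int l + 1) * \<epsilon>" "0 < \<delta> / n" using \<epsilon> \<delta> n by simp_all
    from narrow_cut[OF \<psi> g this] obtain a \<eta> where
      a: "real_of_int l * \<epsilon> < a" "a < (real_of_int l + 1) * \<epsilon>" "0 < \<eta>"
      "\<eta> \<le> ((real_of_int l + 1) * \<epsilon> - real_of_int l * \<epsilon>) / 4" "gap (a, \<eta>) \<le> \<delta> / n"
      unfolding gap_def by (elim exE conjE)
    have "(real_of_int l + 1) * \<epsilon> - real_of_int l * \<epsilon> = \<epsilon>" by (simp add: algebra_simps)
    with a show "\<exists>x. real_of_int l * \<epsilon> < fst x \<and> fst x < (real_of_int l + 1) * \<epsilon> \<and>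
      0 < snd x \<and> snd x \<le> \<epsilon> / 4 \<and> gap x \<le> \<delta> / n" by (intro exI[of _ "(a, \<eta>)"]) simp
  qed
  then obtain q where q: "\<forall>l. real_of_int l * \<epsilon> < fst (q l) \<and> fst (q l) < (real_of_int l + 1) * \<epsilon> \<and>
      0 < snd (q l) \<and> snd (q l) \<le> \<epsilon> / 4 \<and> gap (q l) \<le> \<delta> / n"
    using choice[of "\<lambda>l x. real_of_int l * \<epsilon> < fst x \<and> fst x < (real_of_int l + 1) * \<epsilon> \<and>
      0 < snd x \<and> snd x \<le> \<epsilon> / 4 \<and> gap x \<le> \<delta> / n"] by auto
  define p \<eta> where "p = (\<lambda>l. fst (q l))" and "\<eta> = (\<lambda>l. snd (q l))"
  have p: "real_of_int l * \<epsilon> < p l" "p l < (real_of_int l + 1) * \<epsilon>" "0 < \<eta> l" "\<eta> l \<le> \<epsilon> / 4"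
    and gap: "gap (p l, \<eta> l) \<le> \<delta> / n" for l
    using q by (simp_all add: p_def \<eta>_def)
  define T where "T = (\<lambda>l. (g, p l, \<eta> l)) ` {-m..m}"
  have fin: "finite T" by (simp add: T_def)
  have V: "cplx (\<lambda>t. 1 - above c t - below c t) \<in> V" if c: "c \<in> T" for c
  proof -
    obtain l where "c = (g, p l, \<eta> l)" using c by (auto simp: T_def)
    then show ?thesis using V_gap[OF g p(3)[of l], of "p l"] by (simp only:)
  qed
  have "Re (\<psi> (cplx (\<lambda>t. \<Sum>c\<in>T. 1 - above c t - below c t))) =
      (\<Sum>c\<in>T. Re (\<psi> (cplx (\<lambda>t. 1 - above c t - below c t))))"
    by (rule Re_form_sum[OF \<psi> V])
  also have "\<dots> \<le> of_nat (card T) * (\<delta> / n)"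
  proof (rule sum_bounded_above)
    fix c assume "c \<in> T"
    then obtain l where "c = (g, p l, \<eta> l)" by (auto simp: T_def)
    then show "Re (\<psi> (cplx (\<lambda>t. 1 - above c t - below c t))) \<le> \<delta> / n"
      using gap[of l] unfolding gap_def by (simp only:)
  qed
  also have "\<dots> \<le> n * (\<delta> / n)"
  proof (rule mult_right_mono)
    have "card T \<le> card {-m..m}" unfolding T_def by (rule card_image_le) simp
    then show "real (card T) \<le> n" unfolding n_def by (rule of_nat_mono)
    show "0 \<le> \<delta> / n" using \<delta> n by simp
  qed
  also have "\<dots> = \<delta>" using n by simp
  finally have small: "Re (\<psi> (cplx (\<lambda>t. \<Sum>c\<in>T. 1 - above c t - below c t))) \<le> \<delta>" .
  have osc: "g t' \<le> g t + e" if t: "\<bar>g t\<bar> \<le> R" "\<bar>g t'\<bar> \<le> R"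
    and same: "\<forall>c\<in>T. ramp c t \<noteq> 0 \<and> ramp c t' \<noteq> 0 \<or> ramp c t \<noteq> 1 \<and> ramp c t' \<noteq> 1" for t t'
  proof (rule ccontr)
    assume "\<not> g t' \<le> g t + e"
    then have far: "g t + 4 * \<epsilon> < g t'" by (simp add: \<epsilon>_def)
    define l where "l = \<lceil>(g t + \<epsilon>) / \<epsilon>\<rceil>"
    have "(g t + \<epsilon>) / \<epsilon> \<le> real_of_int l" "real_of_int l < (g t + \<epsilon>) / \<epsilon> + 1"
      unfolding l_def by linarith+
    then have l: "g t + \<epsilon> \<le> real_of_int l * \<epsilon>" "real_of_int l * \<epsilon> < g t + 2 * \<epsilon>"
      using \<epsilon> by (simp_all add: divide_simps algebra_simps)
    have "R \<le> real_of_int m * \<epsilon>" using m \<epsilon> by (simp add: divide_simps)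
    then have "real_of_int l * \<epsilon> < real_of_int m * \<epsilon>" "- (real_of_int m * \<epsilon>) < real_of_int l * \<epsilon>"
      using l t far \<epsilon> by linarith+
    then have h: "real_of_int l * \<epsilon> < real_of_int m * \<epsilon>" "real_of_int (- m) * \<epsilon> < real_of_int l * \<epsilon>"
      by (simp_all only: of_int_minus mult_minus_left)
    have "real_of_int l < real_of_int m" "real_of_int (- m) < real_of_int l"
      by (rule mult_right_less_imp_less[OF h(1) less_imp_le[OF \<epsilon>]],
          rule mult_right_less_imp_less[OF h(2) less_imp_le[OF \<epsilon>]])
    then have "- m < l" "l < m" by (simp_all only: of_int_less_iff)
    then have lT: "(g, p l, \<eta> l) \<in> T" by (simp add: T_def)
    have "real_of_int l * \<epsilon> + \<epsilon> = (real_of_int l + 1) * \<epsilon>" by (simp add: algebra_simps)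
    then have "g t \<le> p l - \<eta> l" "p l + \<eta> l \<le> g t'"
      using l p(1,2,4)[of l] far \<epsilon> by linarith+
    then have "ramp (g, p l, \<eta> l) t = 0" "ramp (g, p l, \<eta> l) t' = 1"
      using cut_properties(3)[OF p(3)[of l], of g "p l" t] cut_properties(4)[OF p(3)[of l], of g "p l" t']
      by linarith+
    then show False using same lT by fastforce
  qed
  have "fine_for T g e"
    unfolding fine_for_def
  proof (intro exI[of _ R] conjI gR allI impI)
    fix t t' assume *: "\<bar>g t\<bar> \<le> R" "\<bar>g t'\<bar> \<le> R"
      "\<forall>c\<in>T. ramp c t \<noteq> 0 \<and> ramp c t' \<noteq> 0 \<or> ramp c t \<noteq> 1 \<and> ramp c t' \<noteq> 1"
    have "\<forall>c\<in>T. ramp c t' \<noteq> 0 \<and> ramp c t \<noteq> 0 \<or> ramp c t' \<noteq> 1 \<and> ramp c t \<noteq> 1" using *(3) by blast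
    from osc[OF *] osc[OF *(2,1) this] show "\<bar>g t - g t'\<bar> \<le> e" by linarith
  qed
  then show ?thesis using fin small g p(3) by (intro exI[of _ T]) (auto simp: T_def)
qed

lemma fine_for_mono: "fine_for T g e \<Longrightarrow> T \<subseteq> T' \<Longrightarrow> fine_for T' g e"
  unfolding fine_for_def by (meson subset_iff)

lemma fine_cuts:
  assumes \<psi>: "positive_form \<psi>" and e: "0 < e"
    and "finite \<G>" "\<forall>g\<in>\<G>. cplx g \<in> V" "0 < \<delta>"
  shows "\<exists>T. finite T \<and> (\<forall>(g, a, \<eta>)\<in>T. 0 < \<eta> \<and> cplx g \<in> V) \<and>
    Re (\<psi> (cplx (\<lambda>t. \<Sum>c\<in>T. 1 - above c t - below c t))) \<le> \<delta> \<and> (\<forall>g\<in>\<G>. fine_for T g e)"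
  using assms(3-5)
proof (induction \<G> arbitrary: \<delta> rule: finite_induct)
  case empty
  then show ?case
    using bounded_form_0[OF positive_formD(1)[OF \<psi>]] by (intro exI[of _ "{}"]) auto
next
  case (insert g \<G>)
  obtain T where T: "finite T" "\<forall>(g, a, \<eta>)\<in>T. 0 < \<eta> \<and> cplx g \<in> V"
    "Re (\<psi> (cplx (\<lambda>t. \<Sum>c\<in>T. 1 - above c t - below c t))) \<le> \<delta> / 2" "\<forall>g\<in>\<G>. fine_for T g e"
    using insert.IH[of "\<delta> / 2"] insert.prems by auto
  obtain T' where T': "finite T'" "\<forall>(g, a, \<eta>)\<in>T'. 0 < \<eta> \<and> cplx g \<in> V"
    "Re (\<psi> (cplx (\<lambda>t. \<Sum>c\<in>T'. 1 - above c t - below c t))) \<le> \<delta> / 2" "fine_for T' g e"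
    using fine_cuts_single[OF \<psi> _ e, of g "\<delta> / 2"] insert.prems by auto
  have V: "cplx (\<lambda>t. 1 - above c t - below c t) \<in> V" if "c \<in> T \<union> T'" for c
  proof -
    obtain g a \<eta> where c: "c = (g, a, \<eta>)" by (cases c)
    then have g: "cplx g \<in> V" "0 < \<eta>" using T(2) T'(2) that by auto
    show ?thesis unfolding c by (rule V_gap[OF g])
  qed
  have nn: "0 \<le> Re (\<psi> (cplx (\<lambda>t. 1 - above c t - below c t)))" if "c \<in> T \<union> T'" for c
  proof (rule positive_formD(3)[OF \<psi> V[OF that]])
    obtain g a \<eta> where c: "c = (g, a, \<eta>)" by (cases c)
    then have "0 < \<eta>" using that T(2) T'(2) by auto
    then have "0 \<le> 1 - above c t - below c t" for t using cut_properties(5)[of \<eta> g a t] unfolding c by linarith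
    then show "\<forall>\<^sub>F t in F. 0 \<le> 1 - above c t - below c t" by simp
  qed
  have "Re (\<psi> (cplx (\<lambda>t. \<Sum>c\<in>T \<union> T'. 1 - above c t - below c t))) =
      (\<Sum>c\<in>T \<union> T'. Re (\<psi> (cplx (\<lambda>t. 1 - above c t - below c t))))"
    by (rule Re_form_sum[OF \<psi> V])
  also have "\<dots> \<le> (\<Sum>c\<in>T. Re (\<psi> (cplx (\<lambda>t. 1 - above c t - below c t)))) +
      (\<Sum>c\<in>T'. Re (\<psi> (cplx (\<lambda>t. 1 - above c t - below c t))))"
  proof -
    have "0 \<le> (\<Sum>c\<in>T \<inter> T'. Re (\<psi> (cplx (\<lambda>t. 1 - above c t - below c t))))"
      by (rule sum_nonneg, rule nn) simp
    then show ?thesis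
      using sum.union_inter[OF T(1) T'(1), of "\<lambda>c. Re (\<psi> (cplx (\<lambda>t. 1 - above c t - below c t)))"] by linarith
  qed
  also have "\<dots> = Re (\<psi> (cplx (\<lambda>t. \<Sum>c\<in>T. 1 - above c t - below c t))) +
      Re (\<psi> (cplx (\<lambda>t. \<Sum>c\<in>T'. 1 - above c t - below c t)))"
  proof -
    have "Re (\<psi> (cplx (\<lambda>t. \<Sum>c\<in>T. 1 - above c t - below c t))) =
          (\<Sum>c\<in>T. Re (\<psi> (cplx (\<lambda>t. 1 - above c t - below c t))))"
      by (rule Re_form_sum[OF \<psi>], rule V) simp
    moreover have "Re (\<psi> (cplx (\<lambda>t. \<Sum>c\<in>T'. 1 - above c t - below c t))) =
          (\<Sum>c\<in>T'. Re (\<psi> (cplx (\<lambda>t. 1 - above c t - below c t))))"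
      by (rule Re_form_sum[OF \<psi>], rule V) simp
    ultimately show ?thesis by linarith
  qed
  also have "\<dots> \<le> \<delta>" using T(3) T'(3) by simp
  finally have "Re (\<psi> (cplx (\<lambda>t. \<Sum>c\<in>T \<union> T'. 1 - above c t - below c t))) \<le> \<delta>" .
  then show ?case using T T' by (intro exI[of _ "T \<union> T'"]) (auto intro: fine_for_mono)
qed

lemma V_cell:
  assumes "finite T" "\<forall>(g, a, \<eta>)\<in>T. 0 < \<eta> \<and> cplx g \<in> V" "\<alpha> \<subseteq> T"
  shows "cplx (cell T \<alpha>) \<in> V" "cplx (core T \<alpha>) \<in> V"
proof -
  have c: "cplx (ramp c) \<in> V" "cplx (above c) \<in> V" "cplx (below c) \<in> V" if "c \<in> T" for c
  proof -
    obtain g a \<eta> where c: "c = (g, a, \<eta>)" by (cases c)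
    then have g: "cplx g \<in> V" "0 < \<eta>" using assms(2) that by auto
    show "cplx (ramp c) \<in> V" "cplx (above c) \<in> V" "cplx (below c) \<in> V"
      unfolding c by (rule V_cut[OF g])+
  qed
  have r: "cplx (\<lambda>t. 1 - ramp c t) \<in> V" if "c \<in> T" for c
    using V_diff[OF V_const[of 1] c(1)[OF that]] by simp
  have "(\<lambda>t. (\<Prod>c\<in>\<alpha>. cplx (ramp c) t) * (\<Prod>c\<in>T - \<alpha>. cplx (\<lambda>t. 1 - ramp c t) t)) \<in> V"
    using assms(3) by (intro V_mult V_prod c r) auto
  then show "cplx (cell T \<alpha>) \<in> V" by (simp add: cell_def)
  have "(\<lambda>t. (\<Prod>c\<in>\<alpha>. cplx (above c) t) * (\<Prod>c\<in>T - \<alpha>. cplx (below c) t)) \<in> V"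
    using assms(3) by (intro V_mult V_prod c) auto
  then show "cplx (core T \<alpha>) \<in> V" by (simp add: core_def)
qed

text \<open>
  The functions \<open>k\<close> are cores and the functions \<open>h\<close> are essentially cells. Functionals of norm one
  that are biorthogonal to \<open>h\<close> exist only if every \<open>h \<alpha>\<close> has norm one, which may fail for some
  cells. Therefore a minimal subfamily of cells is taken whose supports still cover the space, and it
  is divided by its sum: by minimality each of its members is somewhere the only nonzero one.
\<close>

lemma partition_of_unity:
  assumes \<psi>: "positive_form \<psi>" and S: "finite S" "S \<subseteq> V" and e: "0 < e" and \<delta>: "0 < \<delta>"
  obtains J :: "'a cut set set" and h k where "finite J" "J \<noteq> {}"
    "\<And>\<alpha>. \<alpha> \<in> J \<Longrightarrow> cplx (h \<alpha>) \<in> V" "\<And>\<alpha>. \<alpha> \<in> J \<Longrightarrow> cplx (k \<alpha>) \<in> V"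
    "\<And>\<alpha>. \<alpha> \<in> J \<Longrightarrow> \<forall>\<^sub>F t in F. 0 \<le> h \<alpha> t" "\<And>\<alpha>. \<alpha> \<in> J \<Longrightarrow> \<forall>\<^sub>F t in F. 0 \<le> k \<alpha> t"
    "\<And>\<alpha>. \<alpha> \<in> J \<Longrightarrow> \<forall>\<^sub>F t in F. k \<alpha> t \<le> h \<alpha> t"
    "\<And>\<alpha>. \<alpha> \<in> J \<Longrightarrow> \<forall>\<^sub>F t in F. k \<alpha> t \<noteq> 0 \<longrightarrow> h \<alpha> t = 1"
    "\<And>\<alpha>. \<alpha> \<in> J \<Longrightarrow> \<exists>\<^sub>F t in F. h \<alpha> t = 1"
    "\<And>\<alpha> f. \<alpha> \<in> J \<Longrightarrow> f \<in> S \<Longrightarrow> \<exists>c. \<forall>\<^sub>F t in F. h \<alpha> t \<noteq> 0 \<longrightarrow> cmod (f t - c) \<le> e"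
    "\<forall>\<^sub>F t in F. (\<Sum>\<alpha>\<in>J. h \<alpha> t) = 1"
    "Re (\<psi> (cplx (\<lambda>t. 1 - (\<Sum>\<alpha>\<in>J. k \<alpha> t)))) \<le> \<delta>"
proof -
  define \<G> where "\<G> = (\<lambda>f t. Re (f t)) ` S \<union> (\<lambda>f t. Im (f t)) ` S"
  have "finite \<G>" "\<forall>g\<in>\<G>. cplx g \<in> V" using S V_Re V_Im by (auto simp: \<G>_def)
  then obtain T where T: "finite T" "\<forall>(g, a, \<eta>)\<in>T. 0 < \<eta> \<and> cplx g \<in> V"
    "Re (\<psi> (cplx (\<lambda>t. \<Sum>c\<in>T. 1 - above c t - below c t))) \<le> \<delta>"
    "\<forall>g\<in>\<G>. fine_for T g (e / 2)"
    using fine_cuts[OF \<psi>, of "e / 2" \<G> \<delta>] e \<delta> by auto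
  have T\<eta>: "\<And>g a \<eta>. (g, a, \<eta>) \<in> T \<Longrightarrow> 0 < \<eta>" using T(2) by auto
  note VC = V_cell[OF T(1,2)]
  define Q where "Q = (\<lambda>J. J \<subseteq> Pow T \<and> (\<forall>\<^sub>F t in F. \<exists>\<alpha>\<in>J. cell T \<alpha> t \<noteq> 0))"
  have "\<exists>\<alpha>\<in>Pow T. cell T \<alpha> t \<noteq> 0" for t
    using sum_cell[OF T(1), of t] sum.neutral[of "Pow T" "\<lambda>\<alpha>. cell T \<alpha> t"] by fastforce
  then have "Q (Pow T)" by (simp add: Q_def)
  then obtain J where J: "Q J" "\<And>K. Q K \<Longrightarrow> card J \<le> card K"
    using ex_has_least_nat[of Q "Pow T" card] by blast
  have JT: "J \<subseteq> Pow T" and cover: "\<forall>\<^sub>F t in F. \<exists>\<alpha>\<in>J. cell T \<alpha> t \<noteq> 0" using J(1) by (auto simp: Q_def)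
  have finJ: "finite J" using JT T(1) finite_subset by auto
  have neJ: "J \<noteq> {}" using cover F by auto
  have VJ: "cplx (cell T \<alpha>) \<in> V" "cplx (core T \<alpha>) \<in> V" if "\<alpha> \<in> J" for \<alpha> using VC[of \<alpha>] JT that by auto
  define s where "s = (\<lambda>t. \<Sum>\<alpha>\<in>J. cell T \<alpha> t)"
  define h where "h = (\<lambda>\<alpha> t. cell T \<alpha> t / s t)"
  have sV: "cplx s \<in> V" unfolding s_def by (rule V_real_sum) (rule VJ)
  have cs: "cell T \<alpha> t \<le> s t" if "\<alpha> \<in> J" for \<alpha> t
    unfolding s_def by (rule member_le_sum[OF that cell_nonneg finJ])
  have s: "0 < s t" if c: "\<exists>\<alpha>\<in>J. cell T \<alpha> t \<noteq> 0" for t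
  proof -
    obtain \<alpha> where \<alpha>: "\<alpha> \<in> J" "cell T \<alpha> t \<noteq> 0" using c by blast
    then have "0 < cell T \<alpha> t" using cell_nonneg[of T \<alpha> t] by simp
    then show ?thesis using cs[OF \<alpha>(1), of t] by linarith
  qed
  have hV: "cplx (h \<alpha>) \<in> V" if "\<alpha> \<in> J" for \<alpha>
  proof -
    have "(\<lambda>t. cplx (cell T \<alpha>) t / cplx s t) \<in> V"
    proof (rule V_divide[OF VJ(1)[OF that] sV])
      show "\<forall>\<^sub>F t in F. cplx s t \<noteq> 0" using cover by eventually_elim (use s in force)
      show "\<forall>\<^sub>F t in F. cmod (cplx (cell T \<alpha>) t) \<le> cmod (cplx s t)"
      proof (intro always_eventually allI)
        fix t show "cmod (cplx (cell T \<alpha>) t) \<le> cmod (cplx s t)"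
          using cs[OF that, of t] cell_nonneg[of T \<alpha> t] by simp
      qed
    qed
    then show ?thesis by (simp add: h_def)
  qed
  have one: "h \<alpha> t = 1" if "\<alpha> \<in> J" "\<exists>\<alpha>\<in>J. cell T \<alpha> t \<noteq> 0" "\<forall>\<beta>\<in>J - {\<alpha>}. cell T \<beta> t = 0" for \<alpha> t
  proof -
    have "s t = cell T \<alpha> t" unfolding s_def using that(1,3) finJ by (subst sum.remove[OF finJ that(1)]) simp
    then show ?thesis using s[OF that(2)] by (simp add: h_def)
  qed
  have core1: "(\<forall>\<beta>\<in>Pow T - {\<alpha>}. cell T \<beta> t = 0)" if "\<alpha> \<subseteq> T" "core T \<alpha> t \<noteq> 0" for \<alpha> t
  proof -
    have "cell T \<alpha> t = 1" by (rule cell_core[OF T(1) T\<eta> that])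
    then have "(\<Sum>\<beta>\<in>Pow T - {\<alpha>}. cell T \<beta> t) = 0"
      using sum_cell[OF T(1), of t] sum.remove[of "Pow T" \<alpha> "\<lambda>\<beta>. cell T \<beta> t"] T(1) that(1) by simp
    then show ?thesis using T(1) by (subst (asm) sum_nonneg_eq_0_iff) (auto simp: cell_nonneg)
  qed
  have kh: "\<forall>\<^sub>F t in F. core T \<alpha> t \<noteq> 0 \<longrightarrow> h \<alpha> t = 1" if "\<alpha> \<in> J" for \<alpha>
    using cover
  proof eventually_elim
    case (elim t)
    show ?case using one[OF that elim] core1[of \<alpha> t] that JT by blast
  qed
  have h0: "0 \<le> h \<alpha> t" for \<alpha> t
    unfolding h_def s_def by (intro divide_nonneg_nonneg sum_nonneg cell_nonneg)
  have freq: "\<exists>\<^sub>F t in F. h \<alpha> t = 1" if \<alpha>: "\<alpha> \<in> J" for \<alpha>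
  proof -
    have "card (J - {\<alpha>}) < card J" using finJ \<alpha> by (rule card_Diff1_less)
    then have "\<not> Q (J - {\<alpha>})" using J(2)[of "J - {\<alpha>}"] by auto
    then have "\<exists>\<^sub>F t in F. \<not> (\<exists>\<beta>\<in>J - {\<alpha>}. cell T \<beta> t \<noteq> 0)"
      using JT unfolding Q_def frequently_def by auto
    then show ?thesis
      by (rule frequently_rev_mp) (use cover in eventually_elim, use one[OF \<alpha>] in blast)
  qed
  show ?thesis
  proof (rule that[of J h "core T", OF finJ neJ hV VJ(2) _ _ _ kh freq])
    fix \<alpha> assume \<alpha>: "\<alpha> \<in> J"
    show "\<forall>\<^sub>F t in F. 0 \<le> h \<alpha> t" "\<forall>\<^sub>F t in F. 0 \<le> core T \<alpha> t" by (simp_all add: h0 core_nonneg)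
    show "\<forall>\<^sub>F t in F. core T \<alpha> t \<le> h \<alpha> t"
      using kh[OF \<alpha>] by eventually_elim (metis core_le_one h0)
  next
    fix \<alpha> f assume \<alpha>: "\<alpha> \<in> J" and f: "f \<in> S"
    have "fine_for T (\<lambda>t. Re (f t)) (e / 2)" "fine_for T (\<lambda>t. Im (f t)) (e / 2)"
      using T(4) f by (auto simp: \<G>_def)
    then obtain R R' where R: "\<forall>\<^sub>F t in F. \<bar>Re (f t)\<bar> \<le> R" "\<forall>\<^sub>F t in F. \<bar>Im (f t)\<bar> \<le> R'"
      "\<And>t t'. \<bar>Re (f t)\<bar> \<le> R \<Longrightarrow> \<bar>Re (f t')\<bar> \<le> R \<Longrightarrow>
        (\<forall>c\<in>T. ramp c t \<noteq> 0 \<and> ramp c t' \<noteq> 0 \<or> ramp c t \<noteq> 1 \<and> ramp c t' \<noteq> 1) \<Longrightarrow>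
        \<bar>Re (f t) - Re (f t')\<bar> \<le> e / 2"
      "\<And>t t'. \<bar>Im (f t)\<bar> \<le> R' \<Longrightarrow> \<bar>Im (f t')\<bar> \<le> R' \<Longrightarrow>
        (\<forall>c\<in>T. ramp c t \<noteq> 0 \<and> ramp c t' \<noteq> 0 \<or> ramp c t \<noteq> 1 \<and> ramp c t' \<noteq> 1) \<Longrightarrow>
        \<bar>Im (f t) - Im (f t')\<bar> \<le> e / 2"
      unfolding fine_for_def by blast
    have "\<forall>\<^sub>F t in F. h \<alpha> t = 1 \<longrightarrow> \<bar>Re (f t)\<bar> \<le> R \<and> \<bar>Im (f t)\<bar> \<le> R' \<and> h \<alpha> t = 1"
      using R(1,2) by eventually_elim simp
    from frequently_rev_mp[OF freq[OF \<alpha>] this]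
    obtain t0 where t0: "\<bar>Re (f t0)\<bar> \<le> R" "\<bar>Im (f t0)\<bar> \<le> R'" "h \<alpha> t0 = 1"
      using frequently_ex by blast
    have fin: "finite \<alpha>" "finite (T - \<alpha>)" using T(1) JT \<alpha> by (auto intro: finite_subset)
    have cellD: "\<And>c. c \<in> \<alpha> \<Longrightarrow> ramp c t \<noteq> 0" "\<And>c. c \<in> T - \<alpha> \<Longrightarrow> ramp c t \<noteq> 1" if "h \<alpha> t \<noteq> 0" for t
    proof -
      have "cell T \<alpha> t \<noteq> 0" using that by (auto simp: h_def)
      then show "\<And>c. c \<in> \<alpha> \<Longrightarrow> ramp c t \<noteq> 0" "\<And>c. c \<in> T - \<alpha> \<Longrightarrow> ramp c t \<noteq> 1"
        using fin unfolding cell_def by auto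
    qed
    show "\<exists>c. \<forall>\<^sub>F t in F. h \<alpha> t \<noteq> 0 \<longrightarrow> cmod (f t - c) \<le> e"
    proof (rule exI[of _ "f t0"], use R(1,2) in eventually_elim, rule impI)
      fix t assume t: "\<bar>Re (f t)\<bar> \<le> R" "\<bar>Im (f t)\<bar> \<le> R'" "h \<alpha> t \<noteq> 0"
      have "h \<alpha> t0 \<noteq> 0" using t0(3) by simp
      then have same: "\<forall>c\<in>T. ramp c t \<noteq> 0 \<and> ramp c t0 \<noteq> 0 \<or> ramp c t \<noteq> 1 \<and> ramp c t0 \<noteq> 1"
        using cellD[OF t(3)] cellD by blast
      have "cmod (f t - f t0) \<le> \<bar>Re (f t - f t0)\<bar> + \<bar>Im (f t - f t0)\<bar>" by (rule cmod_le)
      also have "\<dots> \<le> e / 2 + e / 2"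
        using R(3)[OF t(1) t0(1) same] R(4)[OF t(2) t0(2) same] by simp
      finally show "cmod (f t - f t0) \<le> e" by simp
    qed
  next
    show "\<forall>\<^sub>F t in F. (\<Sum>\<alpha>\<in>J. h \<alpha> t) = 1"
      using cover
    proof eventually_elim
      case (elim t)
      have "(\<Sum>\<alpha>\<in>J. h \<alpha> t) = s t / s t" unfolding h_def s_def by (rule sum_divide_distrib[symmetric])
      then show ?case using s[OF elim] by simp
    qed
    have VP: "cplx (\<lambda>t. 1 - above c t - below c t) \<in> V" if "c \<in> T" for c
    proof -
      obtain g a \<eta> where c: "c = (g, a, \<eta>)" by (cases c)
      then have g: "cplx g \<in> V" "0 < \<eta>" using T(2) that by auto
      show ?thesis unfolding c by (rule V_gap[OF g])
    qed
    have "Re (\<psi> (cplx (\<lambda>t. 1 - (\<Sum>\<alpha>\<in>J. core T \<alpha> t)))) \<le>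
        Re (\<psi> (cplx (\<lambda>t. \<Sum>c\<in>T. 1 - above c t - below c t)))"
    proof (rule positive_form_mono[OF \<psi>])
      show "cplx (\<lambda>t. 1 - (\<Sum>\<alpha>\<in>J. core T \<alpha> t)) \<in> V"
        using V_diff[OF V_const[of 1] V_real_sum[of J "core T"]] VJ(2) by simp
      show "cplx (\<lambda>t. \<Sum>c\<in>T. 1 - above c t - below c t) \<in> V" by (rule V_real_sum[OF VP])
      show "\<forall>\<^sub>F t in F. 1 - (\<Sum>\<alpha>\<in>J. core T \<alpha> t) \<le> (\<Sum>c\<in>T. 1 - above c t - below c t)"
        using cover
      proof eventually_elim
        case (elim t)
        have "core T \<alpha> t = 0" if "\<alpha> \<in> Pow T - J" for \<alpha>
        proof (rule ccontr)
          assume "core T \<alpha> t \<noteq> 0"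
          with core1[of \<alpha> t] that have "\<forall>\<beta>\<in>Pow T - {\<alpha>}. cell T \<beta> t = 0" by blast
          then show False using elim JT that by blast
        qed
        then have "(\<Sum>\<alpha>\<in>J. core T \<alpha> t) = (\<Sum>\<alpha>\<in>Pow T. core T \<alpha> t)"
          using JT T(1) by (intro sum.mono_neutral_left) auto
        then show ?case using one_minus_sum_core_le[where t = t, OF T(1) T\<eta>] by simp
      qed
    qed
    then show "Re (\<psi> (cplx (\<lambda>t. 1 - (\<Sum>\<alpha>\<in>J. core T \<alpha> t)))) \<le> \<delta>" using T(3) by linarith
  qed
qed

section \<open>Means\<close>

text \<open>
  A mean takes \<open>f\<close> into every closed disc that contains its values at \<open>F\<close>-almost all
  points of \<open>S\<close>.
\<close>

definition mean_on :: "'a set \<Rightarrow> (('a \<Rightarrow> complex) \<Rightarrow> complex) \<Rightarrow> bool" where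
  "mean_on S \<nu> \<longleftrightarrow> bounded_form V N \<nu> \<and>
     (\<forall>f\<in>V. \<forall>c e. 0 \<le> e \<longrightarrow> (\<forall>\<^sub>F t in F. t \<in> S \<longrightarrow> cmod (f t - c) \<le> e) \<longrightarrow> cmod (\<nu> f - c) \<le> e)"

lemma mean_onD:
  "mean_on S \<nu> \<Longrightarrow> f \<in> V \<Longrightarrow> 0 \<le> e \<Longrightarrow> \<forall>\<^sub>F t in F. t \<in> S \<longrightarrow> cmod (f t - c) \<le> e \<Longrightarrow> cmod (\<nu> f - c) \<le> e"
  unfolding mean_on_def by blast

lemma mean_on_le:
  assumes "mean_on S \<nu>" "f \<in> V"
  shows "cmod (\<nu> f) \<le> N f"
proof -
  have "\<forall>\<^sub>F t in F. t \<in> S \<longrightarrow> cmod (f t - 0) \<le> N f"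
    using eventually_le_N[OF assms(2)] by eventually_elim simp
  from mean_onD[OF assms N_nonneg[OF assms(2)] this] show ?thesis by simp
qed

text \<open>
  A cluster point of the evaluations at points of \<open>S\<close>. Evaluation at \<open>t\<close> is bounded by \<open>N\<close> only for
  \<open>F\<close>-almost all \<open>t\<close>, hence the truncation in \<open>\<Lambda>\<close>.
\<close>

lemma limit_mean:
  assumes "\<exists>\<^sub>F t in F. t \<in> S"
  shows "\<exists>\<nu>. mean_on S \<nu>"
proof -
  define Q where "Q = inf F (principal S)"
  have Q: "Q \<noteq> bot"
    using assms unfolding Q_def trivial_limit_def eventually_inf_principal frequently_def by simp
  define \<Lambda> where "\<Lambda> = (\<lambda>t f. if cmod (f t) \<le> N f then f t else 0 :: complex)"
  have FQ: "eventually P Q" if "eventually P F" for P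
    using that unfolding Q_def by (rule filter_leD[OF inf_le1])
  have \<Lambda>: "\<forall>\<^sub>F t in Q. \<Lambda> t f = f t" if "f \<in> V" for f
    using FQ[OF eventually_le_N[OF that]] by eventually_elim (simp add: \<Lambda>_def)
  have "\<exists>L. bounded_form V N L \<and> (\<forall>f\<in>V. cmod (L f) \<le> 1 * N f) \<and>
      (\<forall>f T. f \<in> V \<longrightarrow> closed T \<longrightarrow> (\<forall>\<^sub>F i in Q. \<Lambda> i f \<in> T) \<longrightarrow> L f \<in> T)"
  proof (rule cluster_form[OF Q])
    fix t f assume "f \<in> V" then show "cmod (\<Lambda> t f) \<le> 1 * N f" using N_nonneg by (simp add: \<Lambda>_def)
  next
    fix f g assume fg: "f \<in> V" "g \<in> V"
    show "\<forall>\<^sub>F t in Q. \<Lambda> t (\<lambda>t. f t + g t) = \<Lambda> t f + \<Lambda> t g"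
      using \<Lambda>[OF fg(1)] \<Lambda>[OF fg(2)] \<Lambda>[OF V_add[OF fg]] by eventually_elim simp
  next
    fix c f assume f: "f \<in> V"
    show "\<forall>\<^sub>F t in Q. \<Lambda> t (\<lambda>t. c * f t) = c * \<Lambda> t f"
      using \<Lambda>[OF f] \<Lambda>[OF V_smult[OF f]] by eventually_elim simp
  qed
  then obtain L where L: "bounded_form V N L"
    "\<And>f T. f \<in> V \<Longrightarrow> closed T \<Longrightarrow> \<forall>\<^sub>F i in Q. \<Lambda> i f \<in> T \<Longrightarrow> L f \<in> T" by blast
  have "mean_on S L"
    unfolding mean_on_def
  proof (intro conjI ballI allI impI L(1))
    fix f c e assume f: "f \<in> V" and *: "\<forall>\<^sub>F t in F. t \<in> S \<longrightarrow> cmod (f t - c) \<le> e"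
    have "\<forall>\<^sub>F t in Q. t \<in> S" unfolding Q_def eventually_inf_principal by simp
    then have "\<forall>\<^sub>F t in Q. \<Lambda> t f \<in> cball c e"
      using \<Lambda>[OF f] FQ[OF *] by eventually_elim (simp add: dist_norm norm_minus_commute)
    from L(2)[OF f closed_cball this] show "cmod (L f - c) \<le> e" by (simp add: dist_norm norm_minus_commute)
  qed
  then show ?thesis by (intro exI[of _ L])
qed

text \<open>
  The weighted average \<open>\<psi> (k f) / \<psi> k\<close>. If \<open>\<psi> k = 0\<close>, then \<open>\<psi> (k f) = 0\<close> for all \<open>f\<close>, and any
  mean on \<open>S\<close> satisfies the equation.
\<close>

lemma weighted_mean:
  assumes \<psi>: "positive_form \<psi>" and k: "cplx k \<in> V" "\<forall>\<^sub>F t in F. 0 \<le> k t"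
    and kS: "\<forall>\<^sub>F t in F. k t \<noteq> 0 \<longrightarrow> t \<in> S" and S: "\<exists>\<^sub>F t in F. t \<in> S"
  shows "\<exists>\<nu>. mean_on S \<nu> \<and> (\<forall>f\<in>V. \<nu> f * \<psi> (cplx k) = \<psi> (\<lambda>t. cplx k t * f t))"
proof -
  note b = positive_formD(1)[OF \<psi>]
  define m where "m = Re (\<psi> (cplx k))"
  have m0: "0 \<le> m" unfolding m_def by (rule positive_formD(3)[OF \<psi> k])
  have m: "\<psi> (cplx k) = of_real m" unfolding m_def by (rule positive_formD(2)[OF \<psi> k(1)])
  have kf: "(\<lambda>t. cplx k t * f t) \<in> V" if "f \<in> V" for f by (rule V_mult[OF k(1) that])
  have main: "cmod (\<psi> (\<lambda>t. cplx k t * f t) - c * of_real m) \<le> e * m"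
    if f: "f \<in> V" and ev: "\<forall>\<^sub>F t in F. t \<in> S \<longrightarrow> cmod (f t - c) \<le> e" for f c e
  proof -
    have fc: "(\<lambda>t. f t - c) \<in> V" by (rule V_diff[OF f V_const])
    have "\<psi> (\<lambda>t. cplx k t * (f t - c)) = \<psi> (\<lambda>t. cplx k t * f t) - c * of_real m"
      using bounded_form_diff[OF b kf[OF f] V_smult[OF k(1), of c]] bounded_form_smult[OF b k(1), of c] m
      by (simp add: algebra_simps)
    moreover have ek: "cplx (\<lambda>t. e * k t) \<in> V" using V_smult[OF k(1), of "of_real e"] by simp
    have "cmod (\<psi> (\<lambda>t. cplx k t * (f t - c))) \<le> Re (\<psi> (cplx (\<lambda>t. e * k t)))"
    proof (rule positive_form_cmod_le[OF \<psi> kf[OF fc] ek])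
      show "\<forall>\<^sub>F t in F. cmod (cplx k t * (f t - c)) \<le> e * k t"
        using k(2) kS ev
      proof eventually_elim
        case (elim t)
        show ?case
        proof (cases "k t = 0")
          case False
          then have "k t * cmod (f t - c) \<le> k t * e" using elim by (intro mult_left_mono) auto
          then show ?thesis using elim(1) by (simp add: norm_mult mult.commute)
        qed simp
      qed
    qed
    moreover have "\<psi> (cplx (\<lambda>t. e * k t)) = of_real (e * m)"
      using bounded_form_smult[OF b k(1), of "of_real e"] m by simp
    ultimately show ?thesis by simp
  qed
  show ?thesis
  proof (cases "m = 0")
    case True
    obtain \<nu> where "mean_on S \<nu>" using limit_mean[OF S] by blast
    moreover have "\<psi> (\<lambda>t. cplx k t * f t) = 0" if f: "f \<in> V" for f
    proof -
      have "\<forall>\<^sub>F t in F. t \<in> S \<longrightarrow> cmod (f t - 0) \<le> N f"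
        using eventually_le_N[OF f] by eventually_elim simp
      from main[OF f this] show ?thesis using True by simp
    qed
    ultimately show ?thesis using m True by auto
  next
    case False
    with m0 have mp: "0 < m" by simp
    define \<nu> where "\<nu> = (\<lambda>f. \<psi> (\<lambda>t. cplx k t * f t) / of_real m)"
    have mean: "cmod (\<nu> f - c) \<le> e"
      if f: "f \<in> V" and ev: "\<forall>\<^sub>F t in F. t \<in> S \<longrightarrow> cmod (f t - c) \<le> e" for f c e
    proof -
      have "\<nu> f - c = (\<psi> (\<lambda>t. cplx k t * f t) - c * of_real m) / of_real m"
        using mp by (simp add: \<nu>_def divide_simps)
      then have "cmod (\<nu> f - c) = cmod (\<psi> (\<lambda>t. cplx k t * f t) - c * of_real m) / m"
        using mp by (simp only: norm_divide norm_of_real abs_of_pos)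
      also have "\<dots> \<le> e * m / m" using main[OF f ev] mp by (intro divide_right_mono) auto
      also have "\<dots> = e" using mp by simp
      finally show ?thesis .
    qed
    have "bounded_form V N \<nu>"
    proof (rule bounded_formI)
      fix f g assume fg: "f \<in> V" "g \<in> V"
      have "\<psi> (\<lambda>t. cplx k t * (f t + g t)) = \<psi> (\<lambda>t. cplx k t * f t) + \<psi> (\<lambda>t. cplx k t * g t)"
        using bounded_form_add[OF b kf[OF fg(1)] kf[OF fg(2)]] by (simp add: algebra_simps)
      then show "\<nu> (\<lambda>t. f t + g t) = \<nu> f + \<nu> g" by (simp add: \<nu>_def add_divide_distrib)
    next
      fix c f assume f: "f \<in> V"
      have "\<psi> (\<lambda>t. cplx k t * (c * f t)) = c * \<psi> (\<lambda>t. cplx k t * f t)"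
        using bounded_form_smult[OF b kf[OF f], of c] by (simp add: algebra_simps)
      then show "\<nu> (\<lambda>t. c * f t) = c * \<nu> f" by (simp add: \<nu>_def)
    next
      fix f assume f: "f \<in> V"
      have "\<forall>\<^sub>F t in F. t \<in> S \<longrightarrow> cmod (f t - 0) \<le> N f"
        using eventually_le_N[OF f] by eventually_elim simp
      from mean[OF f this] show "cmod (\<nu> f) \<le> 1 * N f" by simp
    qed
    then have "mean_on S \<nu>" using mean unfolding mean_on_def by blast
    moreover have "\<nu> f * \<psi> (cplx k) = \<psi> (\<lambda>t. cplx k t * f t)" for f
      using mp by (simp add: \<nu>_def m)
    ultimately show ?thesis by blast
  qed
qed

section \<open>Approximating systems for essential supremum norms\<close>

text \<open>
  The means \<open>\<nu> \<alpha>\<close> are supported where \<open>h \<alpha> = 1\<close> and hence all other \<open>h \<beta>\<close> vanish; this gives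
  biorthogonality. All combinations \<open>\<Sum> a \<alpha> h \<alpha>\<close> are pointwise convex combinations of the
  coefficients, so the norms are bounded by the largest coefficient. For \<open>\<phi> \<in> B\<close> let \<open>w\<close> be its
  approximate density. Then \<open>\<psi> (w P f) = \<Sum> \<nu> \<alpha> f \<psi> (w h \<alpha>)\<close>. Replacing \<open>h \<alpha>\<close> by \<open>k \<alpha>\<close> costs only the
  small mass of the overlaps, and on the support of \<open>k \<alpha>\<close> the function \<open>w\<close> is nearly constant, so that
  \<open>\<nu> \<alpha> f \<psi> (w k \<alpha>)\<close> is close to \<open>\<psi> (w k \<alpha> f)\<close>. The sum of these is close to \<open>\<psi> (w f)\<close>.
\<close>

theorem ess_sup_approximating_system:
  assumes A: "finite A" "A \<subseteq> V" and B: "finite B" "\<forall>\<phi>\<in>B. bounded_form V N \<phi>" and e: "0 < e"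
  shows "\<exists>(J :: 'a cut set set) x \<nu>. approximating_system V N A B e J x \<nu>"
proof -
  obtain \<psi> where \<psi>: "positive_form \<psi>"
    and dom: "\<forall>\<phi>\<in>B. \<forall>f\<in>V. cmod (\<phi> f) \<le> Re (\<psi> (cplx (\<lambda>t. cmod (f t))))"
    using common_dominating_positive_form[OF B] by blast
  note b = positive_formD(1)[OF \<psi>]
  have "\<exists>u\<in>V. \<forall>f\<in>V. cmod (\<psi> (\<lambda>t. u t * f t) - \<phi> f) \<le> e / 4 * N f" if "\<phi> \<in> B" for \<phi>
    using that B(2) dom e by (intro approximate_density[OF \<psi>]) auto
  then obtain u where u: "\<And>\<phi>. \<phi> \<in> B \<Longrightarrow> u \<phi> \<in> V"
    "\<And>\<phi> f. \<phi> \<in> B \<Longrightarrow> f \<in> V \<Longrightarrow> cmod (\<psi> (\<lambda>t. u \<phi> t * f t) - \<phi> f) \<le> e / 4 * N f" by metis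
  define R where "R = (\<Sum>\<phi>\<in>B. N (u \<phi>)) + 1"
  have Ru: "N (u \<phi>) \<le> R" if "\<phi> \<in> B" for \<phi>
    using member_le_sum[OF that, of "\<lambda>\<phi>. N (u \<phi>)"] N_nonneg u(1) B(1) by (simp add: R_def)
  have R: "0 < R" using sum_nonneg[of B "\<lambda>\<phi>. N (u \<phi>)"] N_nonneg u(1) by (simp add: R_def)
  define M where "M = Re (\<psi> (cplx (\<lambda>t. 1)))"
  have M0: "0 \<le> M" unfolding M_def by (rule positive_formD(3)[OF \<psi>]) (auto simp: V_const)
  define \<epsilon> where "\<epsilon> = e / (8 * (M + 1))"
  have \<epsilon>: "0 < \<epsilon>" "2 * \<epsilon> \<le> e" "2 * (\<epsilon> * M) \<le> e / 4"
    using e M0 by (auto simp: \<epsilon>_def divide_simps)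
  define \<delta> where "\<delta> = e / (8 * R)"
  have \<delta>: "0 < \<delta>" "2 * (R * \<delta>) = e / 4" using e R by (auto simp: \<delta>_def)
  have S: "finite (A \<union> u ` B)" "A \<union> u ` B \<subseteq> V" using A B(1) u(1) by auto
  obtain J :: "'a cut set set" and h k where J: "finite J" "J \<noteq> {}"
    and hk: "\<And>\<alpha>. \<alpha> \<in> J \<Longrightarrow> cplx (h \<alpha>) \<in> V" "\<And>\<alpha>. \<alpha> \<in> J \<Longrightarrow> cplx (k \<alpha>) \<in> V"
    "\<And>\<alpha>. \<alpha> \<in> J \<Longrightarrow> \<forall>\<^sub>F t in F. 0 \<le> h \<alpha> t" "\<And>\<alpha>. \<alpha> \<in> J \<Longrightarrow> \<forall>\<^sub>F t in F. 0 \<le> k \<alpha> t"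
    "\<And>\<alpha>. \<alpha> \<in> J \<Longrightarrow> \<forall>\<^sub>F t in F. k \<alpha> t \<le> h \<alpha> t"
    "\<And>\<alpha>. \<alpha> \<in> J \<Longrightarrow> \<forall>\<^sub>F t in F. k \<alpha> t \<noteq> 0 \<longrightarrow> h \<alpha> t = 1"
    "\<And>\<alpha>. \<alpha> \<in> J \<Longrightarrow> \<exists>\<^sub>F t in F. h \<alpha> t = 1"
    and osc: "\<And>\<alpha> f. \<alpha> \<in> J \<Longrightarrow> f \<in> A \<union> u ` B \<Longrightarrow> \<exists>c. \<forall>\<^sub>F t in F. h \<alpha> t \<noteq> 0 \<longrightarrow> cmod (f t - c) \<le> \<epsilon>"
    and one: "\<forall>\<^sub>F t in F. (\<Sum>\<alpha>\<in>J. h \<alpha> t) = 1"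
    and small: "Re (\<psi> (cplx (\<lambda>t. 1 - (\<Sum>\<alpha>\<in>J. k \<alpha> t)))) \<le> \<delta>"
  proof -
    show ?thesis
    proof (rule partition_of_unity[OF \<psi> S \<epsilon>(1) \<delta>(1)], goal_cases)
      case (1 J h k)
      show ?case by (rule that[OF 1])
    qed
  qed
  have "\<exists>\<nu>. mean_on {t. h \<alpha> t = 1} \<nu> \<and> (\<forall>f\<in>V. \<nu> f * \<psi> (cplx (k \<alpha>)) = \<psi> (\<lambda>t. cplx (k \<alpha>) t * f t))"
    if "\<alpha> \<in> J" for \<alpha>
    using hk[OF that] by (intro weighted_mean[OF \<psi>]) auto
  then obtain \<nu> where \<nu>: "\<And>\<alpha>. \<alpha> \<in> J \<Longrightarrow> mean_on {t. h \<alpha> t = 1} (\<nu> \<alpha>)"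
    "\<And>\<alpha> f. \<alpha> \<in> J \<Longrightarrow> f \<in> V \<Longrightarrow> \<nu> \<alpha> f * \<psi> (cplx (k \<alpha>)) = \<psi> (\<lambda>t. cplx (k \<alpha>) t * f t)" by metis
  have all0: "\<forall>\<^sub>F t in F. \<forall>\<alpha>\<in>J. 0 \<le> h \<alpha> t" using J(1) hk(3) by (simp add: eventually_ball_finite)
  have unit: "\<forall>\<^sub>F t in F. (\<forall>\<alpha>\<in>J. 0 \<le> h \<alpha> t) \<and> (\<Sum>\<alpha>\<in>J. h \<alpha> t) = 1"
    using all0 one by eventually_elim simp
  have comb: "cmod (\<Sum>\<alpha>\<in>J. a \<alpha> * cplx (h \<alpha>) t) \<le> r"
    if "(\<forall>\<alpha>\<in>J. 0 \<le> h \<alpha> t) \<and> (\<Sum>\<alpha>\<in>J. h \<alpha> t) = 1" "\<And>\<alpha>. \<alpha> \<in> J \<Longrightarrow> h \<alpha> t \<noteq> 0 \<Longrightarrow> cmod (a \<alpha>) \<le> r" for a r t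
  proof -
    have "cmod (\<Sum>\<alpha>\<in>J. a \<alpha> * cplx (h \<alpha>) t) \<le> (\<Sum>\<alpha>\<in>J. r * h \<alpha> t)"
    proof (rule order_trans[OF norm_sum sum_mono])
      fix \<alpha> assume \<alpha>: "\<alpha> \<in> J"
      show "cmod (a \<alpha> * cplx (h \<alpha>) t) \<le> r * h \<alpha> t"
        using that \<alpha> by (cases "h \<alpha> t = 0") (auto simp: norm_mult intro!: mult_right_mono)
    qed
    also have "\<dots> = r" using that(1) by (simp add: sum_distrib_left[symmetric])
    finally show ?thesis .
  qed
  have combV: "(\<lambda>t. \<Sum>\<alpha>\<in>J. a \<alpha> * cplx (h \<alpha>) t) \<in> V" for a
    by (rule V_sum) (rule V_smult[OF hk(1)])
  have "approximating_system V N A B e J (\<lambda>\<alpha>. cplx (h \<alpha>)) \<nu>"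
    unfolding approximating_system_def
  proof (intro conjI ballI allI impI J hk(1))
    fix \<alpha> assume "\<alpha> \<in> J" then show "bounded_form V N (\<nu> \<alpha>)" using \<nu>(1) unfolding mean_on_def by blast
  next
    fix \<alpha> \<beta> assume \<alpha>\<beta>: "\<alpha> \<in> J" "\<beta> \<in> J"
    have "\<forall>\<^sub>F t in F. t \<in> {t. h \<beta> t = 1} \<longrightarrow> cmod (cplx (h \<alpha>) t - (if \<alpha> = \<beta> then 1 else 0)) \<le> 0"
      using unit
    proof eventually_elim
      case (elim t)
      show ?case
      proof
        assume "t \<in> {t. h \<beta> t = 1}"
        then have "h \<beta> t = 1" by simp
        moreover have "h \<alpha> t = 0" if "\<alpha> \<noteq> \<beta>"
        proof -
          have "(\<Sum>\<gamma>\<in>J - {\<beta>}. h \<gamma> t) = 0"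
            using elim sum.remove[OF J(1) \<alpha>\<beta>(2), of "\<lambda>\<gamma>. h \<gamma> t"] \<open>h \<beta> t = 1\<close> by simp
          then have "\<forall>\<gamma>\<in>J - {\<beta>}. h \<gamma> t = 0"
            using J(1) elim by (subst (asm) sum_nonneg_eq_0_iff) auto
          then show ?thesis using \<alpha>\<beta>(1) that by blast
        qed
        ultimately show "cmod (cplx (h \<alpha>) t - (if \<alpha> = \<beta> then 1 else 0)) \<le> 0" by simp
      qed
    qed
    from mean_onD[OF \<nu>(1)[OF \<alpha>\<beta>(2)] hk(1)[OF \<alpha>\<beta>(1)] order_refl this]
    show "\<nu> \<beta> (cplx (h \<alpha>)) = (if \<alpha> = \<beta> then 1 else 0)" by simp
  next
    fix \<sigma> s f assume \<sigma>: "bij_betw \<sigma> J J" and s: "\<forall>i\<in>J. s i \<in> {1, - 1 :: complex}" and f: "f \<in> V"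
    have bd: "cmod (s \<alpha> * \<nu> (\<sigma> \<alpha>) f) \<le> N f" if "\<alpha> \<in> J" for \<alpha>
    proof -
      have "\<sigma> \<alpha> \<in> J" using \<sigma> that by (auto simp: bij_betw_def)
      moreover have "cmod (s \<alpha>) = 1" using s that by fastforce
      ultimately show ?thesis using mean_on_le[OF \<nu>(1) f] by (simp add: norm_mult)
    qed
    have "\<forall>\<^sub>F t in F. cmod (\<Sum>\<alpha>\<in>J. s \<alpha> * \<nu> (\<sigma> \<alpha>) f * cplx (h \<alpha>) t) \<le> N f"
      using unit by eventually_elim (rule comb, assumption, rule bd)
    then show "N (\<lambda>t. \<Sum>\<alpha>\<in>J. s \<alpha> * \<nu> (\<sigma> \<alpha>) f * cplx (h \<alpha>) t) \<le> N f"
      by (subst N_le_iff[OF combV N_nonneg[OF f]])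
  next
    fix f assume f: "f \<in> A"
    then have fV: "f \<in> V" using A by auto
    have near: "\<forall>\<^sub>F t in F. h \<alpha> t \<noteq> 0 \<longrightarrow> cmod (\<nu> \<alpha> f - f t) \<le> e" if \<alpha>: "\<alpha> \<in> J" for \<alpha>
    proof -
      obtain c where c: "\<forall>\<^sub>F t in F. h \<alpha> t \<noteq> 0 \<longrightarrow> cmod (f t - c) \<le> \<epsilon>" using osc[OF \<alpha>, of f] f by auto
      have "\<forall>\<^sub>F t in F. t \<in> {t. h \<alpha> t = 1} \<longrightarrow> cmod (f t - c) \<le> \<epsilon>"
        using c by eventually_elim simp
      from mean_onD[OF \<nu>(1)[OF \<alpha>] fV less_imp_le[OF \<epsilon>(1)] this] have *: "cmod (\<nu> \<alpha> f - c) \<le> \<epsilon>" .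
      show ?thesis using c
      proof eventually_elim
        case (elim t)
        show ?case
        proof
          assume "h \<alpha> t \<noteq> 0"
          then have "cmod (f t - c) \<le> \<epsilon>" using elim by simp
          then show "cmod (\<nu> \<alpha> f - f t) \<le> e"
            using * \<epsilon>(2) norm_triangle_ineq4[of "\<nu> \<alpha> f - c" "f t - c"] by simp
        qed
      qed
    qed
    have "\<forall>\<^sub>F t in F. \<forall>\<alpha>\<in>J. h \<alpha> t \<noteq> 0 \<longrightarrow> cmod (\<nu> \<alpha> f - f t) \<le> e"
      using J(1) near by (simp add: eventually_ball_finite)
    then have "\<forall>\<^sub>F t in F. cmod ((\<Sum>\<alpha>\<in>J. \<nu> \<alpha> f * cplx (h \<alpha>) t) - f t) \<le> e"
      using unit
    proof eventually_elim
      case (elim t)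
      have "(\<Sum>\<alpha>\<in>J. cplx (h \<alpha>) t) = 1" using elim(2) by (metis of_real_1 of_real_sum)
      then have "f t = (\<Sum>\<alpha>\<in>J. f t * cplx (h \<alpha>) t)" by (simp add: sum_distrib_left[symmetric])
      then have "(\<Sum>\<alpha>\<in>J. \<nu> \<alpha> f * cplx (h \<alpha>) t) - f t =
          (\<Sum>\<alpha>\<in>J. \<nu> \<alpha> f * cplx (h \<alpha>) t) - (\<Sum>\<alpha>\<in>J. f t * cplx (h \<alpha>) t)" by simp
      also have "\<dots> = (\<Sum>\<alpha>\<in>J. (\<nu> \<alpha> f - f t) * cplx (h \<alpha>) t)"
        by (simp add: sum_subtractf left_diff_distrib)
      finally show ?case using comb[OF elim(2), of "\<lambda>\<alpha>. \<nu> \<alpha> f - f t" e] elim(1) by simp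
    qed
    then show "N (\<lambda>t. (\<Sum>\<alpha>\<in>J. \<nu> \<alpha> f * cplx (h \<alpha>) t) - f t) \<le> e"
      using e by (subst N_le_iff[OF V_diff[OF combV fV]]) auto
  next
    fix \<phi> f assume \<phi>: "\<phi> \<in> B" and f: "f \<in> V"
    define w where "w = u \<phi>"
    have w: "w \<in> V" using u(1)[OF \<phi>] by (simp add: w_def)
    have wR: "\<forall>\<^sub>F t in F. cmod (w t) \<le> R"
      using eventually_le_N[OF w] by eventually_elim (use Ru[OF \<phi>] in \<open>simp add: w_def\<close>)
    define Pf where "Pf = (\<lambda>t. \<Sum>\<alpha>\<in>J. \<nu> \<alpha> f * cplx (h \<alpha>) t)"
    have Pf: "Pf \<in> V" unfolding Pf_def by (rule combV)
    have "\<forall>\<^sub>F t in F. cmod (Pf t) \<le> N f"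
      unfolding Pf_def using unit by eventually_elim (rule comb, assumption, rule mean_on_le[OF \<nu>(1) f])
    then have NPf: "N Pf \<le> N f" by (subst N_le_iff[OF Pf N_nonneg[OF f]])
    define H where "H = (\<lambda>\<alpha>. Re (\<psi> (cplx (\<lambda>t. h \<alpha> t - k \<alpha> t))))"
    define m where "m = (\<lambda>\<alpha>. Re (\<psi> (cplx (k \<alpha>))))"
    have m0: "0 \<le> m \<alpha>" if "\<alpha> \<in> J" for \<alpha>
      unfolding m_def by (rule positive_formD(3)[OF \<psi> hk(2)[OF that] hk(4)[OF that]])
    have hkV: "cplx (\<lambda>t. h \<alpha> t - k \<alpha> t) \<in> V" if "\<alpha> \<in> J" for \<alpha>
      using V_diff[OF hk(1)[OF that] hk(2)[OF that]] by simp
    have wh: "(\<lambda>t. w t * cplx (h \<alpha>) t) \<in> V" "(\<lambda>t. w t * cplx (k \<alpha>) t) \<in> V" if "\<alpha> \<in> J" for \<alpha>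
      by (intro V_mult w hk that)+
    have wf: "(\<lambda>t. w t * f t) \<in> V" by (rule V_mult[OF w f])
    have kwf: "(\<lambda>t. cplx (k \<alpha>) t * (w t * f t)) \<in> V" "(\<lambda>t. cplx (k \<alpha>) t * f t) \<in> V" if "\<alpha> \<in> J" for \<alpha>
      by (intro V_mult w f hk that)+
    have scaled: "cplx (\<lambda>t. r * g t) \<in> V" "Re (\<psi> (cplx (\<lambda>t. r * g t))) = r * Re (\<psi> (cplx g))"
      if "cplx g \<in> V" for r g
      using V_smult[OF that, of "of_real r"] bounded_form_smult[OF b that, of "of_real r"] by simp_all
    have t1: "cmod (\<psi> (\<lambda>t. w t * cplx (h \<alpha>) t) - \<psi> (\<lambda>t. w t * cplx (k \<alpha>) t)) \<le> R * H \<alpha>" if \<alpha>: "\<alpha> \<in> J" for \<alpha>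
    proof -
      have "cmod (\<psi> (\<lambda>t. w t * cplx (h \<alpha>) t - w t * cplx (k \<alpha>) t)) \<le> Re (\<psi> (cplx (\<lambda>t. R * (h \<alpha> t - k \<alpha> t))))"
      proof (rule positive_form_cmod_le[OF \<psi> V_diff[OF wh(1)[OF \<alpha>] wh(2)[OF \<alpha>]] scaled(1)[OF hkV[OF \<alpha>]]])
        show "\<forall>\<^sub>F t in F. cmod (w t * cplx (h \<alpha>) t - w t * cplx (k \<alpha>) t) \<le> R * (h \<alpha> t - k \<alpha> t)"
          using wR hk(5)[OF \<alpha>]
        proof eventually_elim
          case (elim t)
          have "w t * cplx (h \<alpha>) t - w t * cplx (k \<alpha>) t = w t * complex_of_real (h \<alpha> t - k \<alpha> t)"
            by (simp add: algebra_simps)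
          then have "cmod (w t * cplx (h \<alpha>) t - w t * cplx (k \<alpha>) t) = cmod (w t) * (h \<alpha> t - k \<alpha> t)"
            using elim(2) by (simp add: norm_mult del: of_real_diff)
          then show ?case using elim by (simp add: mult_right_mono)
        qed
      qed
      then show ?thesis
        by (simp only: bounded_form_diff[OF b wh(1)[OF \<alpha>] wh(2)[OF \<alpha>]] scaled(2)[OF hkV[OF \<alpha>]] H_def)
    qed
    \<comment> \<open>Both \<open>w\<close> and \<open>\<nu> \<alpha>\<close> are nearly constant where \<open>k \<alpha>\<close> lives.\<close>
    have t2: "cmod (\<nu> \<alpha> f * \<psi> (\<lambda>t. w t * cplx (k \<alpha>) t) - \<psi> (\<lambda>t. cplx (k \<alpha>) t * (w t * f t)))
        \<le> 2 * \<epsilon> * N f * m \<alpha>" if \<alpha>: "\<alpha> \<in> J" for \<alpha>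
    proof -
      have "w \<in> A \<union> u ` B" using \<phi> by (auto simp: w_def)
      then obtain c where c: "\<forall>\<^sub>F t in F. h \<alpha> t \<noteq> 0 \<longrightarrow> cmod (w t - c) \<le> \<epsilon>" using osc[OF \<alpha>] by blast
      have cw: "\<forall>\<^sub>F t in F. 0 \<le> k \<alpha> t \<and> (k \<alpha> t \<noteq> 0 \<longrightarrow> cmod (w t - c) \<le> \<epsilon>)"
        using c hk(6)[OF \<alpha>] hk(4)[OF \<alpha>] by eventually_elim simp
      have ck: "(\<lambda>t. c * cplx (k \<alpha>) t) \<in> V" by (rule V_smult[OF hk(2)[OF \<alpha>]])
      have ckf: "(\<lambda>t. c * (cplx (k \<alpha>) t * f t)) \<in> V" by (rule V_smult[OF kwf(2)[OF \<alpha>]])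
      have "cmod (\<psi> (\<lambda>t. w t * cplx (k \<alpha>) t - c * cplx (k \<alpha>) t)) \<le> Re (\<psi> (cplx (\<lambda>t. \<epsilon> * k \<alpha> t)))"
      proof (rule positive_form_cmod_le[OF \<psi> V_diff[OF wh(2)[OF \<alpha>] ck] scaled(1)[OF hk(2)[OF \<alpha>]]])
        show "\<forall>\<^sub>F t in F. cmod (w t * cplx (k \<alpha>) t - c * cplx (k \<alpha>) t) \<le> \<epsilon> * k \<alpha> t"
          using cw
        proof eventually_elim
          case (elim t)
          have "w t * cplx (k \<alpha>) t - c * cplx (k \<alpha>) t = (w t - c) * cplx (k \<alpha>) t" by (simp add: algebra_simps)
          then show ?case using elim by (cases "k \<alpha> t = 0") (auto simp: norm_mult intro!: mult_right_mono)
        qed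
      qed
      then have a1: "cmod (\<psi> (\<lambda>t. w t * cplx (k \<alpha>) t) - c * \<psi> (cplx (k \<alpha>))) \<le> \<epsilon> * m \<alpha>"
        by (simp only: bounded_form_diff[OF b wh(2)[OF \<alpha>] ck] bounded_form_smult[OF b hk(2)[OF \<alpha>]]
            scaled(2)[OF hk(2)[OF \<alpha>]] m_def)
      have "cmod (\<psi> (\<lambda>t. c * (cplx (k \<alpha>) t * f t) - cplx (k \<alpha>) t * (w t * f t))) \<le>
          Re (\<psi> (cplx (\<lambda>t. (\<epsilon> * N f) * k \<alpha> t)))"
      proof (rule positive_form_cmod_le[OF \<psi> V_diff[OF ckf kwf(1)[OF \<alpha>]] scaled(1)[OF hk(2)[OF \<alpha>]]])
        show "\<forall>\<^sub>F t in F. cmod (c * (cplx (k \<alpha>) t * f t) - cplx (k \<alpha>) t * (w t * f t)) \<le> \<epsilon> * N f * k \<alpha> t"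
          using cw eventually_le_N[OF f]
        proof eventually_elim
          case (elim t)
          have "c * (cplx (k \<alpha>) t * f t) - cplx (k \<alpha>) t * (w t * f t) = - ((w t - c) * f t) * cplx (k \<alpha>) t"
            by (simp add: algebra_simps)
          moreover have "cmod (- ((w t - c) * f t) * cplx (k \<alpha>) t) \<le> \<epsilon> * N f * k \<alpha> t"
          proof (cases "k \<alpha> t = 0")
            case False
            then have "cmod (w t - c) * cmod (f t) \<le> \<epsilon> * N f"
              using elim \<epsilon>(1) by (intro mult_mono) auto
            then show ?thesis using elim by (simp add: norm_mult mult_right_mono)
          qed simp
          ultimately show ?case by simp
        qed
      qed
      then have "cmod (c * \<psi> (\<lambda>t. cplx (k \<alpha>) t * f t) - \<psi> (\<lambda>t. cplx (k \<alpha>) t * (w t * f t))) \<le> \<epsilon> * N f * m \<alpha>"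
        by (simp only: bounded_form_diff[OF b ckf kwf(1)[OF \<alpha>]] bounded_form_smult[OF b kwf(2)[OF \<alpha>]]
            scaled(2)[OF hk(2)[OF \<alpha>]] m_def)
      then have a2: "cmod (c * (\<nu> \<alpha> f * \<psi> (cplx (k \<alpha>))) - \<psi> (\<lambda>t. cplx (k \<alpha>) t * (w t * f t))) \<le> \<epsilon> * N f * m \<alpha>"
        by (simp only: \<nu>(2)[OF \<alpha> f])
      have "cmod (\<nu> \<alpha> f * (\<psi> (\<lambda>t. w t * cplx (k \<alpha>) t) - c * \<psi> (cplx (k \<alpha>)))) \<le> N f * (\<epsilon> * m \<alpha>)"
        unfolding norm_mult by (intro mult_mono mean_on_le[OF \<nu>(1)[OF \<alpha>] f] a1 N_nonneg f) simp
      moreover have "\<nu> \<alpha> f * \<psi> (\<lambda>t. w t * cplx (k \<alpha>) t) - \<psi> (\<lambda>t. cplx (k \<alpha>) t * (w t * f t)) =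
          \<nu> \<alpha> f * (\<psi> (\<lambda>t. w t * cplx (k \<alpha>) t) - c * \<psi> (cplx (k \<alpha>))) +
          (c * (\<nu> \<alpha> f * \<psi> (cplx (k \<alpha>))) - \<psi> (\<lambda>t. cplx (k \<alpha>) t * (w t * f t)))"
        by (simp add: algebra_simps)
      ultimately show ?thesis
        using a2 norm_triangle_ineq[of "\<nu> \<alpha> f * (\<psi> (\<lambda>t. w t * cplx (k \<alpha>) t) - c * \<psi> (cplx (k \<alpha>)))"
          "c * (\<nu> \<alpha> f * \<psi> (cplx (k \<alpha>))) - \<psi> (\<lambda>t. cplx (k \<alpha>) t * (w t * f t))"] by (simp add: algebra_simps)
    qed
    have t12: "cmod (\<nu> \<alpha> f * \<psi> (\<lambda>t. w t * cplx (h \<alpha>) t) - \<psi> (\<lambda>t. cplx (k \<alpha>) t * (w t * f t)))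
        \<le> N f * (R * H \<alpha> + 2 * \<epsilon> * m \<alpha>)" if \<alpha>: "\<alpha> \<in> J" for \<alpha>
    proof -
      have "cmod (\<nu> \<alpha> f * (\<psi> (\<lambda>t. w t * cplx (h \<alpha>) t) - \<psi> (\<lambda>t. w t * cplx (k \<alpha>) t))) \<le> N f * (R * H \<alpha>)"
        unfolding norm_mult by (intro mult_mono mean_on_le[OF \<nu>(1)[OF \<alpha>] f] t1[OF \<alpha>] N_nonneg f) simp
      moreover have "\<nu> \<alpha> f * \<psi> (\<lambda>t. w t * cplx (h \<alpha>) t) - \<psi> (\<lambda>t. cplx (k \<alpha>) t * (w t * f t)) =
          \<nu> \<alpha> f * (\<psi> (\<lambda>t. w t * cplx (h \<alpha>) t) - \<psi> (\<lambda>t. w t * cplx (k \<alpha>) t)) +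
          (\<nu> \<alpha> f * \<psi> (\<lambda>t. w t * cplx (k \<alpha>) t) - \<psi> (\<lambda>t. cplx (k \<alpha>) t * (w t * f t)))"
        by (simp add: algebra_simps)
      ultimately show ?thesis
        using t2[OF \<alpha>] norm_triangle_ineq[of "\<nu> \<alpha> f * (\<psi> (\<lambda>t. w t * cplx (h \<alpha>) t) - \<psi> (\<lambda>t. w t * cplx (k \<alpha>) t))"
          "\<nu> \<alpha> f * \<psi> (\<lambda>t. w t * cplx (k \<alpha>) t) - \<psi> (\<lambda>t. cplx (k \<alpha>) t * (w t * f t))"] by (simp add: algebra_simps)
    qed
    have ksum: "cplx (\<lambda>t. \<Sum>\<alpha>\<in>J. k \<alpha> t) \<in> V" "cplx (\<lambda>t. \<Sum>\<alpha>\<in>J. h \<alpha> t) \<in> V"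
      by (rule V_real_sum, erule hk(2), rule V_real_sum, erule hk(1))
    have k1: "cplx (\<lambda>t. 1 - (\<Sum>\<alpha>\<in>J. k \<alpha> t)) \<in> V" using V_diff[OF V_const[of 1] ksum(1)] by simp
    have sumh: "Re (\<psi> (cplx (\<lambda>t. \<Sum>\<alpha>\<in>J. h \<alpha> t))) = M"
    proof -
      have "\<psi> (cplx (\<lambda>t. \<Sum>\<alpha>\<in>J. h \<alpha> t)) = \<psi> (cplx (\<lambda>t. 1))"
      proof (rule bounded_form_AE_cong[OF b ksum(2) V_const])
        show "\<forall>\<^sub>F t in F. cplx (\<lambda>t. \<Sum>\<alpha>\<in>J. h \<alpha> t) t = complex_of_real 1"
          using one by eventually_elim (simp only:)
      qed
      then show ?thesis by (simp only: M_def)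
    qed
    have sumk: "M - \<delta> \<le> (\<Sum>\<alpha>\<in>J. m \<alpha>)" "(\<Sum>\<alpha>\<in>J. m \<alpha>) \<le> M"
    proof -
      have eq: "(\<Sum>\<alpha>\<in>J. m \<alpha>) = Re (\<psi> (cplx (\<lambda>t. \<Sum>\<alpha>\<in>J. k \<alpha> t)))"
        unfolding m_def by (rule Re_form_sum[OF \<psi> hk(2), symmetric])
      have "Re (\<psi> (cplx (\<lambda>t. 1 - (\<Sum>\<alpha>\<in>J. k \<alpha> t)))) = M - (\<Sum>\<alpha>\<in>J. m \<alpha>)"
        using bounded_form_diff[OF b V_const[of 1] ksum(1)] unfolding eq M_def by simp
      then show "M - \<delta> \<le> (\<Sum>\<alpha>\<in>J. m \<alpha>)" using small by linarith
      have "\<forall>\<^sub>F t in F. \<forall>\<alpha>\<in>J. k \<alpha> t \<le> h \<alpha> t" using J(1) hk(5) by (simp add: eventually_ball_finite)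
      then have "\<forall>\<^sub>F t in F. (\<Sum>\<alpha>\<in>J. k \<alpha> t) \<le> (\<Sum>\<alpha>\<in>J. h \<alpha> t)"
        by eventually_elim (simp add: sum_mono)
      from positive_form_mono[OF \<psi> ksum this] show "(\<Sum>\<alpha>\<in>J. m \<alpha>) \<le> M" unfolding eq sumh .
    qed
    have sumH: "(\<Sum>\<alpha>\<in>J. H \<alpha>) \<le> \<delta>"
    proof -
      have "H \<alpha> = Re (\<psi> (cplx (h \<alpha>))) - m \<alpha>" if "\<alpha> \<in> J" for \<alpha>
        using bounded_form_diff[OF b hk(1)[OF that] hk(2)[OF that]] by (simp add: H_def m_def)
      then have "(\<Sum>\<alpha>\<in>J. H \<alpha>) = (\<Sum>\<alpha>\<in>J. Re (\<psi> (cplx (h \<alpha>)))) - (\<Sum>\<alpha>\<in>J. m \<alpha>)"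
        by (simp add: sum_subtractf)
      also have "(\<Sum>\<alpha>\<in>J. Re (\<psi> (cplx (h \<alpha>)))) = M"
        unfolding sumh[symmetric] by (rule Re_form_sum[OF \<psi> hk(1), symmetric])
      finally show ?thesis using sumk(1) by linarith
    qed
    have hwV: "(\<lambda>t. \<nu> \<alpha> f * (w t * cplx (h \<alpha>) t)) \<in> V" if "\<alpha> \<in> J" for \<alpha> by (rule V_smult[OF wh(1)[OF that]])
    have e1: "\<psi> (\<lambda>t. w t * Pf t) = (\<Sum>\<alpha>\<in>J. \<nu> \<alpha> f * \<psi> (\<lambda>t. w t * cplx (h \<alpha>) t))"
    proof -
      have "(\<lambda>t. w t * Pf t) = (\<lambda>t. \<Sum>\<alpha>\<in>J. \<nu> \<alpha> f * (w t * cplx (h \<alpha>) t))"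
        by (simp add: Pf_def sum_distrib_left algebra_simps)
      then have "\<psi> (\<lambda>t. w t * Pf t) = (\<Sum>\<alpha>\<in>J. \<psi> (\<lambda>t. \<nu> \<alpha> f * (w t * cplx (h \<alpha>) t)))"
        using bounded_form_sum[OF b hwV] by simp
      also have "\<dots> = (\<Sum>\<alpha>\<in>J. \<nu> \<alpha> f * \<psi> (\<lambda>t. w t * cplx (h \<alpha>) t))"
        by (intro sum.cong refl bounded_form_smult[OF b wh(1)])
      finally show ?thesis .
    qed
    have t3: "cmod ((\<Sum>\<alpha>\<in>J. \<psi> (\<lambda>t. cplx (k \<alpha>) t * (w t * f t))) - \<psi> (\<lambda>t. w t * f t)) \<le> R * N f * \<delta>"
    proof -
      have sV: "(\<lambda>t. \<Sum>\<alpha>\<in>J. cplx (k \<alpha>) t * (w t * f t)) \<in> V" by (rule V_sum[OF kwf(1)])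
      have "cmod (\<psi> (\<lambda>t. (\<Sum>\<alpha>\<in>J. cplx (k \<alpha>) t * (w t * f t)) - w t * f t)) \<le>
          Re (\<psi> (cplx (\<lambda>t. (R * N f) * (1 - (\<Sum>\<alpha>\<in>J. k \<alpha> t)))))"
      proof (rule positive_form_cmod_le[OF \<psi> V_diff[OF sV wf] scaled(1)[OF k1]])
        have "\<forall>\<^sub>F t in F. \<forall>\<alpha>\<in>J. k \<alpha> t \<le> h \<alpha> t" using J(1) hk(5) by (simp add: eventually_ball_finite)
        then show "\<forall>\<^sub>F t in F. cmod ((\<Sum>\<alpha>\<in>J. cplx (k \<alpha>) t * (w t * f t)) - w t * f t)
            \<le> R * N f * (1 - (\<Sum>\<alpha>\<in>J. k \<alpha> t))"
          using one wR eventually_le_N[OF f]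
        proof eventually_elim
          case (elim t)
          define g where "g = 1 - (\<Sum>\<alpha>\<in>J. k \<alpha> t)"
          have "(\<Sum>\<alpha>\<in>J. k \<alpha> t) \<le> (\<Sum>\<alpha>\<in>J. h \<alpha> t)" using elim(1) by (intro sum_mono) auto
          then have g0: "0 \<le> g" using elim(2) by (simp add: g_def)
          have "(\<Sum>\<alpha>\<in>J. cplx (k \<alpha>) t * (w t * f t)) = complex_of_real (\<Sum>\<alpha>\<in>J. k \<alpha> t) * (w t * f t)"
            by (simp add: sum_distrib_right)
          then have "(\<Sum>\<alpha>\<in>J. cplx (k \<alpha>) t * (w t * f t)) - w t * f t = - complex_of_real g * (w t * f t)"
            by (simp add: g_def algebra_simps)
          then have "cmod ((\<Sum>\<alpha>\<in>J. cplx (k \<alpha>) t * (w t * f t)) - w t * f t) = (cmod (w t) * cmod (f t)) * g"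
            using g0 by (simp add: norm_mult)
          also have "\<dots> \<le> (R * N f) * g"
            using elim R g0 by (intro mult_right_mono mult_mono) auto
          finally show ?case by (simp add: g_def)
        qed
      qed
      also have "\<dots> = (R * N f) * Re (\<psi> (cplx (\<lambda>t. 1 - (\<Sum>\<alpha>\<in>J. k \<alpha> t))))" by (rule scaled(2)[OF k1])
      also have "\<dots> \<le> (R * N f) * \<delta>" using small R N_nonneg[OF f] by (intro mult_left_mono) auto
      also have "\<psi> (\<lambda>t. (\<Sum>\<alpha>\<in>J. cplx (k \<alpha>) t * (w t * f t)) - w t * f t) =
          (\<Sum>\<alpha>\<in>J. \<psi> (\<lambda>t. cplx (k \<alpha>) t * (w t * f t))) - \<psi> (\<lambda>t. w t * f t)"
        by (simp only: bounded_form_diff[OF b sV wf] bounded_form_sum[OF b kwf(1)])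
      finally show ?thesis .
    qed
    have "cmod (\<psi> (\<lambda>t. w t * Pf t) - (\<Sum>\<alpha>\<in>J. \<psi> (\<lambda>t. cplx (k \<alpha>) t * (w t * f t)))) \<le>
        (\<Sum>\<alpha>\<in>J. N f * (R * H \<alpha> + 2 * \<epsilon> * m \<alpha>))"
      unfolding e1 sum_subtractf[symmetric] by (rule order_trans[OF norm_sum sum_mono[OF t12]])
    also have "\<dots> = N f * (R * (\<Sum>\<alpha>\<in>J. H \<alpha>) + 2 * \<epsilon> * (\<Sum>\<alpha>\<in>J. m \<alpha>))"
      by (simp only: sum_distrib_left sum.distrib distrib_left mult.assoc)
    also have "\<dots> \<le> N f * (R * \<delta> + 2 * \<epsilon> * M)"
      using R \<epsilon>(1) sumH sumk(2) by (intro mult_left_mono add_mono N_nonneg f) auto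
    finally have "cmod (\<psi> (\<lambda>t. w t * Pf t) - \<psi> (\<lambda>t. w t * f t)) \<le> N f * (R * \<delta> + 2 * \<epsilon> * M) + R * N f * \<delta>"
      using t3 norm_triangle_ineq[of "\<psi> (\<lambda>t. w t * Pf t) - (\<Sum>\<alpha>\<in>J. \<psi> (\<lambda>t. cplx (k \<alpha>) t * (w t * f t)))"
        "(\<Sum>\<alpha>\<in>J. \<psi> (\<lambda>t. cplx (k \<alpha>) t * (w t * f t))) - \<psi> (\<lambda>t. w t * f t)"] by simp
    also have "\<dots> = N f * (2 * (R * \<delta>) + 2 * (\<epsilon> * M))" by (simp add: algebra_simps)
    also have "\<dots> \<le> N f * (e / 4 + e / 4)"
      using \<delta>(2) \<epsilon>(3) by (intro mult_left_mono N_nonneg f) linarith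
    finally have mid: "cmod (\<psi> (\<lambda>t. w t * Pf t) - \<psi> (\<lambda>t. w t * f t)) \<le> e / 2 * N f" by (simp add: algebra_simps)
    have "cmod (\<psi> (\<lambda>t. w t * Pf t) - \<phi> Pf) \<le> e / 4 * N Pf" "cmod (\<psi> (\<lambda>t. w t * f t) - \<phi> f) \<le> e / 4 * N f"
      unfolding w_def by (rule u(2)[OF \<phi> Pf], rule u(2)[OF \<phi> f])
    moreover have "e / 4 * N Pf \<le> e / 4 * N f" using NPf e by (intro mult_left_mono) auto
    moreover have "cmod (\<phi> Pf - \<phi> f) \<le> cmod (\<psi> (\<lambda>t. w t * Pf t) - \<phi> Pf) +
        (cmod (\<psi> (\<lambda>t. w t * Pf t) - \<psi> (\<lambda>t. w t * f t)) + cmod (\<psi> (\<lambda>t. w t * f t) - \<phi> f))"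
    proof -
      have tri: "cmod (c - a) \<le> cmod (x - c) + (cmod (x - y) + cmod (y - a))" for a c x y :: complex
        using norm_triangle_ineq[of "c - x" "(x - y) + (y - a)"] norm_triangle_ineq[of "x - y" "y - a"]
        by (simp add: norm_minus_commute)
      show ?thesis by (rule tri)
    qed
    ultimately have "cmod (\<phi> Pf - \<phi> f) \<le> e / 4 * N f + (e / 2 * N f + e / 4 * N f)"
      using mid by linarith
    then show "cmod (\<phi> (\<lambda>t. \<Sum>\<alpha>\<in>J. \<nu> \<alpha> f * cplx (h \<alpha>) t) - \<phi> f) \<le> e * N f"
      by (simp add: Pf_def algebra_simps)
  qed
  then show ?thesis by blast
qed

end

section \<open>Continuous functions and essentially bounded functions\<close>

lemma infinite_dimensional_nonzero:
  fixes X :: "'v normed_module"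
  assumes X: "vectorspace class_ring X" and inf: "infinite_dimensional X"
  shows "\<exists>v\<in>carrier X. v \<noteq> \<zero>\<^bsub>X\<^esub>"
proof (rule ccontr)
  assume none: "\<not> ?thesis"
  interpret X: vectorspace class_ring X by (rule X)
  have z: "{\<zero>\<^bsub>X\<^esub>} \<subseteq> carrier X" using X.zero_closed by simp
  have "carrier X \<subseteq> {\<zero>\<^bsub>X\<^esub>}" using none by blast
  moreover have "{\<zero>\<^bsub>X\<^esub>} \<subseteq> X.span {\<zero>\<^bsub>X\<^esub>}" by (rule X.in_own_span[OF z])
  moreover have "X.span {\<zero>\<^bsub>X\<^esub>} \<subseteq> carrier X"
    using submodule.subset[OF X.span_is_submodule[OF z]] .
  ultimately have "X.span {\<zero>\<^bsub>X\<^esub>} = carrier X" by blast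
  then have "X.fin_dim" unfolding X.fin_dim_def using z by (intro exI[of _ "{\<zero>\<^bsub>X\<^esub>}"]) simp
  then show False using inf by (simp add: infinite_dimensional_def)
qed

lemma continuous_map_complex_iff:
  "continuous_map K euclidean (f :: 'k \<Rightarrow> complex) \<longleftrightarrow> (\<forall>x\<in>topspace K. (f \<longlongrightarrow> f x) (atin K x))"
  unfolding continuous_map_atin limitin_canonical_iff by simp

text \<open>
  Quotients are continuous because the denominator has no zero on \<open>K\<close>, and the suprema are finite
  because \<open>K\<close> is compact.
\<close>

lemma ess_sup_algebra_continuous:
  fixes K :: "'k topology"
  assumes K: "compact_space K" and ne: "topspace K \<noteq> {}"
  shows "ess_sup_algebra {f. continuous_map K euclidean f} (principal (topspace K))
    (\<lambda>f. SUP t\<in>topspace K. cmod (f t))"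
proof -
  have bdd: "bdd_above ((\<lambda>t. cmod (f t)) ` topspace K)" if "continuous_map K euclidean f" for f
  proof -
    have "compactin euclidean (f ` topspace K)"
      using K that unfolding compact_space_def by (rule image_compactin)
    then have "bounded (f ` topspace K)" by (simp add: compact_imp_bounded)
    then obtain B where "\<forall>t\<in>topspace K. cmod (f t) \<le> B" unfolding bounded_iff by blast
    then show ?thesis by (intro bdd_aboveI2[of _ _ B]) simp
  qed
  have iff: "(SUP t\<in>topspace K. cmod (f t)) \<le> c \<longleftrightarrow> (\<forall>t\<in>topspace K. cmod (f t) \<le> c)"
    if "continuous_map K euclidean f" for f c
    by (rule cSUP_le_iff[OF ne bdd[OF that]])
  obtain t0 where t0: "t0 \<in> topspace K" using ne by blast
  show ?thesis
  proof (unfold_locales, goal_cases)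
    case 1
    then show ?case using ne by (simp add: principal_eq_bot_iff)
  next
    case (2 c)
    then show ?case by simp
  next
    case (3 f g)
    then show ?case unfolding mem_Collect_eq continuous_map_complex_iff by (auto intro: tendsto_add)
  next
    case (4 f g)
    then show ?case unfolding mem_Collect_eq continuous_map_complex_iff by (auto intro: tendsto_mult)
  next
    case (5 G f)
    then have "continuous_map euclidean euclidean G" by simp
    from continuous_map_compose[OF _ this, of K f] 5 show ?case by (simp add: o_def)
  next
    case (6 f g)
    then have "\<forall>t\<in>topspace K. g t \<noteq> 0" by (simp add: eventually_principal)
    with 6(1,2) show ?case unfolding mem_Collect_eq continuous_map_complex_iff by (auto intro: tendsto_divide)
  next
    case (7 f c)
    then show ?case using iff[of f c] by (simp add: eventually_principal)
  next
    case (8 f)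
    have "cmod (f t0) \<le> (SUP t\<in>topspace K. cmod (f t))"
      using 8 t0 by (intro cSUP_upper bdd) auto
    then show ?case using norm_ge_zero[of "f t0"] by linarith
  qed
qed

lemma function_model_C_space:
  fixes K :: "'k topology"
  assumes K: "compact_space K" and ne: "topspace K \<noteq> {}"
  shows "function_model (C_space K) {f. continuous_map K euclidean f}
    (\<lambda>f. SUP t\<in>topspace K. cmod (f t)) (\<lambda>f. restrict f (topspace K))"
proof -
  interpret E: ess_sup_algebra "{f. continuous_map K euclidean f}" "principal (topspace K)"
    "\<lambda>f. SUP t\<in>topspace K. cmod (f t)" by (rule ess_sup_algebra_continuous[OF K ne])
  have r: "continuous_map K euclidean (restrict f (topspace K))" if "continuous_map K euclidean f" for f :: "'k \<Rightarrow> complex"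
    by (rule continuous_map_eq[OF that]) simp
  show ?thesis
  proof (rule function_model.intro, goal_cases)
    case 1
    show ?case by (rule vectorspace_C_space)
  next
    case (2 f g)
    then show ?case by (rule E.V_add)
  next
    case (3 c f)
    then show ?case by (rule E.V_smult)
  next
    case 4
    show ?case
    proof
      show "(\<lambda>f. restrict f (topspace K)) ` {f. continuous_map K euclidean f} \<subseteq> carrier (C_space K)"
        using r by (auto simp: C_space_def)
      show "carrier (C_space K) \<subseteq> (\<lambda>f. restrict f (topspace K)) ` {f. continuous_map K euclidean f}"
      proof
        fix f assume "f \<in> carrier (C_space K)"
        then have "f \<in> extensional (topspace K)" "continuous_map K euclidean f" by (auto simp: C_space_def)
        then show "f \<in> (\<lambda>f. restrict f (topspace K)) ` {f. continuous_map K euclidean f}"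
          by (intro image_eqI[of _ _ f]) (simp_all add: extensional_restrict)
      qed
    qed
  next
    case (5 f g)
    show ?case by (auto simp: C_space_def)
  next
    case (6 c f)
    show ?case by (auto simp: C_space_def)
  next
    case (7 f)
    show ?case by (simp add: C_space_def)
  next
    case 8
    show ?case using ne by simp
  next
    case (9 f)
    then show ?case by (rule E.N_nonneg)
  qed
qed

theorem property_A_C_space:
  fixes K :: "'k topology"
  assumes K: "compact_space K" and inf: "infinite_dimensional (C_space K)"
  shows "property_A (C_space K)"
proof -
  have ne: "topspace K \<noteq> {}"
  proof
    assume "topspace K = {}"
    then have "carrier (C_space K) \<subseteq> {\<zero>\<^bsub>C_space K\<^esub>}" by (auto simp: C_space_def extensional_def)
    then show False using infinite_dimensional_nonzero[OF vectorspace_C_space inf] by blast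
  qed
  interpret E: ess_sup_algebra "{f. continuous_map K euclidean f}" "principal (topspace K)"
    "\<lambda>f. SUP t\<in>topspace K. cmod (f t)" by (rule ess_sup_algebra_continuous[OF K ne])
  show ?thesis
    by (rule function_model.property_A_of_approximating_systems[OF function_model_C_space[OF K ne]
          E.ess_sup_approximating_system])
qed

lemma Lp_infinity_iff:
  "f \<in> Lp_functions M \<infinity> \<longleftrightarrow> f \<in> borel_measurable M \<and> (\<exists>c. AE t in M. cmod (f t) \<le> c)"
proof
  assume f: "f \<in> Lp_functions M \<infinity>"
  then have [measurable]: "f \<in> borel_measurable M" and fin: "esssup M (\<lambda>t. ennreal (cmod (f t))) < \<infinity>"
    by (auto simp: Lp_functions_def)
  have "AE t in M. cmod (f t) \<le> enn2real (esssup M (\<lambda>t. ennreal (cmod (f t))))"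
    using esssup_AE[of "\<lambda>t. ennreal (cmod (f t))" M]
  proof eventually_elim
    case (elim t)
    then have "enn2real (ennreal (cmod (f t))) \<le> enn2real (esssup M (\<lambda>t. ennreal (cmod (f t))))"
      using fin by (intro enn2real_mono) auto
    then show ?case by simp
  qed
  then show "f \<in> borel_measurable M \<and> (\<exists>c. AE t in M. cmod (f t) \<le> c)" by auto
next
  assume *: "f \<in> borel_measurable M \<and> (\<exists>c. AE t in M. cmod (f t) \<le> c)"
  then have [measurable]: "f \<in> borel_measurable M" by simp
  obtain c where c: "AE t in M. cmod (f t) \<le> c" using * by blast
  have "esssup M (\<lambda>t. ennreal (cmod (f t))) \<le> ennreal c"
    using c by (intro esssup_I) (auto elim!: eventually_mono intro: ennreal_leI)
  also have "\<dots> < \<infinity>" by simp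
  finally show "f \<in> Lp_functions M \<infinity>" by (simp add: Lp_functions_def)
qed

lemma Lp_infinity_seminorm_le_iff:
  assumes f: "f \<in> Lp_functions M \<infinity>" and c: "0 \<le> c"
  shows "Lp_seminorm M \<infinity> f \<le> c \<longleftrightarrow> (AE t in M. cmod (f t) \<le> c)"
proof -
  have [measurable]: "f \<in> borel_measurable M" and fin: "esssup M (\<lambda>t. ennreal (cmod (f t))) < \<infinity>"
    using f by (auto simp: Lp_functions_def)
  show ?thesis
  proof
    assume "Lp_seminorm M \<infinity> f \<le> c"
    then have le: "enn2real (esssup M (\<lambda>t. ennreal (cmod (f t)))) \<le> c" by (simp add: Lp_seminorm_def)
    show "AE t in M. cmod (f t) \<le> c"
      using esssup_AE[of "\<lambda>t. ennreal (cmod (f t))" M]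
    proof eventually_elim
      case (elim t)
      then have "enn2real (ennreal (cmod (f t))) \<le> enn2real (esssup M (\<lambda>t. ennreal (cmod (f t))))"
        using fin by (intro enn2real_mono) auto
      with le show ?case by simp
    qed
  next
    assume "AE t in M. cmod (f t) \<le> c"
    then have "esssup M (\<lambda>t. ennreal (cmod (f t))) \<le> ennreal c"
      by (intro esssup_I) (auto elim!: eventually_mono intro: ennreal_leI)
    then have "enn2real (esssup M (\<lambda>t. ennreal (cmod (f t)))) \<le> c" using c by (rule enn2real_leI[rotated])
    then show "Lp_seminorm M \<infinity> f \<le> c" by (simp add: Lp_seminorm_def)
  qed
qed

lemma function_model_Lp_space:
  "function_model (Lp_space M p) (Lp_functions M p) (Lp_seminorm M p) (\<lambda>f. Lp_eq M p `` {f})"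
proof (rule function_model.intro, goal_cases)
  case 8
  have "esssup M (\<lambda>t. 0 :: ennreal) \<le> 0" by (rule esssup_I) auto
  then show ?case by (simp add: Lp_seminorm_def)
next
  case (9 f)
  then show ?case by (simp add: Lp_seminorm_def)
qed (simp_all add: vectorspace_Lp_space Lp_functions_add Lp_functions_smult Lp_space_carrier Lp_space_add
    Lp_space_smult Lp_space_nrm)

text \<open>
  The index set of an approximating system is nonempty, which is impossible in the zero space; hence the
  interest in a nonzero element.
\<close>

lemma Lp_space_nonzero:
  assumes "infinite_dimensional (Lp_space M p)"
  shows "\<exists>f\<in>Lp_functions M p. \<not> (AE t in M. f t = 0)"
proof -
  obtain v where v: "v \<in> carrier (Lp_space M p)" "v \<noteq> \<zero>\<^bsub>Lp_space M p\<^esub>"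
    using infinite_dimensional_nonzero[OF vectorspace_Lp_space assms] by blast
  then obtain f where f: "f \<in> Lp_functions M p" "v = Lp_eq M p `` {f}" by (auto simp: Lp_space_carrier)
  have "\<not> (AE t in M. f t = 0)"
    using v(2) Lp_class_eq[OF f(1) Lp_functions_0] unfolding f(2) Lp_space_zero by blast
  with f(1) show ?thesis by blast
qed

lemma ess_sup_algebra_Lp_infinity:
  assumes "\<not> (AE t in M. False)"
  shows "ess_sup_algebra (Lp_functions M \<infinity>) (ae_filter M) (Lp_seminorm M \<infinity>)"
proof (unfold_locales, goal_cases)
  case 1
  show ?case using assms by (simp add: trivial_limit_def)
next
  case (2 c)
  show ?case unfolding Lp_infinity_iff by auto
next
  case (3 f g)
  then show ?case by (rule Lp_functions_add)
next
  case (4 f g)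
  then obtain a b where ab: "AE t in M. cmod (f t) \<le> a" "AE t in M. cmod (g t) \<le> b"
    and [measurable]: "f \<in> borel_measurable M" "g \<in> borel_measurable M"
    unfolding Lp_infinity_iff by blast
  have "AE t in M. cmod (f t * g t) \<le> \<bar>a\<bar> * \<bar>b\<bar>"
    using ab by eventually_elim (auto simp: norm_mult intro!: mult_mono)
  then show ?case unfolding Lp_infinity_iff by auto
next
  case (5 G f)
  then obtain a where a: "AE t in M. cmod (f t) \<le> a" and [measurable]: "f \<in> borel_measurable M"
    unfolding Lp_infinity_iff by blast
  have [measurable]: "G \<in> borel_measurable borel" by (rule borel_measurable_continuous_onI[OF 5(1)])
  have "compact (G ` cball 0 a)"
    by (intro compact_continuous_image continuous_on_subset[OF 5(1)]) auto
  then have "bounded (G ` cball 0 a)" by (rule compact_imp_bounded)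
  then obtain b where b: "\<forall>z\<in>G ` cball 0 a. norm z \<le> b" unfolding bounded_iff ..
  have "AE t in M. cmod (G (f t)) \<le> b"
    using a by eventually_elim (rule bspec[OF b imageI], simp)
  then show ?case unfolding Lp_infinity_iff by auto
next
  case (6 f g)
  have [measurable]: "f \<in> borel_measurable M" "g \<in> borel_measurable M" using 6 unfolding Lp_infinity_iff by auto
  have "AE t in M. cmod (f t / g t) \<le> 1"
    using 6(3,4) by eventually_elim (simp add: norm_divide divide_le_eq)
  then show ?case unfolding Lp_infinity_iff by auto
next
  case (7 f c)
  then show ?case by (rule Lp_infinity_seminorm_le_iff)
next
  case (8 f)
  show ?case by (simp add: Lp_seminorm_def)
qed

theorem property_A_Lp_infinity:
  assumes inf: "infinite_dimensional (Lp_space M \<infinity>)"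
  shows "property_A (Lp_space M \<infinity>)"
proof -
  have "\<not> (AE t in M. False)"
  proof
    assume "AE t in M. False"
    then have "AE t in M. f t = 0" for f :: "'a \<Rightarrow> complex" by (rule eventually_mono) simp
    then show False using Lp_space_nonzero[OF inf] by blast
  qed
  then interpret E: ess_sup_algebra "Lp_functions M \<infinity>" "ae_filter M" "Lp_seminorm M \<infinity>"
    by (rule ess_sup_algebra_Lp_infinity)
  show ?thesis
    by (rule function_model.property_A_of_approximating_systems[OF function_model_Lp_space
          E.ess_sup_approximating_system])
qed

section \<open>Scalar inequalities for powers\<close>

lemma exp_le_quadratic:
  fixes x :: real
  assumes "\<bar>x\<bar> \<le> 1"
  shows "exp x \<le> 1 + x + x\<^sup>2"
proof (cases "0 \<le> x")
  case True
  then show ?thesis using exp_bound[of x] assms by simp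
next
  case False
  define y where "y = - x"
  have y: "0 \<le> y" using False by (simp add: y_def)
  have "1 \<le> (1 - y + y\<^sup>2) * (1 + y + y\<^sup>2 / 2)"
  proof -
    have "(1 - y + y\<^sup>2) * (1 + y + y\<^sup>2 / 2) = 1 + (y\<^sup>2 / 2 + y ^ 3 / 2 + y ^ 4 / 2)"
      by (simp add: field_simps power2_eq_square power3_eq_cube power4_eq_xxxx)
    then show ?thesis using y by simp
  qed
  also have "\<dots> \<le> (1 - y + y\<^sup>2) * exp y"
  proof (rule mult_left_mono[OF exp_lower_Taylor_quadratic[OF y]])
    have "0 \<le> (1 - y / 2)\<^sup>2 + 3 / 4 * y\<^sup>2" by simp
    also have "\<dots> = 1 - y + y\<^sup>2" by (simp add: power2_eq_square algebra_simps)
    finally show "0 \<le> 1 - y + y\<^sup>2" .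
  qed
  finally have "exp x \<le> 1 - y + y\<^sup>2" by (simp add: y_def exp_minus field_simps)
  then show ?thesis by (simp add: y_def)
qed

text \<open>
  A Taylor estimate at \<open>1\<close>. For small \<open>w\<close> one has \<open>\<bar>1 + w\<bar>\<^sup>2 = 1 + v\<close> with \<open>v = 2 Re w + \<bar>w\<bar>\<^sup>2\<close>, and
  \<open>(1 + v) powr (r / 2) \<le> exp (r v / 2)\<close>; the threshold \<open>1 / (2 (r + 2))\<close> makes the exponent at
  most one in modulus. For large \<open>w\<close> all terms are dominated by \<open>\<bar>w\<bar> powr r\<close>.
\<close>

lemma cmod_one_plus_powr_le:
  fixes r :: real
  assumes r: "1 < r"
  obtains C where "0 \<le> C"
    "\<And>w. 2 * (r + 2) * cmod w \<le> 1 \<Longrightarrow> cmod (1 + w) powr r \<le> 1 + r * Re w + C * (cmod w)\<^sup>2"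
    "\<And>w. 1 < 2 * (r + 2) * cmod w \<Longrightarrow> cmod (1 + w) powr r \<le> 1 + r * Re w + C * cmod w powr r"
proof -
  define b where "b = 2 * (r + 2)"
  have b: "6 < b" "r / b \<le> 1 / 2" using r by (auto simp: b_def divide_simps)
  define C where "C = r / 2 + 2 * r\<^sup>2 + (1 + b) powr r + r * b powr (r - 1)"
  have C0: "0 \<le> C" unfolding C_def using r b by (intro add_nonneg_nonneg mult_nonneg_nonneg) auto
  have small: "cmod (1 + w) powr r \<le> 1 + r * Re w + C * (cmod w)\<^sup>2" if w: "b * cmod w \<le> 1" for w
  proof -
    define v where "v = 2 * Re w + (cmod w)\<^sup>2"
    have w1: "cmod w \<le> 1 / b" using w b by (simp add: divide_simps mult.commute)
    also have "\<dots> \<le> 1 / 6" using b by (simp add: divide_simps)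
    finally have w6: "cmod w \<le> 1 / 6" .
    have "(cmod w)\<^sup>2 \<le> 1 / 6 * cmod w"
      using mult_right_mono[OF w6 norm_ge_zero[of w]] unfolding power2_eq_square .
    moreover have "\<bar>Re w\<bar> \<le> cmod w" by (rule abs_Re_le_cmod)
    moreover have "0 \<le> (cmod w)\<^sup>2" by simp
    ultimately have v: "\<bar>v\<bar> \<le> 9 / 4 * cmod w" unfolding v_def abs_le_iff by linarith
    then have v1: "- 1 < v" using w6 by linarith
    have "(cmod (1 + w))\<^sup>2 = 1 + v"
      unfolding v_def cmod_power2 by (simp add: power2_eq_square algebra_simps)
    then have "cmod (1 + w) powr r = (1 + v) powr (r / 2)"
      by (metis norm_ge_zero powr_half_sqrt powr_powr real_sqrt_abs abs_of_nonneg mult_2 field_sum_of_halves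
          zero_le_power2 times_divide_eq_left mult_1)
    also have "\<dots> \<le> exp (r / 2 * v)"
    proof -
      have "(1 + v) powr (r / 2) = exp (r / 2 * ln (1 + v))" using v1 by (simp add: powr_def)
      moreover have "ln (1 + v) \<le> v" using v1 by (rule ln_add_one_self_le_self2)
      then have "r / 2 * ln (1 + v) \<le> r / 2 * v" using r by (intro mult_left_mono) auto
      ultimately show ?thesis by simp
    qed
    also have "\<dots> \<le> 1 + r / 2 * v + (r / 2 * v)\<^sup>2"
    proof (rule exp_le_quadratic)
      have "\<bar>r / 2 * v\<bar> = r / 2 * \<bar>v\<bar>" using r by (simp add: abs_mult)
      also have "\<dots> \<le> r / 2 * (9 / 4 * (1 / b))" using r v w1 by (intro mult_left_mono) auto
      also have "\<dots> = 9 / 8 * (r / b)" by simp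
      also have "\<dots> \<le> 1" using b by linarith
      finally show "\<bar>r / 2 * v\<bar> \<le> 1" .
    qed
    also have "(r / 2 * v)\<^sup>2 \<le> 2 * r\<^sup>2 * (cmod w)\<^sup>2"
    proof -
      have "v\<^sup>2 \<le> (9 / 4 * cmod w)\<^sup>2" using v by (simp add: abs_le_square_iff[symmetric])
      then have "r\<^sup>2 / 4 * v\<^sup>2 \<le> r\<^sup>2 / 4 * (81 / 16 * (cmod w)\<^sup>2)"
        by (intro mult_left_mono) (auto simp: power2_eq_square)
      also have "\<dots> = 81 / 64 * (r\<^sup>2 * (cmod w)\<^sup>2)" by simp
      also have "\<dots> \<le> 2 * (r\<^sup>2 * (cmod w)\<^sup>2)" by (intro mult_right_mono) auto
      finally show ?thesis by (simp add: power_mult_distrib power_divide)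
    qed
    also have "1 + r / 2 * v + 2 * r\<^sup>2 * (cmod w)\<^sup>2 = 1 + r * Re w + (r / 2 + 2 * r\<^sup>2) * (cmod w)\<^sup>2"
      by (simp add: v_def algebra_simps)
    also have "(r / 2 + 2 * r\<^sup>2) * (cmod w)\<^sup>2 \<le> C * (cmod w)\<^sup>2"
      using r b by (intro mult_right_mono) (auto simp: C_def)
    finally show ?thesis by simp
  qed
  have large: "cmod (1 + w) powr r \<le> 1 + r * Re w + C * cmod w powr r" if w: "1 < b * cmod w" for w
  proof -
    have w0: "0 < cmod w" using w b by (cases "w = 0") auto
    have "cmod (1 + w) \<le> 1 + cmod w" by (metis norm_one norm_triangle_ineq)
    also have "\<dots> \<le> (1 + b) * cmod w" using w by (simp add: algebra_simps)
    finally have "cmod (1 + w) powr r \<le> ((1 + b) * cmod w) powr r" using r by (intro powr_mono2) auto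
    also have "\<dots> = (1 + b) powr r * cmod w powr r" by (rule powr_mult)
    finally have 1: "cmod (1 + w) powr r \<le> (1 + b) powr r * cmod w powr r" .
    have "- Re w \<le> cmod w" using abs_Re_le_cmod[of w] by linarith
    also have "\<dots> \<le> (b * cmod w) powr (r - 1) * cmod w"
    proof -
      have "1 powr (r - 1) \<le> (b * cmod w) powr (r - 1)" using w r by (intro powr_mono2) auto
      then show ?thesis using w0 by simp
    qed
    also have "\<dots> = b powr (r - 1) * (cmod w powr (r - 1) * cmod w powr 1)"
      using w0 by (simp add: powr_mult)
    also have "\<dots> = b powr (r - 1) * cmod w powr r" by (simp only: powr_add[symmetric]) simp
    finally have "r * (- Re w) \<le> r * (b powr (r - 1) * cmod w powr r)" using r by (intro mult_left_mono) auto
    moreover have "0 \<le> (r / 2 + 2 * r\<^sup>2) * cmod w powr r" using r by simp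
    ultimately show ?thesis using 1 unfolding C_def by (simp add: algebra_simps)
  qed
  show ?thesis using that[OF C0] small large unfolding b_def by blast
qed

text \<open>
  The function \<open>cnj z \<bar>z\<bar> powr (r - 2)\<close> represents the derivative of \<open>\<bar>z\<bar> powr r / r\<close>: its real
  pairing with \<open>b\<close> is the derivative in the direction \<open>b\<close>.
\<close>

definition conj_power :: "real \<Rightarrow> complex \<Rightarrow> complex" where
  "conj_power r z = of_real (cmod z powr (r - 2)) * cnj z"

lemma cmod_conj_power: "cmod (conj_power r z) = cmod z powr (r - 1)"
proof (cases "z = 0")
  case False
  then have "cmod (conj_power r z) = cmod z powr (r - 2) * cmod z powr 1"
    by (simp add: conj_power_def norm_mult)
  also have "\<dots> = cmod z powr (r - 1)" by (simp only: powr_add[symmetric]) simp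
  finally show ?thesis .
qed (simp add: conj_power_def)

text \<open>
  Uniform smoothness of \<open>\<bar>\<cdot>\<bar> powr r\<close>: the error of the first order expansion, divided by
  \<open>\<bar>a\<bar> powr r + \<bar>b\<bar> powr r\<close>, is \<open>o(\<tau>)\<close> uniformly in \<open>a\<close> and \<open>b\<close>, because \<open>min r 2 > 1\<close>. If
  \<open>a \<noteq> 0\<close>, homogeneity reduces this to \<open>a = 1\<close>.
\<close>

lemma cmod_powr_smooth:
  fixes r :: real
  assumes r: "1 < r"
  obtains C where "0 < C"
    "\<And>a b \<tau>. 0 < \<tau> \<Longrightarrow> \<tau> \<le> 1 \<Longrightarrow> cmod (a + of_real \<tau> * b) powr r \<le>
       cmod a powr r + r * \<tau> * Re (conj_power r a * b) + C * \<tau> powr (min r 2) * (cmod a powr r + cmod b powr r)"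
proof -
  obtain C where C: "0 \<le> C"
    "\<And>w. 2 * (r + 2) * cmod w \<le> 1 \<Longrightarrow> cmod (1 + w) powr r \<le> 1 + r * Re w + C * (cmod w)\<^sup>2"
    "\<And>w. 1 < 2 * (r + 2) * cmod w \<Longrightarrow> cmod (1 + w) powr r \<le> 1 + r * Re w + C * cmod w powr r"
    using cmod_one_plus_powr_le[OF r] by metis
  define s where "s = min r 2"
  have sr: "\<tau> powr r \<le> \<tau> powr s" if "0 < \<tau>" "\<tau> \<le> 1" for \<tau> :: real
    using that by (intro powr_mono') (auto simp: s_def)
  have unit: "cmod (1 + of_real \<tau> * z) powr r \<le> 1 + r * \<tau> * Re z + C * \<tau> powr s * (1 + cmod z powr r)"
    if \<tau>: "0 < \<tau>" "\<tau> \<le> 1" for \<tau> z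
  proof -
    let ?w = "of_real \<tau> * z"
    have wr: "cmod ?w powr r = \<tau> powr r * cmod z powr r" using \<tau> by (simp add: norm_mult powr_mult)
    also have "\<dots> \<le> \<tau> powr s * (1 + cmod z powr r)" using sr[OF \<tau>] by (intro mult_mono) auto
    finally have wr': "cmod ?w powr r \<le> \<tau> powr s * (1 + cmod z powr r)" .
    show ?thesis
    proof (cases "2 * (r + 2) * cmod ?w \<le> 1")
      case True
      have "1 * cmod ?w \<le> 2 * (r + 2) * cmod ?w" using r by (intro mult_right_mono) auto
      then have w1: "cmod ?w \<le> 1" using True by simp
      have "(cmod ?w)\<^sup>2 \<le> \<tau> powr s * (1 + cmod z powr r)"
      proof (cases "r \<le> 2")
        case True
        have "(cmod ?w)\<^sup>2 = cmod ?w powr 2" by simp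
        also have "\<dots> \<le> cmod ?w powr r" using True w1 by (intro powr_mono') auto
        finally show ?thesis using wr' by linarith
      next
        case False
        then have s2: "\<tau> powr s = \<tau>\<^sup>2" using \<tau> by (simp add: s_def)
        have "(cmod z)\<^sup>2 \<le> 1 + cmod z powr r"
        proof (cases "cmod z \<le> 1")
          case True
          then have "(cmod z)\<^sup>2 \<le> 1" by (simp add: power_le_one)
          then show ?thesis using powr_ge_zero[of "cmod z" r] by linarith
        next
          case z: False
          have "(cmod z)\<^sup>2 = cmod z powr 2" by simp
          also have "\<dots> \<le> cmod z powr r" using False z by (intro powr_mono) auto
          finally show ?thesis by simp
        qed
        then show ?thesis unfolding s2 using \<tau> by (simp add: norm_mult power_mult_distrib)
      qed
      then have "C * (cmod ?w)\<^sup>2 \<le> C * (\<tau> powr s * (1 + cmod z powr r))" using C(1) by (rule mult_left_mono)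
      then show ?thesis using C(2)[OF True] by (simp add: mult.assoc)
    next
      case False
      then have "C * cmod ?w powr r \<le> C * (\<tau> powr s * (1 + cmod z powr r))"
        using wr' C(1) by (intro mult_left_mono)
      then show ?thesis using C(3)[of ?w] False by (simp add: mult.assoc)
    qed
  qed
  show ?thesis
  proof (rule that[of "C + 1"])
    fix a b :: complex and \<tau> :: real assume \<tau>: "0 < \<tau>" "\<tau> \<le> 1"
    show "cmod (a + of_real \<tau> * b) powr r \<le> cmod a powr r + r * \<tau> * Re (conj_power r a * b) +
        (C + 1) * \<tau> powr (min r 2) * (cmod a powr r + cmod b powr r)"
    proof (cases "a = 0")
      case True
      have "\<tau> powr r * cmod b powr r \<le> ((C + 1) * \<tau> powr s) * cmod b powr r"
      proof (rule mult_right_mono)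
        have "0 \<le> C * \<tau> powr s" using C(1) by simp
        then show "\<tau> powr r \<le> (C + 1) * \<tau> powr s" using sr[OF \<tau>] unfolding distrib_right by linarith
      qed simp
      then show ?thesis using True \<tau> by (simp add: norm_mult powr_mult conj_power_def s_def)
    next
      case False
      define A where "A = cmod a powr r"
      have A: "0 < A" using False by (simp add: A_def)
      have "a + of_real \<tau> * b = a * (1 + of_real \<tau> * (b / a))" using False by (simp add: field_simps)
      then have "cmod (a + of_real \<tau> * b) powr r = A * cmod (1 + of_real \<tau> * (b / a)) powr r"
        by (simp only: norm_mult powr_mult A_def)
      also have "\<dots> \<le> A * (1 + r * \<tau> * Re (b / a) + C * \<tau> powr s * (1 + cmod (b / a) powr r))"
        using A by (intro mult_left_mono[OF unit[OF \<tau>]]) simp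
      also have "\<dots> = A + r * \<tau> * (A * Re (b / a)) + C * \<tau> powr s * (A + A * cmod (b / a) powr r)"
        by (simp add: algebra_simps)
      also have "A * cmod (b / a) powr r = cmod b powr r"
        using False by (simp add: A_def norm_divide powr_divide)
      also have "A * Re (b / a) = Re (conj_power r a * b)"
      proof -
        have "b / a = cnj a * b / of_real ((cmod a)\<^sup>2)"
          using False by (simp add: complex_norm_square[symmetric] field_simps del: of_real_power)
        then have "Re (b / a) = Re (cnj a * b) / (cmod a)\<^sup>2" by (simp only: Re_divide_of_real)
        then have "A * Re (b / a) = (A / (cmod a)\<^sup>2) * Re (cnj a * b)" by simp
        also have "A / (cmod a)\<^sup>2 = cmod a powr (r - 2)"
          using False by (simp add: A_def powr_diff)
        also have "cmod a powr (r - 2) * Re (cnj a * b) = Re (conj_power r a * b)"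
          unfolding conj_power_def mult.assoc by (simp only: Re_complex_of_real times_complex.sel Im_complex_of_real)
        finally show ?thesis .
      qed
      also have "C * \<tau> powr s * (A + cmod b powr r) \<le> (C + 1) * \<tau> powr s * (A + cmod b powr r)"
        using A by (intro mult_right_mono) auto
      finally show ?thesis by (simp add: A_def s_def)
    qed
  qed (use C(1) in simp)
qed

lemma powr_tangent:
  fixes r x a :: real
  assumes r: "1 \<le> r" and x: "0 \<le> x" and a: "0 \<le> a"
  shows "a powr r + r * a powr (r - 1) * (x - a) \<le> x powr r"
proof (cases "r = 1 \<or> a = 0 \<or> x = 0")
  case True
  then show ?thesis
  proof (elim disjE)
    assume "r = 1" then show ?thesis using x a by (cases "a = 0") auto
  next
    assume "a = 0" then show ?thesis by simp
  next
    assume x0: "x = 0"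
    have "a powr (r - 1) * a = a powr r"
      using a by (cases "a = 0") (auto simp: powr_diff)
    then have "a powr r + r * a powr (r - 1) * (x - a) = (1 - r) * a powr r" by (simp add: x0 algebra_simps)
    also have "\<dots> \<le> 0" using r by (simp add: mult_le_0_iff)
    finally show ?thesis by (simp add: x0)
  qed
next
  case False
  then have pos: "0 < a" "0 < x" "1 < r" using assms by auto
  define y where "y = x / a"
  have y: "0 < y" using pos by (simp add: y_def)
  have "(y powr r) powr (1 / r) * 1 powr (1 - 1 / r) \<le> 1 / r * y powr r + (1 - 1 / r) * 1"
    using pos y by (intro Youngs_inequality_0) (auto simp: divide_simps)
  then have "y \<le> (y powr r + (r - 1)) / r" using pos y by (simp add: powr_powr diff_divide_distrib add_divide_distrib)
  then have "1 + r * (y - 1) \<le> y powr r" using pos by (simp add: divide_simps algebra_simps)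
  then have "a powr r * (1 + r * (y - 1)) \<le> a powr r * y powr r" by (intro mult_left_mono) auto
  also have "a powr r * y powr r = x powr r" using pos by (simp add: powr_mult[symmetric] y_def)
  also have "a powr r * (1 + r * (y - 1)) = a powr r + r * a powr (r - 1) * (x - a)"
  proof -
    have "a powr r = a powr (r - 1) * a" using pos by (simp add: powr_diff)
    moreover have "a * (y - 1) = x - a" using pos by (simp add: y_def field_simps)
    ultimately show ?thesis by (simp add: algebra_simps)
  qed
  finally show ?thesis .
qed

section \<open>Step functions and conditional expectations\<close>

definition finite_cells :: "'a measure \<Rightarrow> 'a set set \<Rightarrow> bool" where
  "finite_cells M \<E> \<longleftrightarrow> finite \<E> \<and> disjoint \<E> \<and>
     (\<forall>E\<in>\<E>. E \<in> sets M \<and> 0 < emeasure M E \<and> emeasure M E < \<infinity>)"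

lemma finite_cellsD:
  assumes "finite_cells M \<E>"
  shows "finite \<E>" "E \<in> \<E> \<Longrightarrow> E \<in> sets M" "E \<in> \<E> \<Longrightarrow> emeasure M E < \<infinity>" "E \<in> \<E> \<Longrightarrow> 0 < measure M E"
    "E \<in> \<E> \<Longrightarrow> E' \<in> \<E> \<Longrightarrow> t \<in> E \<Longrightarrow> t \<in> E' \<Longrightarrow> E = E'"
  using assms unfolding finite_cells_def disjoint_def
  by (auto simp: measure_def enn2real_positive_iff)

lemma sum_indicator_collapse:
  fixes c :: "'a set \<Rightarrow> 'b :: comm_ring_1"
  assumes \<E>: "finite_cells M \<E>" and E: "E \<in> \<E>" "t \<in> E"
  shows "(\<Sum>E\<in>\<E>. c E * indicator E t) = c E"
proof -
  have "(\<Sum>E\<in>\<E>. c E * indicator E t) = (\<Sum>E\<in>{E}. c E * indicator E t)"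
    using finite_cellsD(1,5)[OF \<E>] E by (intro sum.mono_neutral_right) (auto simp: indicator_def)
  then show ?thesis using E by simp
qed

text \<open>
  The cells are the sets on which all functions in \<open>S\<close> are constant and not all zero. Those of measure
  zero have to be dropped, which is why the representation holds only almost everywhere.
\<close>

lemma simple_cells:
  fixes S :: "('a \<Rightarrow> complex) set"
  assumes S: "finite S" "\<And>s. s \<in> S \<Longrightarrow> Bochner_Integration.simple_bochner_integrable M s"
  shows "\<exists>\<E>. finite_cells M \<E> \<and> (\<forall>s\<in>S. \<exists>c. AE t in M. s t = (\<Sum>E\<in>\<E>. c E * indicator E t))"
proof -
  have sf: "simple_function M s" and supp: "emeasure M {t \<in> space M. s t \<noteq> 0} < \<infinity>" if "s \<in> S" for s
    using S(2)[OF that] by (auto simp: Bochner_Integration.simple_bochner_integrable.simps less_top)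
  define A where "A = (\<lambda>x. {t \<in> space M. \<forall>s\<in>S. s t = s x})"
  define X where "X = {x \<in> space M. \<exists>s\<in>S. s x \<noteq> 0}"
  define \<E> where "\<E> = {E \<in> A ` X. emeasure M E \<noteq> 0}"
  have Asets: "A x \<in> sets M" for x
  proof -
    have "{t \<in> space M. s t = s x} \<in> sets M" if "s \<in> S" for s
    proof -
      have "{t \<in> space M. s t = s x} = s -` {s x} \<inter> space M" by auto
      then show ?thesis using simple_functionD(2)[OF sf[OF that]] by simp
    qed
    then show ?thesis unfolding A_def using S(1) by (intro sets.sets_Collect_finite_All) auto
  qed
  have "A ` X \<subseteq> (\<lambda>v. {t \<in> space M. \<forall>s\<in>S. s t = v s}) ` (PiE S (\<lambda>s. s ` space M))"
  proof
    fix E assume "E \<in> A ` X"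
    then obtain x where x: "x \<in> space M" "E = A x" by (auto simp: X_def)
    then show "E \<in> (\<lambda>v. {t \<in> space M. \<forall>s\<in>S. s t = v s}) ` (PiE S (\<lambda>s. s ` space M))"
      by (intro image_eqI[of _ _ "restrict (\<lambda>s. s x) S"]) (auto simp: A_def)
  qed
  moreover have "finite (PiE S (\<lambda>s. s ` space M))"
    using S(1) simple_functionD(1)[OF sf] by (intro finite_PiE) auto
  ultimately have finAX: "finite (A ` X)" using finite_subset by blast
  have AA: "A x = A y" if "t \<in> A x" "t \<in> A y" for t x y
  proof -
    have "s x = s y" if "s \<in> S" for s using \<open>t \<in> A x\<close> \<open>t \<in> A y\<close> that unfolding A_def by force
    then have "s t = s x \<longleftrightarrow> s t = s y" if "s \<in> S" for s t using that by (metis (no_types))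
    then have "(\<forall>s\<in>S. s t = s x) \<longleftrightarrow> (\<forall>s\<in>S. s t = s y)" for t by (rule ball_cong[OF refl])
    then show ?thesis unfolding A_def by (simp only:)
  qed
  have cells: "finite_cells M \<E>"
    unfolding finite_cells_def
  proof (intro conjI ballI)
    show "finite \<E>" using finAX by (simp add: \<E>_def)
    show "disjoint \<E>" unfolding disjoint_def \<E>_def using AA by blast
    fix E assume E: "E \<in> \<E>"
    then obtain x s where x: "E = A x" "s \<in> S" "s x \<noteq> 0" by (auto simp: \<E>_def X_def)
    show "E \<in> sets M" using Asets x by simp
    show "0 < emeasure M E" using E by (simp add: \<E>_def zero_less_iff_neq_zero)
    have "{t \<in> space M. s t \<noteq> 0} = space M - (s -` {0} \<inter> space M)" by auto
    then have "{t \<in> space M. s t \<noteq> 0} \<in> sets M" using simple_functionD(2)[OF sf[OF x(2)]] by auto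
    then have "emeasure M E \<le> emeasure M {t \<in> space M. s t \<noteq> 0}"
      using x by (intro emeasure_mono) (auto simp: A_def)
    also have "\<dots> < \<infinity>" by (rule supp[OF x(2)])
    finally show "emeasure M E < \<infinity>" .
  qed
  have "\<exists>c. AE t in M. s t = (\<Sum>E\<in>\<E>. c E * indicator E t)" if s: "s \<in> S" for s
  proof (rule exI[of _ "\<lambda>E. s (SOME u. u \<in> E)"])
    have "AE t in M. \<forall>E\<in>A ` X - \<E>. t \<notin> E"
    proof (rule AE_finite_allI)
      show "finite (A ` X - \<E>)" using finAX by simp
      fix E assume "E \<in> A ` X - \<E>"
      then have "E \<in> null_sets M" using Asets by (auto simp: \<E>_def null_sets_def)
      then show "AE t in M. t \<notin> E" by (rule AE_not_in)
    qed
    then show "AE t in M. s t = (\<Sum>E\<in>\<E>. s (SOME u. u \<in> E) * indicator E t)"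
      using AE_space
    proof eventually_elim
      case (elim t)
      have tA: "t \<in> A t" using elim by (simp add: A_def)
      show ?case
      proof (cases "t \<in> X")
        case True
        then have "A t \<in> \<E>" using elim(1) tA by blast
        then have "(\<Sum>E\<in>\<E>. s (SOME u. u \<in> E) * indicator E t) = s (SOME u. u \<in> A t)"
          by (rule sum_indicator_collapse[OF cells _ tA])
        moreover have "(SOME u. u \<in> A t) \<in> A t" using tA by (rule someI)
        ultimately show ?thesis using s by (auto simp: A_def)
      next
        case False
        have "t \<notin> E" if "E \<in> \<E>" for E
        proof
          assume "t \<in> E"
          obtain x where "x \<in> X" "E = A x" using \<open>E \<in> \<E>\<close> by (auto simp: \<E>_def)
          then obtain s' where "s' \<in> S" "s' x \<noteq> 0" by (auto simp: X_def)
          moreover have "s' t = s' x" using \<open>t \<in> E\<close> \<open>E = A x\<close> \<open>s' \<in> S\<close> by (simp add: A_def)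
          ultimately have "s' t \<noteq> 0" by simp
          then have "\<exists>s\<in>S. s t \<noteq> 0" using \<open>s' \<in> S\<close> by (rule bexI)
          then have "t \<in> X" using elim(2) by (simp add: X_def)
          then show False using False by simp
        qed
        moreover have "s t = 0" using False s elim(2) by (auto simp: X_def)
        ultimately show ?thesis by (simp add: sum.neutral)
      qed
    qed
  qed
  with cells show ?thesis by blast
qed

lemma complex_indicator_integral:
  assumes E: "E \<in> sets M" "emeasure M E < \<infinity>"
  shows "(LINT t|M. indicator E t :: complex) = of_real (measure M E)"
    and "integrable M (\<lambda>t. indicator E t :: complex)"
proof -
  have eq: "(\<lambda>t. indicator E t :: complex) = (\<lambda>t. of_real (indicator E t))" by (auto simp: indicator_def)
  show "integrable M (\<lambda>t. indicator E t :: complex)"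
    unfolding eq by (intro integrable_of_real integrable_real_indicator E)
  show "(LINT t|M. indicator E t :: complex) = of_real (measure M E)"
    unfolding eq using sets.sets_into_space[OF E(1)] by (simp add: Int_absorb2)
qed

locale Lp_finite =
  fixes M :: "'a measure" and r :: real
  assumes r: "1 \<le> r"
begin

abbreviation W where "W \<equiv> Lp_functions M (ennreal r)"
abbreviation N where "N \<equiv> Lp_seminorm M (ennreal r)"

text \<open>
  The \<open>r\<close>-th power of the norm, which is additive over disjoint supports.
\<close>

definition I :: "('a \<Rightarrow> complex) \<Rightarrow> real" where
  "I f = (LINT t|M. cmod (f t) powr r)"

lemma W_iff: "f \<in> W \<longleftrightarrow> f \<in> borel_measurable M \<and> integrable M (\<lambda>t. cmod (f t) powr r)"
  using r by (simp add: Lp_functions_def)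

lemma W_measurable: "f \<in> W \<Longrightarrow> f \<in> borel_measurable M"
  and W_integrable: "f \<in> W \<Longrightarrow> integrable M (\<lambda>t. cmod (f t) powr r)"
  by (simp_all add: W_iff)

lemma I_nonneg: "0 \<le> I f"
  unfolding I_def by (intro integral_nonneg_AE) simp

lemma N_eq: "N f = I f powr (1 / r)"
  using r by (simp add: Lp_seminorm_def I_def)

lemma N_nonneg: "0 \<le> N f"
  by (simp add: N_eq)

lemma N_powr: "N f powr r = I f"
  using r I_nonneg[of f] by (simp add: N_eq powr_powr)

lemma N_le_iff: "0 \<le> c \<Longrightarrow> N f \<le> c \<longleftrightarrow> I f \<le> c powr r"
proof
  assume "0 \<le> c" "N f \<le> c"
  then have "N f powr r \<le> c powr r" using r N_nonneg by (intro powr_mono2) auto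
  then show "I f \<le> c powr r" by (simp add: N_powr)
next
  assume "0 \<le> c" "I f \<le> c powr r"
  then have "I f powr (1 / r) \<le> (c powr r) powr (1 / r)" using r I_nonneg by (intro powr_mono2) auto
  then show "N f \<le> c" using r \<open>0 \<le> c\<close> by (simp add: N_eq powr_powr)
qed

lemma N_smult: "N (\<lambda>t. c * f t) = cmod c * N f"
proof -
  have "I (\<lambda>t. c * f t) = cmod c powr r * I f" by (simp add: I_def norm_mult powr_mult)
  then show ?thesis using r by (simp add: N_eq powr_mult powr_powr)
qed

lemma W_diff: "f \<in> W \<Longrightarrow> g \<in> W \<Longrightarrow> (\<lambda>t. f t - g t) \<in> W"
  using Lp_functions_add[of f M "ennreal r" "\<lambda>t. - 1 * g t"] Lp_functions_smult[of g M "ennreal r" "- 1"] by simp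

lemma I_add_le:
  assumes "f \<in> W" "g \<in> W"
  shows "I (\<lambda>t. f t + g t) \<le> 2 powr r * (I f + I g)"
proof -
  have "I (\<lambda>t. f t + g t) \<le> (LINT t|M. 2 powr r * (cmod (f t) powr r + cmod (g t) powr r))"
    unfolding I_def
  proof (rule integral_mono)
    show "integrable M (\<lambda>t. cmod (f t + g t) powr r)" by (rule W_integrable[OF Lp_functions_add[OF assms]])
    show "integrable M (\<lambda>t. 2 powr r * (cmod (f t) powr r + cmod (g t) powr r))"
      using W_integrable[OF assms(1)] W_integrable[OF assms(2)] by simp
    fix t
    have "cmod (f t + g t) powr r \<le> (cmod (f t) + cmod (g t)) powr r"
      using r by (intro powr_mono2) (auto simp: norm_triangle_ineq)
    also have "\<dots> \<le> 2 powr r * (cmod (f t) powr r + cmod (g t) powr r)" using r by (intro powr_add_le) auto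
    finally show "cmod (f t + g t) powr r \<le> 2 powr r * (cmod (f t) powr r + cmod (g t) powr r)" .
  qed
  also have "\<dots> = 2 powr r * (I f + I g)"
    using W_integrable[OF assms(1)] W_integrable[OF assms(2)] by (simp add: I_def)
  finally show ?thesis .
qed

lemma I_cong_AE: "f \<in> W \<Longrightarrow> g \<in> W \<Longrightarrow> AE t in M. f t = g t \<Longrightarrow> I f = I g"
  unfolding I_def using W_measurable[of f] W_measurable[of g]
  by (intro integral_cong_AE powr_real_measurable) (auto elim: eventually_mono)

lemma simple_in_W:
  assumes s: "Bochner_Integration.simple_bochner_integrable M s"
  shows "s \<in> W"
proof -
  have sf: "simple_function M s" and supp: "emeasure M {t \<in> space M. s t \<noteq> 0} \<noteq> \<infinity>"
    using s by (auto simp: Bochner_Integration.simple_bochner_integrable.simps)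
  have "{t \<in> space M. cmod (s t) powr r \<noteq> 0} = {t \<in> space M. s t \<noteq> 0}" by auto
  then have "Bochner_Integration.simple_bochner_integrable M (\<lambda>t. cmod (s t) powr r)"
    using simple_function_compose[OF sf, of "\<lambda>z. cmod z powr r"] supp
    by (auto simp: Bochner_Integration.simple_bochner_integrable.simps o_def)
  then have "integrable M (\<lambda>t. cmod (s t) powr r)"
    by (rule integrableI_simple_bochner_integrable)
  then show ?thesis using borel_measurable_simple_function[OF sf] by (simp add: W_iff)
qed

lemma simple_approximation:
  assumes f: "f \<in> W"
  shows "\<exists>s. (\<forall>n. Bochner_Integration.simple_bochner_integrable M (s n)) \<and> (\<lambda>n. I (\<lambda>t. f t - s n t)) \<longlonglongrightarrow> 0 \<and>
    (\<lambda>n. I (s n)) \<longlonglongrightarrow> I f"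
proof -
  have fm [measurable]: "f \<in> borel_measurable M" by (rule W_measurable[OF f])
  obtain s where s: "\<And>n. simple_function M (s n)" "\<And>t. t \<in> space M \<Longrightarrow> (\<lambda>n. s n t) \<longlonglongrightarrow> f t"
    "\<And>n t. t \<in> space M \<Longrightarrow> cmod (s n t) \<le> 2 * cmod (f t)"
  proof -
    obtain s where "\<forall>n. simple_function M (s n)" "\<forall>t\<in>space M. (\<lambda>n. s n t) \<longlonglongrightarrow> f t"
      "\<forall>n. \<forall>t\<in>space M. cmod (s n t) \<le> 2 * cmod (f t)"
      using borel_measurable_implies_sequence_metric[OF fm, of 0] unfolding dist_norm diff_0_right
      by (elim exE conjE) (erule (2) that)
    then show thesis by (intro that[of s]) simp_all
  qed
  have sm [measurable]: "s n \<in> borel_measurable M" for n by (rule borel_measurable_simple_function[OF s(1)])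
  have w: "integrable M (\<lambda>t. 3 powr r * cmod (f t) powr r)" using W_integrable[OF f] by simp
  have bnd: "x powr r \<le> 3 powr r * cmod (f t) powr r" if "0 \<le> x" "x \<le> 3 * cmod (f t)" for x t
  proof -
    have "x powr r \<le> (3 * cmod (f t)) powr r" using that r by (intro powr_mono2) auto
    then show ?thesis by (simp add: powr_mult)
  qed
  have b1: "cmod (s n t) powr r \<le> 3 powr r * cmod (f t) powr r" if "t \<in> space M" for n t
    using s(3)[OF that, of n] norm_ge_zero[of "f t"] by (intro bnd[OF norm_ge_zero]) linarith
  have b2: "cmod (f t - s n t) powr r \<le> 3 powr r * cmod (f t) powr r" if "t \<in> space M" for n t
    using s(3)[OF that, of n] norm_triangle_ineq4[of "f t" "s n t"] by (intro bnd[OF norm_ge_zero]) linarith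
  have sW: "integrable M (\<lambda>t. cmod (s n t) powr r)" for n
    by (rule Bochner_Integration.integrable_bound[OF w]) (use b1 in auto)
  have "Bochner_Integration.simple_bochner_integrable M (s n)" for n
  proof -
    have sf: "simple_function M (\<lambda>t. cmod (s n t) powr r)"
      using simple_function_compose[OF s(1), of "\<lambda>z. cmod z powr r"] by (simp add: o_def)
    have "(\<integral>\<^sup>+ t. norm (cmod (s n t) powr r) \<partial>M) < \<infinity>"
      using sW[of n] unfolding integrable_iff_bounded by simp
    then have "Bochner_Integration.simple_bochner_integrable M (\<lambda>t. cmod (s n t) powr r)"
      by (rule simple_bochner_integrableI_bounded[OF sf])
    moreover have "{t \<in> space M. cmod (s n t) powr r \<noteq> 0} = {t \<in> space M. s n t \<noteq> 0}" by auto
    ultimately show ?thesis using s(1) by (auto simp: Bochner_Integration.simple_bochner_integrable.simps)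
  qed
  moreover have "(\<lambda>n. LINT t|M. cmod (f t - s n t) powr r) \<longlonglongrightarrow> (LINT t|M. 0 :: real)"
  proof (rule integral_dominated_convergence[OF _ _ w])
    show "AE t in M. (\<lambda>n. cmod (f t - s n t) powr r) \<longlonglongrightarrow> 0"
    proof (rule AE_I2)
      fix t assume t: "t \<in> space M"
      have "(\<lambda>n. cmod (f t - s n t)) \<longlonglongrightarrow> cmod (f t - f t)"
        by (intro tendsto_intros s(2)[OF t])
      then have "(\<lambda>n. cmod (f t - s n t) powr r) \<longlonglongrightarrow> cmod (f t - f t) powr r"
        using r by (intro tendsto_powr' tendsto_const) auto
      then show "(\<lambda>n. cmod (f t - s n t) powr r) \<longlonglongrightarrow> 0" by simp
    qed
  qed (use b2 in auto)
  moreover have "(\<lambda>n. LINT t|M. cmod (s n t) powr r) \<longlonglongrightarrow> (LINT t|M. cmod (f t) powr r)"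
  proof (rule integral_dominated_convergence[OF _ _ w])
    show "AE t in M. (\<lambda>n. cmod (s n t) powr r) \<longlonglongrightarrow> cmod (f t) powr r"
      using r s(2) by (intro AE_I2 tendsto_powr' tendsto_const tendsto_norm) auto
  qed (use b1 in auto)
  ultimately show ?thesis unfolding I_def by (intro exI[of _ s]) simp
qed

lemma indicator_mult_integrable:
  assumes f: "f \<in> W" and E: "E \<in> sets M" "emeasure M E < \<infinity>"
  shows "integrable M (\<lambda>t. indicator E t * f t)"
proof (rule Bochner_Integration.integrable_bound)
  show "integrable M (\<lambda>t. indicator E t + cmod (f t) powr r)"
    using E W_integrable[OF f] by (intro Bochner_Integration.integrable_add integrable_real_indicator)
  show "(\<lambda>t. indicator E t * f t) \<in> borel_measurable M"
    using E W_measurable[OF f] by measurable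
  show "AE t in M. norm (indicator E t * f t) \<le> norm (indicator E t + cmod (f t) powr r)"
  proof (rule AE_I2)
    fix t
    have "cmod (f t) \<le> 1 + cmod (f t) powr r"
    proof (cases "cmod (f t) \<le> 1")
      case False
      then have "cmod (f t) powr 1 \<le> cmod (f t) powr r" using r by (intro powr_mono) auto
      then show ?thesis using False by simp
    qed (simp add: add_increasing2)
    then show "norm (indicator E t * f t) \<le> norm (indicator E t + cmod (f t) powr r)"
      by (auto simp: indicator_def)
  qed
qed

text \<open>
  Jensen's inequality on one cell, obtained by integrating the tangent line of \<open>x powr r\<close> at the mean
  value \<open>a\<close> of \<open>\<bar>f\<bar>\<close>.
\<close>

lemma cell_integral_le:
  assumes f: "f \<in> W" and E: "E \<in> sets M" "emeasure M E < \<infinity>" "0 < measure M E"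
  shows "cmod (LINT t|M. indicator E t * f t) powr r \<le>
    measure M E powr (r - 1) * (LINT t|M. indicator E t * cmod (f t) powr r)"
proof -
  define m where "m = measure M E"
  have m: "0 < m" using E(3) by (simp add: m_def)
  have iE: "integrable M (indicator E :: 'a \<Rightarrow> real)" using E by (intro integrable_real_indicator)
  have iEv: "(LINT t|M. indicator E t) = m"
    using E sets.sets_into_space[OF E(1)] by (simp add: m_def Int_absorb2)
  have iA: "integrable M (\<lambda>t. indicator E t * cmod (f t))"
    using integrable_norm[OF indicator_mult_integrable[OF f E(1,2)]]
    by (rule Bochner_Integration.integrable_cong[THEN iffD1, OF refl, rotated]) (simp add: norm_mult indicator_def)
  have iR: "integrable M (\<lambda>t. indicator E t * cmod (f t) powr r)"
    using integrable_mult_indicator[OF E(1) W_integrable[OF f]] by simp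
  define A where "A = (LINT t|M. indicator E t * cmod (f t))"
  define a where "a = A / m"
  have A0: "0 \<le> A" unfolding A_def by (intro integral_nonneg_AE) simp
  have a0: "0 \<le> a" using A0 m by (simp add: a_def)
  have "cmod (LINT t|M. indicator E t * f t) \<le> (LINT t|M. cmod (indicator E t * f t))"
    by (rule integral_norm_bound)
  also have "\<dots> = A" unfolding A_def by (intro Bochner_Integration.integral_cong) (auto simp: indicator_def)
  finally have "cmod (LINT t|M. indicator E t * f t) powr r \<le> A powr r" using r by (intro powr_mono2) auto
  also have "A powr r = m powr (r - 1) * (a powr r * m)"
  proof -
    have "A = a * m" using m by (simp add: a_def)
    then have "A powr r = a powr r * m powr r" by (simp add: powr_mult)
    also have "m powr r = m powr (r - 1) * m" using m by (simp add: powr_diff)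
    finally show ?thesis by simp
  qed
  also have "a powr r * m = (LINT t|M. (a powr r - r * a powr (r - 1) * a) * indicator E t +
      r * a powr (r - 1) * (indicator E t * cmod (f t)))"
  proof -
    have "(LINT t|M. (a powr r - r * a powr (r - 1) * a) * indicator E t +
      r * a powr (r - 1) * (indicator E t * cmod (f t))) =
      (a powr r - r * a powr (r - 1) * a) * m + r * a powr (r - 1) * A"
      using iE iA iEv by (simp add: A_def)
    also have "\<dots> = a powr r * m" using m by (simp add: a_def algebra_simps)
    finally show ?thesis by simp
  qed
  also have "m powr (r - 1) * (LINT t|M. (a powr r - r * a powr (r - 1) * a) * indicator E t +
      r * a powr (r - 1) * (indicator E t * cmod (f t))) \<le>
      m powr (r - 1) * (LINT t|M. indicator E t * cmod (f t) powr r)"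
  proof (intro mult_left_mono integral_mono)
    show "integrable M (\<lambda>t. (a powr r - r * a powr (r - 1) * a) * indicator E t +
      r * a powr (r - 1) * (indicator E t * cmod (f t)))" using iE iA by simp
    fix t
    have "a powr r + r * a powr (r - 1) * (cmod (f t) - a) \<le> cmod (f t) powr r"
      by (rule powr_tangent[OF r norm_ge_zero a0])
    then show "(a powr r - r * a powr (r - 1) * a) * indicator E t +
      r * a powr (r - 1) * (indicator E t * cmod (f t)) \<le> indicator E t * cmod (f t) powr r"
      by (auto simp: indicator_def algebra_simps)
  qed (use iR in auto)
  finally show ?thesis by (simp add: m_def)
qed

lemma step_function:
  assumes \<E>: "finite_cells M \<E>"
  shows "(\<lambda>t. \<Sum>E\<in>\<E>. c E * indicator E t) \<in> W"
    and "I (\<lambda>t. \<Sum>E\<in>\<E>. c E * indicator E t) = (\<Sum>E\<in>\<E>. cmod (c E) powr r * measure M E)"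
proof -
  note D = finite_cellsD[OF \<E>]
  have eq: "cmod (\<Sum>E\<in>\<E>. c E * indicator E t) powr r = (\<Sum>E\<in>\<E>. cmod (c E) powr r * indicator E t)" for t
  proof (cases "\<exists>E\<in>\<E>. t \<in> E")
    case True
    then obtain E where E: "E \<in> \<E>" "t \<in> E" by blast
    show ?thesis unfolding sum_indicator_collapse[OF \<E> E] ..
  next
    case False
    then have "(\<Sum>E\<in>\<E>. c E * indicator E t) = 0" "(\<Sum>E\<in>\<E>. cmod (c E) powr r * indicator E t) = 0"
      by (auto intro!: sum.neutral)
    then show ?thesis by simp
  qed
  have ind: "integrable M (indicator E :: 'a \<Rightarrow> real)" "(LINT t|M. indicator E t) = measure M E" if "E \<in> \<E>" for E
    using D(2,3)[OF that] sets.sets_into_space[OF D(2)[OF that]] by (auto simp: Int_absorb2)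
  have "integrable M (\<lambda>t. \<Sum>E\<in>\<E>. cmod (c E) powr r * indicator E t)"
    using ind(1) by (intro Bochner_Integration.integrable_sum) auto
  moreover have "(\<lambda>t. \<Sum>E\<in>\<E>. c E * indicator E t) \<in> borel_measurable M"
    using D(2) by (intro borel_measurable_sum borel_measurable_times borel_measurable_indicator) auto
  ultimately show "(\<lambda>t. \<Sum>E\<in>\<E>. c E * indicator E t) \<in> W" by (simp add: W_iff eq)
  have "I (\<lambda>t. \<Sum>E\<in>\<E>. c E * indicator E t) = (LINT t|M. (\<Sum>E\<in>\<E>. cmod (c E) powr r * indicator E t))"
    by (simp add: I_def eq)
  also have "\<dots> = (\<Sum>E\<in>\<E>. (LINT t|M. cmod (c E) powr r * indicator E t))"
    using ind(1) by (intro Bochner_Integration.integral_sum) auto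
  also have "\<dots> = (\<Sum>E\<in>\<E>. cmod (c E) powr r * measure M E)" using ind by (intro sum.cong) auto
  finally show "I (\<lambda>t. \<Sum>E\<in>\<E>. c E * indicator E t) = (\<Sum>E\<in>\<E>. cmod (c E) powr r * measure M E)" .
qed

text \<open>
  A substitute for the description of the dual space of \<open>L\<^sub>p\<close>. The functional
  \<open>D u = I u / r - Re (\<phi> u)\<close> is bounded below, and by density of simple functions it has a simple almost
  minimiser \<open>u\<close>. Comparing \<open>D u\<close> with \<open>D (u + \<tau> g)\<close> by uniform smoothness shows that
  \<open>Re (\<phi> g - \<integral> J g)\<close> is small on the unit ball, where \<open>J\<close> is the derivative of \<open>I / r\<close> at \<open>u\<close>.
\<close>

lemma form_approximation:
  assumes r1: "1 < r" and \<phi>: "bounded_form W N \<phi>" and e: "0 < e"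
  shows "\<exists>s. Bochner_Integration.simple_bochner_integrable M s \<and>
    (\<forall>f\<in>W. cmod (\<phi> f - (LINT t|M. s t * f t)) \<le> e * N f)"
proof -
  obtain C' where C': "\<forall>f\<in>W. cmod (\<phi> f) \<le> C' * N f" using \<phi> unfolding bounded_form_def by blast
  define C where "C = \<bar>C'\<bar>"
  have C: "cmod (\<phi> f) \<le> C * N f" if "f \<in> W" for f
    using bspec[OF C' that] mult_right_mono[OF abs_ge_self[of C'] N_nonneg[of f]] by (simp add: C_def)
  have C0: "0 \<le> C" by (simp add: C_def)
  \<comment> \<open>Beyond \<open>x\<^sub>1\<close> the term \<open>x powr r / (2 * r)\<close> alone dominates \<open>C * x\<close>.\<close>
  define x\<^sub>1 where "x\<^sub>1 = (2 * r * C) powr (1 / (r - 1))"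
  have x1: "C * x \<le> x powr r / (2 * r) + C * x\<^sub>1" if x: "0 \<le> x" for x
  proof (cases "x \<le> x\<^sub>1")
    case True
    then have "C * x \<le> C * x\<^sub>1" using C0 by (rule mult_left_mono)
    moreover have "0 \<le> x powr r / (2 * r)" using r1 by simp
    ultimately show ?thesis by linarith
  next
    case False
    have x10: "0 \<le> x\<^sub>1" by (simp add: x\<^sub>1_def)
    then have xp: "0 < x" using False by linarith
    have "2 * r * C = x\<^sub>1 powr (r - 1)" using r1 C0 by (simp add: x\<^sub>1_def powr_powr)
    also have "\<dots> \<le> x powr (r - 1)" using False x10 r1 by (intro powr_mono2) auto
    finally have "2 * r * C * x \<le> x powr (r - 1) * x" using x by (rule mult_right_mono)
    also have "\<dots> = x powr r" using xp by (simp add: powr_diff)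
    finally have "C * x \<le> x powr r / (2 * r)" using r1 by (simp add: le_divide_eq algebra_simps)
    moreover have "0 \<le> C * x\<^sub>1" using C0 x10 by simp
    ultimately show ?thesis by linarith
  qed
  define D where "D = (\<lambda>u. I u / r - Re (\<phi> u))"
  have D_ge: "I u / (2 * r) - C * x\<^sub>1 \<le> D u" if u: "u \<in> W" for u
  proof -
    have "Re (\<phi> u) \<le> C * N u" using C[OF u] complex_Re_le_cmod[of "\<phi> u"] by linarith
    also have "\<dots> \<le> I u / (2 * r) + C * x\<^sub>1" using x1[OF N_nonneg[of u]] by (simp only: N_powr)
    finally have "Re (\<phi> u) \<le> I u / (2 * r) + C * x\<^sub>1" .
    moreover have "I u / r = I u / (2 * r) + I u / (2 * r)" using r1 by (simp add: field_simps)
    ultimately show ?thesis unfolding D_def by linarith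
  qed
  define K where "K = 2 * r * (1 + C * x\<^sub>1)"
  have K0: "0 \<le> K" using r1 C0 by (simp add: K_def x\<^sub>1_def)
  obtain C\<^sub>0 where C\<^sub>0: "0 < C\<^sub>0"
    "\<And>a b \<tau>. 0 < \<tau> \<Longrightarrow> \<tau> \<le> 1 \<Longrightarrow> cmod (a + of_real \<tau> * b) powr r \<le>
       cmod a powr r + r * \<tau> * Re (conj_power r a * b) + C\<^sub>0 * \<tau> powr (min r 2) * (cmod a powr r + cmod b powr r)"
    using cmod_powr_smooth[OF r1] by metis
  define s where "s = min r 2"
  have s: "1 < s" using r1 by (simp add: s_def)
  \<comment> \<open>The step \<open>\<tau>\<close> makes the second order error at most \<open>\<tau> * e / 2\<close>; \<open>K\<close> bounds \<open>I u\<close> for every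
      almost minimiser \<open>u\<close>.\<close>
  define Q where "Q = e * r / (2 * C\<^sub>0 * (K + 1))"
  have Q: "0 < Q" using e r1 C\<^sub>0(1) K0 by (simp add: Q_def)
  define \<tau> where "\<tau> = min 1 (Q powr (1 / (s - 1)))"
  have \<tau>: "0 < \<tau>" "\<tau> \<le> 1" using Q by (auto simp: \<tau>_def)
  have "\<tau> powr (s - 1) \<le> (Q powr (1 / (s - 1))) powr (s - 1)"
    using \<tau> s by (intro powr_mono2) (auto simp: \<tau>_def)
  then have \<tau>s: "\<tau> powr (s - 1) \<le> Q" using Q s by (simp add: powr_powr)
  define \<delta> where "\<delta> = min 1 (\<tau> * e / 2)"
  have \<delta>: "0 < \<delta>" "\<delta> \<le> 1" "\<delta> \<le> \<tau> * e / 2" using \<tau> e by (auto simp: \<delta>_def)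
  have zW: "(\<lambda>t. 0) \<in> W" by (rule Lp_functions_0)
  have D0: "D (\<lambda>t. 0) = 0"
    using r bounded_form_smult[OF \<phi> zW, of 0] by (simp add: D_def I_def)
  have bdd: "bdd_below (D ` W)"
  proof (rule bdd_belowI2)
    fix u assume u: "u \<in> W"
    have "0 \<le> I u / (2 * r)" using I_nonneg[of u] r1 by simp
    then show "- (C * x\<^sub>1) \<le> D u" using D_ge[OF u] by linarith
  qed
  have "Inf (D ` W) < Inf (D ` W) + \<delta>" using \<delta> by simp
  then obtain w where w: "w \<in> W" "D w < Inf (D ` W) + \<delta>"
    using cInf_lessD[of "D ` W"] zW by blast
  obtain S where S: "\<And>n. Bochner_Integration.simple_bochner_integrable M (S n)" "(\<lambda>n. I (\<lambda>t. w t - S n t)) \<longlonglongrightarrow> 0"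
    "(\<lambda>n. I (S n)) \<longlonglongrightarrow> I w"
    using simple_approximation[OF w(1)] by blast
  have "(\<lambda>n. C * N (\<lambda>t. w t - S n t)) \<longlonglongrightarrow> C * 0 powr (1 / r)"
    unfolding N_eq using r I_nonneg S(2) by (intro tendsto_intros tendsto_powr') auto
  then have "(\<lambda>n. C * N (\<lambda>t. w t - S n t)) \<longlonglongrightarrow> 0" by simp
  then have "(\<lambda>n. \<phi> w - \<phi> (S n)) \<longlonglongrightarrow> 0"
  proof (rule Lim_null_comparison[rotated])
    show "\<forall>\<^sub>F n in sequentially. norm (\<phi> w - \<phi> (S n)) \<le> C * N (\<lambda>t. w t - S n t)"
    proof (rule always_eventually, rule allI)
      fix n
      have Sn: "S n \<in> W" by (rule simple_in_W) (rule S(1))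
      have "\<phi> (\<lambda>t. w t + - 1 * S n t) = \<phi> w + - 1 * \<phi> (S n)"
        by (simp only: bounded_form_add[OF \<phi> w(1) Lp_functions_smult[OF Sn]] bounded_form_smult[OF \<phi> Sn])
      then show "norm (\<phi> w - \<phi> (S n)) \<le> C * N (\<lambda>t. w t - S n t)" using C[OF W_diff[OF w(1) Sn]] by simp
    qed
  qed
  then have "(\<lambda>n. \<phi> w - (\<phi> w - \<phi> (S n))) \<longlonglongrightarrow> \<phi> w - 0" by (intro tendsto_diff tendsto_const)
  then have "(\<lambda>n. D (S n)) \<longlonglongrightarrow> D w"
    unfolding D_def using r1 S(3) by (intro tendsto_intros tendsto_Re) auto
  then have "\<forall>\<^sub>F n in sequentially. D (S n) < Inf (D ` W) + \<delta>" using w(2) by (rule order_tendstoD)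
  then obtain n where n: "D (S n) < Inf (D ` W) + \<delta>" by (auto simp: eventually_sequentially)
  define u where "u = S n"
  have su: "Bochner_Integration.simple_bochner_integrable M u" unfolding u_def by (rule S(1))
  have u: "u \<in> W" by (rule simple_in_W[OF su])
  have umin: "D u \<le> D g + \<delta>" if "g \<in> W" for g
    using cInf_lower[OF imageI[OF that] bdd] n unfolding u_def by linarith
  have Iu: "I u \<le> K"
  proof -
    have "I u / (2 * r) \<le> 1 + C * x\<^sub>1" using umin[OF zW] D0 D_ge[OF u] \<delta> by linarith
    then show ?thesis using r1 by (simp add: K_def divide_le_eq mult.commute)
  qed
  define J where "J = (\<lambda>t. conj_power r (u t))"
  have sfu: "simple_function M u" and suppu: "emeasure M {t \<in> space M. u t \<noteq> 0} \<noteq> \<infinity>"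
    using su by (auto simp: Bochner_Integration.simple_bochner_integrable.simps)
  have sfJ: "simple_function M J"
    using simple_function_compose[OF sfu, of "conj_power r"] by (simp add: J_def o_def)
  have "{t \<in> space M. J t \<noteq> 0} = {t \<in> space M. u t \<noteq> 0}" by (auto simp: J_def conj_power_def)
  then have sJ: "Bochner_Integration.simple_bochner_integrable M J" using sfJ suppu by (auto simp: Bochner_Integration.simple_bochner_integrable.simps)
  have Jg: "integrable M (\<lambda>t. J t * g t)" if g: "g \<in> W" for g
  proof (rule Bochner_Integration.integrable_bound)
    show "integrable M (\<lambda>t. cmod (u t) powr r + cmod (g t) powr r)"
      using W_integrable[OF u] W_integrable[OF g] by simp
    show "(\<lambda>t. J t * g t) \<in> borel_measurable M"
      by (intro borel_measurable_times borel_measurable_simple_function[OF sfJ] W_measurable[OF g])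
    show "AE t in M. norm (J t * g t) \<le> norm (cmod (u t) powr r + cmod (g t) powr r)"
    proof (rule AE_I2)
      fix t
      define y where "y = max (cmod (u t)) (cmod (g t))"
      have y0: "0 \<le> y" by (simp add: y_def le_max_iff_disj)
      have "norm (J t * g t) = cmod (u t) powr (r - 1) * cmod (g t)"
        by (simp only: norm_mult J_def cmod_conj_power)
      also have "\<dots> \<le> y powr (r - 1) * y"
        using r by (intro mult_mono powr_mono2) (auto simp: y_def)
      also have "\<dots> = y powr r" using y0 by (cases "y = 0") (auto simp: powr_diff)
      also have "\<dots> \<le> cmod (u t) powr r + cmod (g t) powr r" unfolding y_def max_def by simp
      finally show "norm (J t * g t) \<le> norm (cmod (u t) powr r + cmod (g t) powr r)" by simp
    qed
  qed
  define \<Phi> where "\<Phi> = (\<lambda>f. \<phi> f - (LINT t|M. J t * f t))"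
  have main: "Re (\<Phi> g) \<le> e" if g: "g \<in> W" "N g \<le> 1" for g
  proof -
    have Ig: "I g \<le> 1" using g(2) N_le_iff[of 1 g] by simp
    let ?h = "\<lambda>t. u t + of_real \<tau> * g t"
    have \<tau>g: "(\<lambda>t. of_real \<tau> * g t) \<in> W" by (rule Lp_functions_smult[OF g(1)])
    have h: "?h \<in> W" by (rule Lp_functions_add[OF u \<tau>g])
    have iRe: "integrable M (\<lambda>t. Re (J t * g t))" by (rule integrable_Re[OF Jg[OF g(1)]])
    have "I ?h \<le> (LINT t|M. (cmod (u t) powr r + r * \<tau> * Re (J t * g t)) +
        C\<^sub>0 * \<tau> powr s * (cmod (u t) powr r + cmod (g t) powr r))"
      unfolding I_def
    proof (rule integral_mono[OF W_integrable[OF h]])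
      show "integrable M (\<lambda>t. (cmod (u t) powr r + r * \<tau> * Re (J t * g t)) +
        C\<^sub>0 * \<tau> powr s * (cmod (u t) powr r + cmod (g t) powr r))"
        by (intro Bochner_Integration.integrable_add integrable_mult_right W_integrable u g(1) iRe)
      fix t show "cmod (u t + of_real \<tau> * g t) powr r \<le> (cmod (u t) powr r + r * \<tau> * Re (J t * g t)) +
        C\<^sub>0 * \<tau> powr s * (cmod (u t) powr r + cmod (g t) powr r)"
        using C\<^sub>0(2)[OF \<tau>, of "u t" "g t"] unfolding J_def s_def .
    qed
    also have "\<dots> = (I u + r * \<tau> * (LINT t|M. Re (J t * g t))) + C\<^sub>0 * \<tau> powr s * (I u + I g)"
      unfolding I_def using W_integrable[OF u] W_integrable[OF g(1)] iRe by simp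
    also have "(LINT t|M. Re (J t * g t)) = Re (LINT t|M. J t * g t)"
      by (rule integral_Re[OF Jg[OF g(1)]])
    also have "C\<^sub>0 * \<tau> powr s * (I u + I g) \<le> C\<^sub>0 * \<tau> powr s * (K + 1)"
      using C\<^sub>0(1) Iu Ig by (intro mult_left_mono) auto
    finally have "I ?h / r \<le> (I u + r * \<tau> * Re (LINT t|M. J t * g t) + C\<^sub>0 * \<tau> powr s * (K + 1)) / r"
      using r1 by (intro divide_right_mono) auto
    also have "\<dots> = I u / r + \<tau> * Re (LINT t|M. J t * g t) + C\<^sub>0 * \<tau> powr s * (K + 1) / r"
      using r1 by (simp add: add_divide_distrib)
    finally have Ih: "I ?h / r \<le> I u / r + \<tau> * Re (LINT t|M. J t * g t) + C\<^sub>0 * \<tau> powr s * (K + 1) / r" .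
    have "\<phi> ?h = \<phi> u + of_real \<tau> * \<phi> g"
      by (simp only: bounded_form_add[OF \<phi> u \<tau>g] bounded_form_smult[OF \<phi> g(1)])
    then have "Re (\<phi> ?h) = Re (\<phi> u) + \<tau> * Re (\<phi> g)" by simp
    then have "\<tau> * Re (\<Phi> g) \<le> \<delta> + C\<^sub>0 * \<tau> powr s * (K + 1) / r"
      using umin[OF h] Ih unfolding D_def \<Phi>_def by (simp add: right_diff_distrib)
    also have "C\<^sub>0 * \<tau> powr s * (K + 1) / r \<le> \<tau> * (e / 2)"
    proof -
      have "\<tau> powr s = \<tau> powr (s - 1) * \<tau>" using \<tau> by (simp add: powr_diff)
      also have "\<dots> \<le> Q * \<tau>" using \<tau>s \<tau> by (intro mult_right_mono) auto
      finally have "C\<^sub>0 * (K + 1) / r * \<tau> powr s \<le> C\<^sub>0 * (K + 1) / r * (Q * \<tau>)"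
        using C\<^sub>0(1) K0 r1 by (intro mult_left_mono) auto
      also have "\<dots> = \<tau> * (e / 2)"
      proof -
        have nz: "C\<^sub>0 \<noteq> 0" "K + 1 \<noteq> 0" "r \<noteq> 0" using C\<^sub>0(1) K0 r1 by auto
        show ?thesis unfolding Q_def using nz by (simp add: divide_simps)
      qed
      finally show ?thesis by (simp add: algebra_simps)
    qed
    finally have "\<tau> * Re (\<Phi> g) \<le> \<tau> * e" using \<delta>(3) by (simp add: field_simps)
    then show ?thesis using \<tau> by simp
  qed
  have "cmod (\<Phi> f) \<le> e * N f" if f: "f \<in> W" for f
  proof (rule cmod_form_le[where W = W])
    fix c g assume g: "g \<in> W"
    show "(\<lambda>t. c * g t) \<in> W" by (rule Lp_functions_smult[OF g])
    show "N (\<lambda>t. c * g t) \<le> cmod c * N g" by (simp only: N_smult order_refl)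
    have "(LINT t|M. J t * (c * g t)) = c * (LINT t|M. J t * g t)"
      using integral_mult_right_zero[of M c "\<lambda>t. J t * g t"] by (simp add: mult.left_commute)
    then show "\<Phi> (\<lambda>t. c * g t) = c * \<Phi> g"
      unfolding \<Phi>_def by (simp add: bounded_form_smult[OF \<phi> g] right_diff_distrib)
  qed (use f main N_nonneg in auto)
  then show ?thesis using sJ unfolding \<Phi>_def by blast
qed

text \<open>
  The exponents are chosen such that the cell vectors have norm one; then they span an isometric copy
  of a finite-dimensional \<open>\<ell>\<^sub>r\<close>.
\<close>

definition cell_vector :: "'a set \<Rightarrow> 'a \<Rightarrow> complex" where
  "cell_vector E t = of_real (measure M E powr (- (1 / r))) * indicator E t"

definition cell_form :: "'a set \<Rightarrow> ('a \<Rightarrow> complex) \<Rightarrow> complex" where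
  "cell_form E f = of_real (measure M E powr (1 / r - 1)) * (LINT t|M. indicator E t * f t)"

lemma cell_form_linear:
  assumes E: "E \<in> sets M" "emeasure M E < \<infinity>"
  shows "f \<in> W \<Longrightarrow> g \<in> W \<Longrightarrow> cell_form E (\<lambda>t. f t + g t) = cell_form E f + cell_form E g"
    "cell_form E (\<lambda>t. c * f t) = c * cell_form E f"
proof -
  show "cell_form E (\<lambda>t. f t + g t) = cell_form E f + cell_form E g" if "f \<in> W" "g \<in> W"
    using Bochner_Integration.integral_add[OF indicator_mult_integrable[OF that(1) E] indicator_mult_integrable[OF that(2) E]]
    by (simp add: cell_form_def distrib_left)
  show "cell_form E (\<lambda>t. c * f t) = c * cell_form E f"
    using integral_mult_right_zero[of M c "\<lambda>t. indicator E t * f t"]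
    by (simp add: cell_form_def mult.left_commute)
qed

lemma cell_form_powr_le:
  assumes f: "f \<in> W" and E: "E \<in> sets M" "emeasure M E < \<infinity>" "0 < measure M E"
  shows "cmod (cell_form E f) powr r \<le> (LINT t|M. indicator E t * cmod (f t) powr r)"
proof -
  let ?m = "measure M E"
  have "cmod (cell_form E f) powr r = ?m powr ((1 / r - 1) * r) * cmod (LINT t|M. indicator E t * f t) powr r"
    by (simp add: cell_form_def norm_mult powr_mult powr_powr)
  also have "(1 / r - 1) * r = 1 - r" using r by (simp add: field_simps)
  also have "?m powr (1 - r) * cmod (LINT t|M. indicator E t * f t) powr r \<le>
      ?m powr (1 - r) * (?m powr (r - 1) * (LINT t|M. indicator E t * cmod (f t) powr r))"
    by (intro mult_left_mono cell_integral_le[OF f E]) simp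
  also have "\<dots> = (?m powr (1 - r) * ?m powr (r - 1)) * (LINT t|M. indicator E t * cmod (f t) powr r)" by simp
  also have "?m powr (1 - r) * ?m powr (r - 1) = 1"
    using E(3) by (simp only: powr_add[symmetric]) simp
  finally show ?thesis by simp
qed

lemma sum_cell_form_powr_le:
  assumes \<E>: "finite_cells M \<E>" and f: "f \<in> W"
  shows "(\<Sum>E\<in>\<E>. cmod (cell_form E f) powr r) \<le> I f"
proof -
  note D = finite_cellsD[OF \<E>]
  have int: "integrable M (\<lambda>t. indicator E t * cmod (f t) powr r)" if "E \<in> \<E>" for E
    using integrable_mult_indicator[OF D(2)[OF that] W_integrable[OF f]] by simp
  have "(\<Sum>E\<in>\<E>. cmod (cell_form E f) powr r) \<le> (\<Sum>E\<in>\<E>. (LINT t|M. indicator E t * cmod (f t) powr r))"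
    by (intro sum_mono cell_form_powr_le[OF f] D(2,3,4))
  also have "\<dots> = (LINT t|M. (\<Sum>E\<in>\<E>. indicator E t * cmod (f t) powr r))"
    using int by (intro Bochner_Integration.integral_sum[symmetric]) auto
  also have "\<dots> \<le> (LINT t|M. cmod (f t) powr r)"
  proof (rule integral_mono[OF _ W_integrable[OF f]])
    show "integrable M (\<lambda>t. \<Sum>E\<in>\<E>. indicator E t * cmod (f t) powr r)"
      using int by (intro Bochner_Integration.integrable_sum) auto
    fix t
    show "(\<Sum>E\<in>\<E>. indicator E t * cmod (f t) powr r) \<le> cmod (f t) powr r"
    proof (cases "\<exists>E\<in>\<E>. t \<in> E")
      case True
      then obtain E where E: "E \<in> \<E>" "t \<in> E" by blast
      show ?thesis
        using sum_indicator_collapse[OF \<E> E, of "\<lambda>_. cmod (f t) powr r"] by (simp add: mult.commute)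
    next
      case False
      then have "(\<Sum>E\<in>\<E>. indicator E t * cmod (f t) powr r) = 0" by (auto intro!: sum.neutral)
      then show ?thesis by simp
    qed
  qed
  finally show ?thesis by (simp add: I_def)
qed

lemma cell_form_bounded:
  assumes \<E>: "finite_cells M \<E>" and E: "E \<in> \<E>"
  shows "bounded_form W N (cell_form E)"
proof -
  note D = finite_cellsD[OF \<E>]
  have "cmod (cell_form E f) \<le> 1 * N f" if f: "f \<in> W" for f
  proof -
    have "cmod (cell_form E f) powr r \<le> (\<Sum>E\<in>\<E>. cmod (cell_form E f) powr r)"
      by (rule member_le_sum[OF E _ D(1)]) simp
    also have "\<dots> \<le> I f" by (rule sum_cell_form_powr_le[OF \<E> f])
    finally have "(cmod (cell_form E f) powr r) powr (1 / r) \<le> I f powr (1 / r)"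
      using r by (intro powr_mono2) auto
    then show ?thesis using r by (simp add: powr_powr N_eq)
  qed
  then show ?thesis unfolding bounded_form_def
    using cell_form_linear[OF D(2,3)[OF E]] by blast
qed

lemma cell_step:
  assumes \<E>: "finite_cells M \<E>"
  shows "(\<lambda>t. \<Sum>E\<in>\<E>. c E * cell_vector E t) \<in> W"
    and "I (\<lambda>t. \<Sum>E\<in>\<E>. c E * cell_vector E t) = (\<Sum>E\<in>\<E>. cmod (c E) powr r)"
proof -
  note D = finite_cellsD[OF \<E>]
  have eq: "(\<lambda>t. \<Sum>E\<in>\<E>. c E * cell_vector E t) =
      (\<lambda>t. \<Sum>E\<in>\<E>. (c E * of_real (measure M E powr (- (1 / r)))) * indicator E t)"
    by (simp add: cell_vector_def mult.assoc)
  show "(\<lambda>t. \<Sum>E\<in>\<E>. c E * cell_vector E t) \<in> W" unfolding eq by (rule step_function(1)[OF \<E>])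
  have "cmod (c E * of_real (measure M E powr (- (1 / r)))) powr r * measure M E = cmod (c E) powr r" if "E \<in> \<E>" for E
  proof -
    have "cmod (c E * of_real (measure M E powr (- (1 / r)))) powr r =
        cmod (c E) powr r * measure M E powr (- (1 / r) * r)"
      by (simp add: norm_mult powr_mult powr_powr)
    also have "- (1 / r) * r = - 1" using r by simp
    finally show ?thesis using D(4)[OF that] by (simp add: powr_minus field_simps)
  qed
  then show "I (\<lambda>t. \<Sum>E\<in>\<E>. c E * cell_vector E t) = (\<Sum>E\<in>\<E>. cmod (c E) powr r)"
    unfolding eq step_function(2)[OF \<E>] by (intro sum.cong refl)
qed

lemma cell_form_cell_vector:
  assumes \<E>: "finite_cells M \<E>" and E: "E \<in> \<E>" "E' \<in> \<E>"
  shows "cell_form E' (cell_vector E) = (if E = E' then 1 else 0)"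
proof -
  note D = finite_cellsD[OF \<E>]
  let ?m = "measure M E"
  have "(LINT t|M. indicator E' t * cell_vector E t) =
      (LINT t|M. of_real (?m powr (- (1 / r))) * (if E = E' then indicator E t else 0 :: complex))"
    using D(5)[OF E] by (intro Bochner_Integration.integral_cong) (auto simp: cell_vector_def indicator_def)
  also have "\<dots> = (if E = E' then of_real (?m powr (- (1 / r))) * of_real ?m else 0)"
  proof -
    have "(LINT t|M. indicator E t :: complex) = of_real ?m"
      by (rule complex_indicator_integral(1)[OF D(2,3)[OF E(1)]])
    then show ?thesis by (cases "E = E'") simp_all
  qed
  finally have *: "(LINT t|M. indicator E' t * cell_vector E t) =
      (if E = E' then of_real (?m powr (- (1 / r))) * of_real ?m else 0)" .
  have "?m powr (1 / r - 1) * (?m powr (- (1 / r)) * ?m powr 1) = 1"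
    using D(4)[OF E(1)] by (simp only: powr_add[symmetric]) simp
  then have "complex_of_real (?m powr (1 / r - 1)) * (of_real (?m powr (- (1 / r))) * of_real ?m) = 1"
    using D(4)[OF E(1)] by (metis abs_of_pos of_real_1 of_real_mult powr_one less_imp_le)
  then show ?thesis unfolding cell_form_def * by auto
qed

text \<open>
  The system defines the conditional expectation with respect to \<open>\<E>\<close>: it fixes step functions, and
  it is symmetric for the pairing by the integral.
\<close>

lemma step_projection:
  assumes \<E>: "finite_cells M \<E>" and s: "s \<in> W" "AE t in M. s t = (\<Sum>E\<in>\<E>. c E * indicator E t)"
  shows "AE t in M. (\<Sum>E\<in>\<E>. cell_form E s * cell_vector E t) = s t"
    and "f \<in> W \<Longrightarrow> (LINT t|M. s t * (\<Sum>E\<in>\<E>. cell_form E f * cell_vector E t)) = (LINT t|M. s t * f t)"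
proof -
  note D = finite_cellsD[OF \<E>]
  have m: "measure M E powr (1 / r - 1) * measure M E powr (- (1 / r)) * measure M E = 1" if "E \<in> \<E>" for E
  proof -
    have "measure M E powr (1 / r - 1) * measure M E powr (- (1 / r)) * measure M E powr 1 = 1"
      using D(4)[OF that] by (simp only: powr_add[symmetric]) simp
    then show ?thesis using D(4)[OF that] by simp
  qed
  have intE: "(LINT t|M. indicator E t :: complex) = of_real (measure M E)"
    "integrable M (\<lambda>t. indicator E t :: complex)" if "E \<in> \<E>" for E
    by (rule complex_indicator_integral[OF D(2,3)[OF that]])+
  have sE: "(LINT t|M. indicator E t * s t) = c E * of_real (measure M E)" if E: "E \<in> \<E>" for E
  proof -
    have "(LINT t|M. indicator E t * s t) = (LINT t|M. c E * indicator E t)"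
    proof (rule integral_cong_AE)
      show "(\<lambda>t. indicator E t * s t) \<in> borel_measurable M" "(\<lambda>t. c E * indicator E t) \<in> borel_measurable M"
        using D(2)[OF E] W_measurable[OF s(1)] by measurable
      show "AE t in M. indicator E t * s t = c E * indicator E t"
        using s(2)
      proof eventually_elim
        case (elim t)
        show ?case
        proof (cases "t \<in> E")
          case True
          show ?thesis using elim sum_indicator_collapse[OF \<E> E True, of c] True by simp
        qed simp
      qed
    qed
    also have "\<dots> = c E * of_real (measure M E)" using intE[OF E] by simp
    finally show ?thesis .
  qed
  have cc: "cell_form E s * of_real (measure M E powr (- (1 / r))) = c E" if E: "E \<in> \<E>" for E
  proof -
    have "cell_form E s * of_real (measure M E powr (- (1 / r))) =
        c E * of_real (measure M E powr (1 / r - 1) * measure M E powr (- (1 / r)) * measure M E)"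
      unfolding cell_form_def sE[OF E] by simp
    then show ?thesis unfolding m[OF E] by simp
  qed
  show "AE t in M. (\<Sum>E\<in>\<E>. cell_form E s * cell_vector E t) = s t"
    using s(2)
  proof eventually_elim
    case (elim t)
    have "(\<Sum>E\<in>\<E>. cell_form E s * cell_vector E t) = (\<Sum>E\<in>\<E>. c E * indicator E t)"
    proof (rule sum.cong[OF refl])
      fix E assume E: "E \<in> \<E>"
      show "cell_form E s * cell_vector E t = c E * indicator E t"
        unfolding cell_vector_def mult.assoc[symmetric] cc[OF E] ..
    qed
    then show ?case using elim by simp
  qed
  fix f assume f: "f \<in> W"
  define g where "g = (\<lambda>t. \<Sum>E\<in>\<E>. cell_form E f * cell_vector E t)"
  have gW: "g \<in> W" unfolding g_def by (rule cell_step(1)[OF \<E>])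
  have pair: "(LINT t|M. s t * h t) = (\<Sum>E\<in>\<E>. c E * (LINT t|M. indicator E t * h t))" if h: "h \<in> W" for h
  proof -
    have "(LINT t|M. s t * h t) = (LINT t|M. (\<Sum>E\<in>\<E>. c E * (indicator E t * h t)))"
    proof (rule integral_cong_AE)
      show "(\<lambda>t. s t * h t) \<in> borel_measurable M"
        by (intro borel_measurable_times W_measurable s(1) h)
      show "(\<lambda>t. \<Sum>E\<in>\<E>. c E * (indicator E t * h t)) \<in> borel_measurable M"
        using D(2) W_measurable[OF h] by (intro borel_measurable_sum borel_measurable_times borel_measurable_indicator) auto
      show "AE t in M. s t * h t = (\<Sum>E\<in>\<E>. c E * (indicator E t * h t))"
        using s(2) by eventually_elim (simp add: sum_distrib_right mult.assoc)
    qed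
    also have "\<dots> = (\<Sum>E\<in>\<E>. (LINT t|M. c E * (indicator E t * h t)))"
      by (intro Bochner_Integration.integral_sum integrable_mult_right indicator_mult_integrable h D(2,3))
    also have "\<dots> = (\<Sum>E\<in>\<E>. c E * (LINT t|M. indicator E t * h t))"
      by (simp only: integral_mult_right_zero)
    finally show ?thesis .
  qed
  have gE: "(LINT t|M. indicator E t * g t) = (LINT t|M. indicator E t * f t)" if E: "E \<in> \<E>" for E
  proof -
    define k where "k = cell_form E f * of_real (measure M E powr (- (1 / r)))"
    have "(LINT t|M. indicator E t * g t) = (LINT t|M. k * indicator E t)"
    proof (rule Bochner_Integration.integral_cong[OF refl])
      fix t
      show "indicator E t * g t = k * indicator E t"
      proof (cases "t \<in> E")
        case True
        have "g t = (\<Sum>E\<in>\<E>. (cell_form E f * of_real (measure M E powr (- (1 / r)))) * indicator E t)"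
          by (simp add: g_def cell_vector_def mult.assoc)
        also have "\<dots> = k" unfolding k_def by (rule sum_indicator_collapse[OF \<E> E True])
        finally show ?thesis using True by simp
      qed simp
    qed
    also have "\<dots> = k * of_real (measure M E)" using intE[OF E] by simp
    also have "\<dots> = of_real (measure M E powr (1 / r - 1) * measure M E powr (- (1 / r)) * measure M E) *
        (LINT t|M. indicator E t * f t)"
      by (simp add: k_def cell_form_def)
    finally show ?thesis unfolding m[OF E] by simp
  qed
  have "(LINT t|M. s t * g t) = (LINT t|M. s t * f t)" unfolding pair[OF gW] pair[OF f] using gE by simp
  then show "(LINT t|M. s t * (\<Sum>E\<in>\<E>. cell_form E f * cell_vector E t)) = (LINT t|M. s t * f t)"
    by (simp only: g_def)
qed

text \<open>
  All functions in \<open>A\<close> and the densities of all functionals in \<open>B\<close> are replaced by simple functions,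
  and the cells are those of these finitely many simple functions. The additional simple function
  \<open>s\<^sub>0\<close> is not zero almost everywhere and guarantees that there is at least one cell.
\<close>

theorem Lp_approximating_system:
  assumes r1: "1 < r" and A: "finite A" "A \<subseteq> W" and B: "finite B" "\<forall>\<phi>\<in>B. bounded_form W N \<phi>"
    and e: "0 < e" and ne: "\<exists>f\<in>W. \<not> (AE t in M. f t = 0)"
  shows "\<exists>(\<E> :: 'a set set) x F. approximating_system W N A B e \<E> x F"
proof -
  have approx: "\<exists>s. Bochner_Integration.simple_bochner_integrable M s \<and> I (\<lambda>t. f t - s t) \<le> d" if f: "f \<in> W" and d: "0 < d" for f d
  proof -
    obtain S where S: "\<And>n. Bochner_Integration.simple_bochner_integrable M (S n)" "(\<lambda>n. I (\<lambda>t. f t - S n t)) \<longlonglongrightarrow> 0"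
      using simple_approximation[OF f] by blast
    have "\<forall>\<^sub>F n in sequentially. I (\<lambda>t. f t - S n t) < d" using S(2) d by (rule order_tendstoD)
    then obtain n where "I (\<lambda>t. f t - S n t) < d" by (auto simp: eventually_sequentially)
    then show ?thesis using S(1) by (intro exI[of _ "S n"]) auto
  qed
  define d where "d = (e powr r) / (2 powr r * 2)"
  have d: "0 < d" using e by (simp add: d_def)
  have "\<forall>f\<in>A. \<exists>s. Bochner_Integration.simple_bochner_integrable M s \<and> I (\<lambda>t. f t - s t) \<le> d" using approx A(2) d by blast
  then obtain S where S: "\<And>f. f \<in> A \<Longrightarrow> Bochner_Integration.simple_bochner_integrable M (S f)"
    "\<And>f. f \<in> A \<Longrightarrow> I (\<lambda>t. f t - S f t) \<le> d" by metis
  have "\<forall>\<phi>\<in>B. \<exists>s. Bochner_Integration.simple_bochner_integrable M s \<and> (\<forall>f\<in>W. cmod (\<phi> f - (LINT t|M. s t * f t)) \<le> e / 2 * N f)"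
    by (intro ballI form_approximation[OF r1] B(2)[rule_format] half_gt_zero e)
  then obtain T where T: "\<And>\<phi>. \<phi> \<in> B \<Longrightarrow> Bochner_Integration.simple_bochner_integrable M (T \<phi>)"
    "\<And>\<phi> f. \<phi> \<in> B \<Longrightarrow> f \<in> W \<Longrightarrow> cmod (\<phi> f - (LINT t|M. T \<phi> t * f t)) \<le> e / 2 * N f" by metis
  obtain f\<^sub>0 where f0: "f\<^sub>0 \<in> W" "\<not> (AE t in M. f\<^sub>0 t = 0)" using ne by blast
  have If0: "0 < I f\<^sub>0"
  proof (rule ccontr)
    assume "\<not> 0 < I f\<^sub>0"
    then have "I f\<^sub>0 = 0" using I_nonneg[of f\<^sub>0] by linarith
    then have "AE t in M. cmod (f\<^sub>0 t) powr r = 0"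
      unfolding I_def by (subst (asm) integral_nonneg_eq_0_iff_AE[OF W_integrable[OF f0(1)]]) auto
    then have "AE t in M. f\<^sub>0 t = 0" by eventually_elim simp
    then show False using f0(2) by simp
  qed
  define d' where "d' = I f\<^sub>0 / (2 powr r * 2)"
  have d': "0 < d'" using If0 by (simp add: d'_def)
  obtain s\<^sub>0 where s0: "Bochner_Integration.simple_bochner_integrable M s\<^sub>0" "I (\<lambda>t. f\<^sub>0 t - s\<^sub>0 t) \<le> d'"
    using approx[OF f0(1) d'] by blast
  define R where "R = insert s\<^sub>0 (S ` A \<union> T ` B)"
  have R: "finite R" "\<And>s. s \<in> R \<Longrightarrow> Bochner_Integration.simple_bochner_integrable M s"
    using A(1) B(1) S(1) T(1) s0(1) by (auto simp: R_def)
  obtain \<E> where \<E>: "finite_cells M \<E>"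
    and rep: "\<forall>s\<in>R. \<exists>c. AE t in M. s t = (\<Sum>E\<in>\<E>. c E * indicator E t)"
    using simple_cells[OF R] by blast
  note D = finite_cellsD[OF \<E>]
  have ne\<E>: "\<E> \<noteq> {}"
  proof
    assume "\<E> = {}"
    have "s\<^sub>0 \<in> R" by (simp add: R_def)
    then have "AE t in M. s\<^sub>0 t = 0" using rep \<open>\<E> = {}\<close> by force
    then have "I (\<lambda>t. f\<^sub>0 t - s\<^sub>0 t) = I f\<^sub>0"
      by (intro I_cong_AE W_diff f0(1) simple_in_W s0(1)) (auto elim: eventually_mono)
    then have "I f\<^sub>0 \<le> I f\<^sub>0 / (2 powr r * 2)" using s0(2) by (simp add: d'_def)
    moreover have "1 powr r \<le> (2::real) powr r" using r by (intro powr_mono2) auto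
    then have "I f\<^sub>0 / (2 powr r * 2) \<le> I f\<^sub>0 / (1 * 2)" using If0 by (intro divide_left_mono mult_mono) auto
    ultimately show False using If0 by simp
  qed
  define P where "P = (\<lambda>f t. \<Sum>E\<in>\<E>. cell_form E f * cell_vector E t)"
  have PW: "P f \<in> W" for f unfolding P_def by (rule cell_step(1)[OF \<E>])
  have IP: "I (P f) \<le> I f" if "f \<in> W" for f
    unfolding P_def cell_step(2)[OF \<E>] by (rule sum_cell_form_powr_le[OF \<E> that])
  have NP: "N (P f) \<le> N f" if "f \<in> W" for f
    unfolding N_eq using r IP[OF that] I_nonneg by (intro powr_mono2) auto
  have "approximating_system W N A B e \<E> cell_vector cell_form"
    unfolding approximating_system_def
  proof (intro conjI ballI allI impI D(1) ne\<E>)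
    fix E assume E: "E \<in> \<E>"
    have "(\<lambda>t. \<Sum>E'\<in>\<E>. (if E' = E then 1 else 0) * cell_vector E' t) \<in> W" by (rule cell_step(1)[OF \<E>])
    moreover have "(\<lambda>t. \<Sum>E'\<in>\<E>. (if E' = E then 1 else 0) * cell_vector E' t) = cell_vector E"
    proof
      fix t
      have "(\<Sum>E'\<in>\<E>. (if E' = E then 1 else 0) * cell_vector E' t) = (\<Sum>E'\<in>\<E>. if E' = E then cell_vector E' t else 0)"
        by (intro sum.cong) auto
      then show "(\<Sum>E'\<in>\<E>. (if E' = E then 1 else 0) * cell_vector E' t) = cell_vector E t"
        using D(1) E by simp
    qed
    ultimately show "cell_vector E \<in> W" by simp
    show "bounded_form W N (cell_form E)" by (rule cell_form_bounded[OF \<E> E])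
  next
    fix E E' assume "E \<in> \<E>" "E' \<in> \<E>"
    then show "cell_form E' (cell_vector E) = (if E = E' then 1 else 0)" by (rule cell_form_cell_vector[OF \<E>])
  next
    fix \<sigma> s f assume \<sigma>: "bij_betw \<sigma> \<E> \<E>" and s: "\<forall>E\<in>\<E>. s E \<in> {1, - 1 :: complex}" and f: "f \<in> W"
    have "I (\<lambda>t. \<Sum>E\<in>\<E>. s E * cell_form (\<sigma> E) f * cell_vector E t) = (\<Sum>E\<in>\<E>. cmod (s E * cell_form (\<sigma> E) f) powr r)"
      by (rule cell_step(2)[OF \<E>])
    also have "\<dots> = (\<Sum>E\<in>\<E>. cmod (cell_form (\<sigma> E) f) powr r)"
    proof (rule sum.cong[OF refl])
      fix E assume "E \<in> \<E>"
      then have "cmod (s E) = 1" using s by fastforce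
      then show "cmod (s E * cell_form (\<sigma> E) f) powr r = cmod (cell_form (\<sigma> E) f) powr r" by (simp add: norm_mult)
    qed
    also have "\<dots> = (\<Sum>E\<in>\<E>. cmod (cell_form E f) powr r)"
      by (rule sum.reindex_bij_betw[OF \<sigma>])
    also have "\<dots> \<le> I f" by (rule sum_cell_form_powr_le[OF \<E> f])
    finally show "N (\<lambda>t. \<Sum>E\<in>\<E>. s E * cell_form (\<sigma> E) f * cell_vector E t) \<le> N f"
      unfolding N_eq using r I_nonneg by (intro powr_mono2) auto
  next
    fix f assume fA: "f \<in> A"
    then have f: "f \<in> W" using A by auto
    have sW: "S f \<in> W" by (rule simple_in_W[OF S(1)[OF fA]])
    have g: "(\<lambda>t. f t - S f t) \<in> W" by (rule W_diff[OF f sW])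
    have "S f \<in> R" using fA by (simp add: R_def)
    then obtain c where c: "AE t in M. S f t = (\<Sum>E\<in>\<E>. c E * indicator E t)" using rep by blast
    have add: "cell_form E f = cell_form E (\<lambda>t. f t - S f t) + cell_form E (S f)" if "E \<in> \<E>" for E
      using cell_form_linear(1)[OF D(2,3)[OF that] g sW] by simp
    have Padd: "P f t = P (\<lambda>t. f t - S f t) t + P (S f) t" for t
      unfolding P_def sum.distrib[symmetric]
      by (rule sum.cong[OF refl]) (simp only: add distrib_right)
    have "AE t in M. P (S f) t = S f t"
      unfolding P_def by (rule step_projection(1)[OF \<E> sW c])
    then have "AE t in M. P f t - f t = P (\<lambda>t. f t - S f t) t + - 1 * (f t - S f t)"
      by eventually_elim (simp add: Padd)
    then have "I (\<lambda>t. P f t - f t) = I (\<lambda>t. P (\<lambda>t. f t - S f t) t + - 1 * (f t - S f t))"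
      by (intro I_cong_AE W_diff PW f Lp_functions_add Lp_functions_smult g)
    also have "\<dots> \<le> 2 powr r * (I (P (\<lambda>t. f t - S f t)) + I (\<lambda>t. - 1 * (f t - S f t)))"
      by (intro I_add_le PW Lp_functions_smult g)
    also have "I (\<lambda>t. - 1 * (f t - S f t)) = I (\<lambda>t. f t - S f t)" by (simp add: I_def norm_minus_commute)
    also have "2 powr r * (I (P (\<lambda>t. f t - S f t)) + I (\<lambda>t. f t - S f t)) \<le> 2 powr r * (d + d)"
      using IP[OF g] S(2)[OF fA] by (intro mult_left_mono add_mono) auto
    also have "\<dots> = e powr r" by (simp add: d_def)
    finally have "N (\<lambda>t. P f t - f t) \<le> e" using e by (subst N_le_iff) auto
    then show "N (\<lambda>t. (\<Sum>E\<in>\<E>. cell_form E f * cell_vector E t) - f t) \<le> e" by (simp only: P_def)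
  next
    fix \<phi> f assume \<phi>: "\<phi> \<in> B" and f: "f \<in> W"
    have "T \<phi> \<in> R" using \<phi> by (simp add: R_def)
    then obtain c where c: "AE t in M. T \<phi> t = (\<Sum>E\<in>\<E>. c E * indicator E t)" using rep by blast
    have eq: "(LINT t|M. T \<phi> t * P f t) = (LINT t|M. T \<phi> t * f t)"
      unfolding P_def by (rule step_projection(2)[OF \<E> simple_in_W[OF T(1)[OF \<phi>]] c f])
    have 1: "cmod (\<phi> (P f) - (LINT t|M. T \<phi> t * P f t)) \<le> e / 2 * N (P f)" by (rule T(2)[OF \<phi> PW])
    have "e / 2 * N (P f) \<le> e / 2 * N f" using NP[OF f] e by (intro mult_left_mono) auto
    with 1 T(2)[OF \<phi> f] have "cmod (\<phi> (P f) - \<phi> f) \<le> e / 2 * N f + e / 2 * N f"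
      unfolding eq using norm_triangle_ineq4[of "\<phi> (P f) - (LINT t|M. T \<phi> t * f t)" "\<phi> f - (LINT t|M. T \<phi> t * f t)"]
      by simp
    then show "cmod (\<phi> (\<lambda>t. \<Sum>E\<in>\<E>. cell_form E f * cell_vector E t) - \<phi> f) \<le> e * N f"
      by (simp add: P_def)
  qed
  then show ?thesis by blast
qed

end

section \<open>Densities of functionals on integrable functions\<close>

text \<open>
  A weight selects the part of the measure space where it is positive. On that part the measure is
  \<open>\<sigma>\<close>-finite, and every integrable function lives on such a part.
\<close>

definition weight :: "'a measure \<Rightarrow> ('a \<Rightarrow> real) \<Rightarrow> bool" where
  "weight M w \<longleftrightarrow> integrable M w \<and> (\<forall>t. 0 \<le> w t)"

lemma L1_iff: "f \<in> Lp_functions M 1 \<longleftrightarrow> integrable M f"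
proof -
  have "f \<in> Lp_functions M 1 \<longleftrightarrow> f \<in> borel_measurable M \<and> integrable M (\<lambda>t. cmod (f t))"
    by (simp add: Lp_functions_def)
  then show ?thesis by (metis borel_measurable_integrable integrable_norm integrable_norm_cancel)
qed

lemma L1_seminorm: "Lp_seminorm M 1 f = (LINT t|M. cmod (f t))"
  by (simp add: Lp_seminorm_def integral_nonneg_AE)

lemma AE_nonpos_of_set_integrals:
  fixes h :: "'a \<Rightarrow> real"
  assumes h: "integrable M h" and le: "\<And>E. E \<in> sets M \<Longrightarrow> (LINT t|M. indicator E t * h t) \<le> 0"
  shows "AE t in M. h t \<le> 0"
proof -
  have [measurable]: "h \<in> borel_measurable M" using h by simp
  define E where "E = {t \<in> space M. 0 < h t}"
  have E: "E \<in> sets M" unfolding E_def by measurable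
  have i: "integrable M (\<lambda>t. indicator E t * h t)" using integrable_mult_indicator[OF E h] by simp
  have "0 \<le> (LINT t|M. indicator E t * h t)" by (intro integral_nonneg_AE AE_I2) (auto simp: E_def indicator_def)
  then have "(LINT t|M. indicator E t * h t) = 0" using le[OF E] by simp
  then have "AE t in M. indicator E t * h t = 0"
    by (subst (asm) integral_nonneg_eq_0_iff_AE[OF i]) (auto simp: E_def indicator_def)
  then show ?thesis using AE_space by eventually_elim (auto simp: E_def indicator_def split: if_splits)
qed

lemma AE_zero_of_set_integrals:
  fixes h :: "'a \<Rightarrow> complex"
  assumes h: "integrable M h" and eq: "\<And>E. E \<in> sets M \<Longrightarrow> (LINT t|M. indicator E t * h t) = 0"
  shows "AE t in M. h t = 0"
proof -
  have re: "(LINT t|M. indicator E t * Re (h t)) = 0" "(LINT t|M. indicator E t * Im (h t)) = 0" if E: "E \<in> sets M" for E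
  proof -
    have i: "integrable M (\<lambda>t. indicator E t * h t)"
      using integrable_mult_indicator[OF E h] by (simp add: scaleR_conv_of_real of_real_indicator)
    have "(LINT t|M. Re (indicator E t * h t)) = 0" "(LINT t|M. Im (indicator E t * h t)) = 0"
      using integral_Re[OF i] integral_Im[OF i] eq[OF E] by simp_all
    moreover have "(\<lambda>t. Re (indicator E t * h t)) = (\<lambda>t. indicator E t * Re (h t))"
      "(\<lambda>t. Im (indicator E t * h t)) = (\<lambda>t. indicator E t * Im (h t))" by (auto simp: indicator_def)
    ultimately show "(LINT t|M. indicator E t * Re (h t)) = 0" "(LINT t|M. indicator E t * Im (h t)) = 0" by simp_all
  qed
  have iRe: "integrable M (\<lambda>t. Re (h t))" "integrable M (\<lambda>t. Im (h t))" using h by simp_all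
  have "AE t in M. Re (h t) \<le> 0" "AE t in M. Im (h t) \<le> 0"
    by (rule AE_nonpos_of_set_integrals[OF iRe(1)], simp add: re) (rule AE_nonpos_of_set_integrals[OF iRe(2)], simp add: re)
  moreover have "AE t in M. - Re (h t) \<le> 0" "AE t in M. - Im (h t) \<le> 0"
    by (rule AE_nonpos_of_set_integrals[OF Bochner_Integration.integrable_minus[OF iRe(1)]], simp add: re)
      (rule AE_nonpos_of_set_integrals[OF Bochner_Integration.integrable_minus[OF iRe(2)]], simp add: re)
  ultimately show ?thesis by eventually_elim (simp add: complex_eq_iff)
qed

text \<open>
  The bound makes \<open>L + C \<integral> w\<close> a finite measure that is absolutely continuous with respect to the finite
  measure with density \<open>w\<close>; apply the Radon-Nikodym theorem to it and subtract \<open>C\<close>. The resulting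
  function obeys the bound only almost everywhere on \<open>w \<noteq> 0\<close>; where it fails it is replaced by zero.
\<close>

lemma real_density:
  assumes w: "weight M w" and C: "0 \<le> C"
    and add: "\<And>E E'. E \<in> sets M \<Longrightarrow> E' \<in> sets M \<Longrightarrow> E \<inter> E' = {} \<Longrightarrow> L (E \<union> E') = L E + L E'"
    and bound: "\<And>E. E \<in> sets M \<Longrightarrow> \<bar>L E\<bar> \<le> C * (LINT t|M. indicator E t * w t)"
  shows "\<exists>g \<in> borel_measurable M. (\<forall>t. \<bar>g t\<bar> \<le> C) \<and>
    (\<forall>E\<in>sets M. L E = (LINT t|M. indicator E t * (g t * w t)))"
proof -
  have wi: "integrable M w" and w0: "\<And>t. 0 \<le> w t" using w by (auto simp: weight_def)
  have [measurable]: "w \<in> borel_measurable M" using wi by simp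
  define \<mu> where "\<mu> = density M (\<lambda>t. ennreal (w t))"
  have s\<mu> [measurable_cong]: "sets \<mu> = sets M" by (simp add: \<mu>_def)
  have sp\<mu>: "space \<mu> = space M" by (simp add: \<mu>_def)
  have iw: "integrable M (\<lambda>t. indicator E t * w t)" if "E \<in> sets M" for E
    using integrable_mult_indicator[OF that wi] by simp
  define m where "m = (\<lambda>E. LINT t|M. indicator E t * w t)"
  have em: "emeasure \<mu> E = ennreal (m E)" if E: "E \<in> sets M" for E
  proof -
    have "emeasure \<mu> E = (\<integral>\<^sup>+t. ennreal (w t) * indicator E t \<partial>M)"
      unfolding \<mu>_def using E by (intro emeasure_density) auto
    also have "\<dots> = (\<integral>\<^sup>+t. ennreal (indicator E t * w t) \<partial>M)"
      by (intro nn_integral_cong) (auto simp: indicator_def)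
    also have "\<dots> = ennreal (m E)"
      unfolding m_def using w0 by (intro nn_integral_eq_integral iw[OF E]) auto
    finally show ?thesis .
  qed
  have m0: "0 \<le> m E" for E unfolding m_def using w0 by (intro integral_nonneg_AE) auto
  have meas: "measure \<mu> E = m E" if "E \<in> sets M" for E using em[OF that] m0 by (simp add: measure_def)
  interpret \<mu>: finite_measure \<mu>
    by (rule finite_measureI) (simp add: sp\<mu> em)
  have L0: "L {} = 0" using add[of "{}" "{}"] by simp
  define \<nu> where "\<nu> = (\<lambda>E. L E + C * m E)"
  have \<nu>0: "0 \<le> \<nu> E" if "E \<in> sets M" for E using bound[OF that] by (simp add: \<nu>_def m_def abs_le_iff)
  have Lsum: "(\<lambda>i. L (A i)) sums L (\<Union>i. A i)" if A: "range A \<subseteq> sets M" "disjoint_family A" for A :: "nat \<Rightarrow> 'a set"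
  proof -
    have As: "A i \<in> sets M" for i using A by auto
    have part: "(\<Sum>i<n. L (A i)) = L (\<Union>i<n. A i)" for n
    proof (induction n)
      case (Suc n)
      have "A i \<inter> A n = {}" if "i < n" for i using A(2) that unfolding disjoint_family_on_def by simp
      then have "(\<Union>i<n. A i) \<inter> A n = {}" by blast
      then have "L ((\<Union>i<n. A i) \<union> A n) = L (\<Union>i<n. A i) + L (A n)" using As by (intro add) auto
      moreover have "(\<Union>i<Suc n. A i) = (\<Union>i<n. A i) \<union> A n" by (auto simp: lessThan_Suc)
      ultimately show ?case using Suc by simp
    qed (simp add: L0)
    have partm: "(\<Sum>i<n. m (A i)) = m (\<Union>i<n. A i)" for n
    proof -
      have "(\<Sum>i<n. measure \<mu> (A i)) = measure \<mu> (\<Union>i<n. A i)"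
        using A(2) As s\<mu> by (intro \<mu>.finite_measure_finite_Union[symmetric])
          (auto intro: disjoint_family_on_mono)
      then show ?thesis using As by (simp add: meas sets.finite_UN)
    qed
    have U: "(\<Union>i. A i) \<in> sets M" "(\<Union>i<n. A i) \<in> sets M" for n using As by auto
    have "(\<lambda>i. measure \<mu> (A i)) sums measure \<mu> (\<Union>i. A i)"
      using A s\<mu> by (intro \<mu>.finite_measure_UNION) auto
    then have "(\<lambda>n. \<Sum>i<n. m (A i)) \<longlonglongrightarrow> m (\<Union>i. A i)"
      unfolding sums_def using As U by (simp add: meas)
    then have lim: "(\<lambda>n. C * (m (\<Union>i. A i) - m (\<Union>i<n. A i))) \<longlonglongrightarrow> C * (m (\<Union>i. A i) - m (\<Union>i. A i))"
      unfolding partm by (intro tendsto_intros)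
    have "(\<lambda>n. L (\<Union>i. A i) - (\<Sum>i<n. L (A i))) \<longlonglongrightarrow> 0"
    proof (rule Lim_null_comparison)
      show "(\<lambda>n. C * (m (\<Union>i. A i) - m (\<Union>i<n. A i))) \<longlonglongrightarrow> 0" using lim by simp
      show "\<forall>\<^sub>F n in sequentially. norm (L (\<Union>i. A i) - (\<Sum>i<n. L (A i))) \<le> C * (m (\<Union>i. A i) - m (\<Union>i<n. A i))"
      proof (intro always_eventually allI)
        fix n
        define D where "D = (\<Union>i. A i) - (\<Union>i<n. A i)"
        have D: "D \<in> sets M" "(\<Union>i<n. A i) \<inter> D = {}" "(\<Union>i<n. A i) \<union> D = (\<Union>i. A i)"
          using U by (auto simp: D_def)
        have "L (\<Union>i. A i) = L (\<Union>i<n. A i) + L D" using add[OF U(2) D(1,2)] D(3) by simp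
        moreover have "m (\<Union>i. A i) = m (\<Union>i<n. A i) + m D"
        proof -
          have "m (\<Union>i. A i) = (LINT t|M. indicator (\<Union>i<n. A i) t * w t + indicator D t * w t)"
            unfolding m_def by (intro Bochner_Integration.integral_cong) (auto simp: D_def indicator_def)
          then show ?thesis unfolding m_def using iw[OF U(2)] iw[OF D(1)] by simp
        qed
        ultimately show "norm (L (\<Union>i. A i) - (\<Sum>i<n. L (A i))) \<le> C * (m (\<Union>i. A i) - m (\<Union>i<n. A i))"
          using bound[OF D(1)] by (simp add: part m_def)
      qed
    qed
    then have "(\<lambda>n. L (\<Union>i. A i) - (L (\<Union>i. A i) - (\<Sum>i<n. L (A i)))) \<longlonglongrightarrow> L (\<Union>i. A i) - 0"
      by (intro tendsto_diff tendsto_const)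
    then show ?thesis by (simp add: sums_def)
  qed
  define K where "K = measure_of (space M) (sets M) (\<lambda>E. ennreal (\<nu> E))"
  have sK: "sets K = sets M" "space K = space M" by (simp_all add: K_def sets.space_closed)
  have eK: "emeasure K E = ennreal (\<nu> E)" if E: "E \<in> sets M" for E
    unfolding K_def
  proof (rule emeasure_measure_of_sigma[OF sets.sigma_algebra_axioms _ _ E])
    show "positive (sets M) (\<lambda>E. ennreal (\<nu> E))" by (simp add: positive_def \<nu>_def L0 m_def)
    show "countably_additive (sets M) (\<lambda>E. ennreal (\<nu> E))"
    proof (rule countably_additiveI)
      fix A :: "nat \<Rightarrow> 'a set" assume A: "range A \<subseteq> sets M" "disjoint_family A" "(\<Union>i. A i) \<in> sets M"
      have As: "A i \<in> sets M" for i using A by auto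
      have "(\<lambda>i. measure \<mu> (A i)) sums measure \<mu> (\<Union>i. A i)"
        using A s\<mu> by (intro \<mu>.finite_measure_UNION) auto
      then have "(\<lambda>i. m (A i)) sums m (\<Union>i. A i)" using As A(3) by (simp add: meas)
      then have "(\<lambda>i. \<nu> (A i)) sums \<nu> (\<Union>i. A i)"
        unfolding \<nu>_def by (intro sums_add sums_mult Lsum A)
      then show "(\<Sum>i. ennreal (\<nu> (A i))) = ennreal (\<nu> (\<Union>i. A i))"
        using \<nu>0[OF As] by (intro suminf_ennreal_eq) auto
    qed
  qed
  have finK: "finite_measure K" by (rule finite_measureI) (simp add: sK eK)
  have acK: "absolutely_continuous \<mu> K"
    unfolding absolutely_continuous_def
  proof
    fix E assume "E \<in> null_sets \<mu>"
    then have E: "E \<in> sets M" "emeasure \<mu> E = 0" using s\<mu> by auto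
    then have "m E = 0" using em[OF E(1)] m0[of E] by simp
    then have "\<nu> E = 0" using bound[OF E(1)] by (simp add: \<nu>_def m_def)
    then show "E \<in> null_sets K" using E(1) eK[OF E(1)] sK by (simp add: null_sets_def)
  qed
  obtain D where D: "D \<in> borel_measurable \<mu>" "AE t in \<mu>. RN_deriv \<mu> K t = ennreal (D t)" "\<And>t. 0 \<le> D t"
    using \<mu>.real_RN_deriv[OF finK acK] sK s\<mu> by metis
  have Dm [measurable]: "D \<in> borel_measurable M" using D(1) s\<mu> by (simp cong: measurable_cong_sets)
  have \<nu>D: "ennreal (\<nu> E) = (\<integral>\<^sup>+t. ennreal (indicator E t * (D t * w t)) \<partial>M)" if E: "E \<in> sets M" for E
  proof -
    have "ennreal (\<nu> E) = emeasure (density \<mu> (RN_deriv \<mu> K)) E"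
      using \<mu>.density_RN_deriv[OF acK] sK s\<mu> eK[OF E] by simp
    also have "\<dots> = (\<integral>\<^sup>+t. RN_deriv \<mu> K t * indicator E t \<partial>\<mu>)"
      using E s\<mu> by (intro emeasure_density) auto
    also have "\<dots> = (\<integral>\<^sup>+t. ennreal (D t) * indicator E t \<partial>\<mu>)"
      using D(2) by (intro nn_integral_cong_AE) (auto elim: eventually_mono)
    also have "\<dots> = (\<integral>\<^sup>+t. ennreal (w t) * (ennreal (D t) * indicator E t) \<partial>M)"
      unfolding \<mu>_def using E by (intro nn_integral_density) auto
    also have "\<dots> = (\<integral>\<^sup>+t. ennreal (indicator E t * (D t * w t)) \<partial>M)"
      using D(3) w0 by (intro nn_integral_cong) (auto simp: indicator_def ennreal_mult mult.commute)
    finally show ?thesis .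
  qed
  have iD: "integrable M (\<lambda>t. D t * w t)"
  proof (rule integrableI_bounded)
    have "(\<integral>\<^sup>+t. ennreal (norm (D t * w t)) \<partial>M) = (\<integral>\<^sup>+t. ennreal (indicator (space M) t * (D t * w t)) \<partial>M)"
      using D(3) w0 by (intro nn_integral_cong) (auto simp: abs_mult)
    also have "\<dots> = ennreal (\<nu> (space M))" by (rule \<nu>D[symmetric]) simp
    finally show "(\<integral>\<^sup>+t. ennreal (norm (D t * w t)) \<partial>M) < \<infinity>" by simp
  qed simp
  have iED: "integrable M (\<lambda>t. indicator E t * (D t * w t))" if "E \<in> sets M" for E
    using integrable_mult_indicator[OF that iD] by simp
  have \<nu>I: "\<nu> E = (LINT t|M. indicator E t * (D t * w t))" if E: "E \<in> sets M" for E
  proof -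
    have "ennreal (\<nu> E) = ennreal (LINT t|M. indicator E t * (D t * w t))"
      unfolding \<nu>D[OF E] using D(3) w0 by (intro nn_integral_eq_integral iED[OF E]) auto
    moreover have "0 \<le> (LINT t|M. indicator E t * (D t * w t))" using D(3) w0 by (intro integral_nonneg_AE) auto
    ultimately show ?thesis using \<nu>0[OF E] by simp
  qed
  have L_eq: "L E = (LINT t|M. indicator E t * ((D t - C) * w t))" if E: "E \<in> sets M" for E
  proof -
    have "(LINT t|M. indicator E t * ((D t - C) * w t)) =
        (LINT t|M. indicator E t * (D t * w t) - C * (indicator E t * w t))"
      by (intro Bochner_Integration.integral_cong) (auto simp: algebra_simps)
    also have "\<dots> = \<nu> E - C * m E" using iED[OF E] iw[OF E] by (simp add: \<nu>I[OF E] m_def)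
    finally show ?thesis by (simp add: \<nu>_def)
  qed
  have "AE t in M. (D t - 2 * C) * w t \<le> 0"
  proof (rule AE_nonpos_of_set_integrals)
    show "integrable M (\<lambda>t. (D t - 2 * C) * w t)" using iD wi by (simp add: left_diff_distrib)
    fix E assume E: "E \<in> sets M"
    have "(LINT t|M. indicator E t * ((D t - 2 * C) * w t)) =
        (LINT t|M. indicator E t * (D t * w t) - 2 * C * (indicator E t * w t))"
      by (intro Bochner_Integration.integral_cong) (auto simp: algebra_simps)
    also have "\<dots> = \<nu> E - 2 * C * m E" using iED[OF E] iw[OF E] by (simp add: \<nu>I[OF E] m_def)
    also have "\<dots> \<le> 0" using bound[OF E] by (simp add: \<nu>_def m_def abs_le_iff)
    finally show "(LINT t|M. indicator E t * ((D t - 2 * C) * w t)) \<le> 0" .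
  qed
  then have small: "AE t in M. w t \<noteq> 0 \<longrightarrow> D t \<le> 2 * C"
  proof eventually_elim
    case (elim t)
    show ?case
    proof
      assume "w t \<noteq> 0"
      then have "0 < w t" using w0[of t] by simp
      then show "D t \<le> 2 * C" using elim by (simp add: mult_le_0_iff)
    qed
  qed
  define g where "g = (\<lambda>t. if D t \<le> 2 * C then D t - C else 0)"
  show ?thesis
  proof (intro bexI[of _ g] conjI allI ballI)
    show "g \<in> borel_measurable M" unfolding g_def by measurable
    show "\<bar>g t\<bar> \<le> C" for t using D(3)[of t] C by (auto simp: g_def abs_le_iff)
    fix E assume E: "E \<in> sets M"
    show "L E = (LINT t|M. indicator E t * (g t * w t))"
      unfolding L_eq[OF E]
    proof (rule integral_cong_AE)
      show "(\<lambda>t. indicator E t * ((D t - C) * w t)) \<in> borel_measurable M"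
        "(\<lambda>t. indicator E t * (g t * w t)) \<in> borel_measurable M"
        unfolding g_def using E by measurable
      show "AE t in M. indicator E t * ((D t - C) * w t) = indicator E t * (g t * w t)"
        using small by eventually_elim (auto simp: g_def)
    qed
  qed
qed

text \<open>
  Densities of the set functions \<open>E \<mapsto> Re (\<phi> (1\<^sub>E w))\<close> and \<open>E \<mapsto> Im (\<phi> (1\<^sub>E w))\<close>. The difference \<open>\<Psi>\<close> of
  both sides vanishes on indicators, hence on simple functions, and it is continuous for bounded
  pointwise convergence.
\<close>

lemma functional_density:
  assumes \<phi>: "bounded_form (Lp_functions M 1) (Lp_seminorm M 1) \<phi>"
    and C: "0 \<le> C" "\<And>f. f \<in> Lp_functions M 1 \<Longrightarrow> cmod (\<phi> f) \<le> C * Lp_seminorm M 1 f" and w: "weight M w"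
  shows "\<exists>g \<in> borel_measurable M. (\<forall>t. \<bar>Re (g t)\<bar> \<le> C \<and> \<bar>Im (g t)\<bar> \<le> C) \<and>
    (\<forall>k \<in> borel_measurable M. \<forall>c. (\<forall>t. cmod (k t) \<le> c) \<longrightarrow>
       \<phi> (\<lambda>t. k t * of_real (w t)) = (LINT t|M. k t * (g t * of_real (w t))))"
proof -
  have wi: "integrable M w" and w0: "\<And>t. 0 \<le> w t" using w by (auto simp: weight_def)
  have wm [measurable]: "w \<in> borel_measurable M" using wi by simp
  have wc: "integrable M (\<lambda>t. complex_of_real (w t))" using wi by simp
  have kw: "integrable M (\<lambda>t. k t * of_real (w t))" if "k \<in> borel_measurable M" "\<And>t. cmod (k t) \<le> c" for k c
  proof (rule Bochner_Integration.integrable_bound[of M "\<lambda>t. c * w t"])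
    show "AE t in M. norm (k t * of_real (w t)) \<le> norm (c * w t)"
    proof (rule AE_I2)
      fix t
      have "cmod (k t) * w t \<le> \<bar>c\<bar> * w t" using that(2)[of t] w0[of t] by (intro mult_right_mono) auto
      then show "norm (k t * of_real (w t)) \<le> norm (c * w t)" using w0[of t] by (simp add: norm_mult abs_mult)
    qed
  qed (use that wi in auto)
  define ind where "ind = (\<lambda>E t. indicator E t * complex_of_real (w t))"
  have ind: "ind E \<in> Lp_functions M 1" if "E \<in> sets M" for E
    unfolding L1_iff ind_def using that by (intro kw[of _ 1]) (auto simp: indicator_def)
  have indN: "Lp_seminorm M 1 (ind E) = (LINT t|M. indicator E t * w t)" for E
    unfolding L1_seminorm ind_def using w0 by (intro Bochner_Integration.integral_cong) (auto simp: indicator_def)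
  have add: "\<phi> (ind (E \<union> E')) = \<phi> (ind E) + \<phi> (ind E')" if "E \<in> sets M" "E' \<in> sets M" "E \<inter> E' = {}" for E E'
  proof -
    have "ind (E \<union> E') = (\<lambda>t. ind E t + ind E' t)" using that(3) by (auto simp: ind_def indicator_def fun_eq_iff)
    then show ?thesis using bounded_form_add[OF \<phi> ind[OF that(1)] ind[OF that(2)]] by simp
  qed
  have bd: "cmod (\<phi> (ind E)) \<le> C * (LINT t|M. indicator E t * w t)" if "E \<in> sets M" for E
    using C(2)[OF ind[OF that]] by (simp only: indN)
  have "\<exists>g \<in> borel_measurable M. (\<forall>t. \<bar>g t\<bar> \<le> C) \<and>
      (\<forall>E\<in>sets M. Re (\<phi> (ind E)) = (LINT t|M. indicator E t * (g t * w t)))"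
  proof (rule real_density[OF w C(1)])
    fix E assume "E \<in> sets M"
    then show "\<bar>Re (\<phi> (ind E))\<bar> \<le> C * (LINT t|M. indicator E t * w t)"
      using bd order_trans[OF abs_Re_le_cmod] by blast
  qed (simp add: add)
  then obtain a where a: "a \<in> borel_measurable M" "\<And>t. \<bar>a t\<bar> \<le> C"
    "\<And>E. E \<in> sets M \<Longrightarrow> Re (\<phi> (ind E)) = (LINT t|M. indicator E t * (a t * w t))" by blast
  have "\<exists>g \<in> borel_measurable M. (\<forall>t. \<bar>g t\<bar> \<le> C) \<and>
      (\<forall>E\<in>sets M. Im (\<phi> (ind E)) = (LINT t|M. indicator E t * (g t * w t)))"
  proof (rule real_density[OF w C(1)])
    fix E assume "E \<in> sets M"
    then show "\<bar>Im (\<phi> (ind E))\<bar> \<le> C * (LINT t|M. indicator E t * w t)"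
      using bd order_trans[OF abs_Im_le_cmod] by blast
  qed (simp add: add)
  then obtain b where b: "b \<in> borel_measurable M" "\<And>t. \<bar>b t\<bar> \<le> C"
    "\<And>E. E \<in> sets M \<Longrightarrow> Im (\<phi> (ind E)) = (LINT t|M. indicator E t * (b t * w t))" by blast
  note [measurable] = a(1) b(1)
  define g where "g = (\<lambda>t. Complex (a t) (b t))"
  have gab: "g = (\<lambda>t. of_real (a t) + \<i> * of_real (b t))" by (auto simp: g_def complex_eq_iff)
  have gm [measurable]: "g \<in> borel_measurable M" unfolding gab by measurable
  have gC: "\<bar>Re (g t)\<bar> \<le> C" "\<bar>Im (g t)\<bar> \<le> C" for t using a(2) b(2) by (simp_all add: g_def)
  have g2: "cmod (g t) \<le> 2 * C" for t using cmod_le[of "g t"] gC[of t] by linarith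
  have gw: "integrable M (\<lambda>t. g t * of_real (w t))" by (rule kw[OF gm g2])
  have kgw: "integrable M (\<lambda>t. k t * (g t * of_real (w t)))" if k: "k \<in> borel_measurable M" "\<And>t. cmod (k t) \<le> c" for k c
  proof -
    have "cmod (k t * g t) \<le> c * (2 * C)" for t
      unfolding norm_mult using k(2)[of t] g2[of t] order_trans[OF norm_ge_zero k(2)[of t]] by (intro mult_mono) auto
    from kw[OF _ this] k(1) show ?thesis by (simp add: mult.assoc)
  qed
  have setE: "\<phi> (ind E) = (LINT t|M. indicator E t * (g t * of_real (w t)))" if E: "E \<in> sets M" for E
  proof -
    have i: "integrable M (\<lambda>t. indicator E t * (g t * of_real (w t)))"
      using E by (intro kgw[of _ 1]) (auto simp: indicator_def)
    have "Re (LINT t|M. indicator E t * (g t * of_real (w t))) = (LINT t|M. indicator E t * (a t * w t))"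
      unfolding integral_Re[OF i, symmetric]
      by (intro Bochner_Integration.integral_cong) (auto simp: g_def indicator_def)
    moreover have "Im (LINT t|M. indicator E t * (g t * of_real (w t))) = (LINT t|M. indicator E t * (b t * w t))"
      unfolding integral_Im[OF i, symmetric]
      by (intro Bochner_Integration.integral_cong) (auto simp: g_def indicator_def)
    ultimately show ?thesis using a(3)[OF E] b(3)[OF E] by (simp add: complex_eq_iff)
  qed
  define \<Psi> where "\<Psi> = (\<lambda>k. \<phi> (\<lambda>t. k t * of_real (w t)) - (LINT t|M. k t * (g t * of_real (w t))))"
  have L1: "(\<lambda>t. k t * complex_of_real (w t)) \<in> Lp_functions M 1" if "k \<in> borel_measurable M" "\<And>t. cmod (k t) \<le> c" for k c
    unfolding L1_iff by (rule kw[OF that])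
  have \<Psi>add: "\<Psi> (\<lambda>t. k t + l t) = \<Psi> k + \<Psi> l"
    if k: "k \<in> borel_measurable M" "\<And>t. cmod (k t) \<le> c" and l: "l \<in> borel_measurable M" "\<And>t. cmod (l t) \<le> d" for k l c d
    using bounded_form_add[OF \<phi> L1[OF k] L1[OF l]] Bochner_Integration.integral_add[OF kgw[OF k] kgw[OF l]]
    by (simp add: \<Psi>_def distrib_right)
  have \<Psi>smult: "\<Psi> (\<lambda>t. x * k t) = x * \<Psi> k" if k: "k \<in> borel_measurable M" "\<And>t. cmod (k t) \<le> c" for k c x
    using bounded_form_smult[OF \<phi> L1[OF k], of x] integral_mult_right_zero[of M x "\<lambda>t. k t * (g t * of_real (w t))"]
    by (simp add: \<Psi>_def mult.assoc right_diff_distrib)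
  have \<Psi>bound: "cmod (\<Psi> k) \<le> 3 * C * (LINT t|M. cmod (k t) * w t)"
    if k: "k \<in> borel_measurable M" "\<And>t. cmod (k t) \<le> c" for k c
  proof -
    have i: "integrable M (\<lambda>t. cmod (k t) * w t)"
      using integrable_norm[OF kw[OF k]] w0 by (simp add: norm_mult)
    have "cmod (\<phi> (\<lambda>t. k t * of_real (w t))) \<le> C * (LINT t|M. cmod (k t) * w t)"
      using C(2)[OF L1[OF k]] w0 by (simp add: L1_seminorm norm_mult)
    moreover have "cmod (LINT t|M. k t * (g t * of_real (w t))) \<le> (LINT t|M. cmod (k t * (g t * of_real (w t))))"
      by (rule integral_norm_bound)
    moreover have "\<dots> \<le> (LINT t|M. 2 * C * (cmod (k t) * w t))"
    proof (rule integral_mono[OF integrable_norm[OF kgw[OF k]]])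
      fix t
      have "cmod (g t) * (cmod (k t) * w t) \<le> 2 * C * (cmod (k t) * w t)"
        using g2[of t] w0[of t] by (intro mult_right_mono) auto
      then show "cmod (k t * (g t * of_real (w t))) \<le> 2 * C * (cmod (k t) * w t)"
        using w0[of t] by (simp add: norm_mult mult.left_commute)
    qed (use i in simp)
    moreover have "(LINT t|M. 2 * C * (cmod (k t) * w t)) = 2 * C * (LINT t|M. cmod (k t) * w t)" by simp
    ultimately show ?thesis
      unfolding \<Psi>_def
      using norm_triangle_ineq4[of "\<phi> (\<lambda>t. k t * of_real (w t))" "LINT t|M. k t * (g t * of_real (w t))"] by linarith
  qed
  have \<Psi>ind: "\<Psi> (indicator E) = 0" if "E \<in> sets M" for E
    using setE[OF that] by (simp add: \<Psi>_def ind_def)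
  have \<Psi>simple: "\<Psi> k = 0" if k: "simple_function M k" and kb: "\<And>t. cmod (k t) \<le> c" for k c
  proof -
    have km: "k \<in> borel_measurable M" by (rule borel_measurable_simple_function[OF k])
    have fin: "finite (k ` space M)" and lev: "k -` {v} \<inter> space M \<in> sets M" for v
      using simple_functionD[OF k] by auto
    have fs: "\<Psi> (\<lambda>t. \<Sum>v\<in>V. v * indicator (k -` {v} \<inter> space M) t) = 0" if "finite V" for V
      using that
    proof (induction V rule: finite_induct)
      case empty
      show ?case using \<Psi>smult[of "\<lambda>t. 0" 0 0] by simp
    next
      case (insert v V)
      let ?l = "\<lambda>v. indicator (k -` {v} \<inter> space M) :: 'a \<Rightarrow> complex"
      have lm: "(\<lambda>t. v * ?l v t) \<in> borel_measurable M" for v using lev by measurable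
      have b1: "cmod (v * ?l v t) \<le> cmod v" for v t by (simp add: norm_mult indicator_def)
      have b2: "cmod (\<Sum>v\<in>V. v * ?l v t) \<le> (\<Sum>v\<in>V. cmod v)" for t
        by (rule order_trans[OF norm_sum sum_mono[OF b1]])
      have m2: "(\<lambda>t. \<Sum>v\<in>V. v * ?l v t) \<in> borel_measurable M" using lm by (intro borel_measurable_sum)
      have "\<Psi> (\<lambda>t. v * ?l v t + (\<Sum>v\<in>V. v * ?l v t)) = \<Psi> (\<lambda>t. v * ?l v t) + \<Psi> (\<lambda>t. \<Sum>v\<in>V. v * ?l v t)"
        by (rule \<Psi>add[OF lm b1 m2 b2])
      also have "\<Psi> (\<lambda>t. v * ?l v t) = v * \<Psi> (?l v)"
        by (intro \<Psi>smult[of _ 1] borel_measurable_indicator lev) (simp add: indicator_def)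
      finally show ?case
        by (simp only: sum.insert[OF insert.hyps(1,2)] insert.IH \<Psi>ind[OF lev] mult_zero_right add_0)
    qed
    define k' where "k' = (\<lambda>t. \<Sum>v\<in>k ` space M. v * indicator (k -` {v} \<inter> space M) t)"
    have k'eq: "k' t = k t" if "t \<in> space M" for t
    proof -
      have "k' t = (\<Sum>v\<in>{k t}. v * indicator (k -` {v} \<inter> space M) t)"
        unfolding k'_def using fin that by (intro sum.mono_neutral_right) (auto simp: indicator_def)
      then show ?thesis using that by simp
    qed
    have k'm: "k' \<in> borel_measurable M"
      using km k'eq by (simp cong: measurable_cong)
    have k'b: "cmod (k' t) \<le> c" for t
    proof (cases "t \<in> space M")
      case False
      then have "k' t = 0" by (simp add: k'_def)
      then show ?thesis using order_trans[OF norm_ge_zero kb[of t]] by simp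
    qed (simp add: k'eq kb)
    have d: "(\<lambda>t. k t + - 1 * k' t) \<in> borel_measurable M" using km k'm by measurable
    have db: "cmod (k t + - 1 * k' t) \<le> c + c" for t
      using norm_triangle_ineq4[of "k t" "k' t"] kb[of t] k'b[of t] by simp
    have "(LINT t|M. cmod (k t + - 1 * k' t) * w t) = (LINT t|M. 0)"
      by (intro Bochner_Integration.integral_cong) (auto simp: k'eq)
    then have "\<Psi> (\<lambda>t. k t + - 1 * k' t) = 0" using \<Psi>bound[OF d db] by simp
    moreover have nm: "(\<lambda>t. - 1 * k' t) \<in> borel_measurable M" using k'm by measurable
    have "\<Psi> (\<lambda>t. k t + - 1 * k' t) = \<Psi> k + \<Psi> (\<lambda>t. - 1 * k' t)"
      by (rule \<Psi>add[OF km kb nm, of c]) (simp add: k'b)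
    moreover have "\<Psi> (\<lambda>t. - 1 * k' t) = - 1 * \<Psi> k'" by (rule \<Psi>smult[OF k'm k'b])
    moreover have "\<Psi> k' = 0" unfolding k'_def by (rule fs[OF fin])
    ultimately show ?thesis by simp
  qed
  have "\<Psi> k = 0" if k: "k \<in> borel_measurable M" and kb: "\<And>t. cmod (k t) \<le> c" for k c
  proof -
    obtain s where s: "\<And>n. simple_function M (s n)" "\<And>t. t \<in> space M \<Longrightarrow> (\<lambda>n. s n t) \<longlonglongrightarrow> k t"
      "\<And>n t. t \<in> space M \<Longrightarrow> cmod (s n t) \<le> 2 * cmod (k t)"
    proof -
      obtain s where "\<forall>n. simple_function M (s n)" "\<forall>t\<in>space M. (\<lambda>n. s n t) \<longlonglongrightarrow> k t"
        "\<forall>n. \<forall>t\<in>space M. cmod (s n t) \<le> 2 * cmod (k t)"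
        using borel_measurable_implies_sequence_metric[OF k, of 0] unfolding dist_norm diff_0_right
        by (elim exE conjE) (erule (2) that)
      then show thesis by (intro that[of s]) simp_all
    qed
    define s' where "s' = (\<lambda>n t. if t \<in> space M then s n t else 0)"
    have s'sf: "simple_function M (s' n)" for n
      using s(1)[of n] by (rule simple_function_cong[THEN iffD1, rotated]) (simp add: s'_def)
    have s'm [measurable]: "s' n \<in> borel_measurable M" for n by (rule borel_measurable_simple_function[OF s'sf])
    have c0: "0 \<le> c" by (rule order_trans[OF norm_ge_zero kb])
    have s'b: "cmod (s' n t) \<le> 2 * c" for n t
    proof (cases "t \<in> space M")
      case True
      then show ?thesis using s(3)[OF True, of n] kb[of t] by (simp add: s'_def)
    qed (simp add: s'_def c0)
    have lim: "(\<lambda>n. LINT t|M. cmod (k t - s' n t) * w t) \<longlonglongrightarrow> (LINT t|M. 0)"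
    proof (rule integral_dominated_convergence[where w = "\<lambda>t. 3 * c * w t"])
      show "AE t in M. (\<lambda>n. cmod (k t - s' n t) * w t) \<longlonglongrightarrow> 0"
      proof (rule AE_I2)
        fix t assume t: "t \<in> space M"
        have "(\<lambda>n. cmod (k t - s n t) * w t) \<longlonglongrightarrow> cmod (k t - k t) * w t"
          by (intro tendsto_intros s(2)[OF t])
        then show "(\<lambda>n. cmod (k t - s' n t) * w t) \<longlonglongrightarrow> 0" using t by (simp add: s'_def)
      qed
      show "AE t in M. norm (cmod (k t - s' n t) * w t) \<le> 3 * c * w t" for n
      proof (rule AE_I2)
        fix t
        have "cmod (k t - s' n t) \<le> 3 * c" using norm_triangle_ineq4[of "k t" "s' n t"] kb[of t] s'b[of n t] by linarith
        then show "norm (cmod (k t - s' n t) * w t) \<le> 3 * c * w t" using w0[of t] by (simp add: mult_right_mono)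
      qed
    qed (use wi k in auto)
    have "cmod (\<Psi> k) \<le> 3 * C * (LINT t|M. cmod (k t - s' n t) * w t)" for n
    proof -
      have d: "(\<lambda>t. k t + - 1 * s' n t) \<in> borel_measurable M" using k by measurable
      have db: "cmod (k t + - 1 * s' n t) \<le> c + 2 * c" for t
        using norm_triangle_ineq4[of "k t" "s' n t"] kb[of t] s'b[of n t] by simp
      have "\<Psi> (\<lambda>t. (k t + - 1 * s' n t) + s' n t) = \<Psi> (\<lambda>t. k t + - 1 * s' n t) + \<Psi> (s' n)"
        by (rule \<Psi>add[OF d db s'm s'b])
      then have "\<Psi> k = \<Psi> (\<lambda>t. k t + - 1 * s' n t)" using \<Psi>simple[OF s'sf s'b] by simp
      then show ?thesis using \<Psi>bound[OF d db] by simp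
    qed
    moreover have "(\<lambda>n. 3 * C * (LINT t|M. cmod (k t - s' n t) * w t)) \<longlonglongrightarrow> 3 * C * (LINT t|M. 0)"
      by (intro tendsto_intros lim)
    ultimately have "cmod (\<Psi> k) \<le> 3 * C * (LINT t|M. 0)" by (intro LIMSEQ_le_const) auto
    then show ?thesis by simp
  qed
  then show ?thesis using gm gC unfolding \<Psi>_def by (intro bexI[of _ g]) auto
qed

section \<open>Local colourings\<close>

lemma indicator_times_integrable:
  fixes f :: "'a \<Rightarrow> complex"
  assumes "E \<in> sets M" "integrable M f"
  shows "integrable M (\<lambda>t. indicator E t * f t)"
  using integrable_mult_indicator[OF assms] by (simp add: scaleR_conv_of_real of_real_indicator)

lemma real_indicator_times_integrable:
  fixes f :: "'a \<Rightarrow> real"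
  assumes "E \<in> sets M" "integrable M f"
  shows "integrable M (\<lambda>t. indicator E t * f t)"
  using integrable_mult_indicator[OF assms] by simp

lemma weight_integrable: "weight M w \<Longrightarrow> integrable M w"
  by (simp add: weight_def)

lemma weight_nonneg: "weight M w \<Longrightarrow> 0 \<le> w t"
  by (simp add: weight_def)

lemma weight_cmod: "integrable M f \<Longrightarrow> weight M (\<lambda>t. cmod (f t))"
  by (simp add: weight_def)

lemma weight_add: "weight M w \<Longrightarrow> weight M w' \<Longrightarrow> weight M (\<lambda>t. w t + w' t)"
  by (simp add: weight_def)

lemma bounded_form_L1_sum:
  assumes \<phi>: "bounded_form (Lp_functions M 1) N \<phi>" and I: "finite I"
    and x: "\<And>i. i \<in> I \<Longrightarrow> integrable M (x i)"
  shows "\<phi> (\<lambda>t. \<Sum>i\<in>I. c i * x i t) = (\<Sum>i\<in>I. c i * \<phi> (x i))"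
  using I x
proof (induction I rule: finite_induct)
  case empty
  have "\<phi> (\<lambda>t. 0 * 0) = 0 * \<phi> (\<lambda>t. 0)" by (rule bounded_form_smult[OF \<phi>]) (simp add: L1_iff)
  then show ?case by simp
next
  case (insert i I)
  have xi: "x i \<in> Lp_functions M 1" using insert.prems by (simp add: L1_iff)
  have ci: "(\<lambda>t. c i * x i t) \<in> Lp_functions M 1" using insert.prems by (simp add: L1_iff)
  have s: "(\<lambda>t. \<Sum>i\<in>I. c i * x i t) \<in> Lp_functions M 1"
    unfolding L1_iff using insert.prems by (intro Bochner_Integration.integrable_sum integrable_mult_right) simp
  have "\<phi> (\<lambda>t. c i * x i t + (\<Sum>i\<in>I. c i * x i t)) = c i * \<phi> (x i) + \<phi> (\<lambda>t. \<Sum>i\<in>I. c i * x i t)"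
    by (simp only: bounded_form_add[OF \<phi> ci s] bounded_form_smult[OF \<phi> xi])
  moreover have "\<phi> (\<lambda>t. \<Sum>i\<in>I. c i * x i t) = (\<Sum>i\<in>I. c i * \<phi> (x i))"
    by (rule insert.IH) (simp add: insert.prems)
  ultimately show ?case by (simp only: sum.insert[OF insert.hyps(1,2)])
qed

text \<open>
  A colouring \<open>\<kappa> w\<close> with finitely many colours for every weight \<open>w\<close>. The colourings for a smaller and
  a larger weight agree almost everywhere on the support of the smaller one; a colouring of the whole
  space need not exist.
\<close>

locale local_colouring =
  fixes M :: "'a measure" and \<C> :: "'c set" and \<kappa> :: "('a \<Rightarrow> real) \<Rightarrow> 'a \<Rightarrow> 'c"
  assumes finite_colours: "finite \<C>"
    and colour_in: "weight M w \<Longrightarrow> t \<in> space M \<Longrightarrow> \<kappa> w t \<in> \<C>"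
    and colour_measurable: "weight M w \<Longrightarrow> \<alpha> \<in> \<C> \<Longrightarrow> {t \<in> space M. \<kappa> w t = \<alpha>} \<in> sets M"
    and colour_consistent: "weight M w \<Longrightarrow> weight M w' \<Longrightarrow> (\<And>t. w' t \<le> w t) \<Longrightarrow>
      AE t in M. 0 < w' t \<longrightarrow> \<kappa> w' t = \<kappa> w t"
begin

definition colour_cell :: "('a \<Rightarrow> real) \<Rightarrow> 'c \<Rightarrow> 'a set" where
  "colour_cell w \<alpha> = {t \<in> space M. \<kappa> w t = \<alpha>}"

text \<open>
  The integral of \<open>f\<close> over its part of colour \<open>\<alpha>\<close>. By consistency any weight above \<open>\<bar>f\<bar>\<close> may be used
  to determine the colours (\<open>colour_form_eq\<close>), and this yields linearity: a common weight serves both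
  summands.
\<close>

definition colour_form :: "'c \<Rightarrow> ('a \<Rightarrow> complex) \<Rightarrow> complex" where
  "colour_form \<alpha> f = (LINT t|M. indicator (colour_cell (\<lambda>t. cmod (f t)) \<alpha>) t * f t)"

lemma colour_cell_sets: "weight M w \<Longrightarrow> \<alpha> \<in> \<C> \<Longrightarrow> colour_cell w \<alpha> \<in> sets M"
  unfolding colour_cell_def by (rule colour_measurable)

lemma sum_colour_cells:
  fixes h :: "'c \<Rightarrow> 'b :: semiring_1"
  assumes "weight M w" "t \<in> space M"
  shows "(\<Sum>\<alpha>\<in>\<C>. indicator (colour_cell w \<alpha>) t * h \<alpha>) = h (\<kappa> w t)"
proof -
  have "(\<Sum>\<alpha>\<in>\<C>. indicator (colour_cell w \<alpha>) t * h \<alpha>) = (\<Sum>\<alpha>\<in>\<C>. if \<alpha> = \<kappa> w t then h \<alpha> else 0)"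
    using assms(2) by (intro sum.cong) (auto simp: colour_cell_def indicator_def)
  then show ?thesis using finite_colours colour_in[OF assms] by simp
qed

lemma colour_form_eq:
  assumes f: "integrable M f" and w: "weight M w" and le: "\<And>t. cmod (f t) \<le> w t" and \<alpha>: "\<alpha> \<in> \<C>"
  shows "colour_form \<alpha> f = (LINT t|M. indicator (colour_cell w \<alpha>) t * f t)"
  unfolding colour_form_def
proof (rule integral_cong_AE)
  show "(\<lambda>t. indicator (colour_cell (\<lambda>t. cmod (f t)) \<alpha>) t * f t) \<in> borel_measurable M"
    by (rule borel_measurable_integrable[OF indicator_times_integrable[OF colour_cell_sets[OF weight_cmod[OF f] \<alpha>] f]])
  show "(\<lambda>t. indicator (colour_cell w \<alpha>) t * f t) \<in> borel_measurable M"
    by (rule borel_measurable_integrable[OF indicator_times_integrable[OF colour_cell_sets[OF w \<alpha>] f]])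
  show "AE t in M. indicator (colour_cell (\<lambda>t. cmod (f t)) \<alpha>) t * f t = indicator (colour_cell w \<alpha>) t * f t"
    using colour_consistent[OF w weight_cmod[OF f] le]
    by eventually_elim (auto simp: colour_cell_def indicator_def)
qed

lemma colour_form_norm_le:
  assumes f: "integrable M f" and \<alpha>: "\<alpha> \<in> \<C>"
  shows "cmod (colour_form \<alpha> f) \<le> (LINT t|M. indicator (colour_cell (\<lambda>t. cmod (f t)) \<alpha>) t * cmod (f t))"
proof -
  have "cmod (colour_form \<alpha> f) \<le> (LINT t|M. cmod (indicator (colour_cell (\<lambda>t. cmod (f t)) \<alpha>) t * f t))"
    unfolding colour_form_def by (rule integral_norm_bound)
  also have "(\<lambda>t. cmod (indicator (colour_cell (\<lambda>t. cmod (f t)) \<alpha>) t * f t)) =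
      (\<lambda>t. indicator (colour_cell (\<lambda>t. cmod (f t)) \<alpha>) t * cmod (f t))"
    by (auto simp: indicator_def)
  finally show ?thesis .
qed

lemma sum_cell_integrals:
  assumes w: "weight M w" and g: "integrable M (g :: 'a \<Rightarrow> real)"
  shows "(\<Sum>\<alpha>\<in>\<C>. (LINT t|M. indicator (colour_cell w \<alpha>) t * g t)) = (LINT t|M. g t)"
proof -
  have "(\<Sum>\<alpha>\<in>\<C>. (LINT t|M. indicator (colour_cell w \<alpha>) t * g t)) =
      (LINT t|M. (\<Sum>\<alpha>\<in>\<C>. indicator (colour_cell w \<alpha>) t * g t))"
    by (intro Bochner_Integration.integral_sum[symmetric] real_indicator_times_integrable colour_cell_sets w g)
  also have "\<dots> = (LINT t|M. g t)"
    by (intro Bochner_Integration.integral_cong refl sum_colour_cells[OF w])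
  finally show ?thesis .
qed

lemma sum_colour_form_le:
  assumes f: "integrable M f"
  shows "(\<Sum>\<alpha>\<in>\<C>. cmod (colour_form \<alpha> f)) \<le> (LINT t|M. cmod (f t))"
proof -
  have "(\<Sum>\<alpha>\<in>\<C>. cmod (colour_form \<alpha> f)) \<le>
      (\<Sum>\<alpha>\<in>\<C>. (LINT t|M. indicator (colour_cell (\<lambda>t. cmod (f t)) \<alpha>) t * cmod (f t)))"
    by (intro sum_mono colour_form_norm_le f)
  also have "\<dots> = (LINT t|M. cmod (f t))"
    by (rule sum_cell_integrals[OF weight_cmod[OF f] integrable_norm[OF f]])
  finally show ?thesis .
qed

lemma bounded_colour_form:
  assumes \<alpha>: "\<alpha> \<in> \<C>"
  shows "bounded_form (Lp_functions M 1) (Lp_seminorm M 1) (colour_form \<alpha>)"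
  unfolding bounded_form_def
proof (intro conjI ballI allI)
  fix f g assume "f \<in> Lp_functions M 1" "g \<in> Lp_functions M 1"
  then have f: "integrable M f" and g: "integrable M g" by (simp_all add: L1_iff)
  define w where "w = (\<lambda>t. cmod (f t) + cmod (g t))"
  have w: "weight M w" unfolding w_def by (rule weight_add[OF weight_cmod[OF f] weight_cmod[OF g]])
  have fg: "integrable M (\<lambda>t. f t + g t)" by (rule Bochner_Integration.integrable_add[OF f g])
  have "colour_form \<alpha> (\<lambda>t. f t + g t) = (LINT t|M. indicator (colour_cell w \<alpha>) t * (f t + g t))"
    by (rule colour_form_eq[OF fg w _ \<alpha>]) (simp add: w_def norm_triangle_ineq)
  also have "\<dots> = (LINT t|M. indicator (colour_cell w \<alpha>) t * f t) + (LINT t|M. indicator (colour_cell w \<alpha>) t * g t)"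
    unfolding distrib_left
    by (rule Bochner_Integration.integral_add[OF indicator_times_integrable[OF colour_cell_sets[OF w \<alpha>] f]
          indicator_times_integrable[OF colour_cell_sets[OF w \<alpha>] g]])
  also have "(LINT t|M. indicator (colour_cell w \<alpha>) t * f t) = colour_form \<alpha> f"
    by (rule colour_form_eq[OF f w _ \<alpha>, symmetric]) (simp add: w_def)
  also have "(LINT t|M. indicator (colour_cell w \<alpha>) t * g t) = colour_form \<alpha> g"
    by (rule colour_form_eq[OF g w _ \<alpha>, symmetric]) (simp add: w_def)
  finally show "colour_form \<alpha> (\<lambda>t. f t + g t) = colour_form \<alpha> f + colour_form \<alpha> g" .
next
  fix c f assume "f \<in> Lp_functions M 1"
  then have f: "integrable M f" by (simp add: L1_iff)
  have cf: "integrable M (\<lambda>t. c * f t)" using f by simp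
  define w where "w = (\<lambda>t. cmod (f t) + cmod (c * f t))"
  have w: "weight M w" unfolding w_def by (rule weight_add[OF weight_cmod[OF f] weight_cmod[OF cf]])
  have "colour_form \<alpha> (\<lambda>t. c * f t) = (LINT t|M. indicator (colour_cell w \<alpha>) t * (c * f t))"
    by (rule colour_form_eq[OF cf w _ \<alpha>]) (simp add: w_def)
  also have "\<dots> = c * (LINT t|M. indicator (colour_cell w \<alpha>) t * f t)"
    by (simp only: mult.left_commute[of _ c] integral_mult_right_zero)
  also have "(LINT t|M. indicator (colour_cell w \<alpha>) t * f t) = colour_form \<alpha> f"
    by (rule colour_form_eq[OF f w _ \<alpha>, symmetric]) (simp add: w_def)
  finally show "colour_form \<alpha> (\<lambda>t. c * f t) = c * colour_form \<alpha> f" .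
next
  have "cmod (colour_form \<alpha> f) \<le> 1 * Lp_seminorm M 1 f" if "f \<in> Lp_functions M 1" for f
  proof -
    have f: "integrable M f" using that by (simp add: L1_iff)
    have "cmod (colour_form \<alpha> f) \<le> (\<Sum>\<alpha>\<in>\<C>. cmod (colour_form \<alpha> f))"
      by (rule member_le_sum[OF \<alpha>]) (simp_all add: finite_colours)
    then show ?thesis using sum_colour_form_le[OF f] by (simp add: L1_seminorm)
  qed
  then show "\<exists>C. \<forall>f\<in>Lp_functions M 1. cmod (colour_form \<alpha> f) \<le> C * Lp_seminorm M 1 f" by blast
qed

definition colour_mass :: "('a \<Rightarrow> real) \<Rightarrow> 'c \<Rightarrow> real" where
  "colour_mass w \<alpha> = (LINT t|M. indicator (colour_cell w \<alpha>) t * w t)"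

lemma colour_mass_nonneg: "weight M w \<Longrightarrow> 0 \<le> colour_mass w \<alpha>"
  unfolding colour_mass_def by (intro integral_nonneg_AE AE_I2) (simp add: weight_nonneg)

lemma colour_mass_zero:
  assumes w: "weight M w" and \<alpha>: "\<alpha> \<in> \<C>" and m: "colour_mass w \<alpha> = 0"
  shows "AE t in M. \<kappa> w t = \<alpha> \<longrightarrow> w t = 0"
proof -
  have "AE t in M. indicator (colour_cell w \<alpha>) t * w t = 0"
    using m unfolding colour_mass_def
    by (subst (asm) integral_nonneg_eq_0_iff_AE[OF
          real_indicator_times_integrable[OF colour_cell_sets[OF w \<alpha>] weight_integrable[OF w]]])
      (simp_all add: weight_nonneg[OF w])
  then show ?thesis using AE_space by eventually_elim (auto simp: colour_cell_def indicator_def)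
qed

definition colour_vector :: "('a \<Rightarrow> real) \<Rightarrow> 'c \<Rightarrow> 'a \<Rightarrow> complex" where
  "colour_vector w \<alpha> t = of_real (indicator (colour_cell w \<alpha>) t * w t / colour_mass w \<alpha>)"

lemma colour_vector_integrable:
  assumes w: "weight M w" and \<alpha>: "\<alpha> \<in> \<C>"
  shows "integrable M (colour_vector w \<alpha>)"
  unfolding colour_vector_def[abs_def]
  by (intro integrable_of_real Bochner_Integration.integrable_divide_zero real_indicator_times_integrable
      colour_cell_sets w \<alpha> weight_integrable)

lemma colour_vector_norm:
  assumes w: "weight M w" and m: "0 < colour_mass w \<alpha>"
  shows "(LINT t|M. cmod (colour_vector w \<alpha> t)) = 1"
proof -
  have "(\<lambda>t. cmod (colour_vector w \<alpha> t)) = (\<lambda>t. indicator (colour_cell w \<alpha>) t * w t / colour_mass w \<alpha>)"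
    unfolding colour_vector_def norm_of_real using m weight_nonneg[OF w] by (intro ext abs_of_nonneg) simp
  then show ?thesis using m by (simp add: colour_mass_def[symmetric])
qed

lemma colour_form_vector:
  assumes w: "weight M w" and \<alpha>: "\<alpha> \<in> \<C>" and \<beta>: "\<beta> \<in> \<C>" and m: "0 < colour_mass w \<alpha>"
  shows "colour_form \<beta> (colour_vector w \<alpha>) = (if \<beta> = \<alpha> then 1 else 0)"
proof -
  define y where "y = colour_vector w \<alpha>"
  have y: "integrable M y" unfolding y_def by (rule colour_vector_integrable[OF w \<alpha>])
  define v where "v = (\<lambda>t. w t + cmod (y t))"
  have v: "weight M v" unfolding v_def by (rule weight_add[OF w weight_cmod[OF y]])
  have "colour_form \<beta> y = (LINT t|M. indicator (colour_cell v \<beta>) t * y t)"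
    by (rule colour_form_eq[OF y v _ \<beta>]) (simp add: v_def weight_nonneg[OF w])
  also have "\<dots> = (LINT t|M. (if \<beta> = \<alpha> then y t else 0))"
  proof (rule integral_cong_AE)
    show "(\<lambda>t. indicator (colour_cell v \<beta>) t * y t) \<in> borel_measurable M"
      by (rule borel_measurable_integrable[OF indicator_times_integrable[OF colour_cell_sets[OF v \<beta>] y]])
    show "(\<lambda>t. if \<beta> = \<alpha> then y t else 0) \<in> borel_measurable M"
      using borel_measurable_integrable[OF y] by simp
    have "AE t in M. 0 < w t \<longrightarrow> \<kappa> w t = \<kappa> v t"
      by (rule colour_consistent[OF v w]) (simp add: v_def)
    then show "AE t in M. indicator (colour_cell v \<beta>) t * y t = (if \<beta> = \<alpha> then y t else 0)"
      using AE_space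
    proof eventually_elim
      case (elim t)
      show ?case
      proof (cases "t \<in> colour_cell w \<alpha> \<and> w t \<noteq> 0")
        case True
        then have "\<kappa> v t = \<alpha>" using elim weight_nonneg[OF w, of t] by (simp add: colour_cell_def)
        then show ?thesis using elim(2) by (simp add: colour_cell_def indicator_def)
      next
        case False
        then have "y t = 0" by (auto simp: y_def colour_vector_def)
        then show ?thesis by simp
      qed
    qed
  qed
  also have "\<dots> = (if \<beta> = \<alpha> then 1 else 0)"
  proof -
    have "(LINT t|M. y t) = of_real (LINT t|M. indicator (colour_cell w \<alpha>) t * w t / colour_mass w \<alpha>)"
      unfolding y_def colour_vector_def
      by (intro integral_of_real Bochner_Integration.integrable_divide_zero real_indicator_times_integrable
          colour_cell_sets w \<alpha> weight_integrable)
    also have "\<dots> = 1" using m by (simp add: colour_mass_def[symmetric])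
    finally show ?thesis by simp
  qed
  finally show ?thesis unfolding y_def .
qed

text \<open>
  If \<open>\<theta>\<close> is nearly a function \<open>c\<close> of the colour, then \<open>f \<mapsto> \<integral> \<theta> f\<close> is nearly the linear
  combination of the colour forms with coefficients \<open>c\<close>.
\<close>

lemma colour_form_approximation:
  assumes c: "\<And>w t. weight M w \<Longrightarrow> t \<in> space M \<Longrightarrow> cmod (\<theta> w t - c (\<kappa> w t)) \<le> d"
    and \<theta>m: "\<And>w. weight M w \<Longrightarrow> \<theta> w \<in> borel_measurable M"
    and \<theta>b: "\<And>w t. weight M w \<Longrightarrow> cmod (\<theta> w t) \<le> D"
    and f: "integrable M f"
  shows "cmod ((LINT t|M. \<theta> (\<lambda>t. cmod (f t)) t * f t) - (\<Sum>\<alpha>\<in>\<C>. c \<alpha> * colour_form \<alpha> f))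
    \<le> d * (LINT t|M. cmod (f t))"
proof -
  define w where "w = (\<lambda>t. cmod (f t))"
  have w: "weight M w" unfolding w_def by (rule weight_cmod[OF f])
  note [measurable] = borel_measurable_integrable[OF f] \<theta>m[OF w]
  have i1: "integrable M (\<lambda>t. \<theta> w t * f t)"
  proof (rule Bochner_Integration.integrable_bound[of M "\<lambda>t. D * cmod (f t)"])
    show "integrable M (\<lambda>t. D * cmod (f t))" using f by simp
    show "(\<lambda>t. \<theta> w t * f t) \<in> borel_measurable M" by measurable
    have "cmod (\<theta> w t) * cmod (f t) \<le> D * cmod (f t)" for t by (rule mult_right_mono[OF \<theta>b[OF w]]) simp
    then have "norm (\<theta> w t * f t) \<le> norm (D * cmod (f t))" for t
      unfolding norm_mult real_norm_def by (rule order_trans[OF _ abs_ge_self])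
    then show "AE t in M. norm (\<theta> w t * f t) \<le> norm (D * cmod (f t))" by simp
  qed
  have i2: "integrable M (\<lambda>t. c \<alpha> * (indicator (colour_cell w \<alpha>) t * f t))" if "\<alpha> \<in> \<C>" for \<alpha>
    by (intro integrable_mult_right indicator_times_integrable colour_cell_sets w that f)
  have i3: "integrable M (\<lambda>t. \<Sum>\<alpha>\<in>\<C>. c \<alpha> * (indicator (colour_cell w \<alpha>) t * f t))"
    by (rule Bochner_Integration.integrable_sum[OF i2])
  have "(\<Sum>\<alpha>\<in>\<C>. c \<alpha> * colour_form \<alpha> f) = (\<Sum>\<alpha>\<in>\<C>. (LINT t|M. c \<alpha> * (indicator (colour_cell w \<alpha>) t * f t)))"
    unfolding colour_form_def w_def by (simp only: integral_mult_right_zero)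
  also have "\<dots> = (LINT t|M. (\<Sum>\<alpha>\<in>\<C>. c \<alpha> * (indicator (colour_cell w \<alpha>) t * f t)))"
    by (rule Bochner_Integration.integral_sum[OF i2, symmetric])
  finally have "(LINT t|M. \<theta> w t * f t) - (\<Sum>\<alpha>\<in>\<C>. c \<alpha> * colour_form \<alpha> f) =
      (LINT t|M. \<theta> w t * f t - (\<Sum>\<alpha>\<in>\<C>. c \<alpha> * (indicator (colour_cell w \<alpha>) t * f t)))"
    by (simp only: Bochner_Integration.integral_diff[OF i1 i3])
  also have "cmod \<dots> \<le> (LINT t|M. d * cmod (f t))"
  proof (rule order_trans[OF integral_norm_bound], rule integral_mono)
    show "integrable M (\<lambda>t. cmod (\<theta> w t * f t - (\<Sum>\<alpha>\<in>\<C>. c \<alpha> * (indicator (colour_cell w \<alpha>) t * f t))))"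
      by (intro integrable_norm Bochner_Integration.integrable_diff i1 i3)
    show "integrable M (\<lambda>t. d * cmod (f t))" using f by simp
    fix t assume t: "t \<in> space M"
    have "(\<Sum>\<alpha>\<in>\<C>. c \<alpha> * (indicator (colour_cell w \<alpha>) t * f t)) =
        (\<Sum>\<alpha>\<in>\<C>. indicator (colour_cell w \<alpha>) t * (c \<alpha> * f t))"
      by (intro sum.cong refl) (simp only: mult.left_commute)
    also have "\<dots> = c (\<kappa> w t) * f t" by (rule sum_colour_cells[OF w t])
    finally have "\<theta> w t * f t - (\<Sum>\<alpha>\<in>\<C>. c \<alpha> * (indicator (colour_cell w \<alpha>) t * f t)) =
        (\<theta> w t - c (\<kappa> w t)) * f t" by (simp only: left_diff_distrib)
    then show "cmod (\<theta> w t * f t - (\<Sum>\<alpha>\<in>\<C>. c \<alpha> * (indicator (colour_cell w \<alpha>) t * f t))) \<le> d * cmod (f t)"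
      using mult_right_mono[OF c[OF w t] norm_ge_zero[of "f t"]] by (simp add: norm_mult)
  qed
  finally show ?thesis unfolding w_def by simp
qed

text \<open>
  The index set consists of the colours that carry mass for some weight. The vector of a colour lives on
  the part of that colour under \<open>w\<^sub>0\<close> whenever this part carries mass, so that \<open>P f\<close> averages \<open>f \<in> A\<close>
  relative to \<open>w\<^sub>0\<close>, and \<open>f\<close> is nearly a multiple of \<open>w\<^sub>0\<close> on each part. A functional in \<open>B\<close> is
  nearly a combination of colour forms, and these are invariant under \<open>P\<close>. The norm estimate holds
  since the vectors have norm one and the moduli of the colour forms sum to at most \<open>\<parallel>f\<parallel>\<close>.
\<close>

theorem colour_approximating_system:
  assumes w0: "weight M w\<^sub>0"
    and A: "\<And>f. f \<in> A \<Longrightarrow> integrable M f" "\<And>f t. f \<in> A \<Longrightarrow> cmod (f t) \<le> w\<^sub>0 t"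
      "\<And>f. f \<in> A \<Longrightarrow> \<exists>c. \<forall>t\<in>space M. cmod (f t - c (\<kappa> w\<^sub>0 t) * of_real (w\<^sub>0 t)) \<le> d * w\<^sub>0 t"
    and B: "\<And>\<phi>. \<phi> \<in> B \<Longrightarrow> \<exists>c. \<forall>f. integrable M f \<longrightarrow>
      cmod (\<phi> f - (\<Sum>\<alpha>\<in>\<C>. c \<alpha> * colour_form \<alpha> f)) \<le> d * (LINT t|M. cmod (f t))"
    and d: "0 \<le> d" "2 * d \<le> e" "2 * d * (LINT t|M. w\<^sub>0 t) \<le> e"
    and ne: "\<exists>f. integrable M f \<and> \<not> (AE t in M. f t = (0 :: complex))"
  shows "\<exists>(J :: 'c set) x F. approximating_system (Lp_functions M 1) (Lp_seminorm M 1) A B e J x F"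
proof -
  define J where "J = {\<alpha> \<in> \<C>. \<exists>w. weight M w \<and> 0 < colour_mass w \<alpha>}"
  have J: "J \<subseteq> \<C>" "finite J" using finite_colours by (auto simp: J_def)
  define u where "u = (\<lambda>\<alpha>. if 0 < colour_mass w\<^sub>0 \<alpha> then w\<^sub>0 else SOME w. weight M w \<and> 0 < colour_mass w \<alpha>)"
  have u: "weight M (u \<alpha>)" "0 < colour_mass (u \<alpha>) \<alpha>" if "\<alpha> \<in> J" for \<alpha>
  proof -
    have "\<exists>w. weight M w \<and> 0 < colour_mass w \<alpha>" using that by (simp add: J_def)
    then have "weight M (SOME w. weight M w \<and> 0 < colour_mass w \<alpha>) \<and>
        0 < colour_mass (SOME w. weight M w \<and> 0 < colour_mass w \<alpha>) \<alpha>" by (rule someI_ex)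
    then show "weight M (u \<alpha>)" "0 < colour_mass (u \<alpha>) \<alpha>" using w0 by (simp_all add: u_def)
  qed
  define y where "y = (\<lambda>\<alpha>. colour_vector (u \<alpha>) \<alpha>)"
  have yi: "integrable M (y \<alpha>)" if "\<alpha> \<in> J" for \<alpha>
    unfolding y_def using J(1) that by (intro colour_vector_integrable u) auto
  have yn: "(LINT t|M. cmod (y \<alpha> t)) = 1" if "\<alpha> \<in> J" for \<alpha>
    unfolding y_def by (rule colour_vector_norm[OF u[OF that]])
  have bi: "colour_form \<beta> (y \<alpha>) = (if \<beta> = \<alpha> then 1 else 0)" if "\<alpha> \<in> J" "\<beta> \<in> \<C>" for \<alpha> \<beta>
    unfolding y_def using J(1) that by (intro colour_form_vector u) auto
  have off: "colour_form \<alpha> f = 0" if f: "integrable M f" and \<alpha>: "\<alpha> \<in> \<C>" "\<alpha> \<notin> J" for \<alpha> f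
  proof -
    have "\<not> 0 < colour_mass (\<lambda>t. cmod (f t)) \<alpha>" using \<alpha> weight_cmod[OF f] by (auto simp: J_def)
    then have "cmod (colour_form \<alpha> f) \<le> 0"
      using colour_form_norm_le[OF f \<alpha>(1)] unfolding colour_mass_def by linarith
    then show ?thesis by simp
  qed
  define P where "P = (\<lambda>f t. \<Sum>\<alpha>\<in>J. colour_form \<alpha> f * y \<alpha> t)"
  have sumJ: "integrable M (\<lambda>t. \<Sum>\<alpha>\<in>J. c \<alpha> * y \<alpha> t)" for c
    by (intro Bochner_Integration.integrable_sum integrable_mult_right yi)
  have nle: "(LINT t|M. cmod (\<Sum>\<alpha>\<in>J. c \<alpha> * y \<alpha> t)) \<le> (\<Sum>\<alpha>\<in>J. cmod (c \<alpha>))" for c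
  proof -
    have "(LINT t|M. cmod (\<Sum>\<alpha>\<in>J. c \<alpha> * y \<alpha> t)) \<le> (LINT t|M. (\<Sum>\<alpha>\<in>J. cmod (c \<alpha>) * cmod (y \<alpha> t)))"
    proof (rule integral_mono[OF integrable_norm[OF sumJ]])
      show "integrable M (\<lambda>t. \<Sum>\<alpha>\<in>J. cmod (c \<alpha>) * cmod (y \<alpha> t))"
        by (intro Bochner_Integration.integrable_sum integrable_mult_right integrable_norm yi)
      show "cmod (\<Sum>\<alpha>\<in>J. c \<alpha> * y \<alpha> t) \<le> (\<Sum>\<alpha>\<in>J. cmod (c \<alpha>) * cmod (y \<alpha> t))" for t
        by (rule order_trans[OF norm_sum]) (simp add: norm_mult)
    qed
    also have "\<dots> = (\<Sum>\<alpha>\<in>J. (LINT t|M. cmod (c \<alpha>) * cmod (y \<alpha> t)))"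
      by (intro Bochner_Integration.integral_sum integrable_mult_right integrable_norm yi)
    also have "\<dots> = (\<Sum>\<alpha>\<in>J. cmod (c \<alpha>))" by (intro sum.cong refl) (simp add: yn)
    finally show ?thesis .
  qed
  have PN: "(LINT t|M. cmod (P f t)) \<le> (LINT t|M. cmod (f t))" if f: "integrable M f" for f
    unfolding P_def
    by (rule order_trans[OF nle order_trans[OF sum_mono2[OF finite_colours J(1)] sum_colour_form_le[OF f]]]) simp
  have Pi: "integrable M (P f)" for f unfolding P_def by (rule sumJ)
  have FP: "colour_form \<beta> (P f) = colour_form \<beta> f" if f: "integrable M f" and \<beta>: "\<beta> \<in> \<C>" for \<beta> f
  proof -
    have "colour_form \<beta> (P f) = (\<Sum>\<alpha>\<in>J. colour_form \<alpha> f * colour_form \<beta> (y \<alpha>))"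
      unfolding P_def by (rule bounded_form_L1_sum[OF bounded_colour_form[OF \<beta>] J(2) yi])
    also have "\<dots> = (\<Sum>\<alpha>\<in>J. if \<beta> = \<alpha> then colour_form \<alpha> f else 0)"
      using \<beta> by (intro sum.cong refl) (simp add: bi)
    also have "\<dots> = colour_form \<beta> f" using J(2) off[OF f \<beta>] by simp
    finally show ?thesis .
  qed
  have "J \<noteq> {}"
  proof
    assume empty: "J = {}"
    obtain f where f: "integrable M f" "\<not> (AE t in M. f t = (0 :: complex))" using ne by blast
    define w where "w = (\<lambda>t. cmod (f t))"
    have w: "weight M w" unfolding w_def by (rule weight_cmod[OF f(1)])
    have "colour_mass w \<alpha> = 0" if "\<alpha> \<in> \<C>" for \<alpha>
    proof -
      have "\<not> 0 < colour_mass w \<alpha>" using empty that w by (auto simp: J_def)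
      then show ?thesis using colour_mass_nonneg[OF w, of \<alpha>] by linarith
    qed
    then have "(LINT t|M. w t) = 0"
      using sum_cell_integrals[OF w weight_integrable[OF w]] by (simp add: colour_mass_def)
    then have "AE t in M. w t = 0"
      using integral_nonneg_eq_0_iff_AE[OF weight_integrable[OF w]] weight_nonneg[OF w] by simp
    then show False using f(2) by (simp add: w_def)
  qed
  moreover have "Lp_seminorm M 1 (\<lambda>t. \<Sum>\<alpha>\<in>J. s \<alpha> * colour_form (\<sigma> \<alpha>) f * y \<alpha> t) \<le> Lp_seminorm M 1 f"
    if \<sigma>: "bij_betw \<sigma> J J" and s: "\<forall>\<alpha>\<in>J. s \<alpha> \<in> {1, - 1}" and f: "f \<in> Lp_functions M 1" for \<sigma> s f
  proof -
    have fi: "integrable M f" using f by (simp add: L1_iff)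
    have "(LINT t|M. cmod (\<Sum>\<alpha>\<in>J. (s \<alpha> * colour_form (\<sigma> \<alpha>) f) * y \<alpha> t)) \<le>
        (\<Sum>\<alpha>\<in>J. cmod (s \<alpha> * colour_form (\<sigma> \<alpha>) f))" by (rule nle)
    also have "\<dots> = (\<Sum>\<alpha>\<in>J. cmod (colour_form (\<sigma> \<alpha>) f))"
      using s by (intro sum.cong refl) (auto simp: norm_mult)
    also have "\<dots> = (\<Sum>\<alpha>\<in>J. cmod (colour_form \<alpha> f))" by (rule sum.reindex_bij_betw[OF \<sigma>])
    also have "\<dots> \<le> (\<Sum>\<alpha>\<in>\<C>. cmod (colour_form \<alpha> f))"
      by (rule sum_mono2[OF finite_colours J(1)]) simp
    also have "\<dots> \<le> (LINT t|M. cmod (f t))" by (rule sum_colour_form_le[OF fi])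
    finally show ?thesis unfolding L1_seminorm .
  qed
  moreover have "Lp_seminorm M 1 (\<lambda>t. P f t - f t) \<le> e" if fA: "f \<in> A" for f
  proof -
    have f: "integrable M f" by (rule A(1)[OF fA])
    obtain c where c: "\<And>t. t \<in> space M \<Longrightarrow> cmod (f t - c (\<kappa> w\<^sub>0 t) * of_real (w\<^sub>0 t)) \<le> d * w\<^sub>0 t"
      using A(3)[OF fA] by blast
    have Ff: "cmod (colour_form \<alpha> f - c \<alpha> * of_real (colour_mass w\<^sub>0 \<alpha>)) \<le> d * colour_mass w\<^sub>0 \<alpha>" if \<alpha>: "\<alpha> \<in> \<C>" for \<alpha>
    proof -
      let ?E = "colour_cell w\<^sub>0 \<alpha>"
      have E: "?E \<in> sets M" by (rule colour_cell_sets[OF w0 \<alpha>])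
      have wc: "integrable M (\<lambda>t. complex_of_real (w\<^sub>0 t))" using weight_integrable[OF w0] by simp
      have i1: "integrable M (\<lambda>t. indicator ?E t * f t)" by (rule indicator_times_integrable[OF E f])
      have i2: "integrable M (\<lambda>t. c \<alpha> * of_real (indicator ?E t * w\<^sub>0 t))"
        by (intro integrable_mult_right integrable_of_real real_indicator_times_integrable E weight_integrable w0)
      have "colour_form \<alpha> f - c \<alpha> * of_real (colour_mass w\<^sub>0 \<alpha>) =
          (LINT t|M. indicator ?E t * f t) - (LINT t|M. c \<alpha> * of_real (indicator ?E t * w\<^sub>0 t))"
        unfolding colour_form_eq[OF f w0 A(2)[OF fA] \<alpha>] colour_mass_def
        by (simp only: integral_mult_right_zero
            integral_of_real[OF real_indicator_times_integrable[OF E weight_integrable[OF w0]]])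
      also have "\<dots> = (LINT t|M. indicator ?E t * f t - c \<alpha> * of_real (indicator ?E t * w\<^sub>0 t))"
        by (rule Bochner_Integration.integral_diff[OF i1 i2, symmetric])
      also have "cmod \<dots> \<le> (LINT t|M. d * (indicator ?E t * w\<^sub>0 t))"
      proof (rule order_trans[OF integral_norm_bound], rule integral_mono)
        show "integrable M (\<lambda>t. cmod (indicator ?E t * f t - c \<alpha> * of_real (indicator ?E t * w\<^sub>0 t)))"
          by (intro integrable_norm Bochner_Integration.integrable_diff i1 i2)
        show "integrable M (\<lambda>t. d * (indicator ?E t * w\<^sub>0 t))"
          by (intro integrable_mult_right real_indicator_times_integrable E weight_integrable w0)
        fix t assume "t \<in> space M"
        then show "cmod (indicator ?E t * f t - c \<alpha> * of_real (indicator ?E t * w\<^sub>0 t)) \<le> d * (indicator ?E t * w\<^sub>0 t)"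
          using c[of t] by (cases "t \<in> ?E") (simp_all add: colour_cell_def)
      qed
      also have "\<dots> = d * colour_mass w\<^sub>0 \<alpha>" unfolding colour_mass_def by (rule integral_mult_right_zero)
      finally show ?thesis .
    qed
    have "AE t in M. \<forall>\<alpha>\<in>\<C>. colour_mass w\<^sub>0 \<alpha> = 0 \<longrightarrow> \<kappa> w\<^sub>0 t = \<alpha> \<longrightarrow> w\<^sub>0 t = 0"
      using colour_mass_zero[OF w0] by (intro AE_finite_allI finite_colours) auto
    then have pt: "AE t in M. cmod (P f t - f t) \<le> 2 * d * w\<^sub>0 t"
      using AE_space
    proof eventually_elim
      case (elim t)
      define \<alpha> where "\<alpha> = \<kappa> w\<^sub>0 t"
      define m where "m = colour_mass w\<^sub>0 \<alpha>"
      have \<alpha>: "\<alpha> \<in> \<C>" unfolding \<alpha>_def by (rule colour_in[OF w0 elim(2)])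
      show ?case
      proof (cases "w\<^sub>0 t = 0")
        case True
        have "f t = 0" using A(2)[OF fA, of t] True by simp
        moreover have "colour_form \<beta> f * y \<beta> t = 0" if "\<beta> \<in> J" for \<beta>
        proof (cases "0 < colour_mass w\<^sub>0 \<beta>")
          case m: True
          then show ?thesis using True by (simp add: y_def u_def colour_vector_def)
        next
          case False
          then have "colour_mass w\<^sub>0 \<beta> = 0" using colour_mass_nonneg[OF w0, of \<beta>] by linarith
          then show ?thesis using Ff[of \<beta>] that J(1) by auto
        qed
        ultimately show ?thesis using True by (simp add: P_def)
      next
        case w: False
        then have wpos: "0 < w\<^sub>0 t" using weight_nonneg[OF w0, of t] by simp
        have "m \<noteq> 0" using elim(1) \<alpha> w unfolding m_def \<alpha>_def by blast
        then have m: "0 < m" using colour_mass_nonneg[OF w0, of \<alpha>] by (simp add: m_def)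
        have \<alpha>J: "\<alpha> \<in> J" using \<alpha> m w0 by (auto simp: J_def m_def)
        have "colour_form \<beta> f * y \<beta> t = (if \<alpha> = \<beta> then colour_form \<alpha> f * of_real (w\<^sub>0 t / m) else 0)" if "\<beta> \<in> J" for \<beta>
        proof (cases "0 < colour_mass w\<^sub>0 \<beta>")
          case True
          then show ?thesis using elim(2)
            by (auto simp: y_def u_def colour_vector_def colour_cell_def \<alpha>_def m_def)
        next
          case False
          then have z: "colour_mass w\<^sub>0 \<beta> = 0" using colour_mass_nonneg[OF w0, of \<beta>] by linarith
          then have "\<alpha> \<noteq> \<beta>" using m by (auto simp: m_def)
          moreover have "colour_form \<beta> f = 0" using Ff[of \<beta>] z that J(1) by auto
          ultimately show ?thesis by simp
        qed
        then have "P f t = (\<Sum>\<beta>\<in>J. if \<alpha> = \<beta> then colour_form \<alpha> f * of_real (w\<^sub>0 t / m) else 0)"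
          unfolding P_def by (rule sum.cong[OF refl])
        then have Pt: "P f t = colour_form \<alpha> f * of_real (w\<^sub>0 t / m)" using J(2) \<alpha>J by simp
        have "P f t - c \<alpha> * of_real (w\<^sub>0 t) = (colour_form \<alpha> f - c \<alpha> * of_real m) * of_real (w\<^sub>0 t / m)"
          unfolding Pt using m by (simp add: field_simps)
        then have "cmod (P f t - c \<alpha> * of_real (w\<^sub>0 t)) = cmod (colour_form \<alpha> f - c \<alpha> * of_real m) * (w\<^sub>0 t / m)"
          using m wpos by (simp add: norm_mult norm_divide)
        also have "\<dots> \<le> (d * m) * (w\<^sub>0 t / m)"
          using Ff[OF \<alpha>] m wpos by (intro mult_right_mono) (simp_all add: m_def)
        also have "\<dots> = d * w\<^sub>0 t" using m by simp
        finally have "cmod (P f t - c \<alpha> * of_real (w\<^sub>0 t)) \<le> d * w\<^sub>0 t" .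
        moreover have "cmod (f t - c \<alpha> * of_real (w\<^sub>0 t)) \<le> d * w\<^sub>0 t" using c[OF elim(2)] by (simp only: \<alpha>_def)
        ultimately show ?thesis
          using norm_triangle_ineq4[of "P f t - c \<alpha> * of_real (w\<^sub>0 t)" "f t - c \<alpha> * of_real (w\<^sub>0 t)"] by simp
      qed
    qed
    have "(LINT t|M. cmod (P f t - f t)) \<le> (LINT t|M. 2 * d * w\<^sub>0 t)"
      using weight_integrable[OF w0] f by (intro integral_mono_AE pt integrable_norm Bochner_Integration.integrable_diff Pi) simp_all
    also have "\<dots> \<le> e" using d(3) by simp
    finally show ?thesis unfolding L1_seminorm .
  qed
  moreover have "cmod (\<phi> (P f) - \<phi> f) \<le> e * Lp_seminorm M 1 f" if \<phi>: "\<phi> \<in> B" and fW: "f \<in> Lp_functions M 1" for \<phi> f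
  proof -
    have f: "integrable M f" using fW by (simp add: L1_iff)
    define n where "n = (LINT t|M. cmod (f t))"
    have n0: "0 \<le> n" unfolding n_def by (intro integral_nonneg_AE) simp
    obtain c where c: "\<And>f. integrable M f \<Longrightarrow>
        cmod (\<phi> f - (\<Sum>\<alpha>\<in>\<C>. c \<alpha> * colour_form \<alpha> f)) \<le> d * (LINT t|M. cmod (f t))" using B[OF \<phi>] by blast
    define L where "L = (\<Sum>\<alpha>\<in>\<C>. c \<alpha> * colour_form \<alpha> f)"
    have "(\<Sum>\<alpha>\<in>\<C>. c \<alpha> * colour_form \<alpha> (P f)) = L"
      unfolding L_def by (intro sum.cong refl) (simp add: FP[OF f])
    then have "cmod (\<phi> (P f) - L) \<le> d * (LINT t|M. cmod (P f t))" using c[OF Pi, of f] by simp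
    also have "\<dots> \<le> d * n" unfolding n_def by (rule mult_left_mono[OF PN[OF f] d(1)])
    finally have 1: "cmod (\<phi> (P f) - L) \<le> d * n" .
    have 2: "cmod (\<phi> f - L) \<le> d * n" unfolding L_def n_def by (rule c[OF f])
    have "cmod (\<phi> (P f) - \<phi> f) \<le> 2 * d * n"
      using norm_triangle_ineq4[of "\<phi> (P f) - L" "\<phi> f - L"] 1 2 by simp
    also have "\<dots> \<le> e * n" by (rule mult_right_mono[OF d(2) n0])
    finally show ?thesis unfolding L1_seminorm n_def .
  qed
  ultimately have "approximating_system (Lp_functions M 1) (Lp_seminorm M 1) A B e J y colour_form"
    unfolding approximating_system_def P_def
    using J yi bi bounded_colour_form by (auto simp: L1_iff)
  then show ?thesis by blast
qed

end

section \<open>Local functions and their colourings\<close>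

text \<open>
  A family of functions indexed by weights that is consistent in the same sense as a colouring. The real
  and imaginary parts are bounded separately, as this is what rounding to a square grid uses.
\<close>

definition local_function :: "'a measure \<Rightarrow> real \<Rightarrow> (('a \<Rightarrow> real) \<Rightarrow> 'a \<Rightarrow> complex) \<Rightarrow> bool" where
  "local_function M D \<theta> \<longleftrightarrow>
     (\<forall>w. weight M w \<longrightarrow> \<theta> w \<in> borel_measurable M \<and> (\<forall>t. \<bar>Re (\<theta> w t)\<bar> \<le> D \<and> \<bar>Im (\<theta> w t)\<bar> \<le> D)) \<and>
     (\<forall>w w'. weight M w \<longrightarrow> weight M w' \<longrightarrow> (\<forall>t. w' t \<le> w t) \<longrightarrow>
        (AE t in M. 0 < w' t \<longrightarrow> \<theta> w' t = \<theta> w t))"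

text \<open>
  Densities of \<open>\<phi>\<close> with respect to all weights. For \<open>w' \<le> w\<close> the density for \<open>w\<close> also represents \<open>\<phi>\<close> on
  the support of \<open>w'\<close>, because \<open>1\<^sub>E w' = (1\<^sub>E w' / w) w\<close>, and densities are unique there.
\<close>

lemma local_density:
  assumes \<phi>: "bounded_form (Lp_functions M 1) (Lp_seminorm M 1) \<phi>"
  shows "\<exists>D \<theta>. local_function M D \<theta> \<and>
    (\<forall>f. integrable M f \<longrightarrow> \<phi> f = (LINT t|M. \<theta> (\<lambda>t. cmod (f t)) t * f t))"
proof -
  obtain C' where C': "\<And>f. f \<in> Lp_functions M 1 \<Longrightarrow> cmod (\<phi> f) \<le> C' * Lp_seminorm M 1 f"
    using \<phi> unfolding bounded_form_def by blast
  define C where "C = max C' 0"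
  have C0: "0 \<le> C" by (simp add: C_def)
  have C: "cmod (\<phi> f) \<le> C * Lp_seminorm M 1 f" if "f \<in> Lp_functions M 1" for f
  proof -
    have "0 \<le> Lp_seminorm M 1 f" unfolding L1_seminorm by (intro integral_nonneg_AE) simp
    then have "C' * Lp_seminorm M 1 f \<le> C * Lp_seminorm M 1 f" by (intro mult_right_mono) (simp_all add: C_def)
    then show ?thesis using C'[OF that] by linarith
  qed
  define good where "good = (\<lambda>w g. g \<in> borel_measurable M \<and> (\<forall>t. \<bar>Re (g t)\<bar> \<le> C \<and> \<bar>Im (g t)\<bar> \<le> C) \<and>
    (\<forall>k \<in> borel_measurable M. \<forall>c. (\<forall>t. cmod (k t) \<le> c) \<longrightarrow>
       \<phi> (\<lambda>t. k t * of_real (w t)) = (LINT t|M. k t * (g t * of_real (w t)))))"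
  define \<theta> where "\<theta> = (\<lambda>w. SOME g. good w g)"
  have \<theta>: "good w (\<theta> w)" if w: "weight M w" for w
  proof -
    obtain g where "good w g" using functional_density[OF \<phi> C0 C w] unfolding good_def by blast
    then show ?thesis unfolding \<theta>_def by (rule someI[of "good w"])
  qed
  have \<theta>m: "\<theta> w \<in> borel_measurable M" if "weight M w" for w using \<theta>[OF that] by (simp add: good_def)
  have rep: "\<phi> (\<lambda>t. k t * of_real (w t)) = (LINT t|M. k t * (\<theta> w t * of_real (w t)))"
    if w: "weight M w" and k: "k \<in> borel_measurable M" "\<And>t. cmod (k t) \<le> c" for w k c
    using \<theta>[OF w] k unfolding good_def by blast
  have int: "integrable M (\<lambda>t. \<theta> w t * of_real (v t))" if w: "weight M w" and v: "integrable M v" for w v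
  proof (rule Bochner_Integration.integrable_bound[of M "\<lambda>t. (C + C) * v t"])
    show "integrable M (\<lambda>t. (C + C) * v t)" using v by simp
    show "(\<lambda>t. \<theta> w t * of_real (v t)) \<in> borel_measurable M"
      using \<theta>m[OF w] borel_measurable_integrable[OF v] by simp
    have "norm (\<theta> w t * of_real (v t)) \<le> norm ((C + C) * v t)" for t
    proof -
      have "cmod (\<theta> w t) \<le> C + C"
        using cmod_le[of "\<theta> w t"] \<theta>[OF w] unfolding good_def by (meson add_mono order_trans)
      then have "cmod (\<theta> w t) * \<bar>v t\<bar> \<le> (C + C) * \<bar>v t\<bar>" by (rule mult_right_mono) simp
      then show ?thesis using C0 by (simp add: norm_mult abs_mult)
    qed
    then show "AE t in M. norm (\<theta> w t * of_real (v t)) \<le> norm ((C + C) * v t)" by simp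
  qed
  have consistent: "AE t in M. 0 < w' t \<longrightarrow> \<theta> w' t = \<theta> w t"
    if w: "weight M w" and w': "weight M w'" and le: "\<forall>t. w' t \<le> w t" for w w'
  proof -
    note [measurable] = borel_measurable_integrable[OF weight_integrable[OF w]]
      borel_measurable_integrable[OF weight_integrable[OF w']]
    define h where "h = (\<lambda>t. \<theta> w' t * of_real (w' t) - \<theta> w t * of_real (w' t))"
    have i': "integrable M (\<lambda>t. \<theta> w' t * of_real (w' t))" "integrable M (\<lambda>t. \<theta> w t * of_real (w' t))"
      by (rule int[OF w' weight_integrable[OF w']]) (rule int[OF w weight_integrable[OF w']])
    have h: "integrable M h" unfolding h_def by (rule Bochner_Integration.integrable_diff[OF i'])
    have "AE t in M. h t = 0"
    proof (rule AE_zero_of_set_integrals[OF h])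
      fix E assume E [measurable]: "E \<in> sets M"
      define k where "k = (\<lambda>t. indicator E t * complex_of_real (w' t / w t))"
      have km: "k \<in> borel_measurable M" unfolding k_def by measurable
      have kb: "cmod (k t) \<le> 1" for t
      proof -
        have "\<bar>w' t / w t\<bar> \<le> 1"
          using weight_nonneg[OF w, of t] weight_nonneg[OF w', of t] le by (simp add: divide_le_eq_1 abs_of_nonneg less_le)
        then show ?thesis unfolding k_def by (simp add: norm_mult indicator_def del: of_real_divide)
      qed
      have kw: "k t * of_real (w t) = indicator E t * of_real (w' t)" for t
        using le weight_nonneg[OF w', of t] by (cases "w t = 0") (auto simp: k_def dest: spec[of _ t])
      have "(LINT t|M. indicator E t * (\<theta> w' t * of_real (w' t))) = \<phi> (\<lambda>t. indicator E t * of_real (w' t))"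
        by (rule rep[OF w', symmetric, of _ 1]) (simp_all add: indicator_def)
      also have "\<dots> = \<phi> (\<lambda>t. k t * of_real (w t))" by (simp only: kw)
      also have "\<dots> = (LINT t|M. k t * (\<theta> w t * of_real (w t)))" by (rule rep[OF w km kb])
      also have "\<dots> = (LINT t|M. indicator E t * (\<theta> w t * of_real (w' t)))"
        by (simp only: mult.left_commute[of "k _"] kw) (simp only: mult.left_commute)
      finally show "(LINT t|M. indicator E t * h t) = 0"
        unfolding h_def right_diff_distrib
        by (simp add: Bochner_Integration.integral_diff indicator_times_integrable[OF E] i')
    qed
    then show ?thesis by eventually_elim (auto simp: h_def)
  qed
  have "local_function M C \<theta>"
    unfolding local_function_def using \<theta> consistent by (simp add: good_def)
  moreover have "\<phi> f = (LINT t|M. \<theta> (\<lambda>t. cmod (f t)) t * f t)" if f: "integrable M f" for f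
  proof -
    have [measurable]: "f \<in> borel_measurable M" by (rule borel_measurable_integrable[OF f])
    define k where "k = (\<lambda>t. f t / of_real (cmod (f t)))"
    have km: "k \<in> borel_measurable M" unfolding k_def by measurable
    have kb: "cmod (k t) \<le> 1" for t by (simp add: k_def norm_divide)
    have kf: "k t * of_real (cmod (f t)) = f t" for t by (simp add: k_def)
    have "\<phi> f = \<phi> (\<lambda>t. k t * of_real (cmod (f t)))" by (simp only: kf)
    also have "\<dots> = (LINT t|M. k t * (\<theta> (\<lambda>t. cmod (f t)) t * of_real (cmod (f t))))"
      by (rule rep[OF weight_cmod[OF f] km kb])
    also have "\<dots> = (LINT t|M. \<theta> (\<lambda>t. cmod (f t)) t * f t)" by (simp only: mult.left_commute[of "k _"] kf)
    finally show ?thesis .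
  qed
  ultimately show ?thesis by blast
qed

definition grid_code :: "real \<Rightarrow> complex \<Rightarrow> int \<times> int" where
  "grid_code \<epsilon> z = (\<lfloor>Re z / \<epsilon>\<rfloor>, \<lfloor>Im z / \<epsilon>\<rfloor>)"

definition grid_point :: "real \<Rightarrow> int \<times> int \<Rightarrow> complex" where
  "grid_point \<epsilon> k = Complex (\<epsilon> * of_int (fst k)) (\<epsilon> * of_int (snd k))"

lemma grid_point_code:
  assumes "0 < \<epsilon>"
  shows "cmod (z - grid_point \<epsilon> (grid_code \<epsilon> z)) \<le> 2 * \<epsilon>"
proof -
  have fl: "\<bar>x - \<epsilon> * of_int \<lfloor>x / \<epsilon>\<rfloor>\<bar> \<le> \<epsilon>" for x
  proof -
    have "\<epsilon> * of_int \<lfloor>x / \<epsilon>\<rfloor> \<le> \<epsilon> * (x / \<epsilon>)" "\<epsilon> * (x / \<epsilon>) \<le> \<epsilon> * (of_int \<lfloor>x / \<epsilon>\<rfloor> + 1)"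
      using assms by (intro mult_left_mono of_int_floor_le real_of_int_floor_add_one_ge; simp)+
    moreover have "\<epsilon> * (x / \<epsilon>) = x" using assms by simp
    ultimately have "\<epsilon> * of_int \<lfloor>x / \<epsilon>\<rfloor> \<le> x" "x \<le> \<epsilon> * of_int \<lfloor>x / \<epsilon>\<rfloor> + \<epsilon>"
      by (simp_all only: distrib_left mult_1_right)
    then show ?thesis by (simp add: abs_le_iff)
  qed
  show ?thesis
    using cmod_le[of "z - grid_point \<epsilon> (grid_code \<epsilon> z)"] fl[of "Re z"] fl[of "Im z"]
    by (simp add: grid_point_def grid_code_def)
qed

lemma colouring_of_local_functions:
  assumes \<Theta>: "finite \<Theta>" "\<And>\<theta>. \<theta> \<in> \<Theta> \<Longrightarrow> local_function M D \<theta>" and \<epsilon>: "0 < \<epsilon>"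
  shows "local_colouring M (PiE \<Theta> (\<lambda>\<theta>. {\<lfloor>- D / \<epsilon>\<rfloor>..\<lfloor>D / \<epsilon>\<rfloor>} \<times> {\<lfloor>- D / \<epsilon>\<rfloor>..\<lfloor>D / \<epsilon>\<rfloor>}))
    (\<lambda>w t. \<lambda>\<theta>\<in>\<Theta>. grid_code \<epsilon> (\<theta> w t))"
proof
  show "finite (PiE \<Theta> (\<lambda>\<theta>. {\<lfloor>- D / \<epsilon>\<rfloor>..\<lfloor>D / \<epsilon>\<rfloor>} \<times> {\<lfloor>- D / \<epsilon>\<rfloor>..\<lfloor>D / \<epsilon>\<rfloor>}))"
    by (rule finite_PiE[OF \<Theta>(1)]) simp
next
  fix w t assume w: "weight M w"
  have fl: "\<lfloor>x / \<epsilon>\<rfloor> \<in> {\<lfloor>- D / \<epsilon>\<rfloor>..\<lfloor>D / \<epsilon>\<rfloor>}" if "\<bar>x\<bar> \<le> D" for x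
  proof -
    have "- D \<le> x" "x \<le> D" using that by linarith+
    then have "- D / \<epsilon> \<le> x / \<epsilon>" "x / \<epsilon> \<le> D / \<epsilon>" using \<epsilon> by (blast intro: divide_right_mono less_imp_le)+
    then show ?thesis unfolding atLeastAtMost_iff by (blast intro: floor_mono)
  qed
  have "\<bar>Re (\<theta> w t)\<bar> \<le> D" "\<bar>Im (\<theta> w t)\<bar> \<le> D" if "\<theta> \<in> \<Theta>" for \<theta>
    using \<Theta>(2)[OF that] w by (simp_all add: local_function_def)
  then have "grid_code \<epsilon> (\<theta> w t) \<in> {\<lfloor>- D / \<epsilon>\<rfloor>..\<lfloor>D / \<epsilon>\<rfloor>} \<times> {\<lfloor>- D / \<epsilon>\<rfloor>..\<lfloor>D / \<epsilon>\<rfloor>}" if "\<theta> \<in> \<Theta>" for \<theta>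
    unfolding grid_code_def using that by (intro SigmaI fl)
  then show "(\<lambda>\<theta>\<in>\<Theta>. grid_code \<epsilon> (\<theta> w t)) \<in> PiE \<Theta> (\<lambda>\<theta>. {\<lfloor>- D / \<epsilon>\<rfloor>..\<lfloor>D / \<epsilon>\<rfloor>} \<times> {\<lfloor>- D / \<epsilon>\<rfloor>..\<lfloor>D / \<epsilon>\<rfloor>})"
    by (rule restrict_PiE_iff[THEN iffD2, rule_format])
next
  fix w \<alpha> assume w: "weight M w"
    and \<alpha>: "\<alpha> \<in> PiE \<Theta> (\<lambda>\<theta>. {\<lfloor>- D / \<epsilon>\<rfloor>..\<lfloor>D / \<epsilon>\<rfloor>} \<times> {\<lfloor>- D / \<epsilon>\<rfloor>..\<lfloor>D / \<epsilon>\<rfloor>})"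
  have "(\<lambda>\<theta>\<in>\<Theta>. grid_code \<epsilon> (\<theta> w t)) = \<alpha> \<longleftrightarrow> (\<forall>\<theta>\<in>\<Theta>. grid_code \<epsilon> (\<theta> w t) = \<alpha> \<theta>)" for t
  proof
    assume *: "(\<lambda>\<theta>\<in>\<Theta>. grid_code \<epsilon> (\<theta> w t)) = \<alpha>"
    show "\<forall>\<theta>\<in>\<Theta>. grid_code \<epsilon> (\<theta> w t) = \<alpha> \<theta>"
    proof
      fix \<theta> assume "\<theta> \<in> \<Theta>"
      then show "grid_code \<epsilon> (\<theta> w t) = \<alpha> \<theta>" using fun_cong[OF *, of \<theta>] by simp
    qed
  next
    assume *: "\<forall>\<theta>\<in>\<Theta>. grid_code \<epsilon> (\<theta> w t) = \<alpha> \<theta>"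
    show "(\<lambda>\<theta>\<in>\<Theta>. grid_code \<epsilon> (\<theta> w t)) = \<alpha>"
      by (rule PiE_ext[OF _ \<alpha>]) (use * \<alpha> in \<open>auto simp: PiE_iff\<close>)
  qed
  moreover have "{t \<in> space M. grid_code \<epsilon> (\<theta> w t) = \<alpha> \<theta>} \<in> sets M" if "\<theta> \<in> \<Theta>" for \<theta>
  proof -
    have [measurable]: "\<theta> w \<in> borel_measurable M" using \<Theta>(2)[OF that] w by (simp add: local_function_def)
    have "grid_code \<epsilon> (\<theta> w t) = \<alpha> \<theta> \<longleftrightarrow>
        of_int (fst (\<alpha> \<theta>)) \<le> Re (\<theta> w t) / \<epsilon> \<and> Re (\<theta> w t) / \<epsilon> < of_int (fst (\<alpha> \<theta>)) + 1 \<and>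
        of_int (snd (\<alpha> \<theta>)) \<le> Im (\<theta> w t) / \<epsilon> \<and> Im (\<theta> w t) / \<epsilon> < of_int (snd (\<alpha> \<theta>)) + 1" for t
      unfolding grid_code_def prod_eq_iff fst_conv snd_conv floor_eq_iff by blast
    then show ?thesis by simp
  qed
  ultimately show "{t \<in> space M. (\<lambda>\<theta>\<in>\<Theta>. grid_code \<epsilon> (\<theta> w t)) = \<alpha>} \<in> sets M"
    by (simp only:) (rule sets.sets_Collect_finite_All[OF _ \<Theta>(1)])
next
  fix w w' assume w: "weight M w" "weight M w'" "\<And>t. w' t \<le> w t"
  have "AE t in M. \<forall>\<theta>\<in>\<Theta>. 0 < w' t \<longrightarrow> \<theta> w' t = \<theta> w t"
  proof (rule AE_finite_allI[OF \<Theta>(1)])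
    fix \<theta> assume "\<theta> \<in> \<Theta>"
    from \<Theta>(2)[OF this] show "AE t in M. 0 < w' t \<longrightarrow> \<theta> w' t = \<theta> w t"
      using w by (simp add: local_function_def)
  qed
  then show "AE t in M. 0 < w' t \<longrightarrow> (\<lambda>\<theta>\<in>\<Theta>. grid_code \<epsilon> (\<theta> w' t)) = (\<lambda>\<theta>\<in>\<Theta>. grid_code \<epsilon> (\<theta> w t))"
    by eventually_elim (auto intro!: restrict_ext)
qed

lemma local_function_mono: "local_function M D \<theta> \<Longrightarrow> D \<le> D' \<Longrightarrow> local_function M D' \<theta>"
  unfolding local_function_def by (meson order_trans)

text \<open>
  The colours record the rounded values of the densities of the functionals in \<open>B\<close> and of the quotients
  \<open>f / w\<^sub>0\<close> for \<open>f \<in> A\<close>, where \<open>w\<^sub>0\<close> is the sum of the \<open>\<bar>f\<bar>\<close>. The quotients depend on no weight and are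
  consistent for trivial reasons.
\<close>

theorem L1_approximating_system:
  fixes M :: "'a measure"
  assumes A: "finite A" "A \<subseteq> Lp_functions M 1"
    and B: "finite B" "\<forall>\<phi>\<in>B. bounded_form (Lp_functions M 1) (Lp_seminorm M 1) \<phi>"
    and e: "0 < e" and ne: "\<exists>f\<in>Lp_functions M 1. \<not> (AE t in M. f t = 0)"
  shows "\<exists>(J :: ((('a \<Rightarrow> real) \<Rightarrow> 'a \<Rightarrow> complex) \<Rightarrow> int \<times> int) set) x F.
    approximating_system (Lp_functions M 1) (Lp_seminorm M 1) A B e J x F"
proof -
  have Ai: "integrable M f" if "f \<in> A" for f using A(2) that by (auto simp: L1_iff)
  define w\<^sub>0 where "w\<^sub>0 = (\<lambda>t. \<Sum>f\<in>A. cmod (f t))"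
  have w0: "weight M w\<^sub>0"
    unfolding w\<^sub>0_def weight_def
    by (intro conjI allI Bochner_Integration.integrable_sum integrable_norm Ai sum_nonneg norm_ge_zero)
  have le: "cmod (f t) \<le> w\<^sub>0 t" if "f \<in> A" for f t
    unfolding w\<^sub>0_def by (rule member_le_sum[OF that _ A(1)]) simp
  define \<rho> where "\<rho> = (\<lambda>f (w :: 'a \<Rightarrow> real) t. f t / complex_of_real (w\<^sub>0 t))"
  have \<rho>: "local_function M 1 (\<rho> f)" if "f \<in> A" for f
  proof -
    have [measurable]: "f \<in> borel_measurable M" "w\<^sub>0 \<in> borel_measurable M"
      by (rule borel_measurable_integrable[OF Ai[OF that]])
        (rule borel_measurable_integrable[OF weight_integrable[OF w0]])
    have "cmod (\<rho> f w t) \<le> 1" for w t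
      using le[OF that, of t] weight_nonneg[OF w0, of t] by (simp add: \<rho>_def norm_divide divide_le_eq_1 less_le)
    then have "\<bar>Re (\<rho> f w t)\<bar> \<le> 1" "\<bar>Im (\<rho> f w t)\<bar> \<le> 1" for w t
      using abs_Re_le_cmod abs_Im_le_cmod order_trans by blast+
    moreover have "\<rho> f w \<in> borel_measurable M" for w unfolding \<rho>_def by measurable
    ultimately show ?thesis by (simp add: local_function_def) (simp add: \<rho>_def)
  qed
  have "\<forall>\<phi>\<in>B. \<exists>D \<theta>. local_function M D \<theta> \<and>
      (\<forall>f. integrable M f \<longrightarrow> \<phi> f = (LINT t|M. \<theta> (\<lambda>t. cmod (f t)) t * f t))"
    by (intro ballI local_density B(2)[rule_format])
  then obtain D \<theta> where \<theta>: "\<And>\<phi>. \<phi> \<in> B \<Longrightarrow> local_function M (D \<phi>) (\<theta> \<phi>)"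
    and rep: "\<And>\<phi> f. \<phi> \<in> B \<Longrightarrow> integrable M f \<Longrightarrow> \<phi> f = (LINT t|M. \<theta> \<phi> (\<lambda>t. cmod (f t)) t * f t)"
    by metis
  define K where "K = 1 + (\<Sum>\<phi>\<in>B. \<bar>D \<phi>\<bar>)"
  have "\<bar>D \<phi>\<bar> \<le> (\<Sum>\<phi>\<in>B. \<bar>D \<phi>\<bar>)" if "\<phi> \<in> B" for \<phi> by (rule member_le_sum[OF that _ B(1)]) simp
  then have DK: "D \<phi> \<le> K" if "\<phi> \<in> B" for \<phi> using that abs_ge_self[of "D \<phi>"] by (fastforce simp: K_def)
  have K1: "1 \<le> K" by (simp add: K_def sum_nonneg)
  define \<Theta> where "\<Theta> = \<rho> ` A \<union> \<theta> ` B"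
  have \<Theta>: "finite \<Theta>" "\<And>\<theta>. \<theta> \<in> \<Theta> \<Longrightarrow> local_function M K \<theta>"
    using A(1) B(1) local_function_mono[OF \<rho> K1] local_function_mono[OF \<theta> DK] by (auto simp: \<Theta>_def)
  define n where "n = (LINT t|M. w\<^sub>0 t)"
  have n0: "0 \<le> n" unfolding n_def by (intro integral_nonneg_AE AE_I2 weight_nonneg[OF w0])
  define \<epsilon> where "\<epsilon> = e / (4 * (n + 1))"
  have \<epsilon>: "0 < \<epsilon>" using e n0 by (simp add: \<epsilon>_def)
  have \<epsilon>n: "4 * \<epsilon> * (n + 1) = e"
  proof -
    have "4 * (e / (4 * L)) * L = e" if "L \<noteq> 0" for L :: real using that by simp
    from this[of "n + 1"] show ?thesis using n0 unfolding \<epsilon>_def by linarith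
  qed
  define \<C> where "\<C> = PiE \<Theta> (\<lambda>\<theta>. {\<lfloor>- K / \<epsilon>\<rfloor>..\<lfloor>K / \<epsilon>\<rfloor>} \<times> {\<lfloor>- K / \<epsilon>\<rfloor>..\<lfloor>K / \<epsilon>\<rfloor>})"
  define \<kappa> where "\<kappa> = (\<lambda>w t. \<lambda>\<theta>\<in>\<Theta>. grid_code \<epsilon> (\<theta> w t))"
  interpret local_colouring M \<C> \<kappa>
    unfolding \<C>_def \<kappa>_def by (rule colouring_of_local_functions[OF \<Theta> \<epsilon>])
  have near: "cmod (\<theta> w t - grid_point \<epsilon> (\<kappa> w t \<theta>)) \<le> 2 * \<epsilon>" if "\<theta> \<in> \<Theta>" for \<theta> w t
    using grid_point_code[OF \<epsilon>, of "\<theta> w t"] that by (simp add: \<kappa>_def)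
  show ?thesis
  proof (rule colour_approximating_system[where d = "2 * \<epsilon>", OF w0])
    show "integrable M f" if "f \<in> A" for f by (rule Ai[OF that])
    show "cmod (f t) \<le> w\<^sub>0 t" if "f \<in> A" for f t by (rule le[OF that])
  next
    fix f assume fA: "f \<in> A"
    have "cmod (f t - grid_point \<epsilon> (\<kappa> w\<^sub>0 t (\<rho> f)) * of_real (w\<^sub>0 t)) \<le> 2 * \<epsilon> * w\<^sub>0 t" for t
    proof -
      have "f t = \<rho> f w\<^sub>0 t * of_real (w\<^sub>0 t)"
        using le[OF fA, of t] by (cases "w\<^sub>0 t = 0") (simp_all add: \<rho>_def)
      then have "f t - grid_point \<epsilon> (\<kappa> w\<^sub>0 t (\<rho> f)) * of_real (w\<^sub>0 t) =
          (\<rho> f w\<^sub>0 t - grid_point \<epsilon> (\<kappa> w\<^sub>0 t (\<rho> f))) * of_real (w\<^sub>0 t)" by (simp only: left_diff_distrib)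
      moreover have "cmod (\<rho> f w\<^sub>0 t - grid_point \<epsilon> (\<kappa> w\<^sub>0 t (\<rho> f))) \<le> 2 * \<epsilon>"
        by (rule near) (simp add: \<Theta>_def fA)
      ultimately show ?thesis
        using weight_nonneg[OF w0, of t] by (simp add: norm_mult mult_right_mono)
    qed
    then show "\<exists>c. \<forall>t\<in>space M. cmod (f t - c (\<kappa> w\<^sub>0 t) * of_real (w\<^sub>0 t)) \<le> 2 * \<epsilon> * w\<^sub>0 t"
      by (intro exI[of _ "\<lambda>\<alpha>. grid_point \<epsilon> (\<alpha> (\<rho> f))"]) simp
  next
    fix \<phi> assume \<phi>: "\<phi> \<in> B"
    have \<theta>\<Theta>: "\<theta> \<phi> \<in> \<Theta>" using \<phi> by (simp add: \<Theta>_def)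
    have b: "cmod (\<theta> \<phi> w t) \<le> K + K" if "weight M w" for w t
      using cmod_le[of "\<theta> \<phi> w t"] \<Theta>(2)[OF \<theta>\<Theta>] that unfolding local_function_def by (meson add_mono order_trans)
    have m: "\<theta> \<phi> w \<in> borel_measurable M" if "weight M w" for w
      using \<Theta>(2)[OF \<theta>\<Theta>] that unfolding local_function_def by blast
    have "cmod (\<phi> f - (\<Sum>\<alpha>\<in>\<C>. grid_point \<epsilon> (\<alpha> (\<theta> \<phi>)) * colour_form \<alpha> f)) \<le> 2 * \<epsilon> * (LINT t|M. cmod (f t))"
      if f: "integrable M f" for f
      unfolding rep[OF \<phi> f]
      by (rule colour_form_approximation[where \<theta> = "\<theta> \<phi>" and c = "\<lambda>\<alpha>. grid_point \<epsilon> (\<alpha> (\<theta> \<phi>))", OF near[OF \<theta>\<Theta>] m b f])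
    then show "\<exists>c. \<forall>f. integrable M f \<longrightarrow>
        cmod (\<phi> f - (\<Sum>\<alpha>\<in>\<C>. c \<alpha> * colour_form \<alpha> f)) \<le> 2 * \<epsilon> * (LINT t|M. cmod (f t))"
      by (intro exI[of _ "\<lambda>\<alpha>. grid_point \<epsilon> (\<alpha> (\<theta> \<phi>))"]) simp
  next
    have "0 \<le> \<epsilon> * n" using \<epsilon> n0 by simp
    then show "0 \<le> 2 * \<epsilon>" "2 * (2 * \<epsilon>) \<le> e" "2 * (2 * \<epsilon>) * (LINT t|M. w\<^sub>0 t) \<le> e"
      using \<epsilon> \<epsilon>n unfolding n_def[symmetric] by (simp_all add: algebra_simps)
    show "\<exists>f. integrable M f \<and> \<not> (AE t in M. f t = (0 :: complex))" using ne by (auto simp: L1_iff)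
  qed
qed

section \<open>Property A\<close>

theorem property_A_Lp_finite:
  assumes r: "1 \<le> r" and inf: "infinite_dimensional (Lp_space M (ennreal r))"
  shows "property_A (Lp_space M (ennreal r))"
proof (cases "r = 1")
  case True
  then have 1: "ennreal r = 1" by simp
  show ?thesis
    using Lp_space_nonzero[OF inf] unfolding 1
    by (intro function_model.property_A_of_approximating_systems[OF function_model_Lp_space
          L1_approximating_system])
next
  case False
  then have r1: "1 < r" using r by simp
  interpret Lp_finite M r by unfold_locales (rule r)
  show ?thesis
    using Lp_space_nonzero[OF inf]
    by (intro function_model.property_A_of_approximating_systems[OF function_model_Lp_space
          Lp_approximating_system[OF r1]])
qed

theorem theorem4p7:
  fixes K :: "'k topology" and M :: "'a measure"
  shows "(compact_space K \<and> Hausdorff_space K \<and> infinite_dimensional (C_space K) \<longrightarrow>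
            property_A (C_space K)) \<and>
         (\<forall>p::ennreal. 1 \<le> p \<and> infinite_dimensional (Lp_space M p) \<longrightarrow>
            property_A (Lp_space M p))"
proof (intro conjI allI impI; elim conjE)
  assume "compact_space K" "infinite_dimensional (C_space K)"
  then show "property_A (C_space K)" by (rule property_A_C_space)
next
  fix p :: ennreal
  assume p: "1 \<le> p" and inf: "infinite_dimensional (Lp_space M p)"
  show "property_A (Lp_space M p)"
  proof (cases p)
    case (real r)
    then have "1 \<le> r" using p by simp
    then show ?thesis using inf unfolding real(2) by (rule property_A_Lp_finite)
  next
    case top
    then show ?thesis using inf property_A_Lp_infinity[of M] by simp
  qed
qed

end
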